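(* Assume $rs^{-1}$ is not a root of unity. The finite-dimensional simple $\widetilde U$-modules (where $\widetilde U=U_{r,s}(\mathfrak{gl}_n)$) are, up to isomorphism, precisely the modules $L_\chi\otimes L(\lambda)$, where $\chi:\widetilde U^0\to\mathbb K$ is an algebra homomorphism with $\chi(\omega_i)=\chi(\omega_i')$ for $1\le i<n$, and $\lambda\in\Lambda^+$.
   Context: $\mathbb K$ is an algebraically closed field, $n$ a positive integer, $r,s\in\mathbb K$ nonzero with $r\ne s$. Let $\epsilon_1,\dots,\epsilon_n$ be an orthonormal basis of a Euclidean space with inner product $\langle\ ,\ \rangle$, and $\alpha_j=\epsilon_j-\epsilon_{j+1}$ ($1\le j<n$). $\widetilde U=U_{r,s}(\mathfrak{gl}_n)$ is the unital associative $\mathbb K$-algebra generated by $e_j,f_j$ ($1\le j<n$) and $a_i^{\pm1},b_i^{\pm1}$ ($1\le i\le n$) with relations: (R1) the $a_i^{\pm1},b_j^{\pm1}$ all commute and $a_ia_i^{-1}=b_jb_j^{-1}=1$; (R2) $a_ie_j=r^{\langle\epsilon_i,\alpha_j\rangle}e_ja_i$, $a_if_j=r^{-\langle\epsilon_i,\alpha_j\rangle}f_ja_i$; (R3) $b_ie_j=s^{\langle\epsilon_i,\alpha_j\rangle}e_jb_i$, $b_if_j=s^{-\langle\epsilon_i,\alpha_j\rangle}f_jb_i$; (R4) $[e_i,f_j]=\frac{\delta_{i,j}}{r-s}(a_ib_{i+1}-a_{i+1}b_i)$; (R5) $[e_i,e_j]=[f_i,f_j]=0$ if $|i-j|>1$;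 (R6) $e_i^2e_{i+1}-(r+s)e_ie_{i+1}e_i+rs\,e_{i+1}e_i^2=0$ and $e_ie_{i+1}^2-(r+s)e_{i+1}e_ie_{i+1}+rs\,e_{i+1}^2e_i=0$; (R7) $f_i^2f_{i+1}-(r^{-1}+s^{-1})f_if_{i+1}f_i+r^{-1}s^{-1}f_{i+1}f_i^2=0$ and $f_if_{i+1}^2-(r^{-1}+s^{-1})f_{i+1}f_if_{i+1}+r^{-1}s^{-1}f_{i+1}^2f_i=0$. Put $\omega_j=a_jb_{j+1}$, $\omega_j'=a_{j+1}b_j$ ($1\le j<n$). Hopf structure: $a_i^{\pm1},b_i^{\pm1}$ are group-like, $\Delta(e_i)=e_i\otimes1+\omega_i\otimes e_i$, $\Delta(f_i)=1\otimes f_i+f_i\otimes\omega_i'$, $\varepsilon(e_i)=\varepsilon(f_i)=0$, $S(e_i)=-\omega_i^{-1}e_i$, $S(f_i)=-f_i(\omega_i')^{-1}$; tensor products of modules are formed via $\Delta$. $\widetilde U^0$ is the subalgebra generated by all $a_i^{\pm1},b_i^{\pm1}$. $\Lambda=\mathbb Z\epsilon_1\oplus\cdots\oplus\mathbb Z\epsilon_n$; $\Lambda^+=\{\lambda\in\Lambda:\langle\alpha_i,\lambda\rangle\ge0,\ 1\le i<n\}$. For $\lambda\in\Lambda$, $\hat\lambda:\widetilde U^0\to\mathbb K$ is the algebra homomorphism with $\hat\lambda(a_i)=r^{\langle\epsilon_i,\lambda\rangle}$, $\hat\lambda(b_i)=s^{\langle\epsilon_i,\lambda\rangle}$. For an algebra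 homomorphism $\psi:\widetilde U^0\to\mathbb K$, let $\widetilde U^{\ge0}$ be the subalgebra generated by the $a_i^{\pm1},b_i^{\pm1},e_j$, let $V^\psi$ be the one-dimensional $\widetilde U^{\ge0}$-module on which $e_j$ acts as $0$ and $\widetilde U^0$ acts via $\psi$. The Verma module is $M(\psi)=\widetilde U\otimes_{\widetilde U^{\ge0}}V^\psi$; it has a unique maximal submodule, and $L(\psi)$ is the corresponding simple quotient. $L(\lambda):=L(\hat\lambda)$ for $\lambda\in\Lambda$. When $\chi(\omega_i)=\chi(\omega_i')$ for all $1\le i<n$, $L(\chi)$ is one-dimensional ($e_i,f_i$ act as $0$, $\widetilde U^0$ acts via $\chi$) and is denoted $L_\chi$. *)

theory Defs
  imports
    "HOL-Library.Poly_Mapping"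
    "HOL-Algebra.QuotRing"
    "HOL-Algebra.Generated_Rings"
    "HOL-Algebra.Free_Abelian_Groups"
    "Jordan_Normal_Form.VS_Connect"
begin

section \<open>Algebras over a field and their left modules\<close>

text \<open>
  The ground field is a type \<open>'k\<close>. An algebra over it is a record \<open>('k, 'a) module\<close> of HOL-Algebra
  (a ring together with scalar multiplication), not necessarily commutative. A left module over an
  algebra \<open>A\<close> is a record \<open>('a, 'v) module\<close> whose scalars are the elements of \<open>A\<close>; its ring
  multiplication and unit are meaningless. The locale \<open>module\<close> of HOL-Algebra needs a
  commutative ring of scalars, hence the next locale, which drops only that.
\<close>

locale left_module = R?: ring R + M?: abelian_group M
  for R :: "('a, 'b) ring_scheme" (structure) and M :: "('a, 'v, 'd) module_scheme" (structure) +
  assumes smult_closed: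
      "\<lbrakk>a \<in> carrier R; x \<in> carrier M\<rbrakk> \<Longrightarrow> a \<odot>\<^bsub>M\<^esub> x \<in> carrier M"
    and smult_l_distr:
      "\<lbrakk>a \<in> carrier R; b \<in> carrier R; x \<in> carrier M\<rbrakk> \<Longrightarrow>
        (a \<oplus> b) \<odot>\<^bsub>M\<^esub> x = a \<odot>\<^bsub>M\<^esub> x \<oplus>\<^bsub>M\<^esub> b \<odot>\<^bsub>M\<^esub> x"
    and smult_r_distr:
      "\<lbrakk>a \<in> carrier R; x \<in> carrier M; y \<in> carrier M\<rbrakk> \<Longrightarrow>
        a \<odot>\<^bsub>M\<^esub> (x \<oplus>\<^bsub>M\<^esub> y) = a \<odot>\<^bsub>M\<^esub> x \<oplus>\<^bsub>M\<^esub> a \<odot>\<^bsub>M\<^esub> y"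
    and smult_assoc1:
      "\<lbrakk>a \<in> carrier R; b \<in> carrier R; x \<in> carrier M\<rbrakk> \<Longrightarrow>
        (a \<otimes> b) \<odot>\<^bsub>M\<^esub> x = a \<odot>\<^bsub>M\<^esub> (b \<odot>\<^bsub>M\<^esub> x)"
    and smult_one:
      "x \<in> carrier M \<Longrightarrow> \<one> \<odot>\<^bsub>M\<^esub> x = x"

text \<open>\<open>Module.submodule\<close> is the HOL-Algebra notion; the one of the AFP entry VectorSpace, which
  shadows it, includes commutativity of the scalars.\<close>

definition simple_module :: "('k, 'a) module \<Rightarrow> ('a, 'v) module \<Rightarrow> bool" where
  "simple_module A M \<longleftrightarrow> left_module A M \<and> carrier M \<noteq> {\<zero>\<^bsub>M\<^esub>} \<and>
     (\<forall>N. Module.submodule N A M \<longrightarrow> N = {\<zero>\<^bsub>M\<^esub>} \<or> N = carrier M)"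

definition max_submodule :: "('k, 'a) module \<Rightarrow> ('a, 'v) module \<Rightarrow> 'v set \<Rightarrow> bool" where
  "max_submodule A M N \<longleftrightarrow> Module.submodule N A M \<and> N \<noteq> carrier M \<and>
     (\<forall>N'. Module.submodule N' A M \<and> N \<subseteq> N' \<and> N' \<noteq> carrier M \<longrightarrow> N' = N)"

definition isomorphic_modules ::
    "('k, 'a) module \<Rightarrow> ('a, 'v) module \<Rightarrow> ('a, 'w) module \<Rightarrow> bool" where
  "isomorphic_modules A M N \<longleftrightarrow> (\<exists>\<phi>\<in>module_hom A M N. bij_betw \<phi> (carrier M) (carrier N))"

text \<open>The vector space underlying a module, scalars acting through \<open>c \<mapsto> c \<cdot> 1\<close>.\<close>

definition underlying_space ::
    "('k, 'a) module \<Rightarrow> ('a, 'v) module \<Rightarrow> ('k, 'v) module" where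
  "underlying_space A M =
     \<lparr>carrier = carrier M, monoid.mult = monoid.mult M, one = one M,
      ring.zero = ring.zero M, ring.add = ring.add M,
      module.smult = \<lambda>c x. (c \<odot>\<^bsub>A\<^esub> \<one>\<^bsub>A\<^esub>) \<odot>\<^bsub>M\<^esub> x\<rparr>"

definition fin_dim_module :: "('k::field, 'a) module \<Rightarrow> ('a, 'v) module \<Rightarrow> bool" where
  "fin_dim_module A M \<longleftrightarrow> vectorspace.fin_dim class_ring (underlying_space A M)"

text \<open>Used both for an algebra modulo a two-sided ideal and for a module modulo a submodule.\<close>

definition quotient :: "('b, 'a) module \<Rightarrow> 'a set \<Rightarrow> ('b, 'a set) module" where
  "quotient M N = ring.extend (M Quot N)
     (module.fields (\<lambda>c Y. \<Union>x\<in>Y. N +>\<^bsub>M\<^esub> (c \<odot>\<^bsub>M\<^esub> x)))"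

definition generated_subalgebra :: "('k, 'a) module \<Rightarrow> 'a set \<Rightarrow> ('k, 'a) module" where
  "generated_subalgebra A S =
     A\<lparr>carrier := generate_ring A (S \<union> range (\<lambda>c. c \<odot>\<^bsub>A\<^esub> \<one>\<^bsub>A\<^esub>))\<rparr>"

definition algebra_hom :: "('k, 'a) module \<Rightarrow> ('k, 'b) module \<Rightarrow> ('a \<Rightarrow> 'b) set" where
  "algebra_hom A B =
     {h \<in> Ring.ring_hom A B. \<forall>c. \<forall>x\<in>carrier A. h (c \<odot>\<^bsub>A\<^esub> x) = c \<odot>\<^bsub>B\<^esub> h x}"

definition ground_algebra :: "('k::field, 'k) module" where
  "ground_algebra =
     \<lparr>carrier = UNIV, monoid.mult = (*), one = 1, ring.zero = 0, ring.add = (+),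
      module.smult = (*)\<rparr>"


section \<open>Tensor products\<close>

text \<open>
  \<open>M \<otimes>\<^sub>B N\<close> for a right \<open>B\<close>-module \<open>M\<close> and a left \<open>B\<close>-module \<open>N\<close>: the free abelian group on
  \<open>M \<times> N\<close> modulo biadditivity and \<open>x b \<otimes> y = x \<otimes> b y\<close>. In the record of the right module \<open>M\<close>,
  \<open>b \<odot>\<^bsub>M\<^esub> x\<close> stands for \<open>x b\<close>. For \<open>B\<close> the ground field there is no difference between left and right.
\<close>

definition tensor_relators ::
    "('b, 'c) ring_scheme \<Rightarrow> ('b, 'm) module \<Rightarrow> ('b, 'n) module \<Rightarrow> ('m \<times> 'n \<Rightarrow>\<^sub>0 int) set" where
  "tensor_relators B M N =
     {frag_of (x \<oplus>\<^bsub>M\<^esub> x', y) - frag_of (x, y) - frag_of (x', y) | x x' y.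
        x \<in> carrier M \<and> x' \<in> carrier M \<and> y \<in> carrier N} \<union>
     {frag_of (x, y \<oplus>\<^bsub>N\<^esub> y') - frag_of (x, y) - frag_of (x, y') | x y y'.
        x \<in> carrier M \<and> y \<in> carrier N \<and> y' \<in> carrier N} \<union>
     {frag_of (b \<odot>\<^bsub>M\<^esub> x, y) - frag_of (x, b \<odot>\<^bsub>N\<^esub> y) | b x y.
        b \<in> carrier B \<and> x \<in> carrier M \<and> y \<in> carrier N}"

definition tensor_subgroup ::
    "('b, 'c) ring_scheme \<Rightarrow> ('b, 'm) module \<Rightarrow> ('b, 'n) module \<Rightarrow> ('m \<times> 'n \<Rightarrow>\<^sub>0 int) set" where
  "tensor_subgroup B M N =
     generate (free_Abelian_group (carrier M \<times> carrier N)) (tensor_relators B M N)"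

definition tensor_group ::
    "('b, 'c) ring_scheme \<Rightarrow> ('b, 'm) module \<Rightarrow> ('b, 'n) module \<Rightarrow> ('m \<times> 'n \<Rightarrow>\<^sub>0 int) set monoid"
  where
  "tensor_group B M N =
     free_Abelian_group (carrier M \<times> carrier N) Mod tensor_subgroup B M N"

definition tensor_class ::
    "('b, 'c) ring_scheme \<Rightarrow> ('b, 'm) module \<Rightarrow> ('b, 'n) module \<Rightarrow>
      ('m \<times> 'n \<Rightarrow>\<^sub>0 int) \<Rightarrow> ('m \<times> 'n \<Rightarrow>\<^sub>0 int) set" where
  "tensor_class B M N t =
     tensor_subgroup B M N #>\<^bsub>free_Abelian_group (carrier M \<times> carrier N)\<^esub> t"

definition pure_tensor ::
    "('b, 'c) ring_scheme \<Rightarrow> ('b, 'm) module \<Rightarrow> ('b, 'n) module \<Rightarrow>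
      'm \<Rightarrow> 'n \<Rightarrow> ('m \<times> 'n \<Rightarrow>\<^sub>0 int) set" where
  "pure_tensor B M N x y = tensor_class B M N (frag_of (x, y))"

text \<open>The biadditive extension of a map on generators.\<close>

definition frag_extend2 ::
    "('a \<Rightarrow> 'b \<Rightarrow> 'c) \<Rightarrow> ('a \<Rightarrow>\<^sub>0 int) \<Rightarrow> ('b \<Rightarrow>\<^sub>0 int) \<Rightarrow> ('c \<Rightarrow>\<^sub>0 int)" where
  "frag_extend2 f x y = frag_extend (\<lambda>p. frag_extend (\<lambda>q. frag_of (f p q)) y) x"

text \<open>\<open>A \<otimes> A'\<close> over the ground field, with \<open>(x \<otimes> x') (y \<otimes> y') = x y \<otimes> x' y'\<close>.\<close>

definition tensor_algebra ::
    "('k::field, 'a) module \<Rightarrow> ('k, 'b) module \<Rightarrow> ('k, ('a \<times> 'b \<Rightarrow>\<^sub>0 int) set) module" where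
  "tensor_algebra A A' =
     \<lparr>carrier = carrier (tensor_group class_ring A A'),
      monoid.mult = \<lambda>S T. \<Union>s\<in>S. \<Union>t\<in>T. tensor_class class_ring A A'
        (frag_extend2 (\<lambda>(x, x') (y, y'). (x \<otimes>\<^bsub>A\<^esub> y, x' \<otimes>\<^bsub>A'\<^esub> y')) s t),
      one = pure_tensor class_ring A A' \<one>\<^bsub>A\<^esub> \<one>\<^bsub>A'\<^esub>,
      ring.zero = one (tensor_group class_ring A A'),
      ring.add = monoid.mult (tensor_group class_ring A A'),
      module.smult = \<lambda>c T. \<Union>t\<in>T. tensor_class class_ring A A'
        (frag_extend (\<lambda>(x, x'). frag_of (c \<odot>\<^bsub>A\<^esub> x, x')) t)\<rparr>"

text \<open>The tensor product over the ground field of two \<open>A\<close>-modules, \<open>A\<close> acting through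
  \<open>\<Delta> : A \<rightarrow> A \<otimes> A\<close> and \<open>(x \<otimes> x') (v \<otimes> w) = x v \<otimes> x' w\<close>.\<close>

definition tensor_module ::
    "('k::field, 'a) module \<Rightarrow> ('a \<Rightarrow> ('a \<times> 'a \<Rightarrow>\<^sub>0 int) set) \<Rightarrow>
      ('a, 'v) module \<Rightarrow> ('a, 'w) module \<Rightarrow> ('a, ('v \<times> 'w \<Rightarrow>\<^sub>0 int) set) module" where
  "tensor_module A \<Delta> V W =
     (let V' = underlying_space A V; W' = underlying_space A W in
      \<lparr>carrier = carrier (tensor_group class_ring V' W'),
       monoid.mult = undefined, one = undefined,
       ring.zero = one (tensor_group class_ring V' W'),
       ring.add = monoid.mult (tensor_group class_ring V' W'),
       module.smult = \<lambda>a T. \<Union>d\<in>\<Delta> a. \<Union>t\<in>T. tensor_class class_ring V' W'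
         (frag_extend2 (\<lambda>(x, x') (v, w). (x \<odot>\<^bsub>V\<^esub> v, x' \<odot>\<^bsub>W\<^esub> w)) d t)\<rparr>)"

text \<open>The induced module \<open>A \<otimes>\<^sub>B V\<close> for a subalgebra \<open>B\<close> of \<open>A\<close>.\<close>

definition right_regular :: "('k, 'a) module \<Rightarrow> ('a, 'a) module" where
  "right_regular A =
     \<lparr>carrier = carrier A, monoid.mult = monoid.mult A, one = one A,
      ring.zero = ring.zero A, ring.add = ring.add A,
      module.smult = \<lambda>b x. x \<otimes>\<^bsub>A\<^esub> b\<rparr>"

definition induced_module ::
    "('k, 'a) module \<Rightarrow> ('k, 'a) module \<Rightarrow> ('a, 'v) module \<Rightarrow>
      ('a, ('a \<times> 'v \<Rightarrow>\<^sub>0 int) set) module" where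
  "induced_module A B V =
     \<lparr>carrier = carrier (tensor_group B (right_regular A) V),
      monoid.mult = undefined, one = undefined,
      ring.zero = one (tensor_group B (right_regular A) V),
      ring.add = monoid.mult (tensor_group B (right_regular A) V),
      module.smult = \<lambda>a T. \<Union>t\<in>T. tensor_class B (right_regular A) V
        (frag_extend (\<lambda>(x, v). frag_of (a \<otimes>\<^bsub>A\<^esub> x, v)) t)\<rparr>"


section \<open>Free associative algebras\<close>

datatype 'g word = Word (letters: "'g list")

instantiation word :: (type) monoid_add
begin

definition zero_word :: "'a word" where "0 = Word []"
definition plus_word :: "'a word \<Rightarrow> 'a word \<Rightarrow> 'a word" where
  "v + w = Word (letters v @ letters w)"

instance by standard (simp_all add: zero_word_def plus_word_def)

end

text \<open>Elements are finitely supported functions on words. The multiplication of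
  \<^typ>\<open>'g word \<Rightarrow>\<^sub>0 'k::field\<close> is convolution along concatenation, by the instance above.\<close>

definition free_algebra :: "'g set \<Rightarrow> ('k::field, 'g word \<Rightarrow>\<^sub>0 'k) module" where
  "free_algebra G =
     \<lparr>carrier = {p. \<forall>w\<in>Poly_Mapping.keys p. set (letters w) \<subseteq> G},
      monoid.mult = (*), one = 1, ring.zero = 0, ring.add = (+),
      module.smult = \<lambda>c p. Poly_Mapping.single 0 c * p\<rparr>"


section \<open>The weight lattice\<close>

text \<open>An element of \<open>\<Lambda>\<close> is given by its coordinates with indices in \<open>{1..n}\<close>, so that
  \<open>\<langle>\<epsilon>\<^sub>i, lam\<rangle> = lam i\<close>.\<close>

definition eps :: "nat \<Rightarrow> nat \<Rightarrow> int" where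
  "eps i = (\<lambda>k. if k = i then 1 else 0)"

definition alpha :: "nat \<Rightarrow> nat \<Rightarrow> int" where
  "alpha j = (\<lambda>k. eps j k - eps (j + 1) k)"

definition ip :: "nat \<Rightarrow> (nat \<Rightarrow> int) \<Rightarrow> (nat \<Rightarrow> int) \<Rightarrow> int" where
  "ip n lam mu = (\<Sum>k = 1..n. lam k * mu k)"

definition weights :: "nat \<Rightarrow> (nat \<Rightarrow> int) set" where
  "weights n = {lam. \<forall>k. k \<notin> {1..n} \<longrightarrow> lam k = 0}"

definition dominant_weights :: "nat \<Rightarrow> (nat \<Rightarrow> int) set" where
  "dominant_weights n = {lam \<in> weights n. \<forall>i\<in>{1..<n}. ip n (alpha i) lam \<ge> 0}"


section \<open>The algebra \<open>U\<^sub>r\<^sub>,\<^sub>s(gl\<^sub>n)\<close>\<close>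

text \<open>\<open>Gen_ai i\<close> and \<open>Gen_bi i\<close> are the generators written \<open>a\<^sub>i\<^sup>-\<^sup>1\<close> and \<open>b\<^sub>i\<^sup>-\<^sup>1\<close>.\<close>

datatype gen = Gen_e nat | Gen_f nat | Gen_a nat | Gen_ai nat | Gen_b nat | Gen_bi nat

definition torus_gens :: "nat \<Rightarrow> gen set" where
  "torus_gens n = Gen_a ` {1..n} \<union> Gen_ai ` {1..n} \<union> Gen_b ` {1..n} \<union> Gen_bi ` {1..n}"

definition gens :: "nat \<Rightarrow> gen set" where
  "gens n = Gen_e ` {1..<n} \<union> Gen_f ` {1..<n} \<union> torus_gens n"

abbreviation gen_free :: "gen \<Rightarrow> gen word \<Rightarrow>\<^sub>0 'k::field" where
  "gen_free g \<equiv> Poly_Mapping.single (Word [g]) 1"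

abbreviation (input) "xe i \<equiv> gen_free (Gen_e i)"
abbreviation (input) "xf i \<equiv> gen_free (Gen_f i)"
abbreviation (input) "xa i \<equiv> gen_free (Gen_a i)"
abbreviation (input) "xai i \<equiv> gen_free (Gen_ai i)"
abbreviation (input) "xb i \<equiv> gen_free (Gen_b i)"
abbreviation (input) "xbi i \<equiv> gen_free (Gen_bi i)"

abbreviation scalar :: "'k::field \<Rightarrow> gen word \<Rightarrow>\<^sub>0 'k" where
  "scalar c \<equiv> Poly_Mapping.single 0 c"

text \<open>A relation \<open>p = q\<close> is represented by \<open>p - q\<close>.\<close>

inductive_set relators :: "nat \<Rightarrow> 'k::field \<Rightarrow> 'k \<Rightarrow> (gen word \<Rightarrow>\<^sub>0 'k) set"
  for n :: nat and r s :: 'k where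
  R1_comm: "\<lbrakk>x \<in> torus_gens n; y \<in> torus_gens n\<rbrakk> \<Longrightarrow>
    gen_free x * gen_free y - gen_free y * gen_free x \<in> relators n r s"
| R1_a: "i \<in> {1..n} \<Longrightarrow> xa i * xai i - 1 \<in> relators n r s"
| R1_b: "i \<in> {1..n} \<Longrightarrow> xb i * xbi i - 1 \<in> relators n r s"
| R2_e: "\<lbrakk>i \<in> {1..n}; j \<in> {1..<n}\<rbrakk> \<Longrightarrow>
    xa i * xe j - scalar (r powi ip n (eps i) (alpha j)) * xe j * xa i
      \<in> relators n r s"
| R2_f: "\<lbrakk>i \<in> {1..n}; j \<in> {1..<n}\<rbrakk> \<Longrightarrow>
    xa i * xf j - scalar (r powi (- ip n (eps i) (alpha j))) * xf j * xa i
      \<in> relators n r s"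
| R3_e: "\<lbrakk>i \<in> {1..n}; j \<in> {1..<n}\<rbrakk> \<Longrightarrow>
    xb i * xe j - scalar (s powi ip n (eps i) (alpha j)) * xe j * xb i
      \<in> relators n r s"
| R3_f: "\<lbrakk>i \<in> {1..n}; j \<in> {1..<n}\<rbrakk> \<Longrightarrow>
    xb i * xf j - scalar (s powi (- ip n (eps i) (alpha j))) * xf j * xb i
      \<in> relators n r s"
| R4: "\<lbrakk>i \<in> {1..<n}; j \<in> {1..<n}\<rbrakk> \<Longrightarrow>
    xe i * xf j - xf j * xe i
      - scalar ((if i = j then 1 else 0) / (r - s))
          * (xa i * xb (i + 1) - xa (i + 1) * xb i)
      \<in> relators n r s"
| R5_e: "\<lbrakk>i \<in> {1..<n}; j \<in> {1..<n}; \<bar>int i - int j\<bar> > 1\<rbrakk> \<Longrightarrow>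
    xe i * xe j - xe j * xe i \<in> relators n r s"
| R5_f: "\<lbrakk>i \<in> {1..<n}; j \<in> {1..<n}; \<bar>int i - int j\<bar> > 1\<rbrakk> \<Longrightarrow>
    xf i * xf j - xf j * xf i \<in> relators n r s"
| R6_1: "\<lbrakk>i \<in> {1..<n}; i + 1 \<in> {1..<n}\<rbrakk> \<Longrightarrow>
    xe i ^ 2 * xe (i + 1) - scalar (r + s) * xe i * xe (i + 1) * xe i
      + scalar (r * s) * xe (i + 1) * xe i ^ 2 \<in> relators n r s"
| R6_2: "\<lbrakk>i \<in> {1..<n}; i + 1 \<in> {1..<n}\<rbrakk> \<Longrightarrow>
    xe i * xe (i + 1) ^ 2 - scalar (r + s) * xe (i + 1) * xe i * xe (i + 1)
      + scalar (r * s) * xe (i + 1) ^ 2 * xe i \<in> relators n r s"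
| R7_1: "\<lbrakk>i \<in> {1..<n}; i + 1 \<in> {1..<n}\<rbrakk> \<Longrightarrow>
    xf i ^ 2 * xf (i + 1)
      - scalar (inverse r + inverse s) * xf i * xf (i + 1) * xf i
      + scalar (inverse r * inverse s) * xf (i + 1) * xf i ^ 2 \<in> relators n r s"
| R7_2: "\<lbrakk>i \<in> {1..<n}; i + 1 \<in> {1..<n}\<rbrakk> \<Longrightarrow>
    xf i * xf (i + 1) ^ 2
      - scalar (inverse r + inverse s) * xf (i + 1) * xf i * xf (i + 1)
      + scalar (inverse r * inverse s) * xf (i + 1) ^ 2 * xf i \<in> relators n r s"

type_synonym 'k Urs_elem = "(gen word \<Rightarrow>\<^sub>0 'k) set"

definition rel_ideal :: "nat \<Rightarrow> 'k::field \<Rightarrow> 'k \<Rightarrow> (gen word \<Rightarrow>\<^sub>0 'k) set" where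
  "rel_ideal n r s = genideal (free_algebra (gens n)) (relators n r s)"

definition Urs :: "nat \<Rightarrow> 'k::field \<Rightarrow> 'k \<Rightarrow> ('k, 'k Urs_elem) module" where
  "Urs n r s = quotient (free_algebra (gens n)) (rel_ideal n r s)"

definition gen_Urs :: "nat \<Rightarrow> 'k::field \<Rightarrow> 'k \<Rightarrow> gen \<Rightarrow> 'k Urs_elem" where
  "gen_Urs n r s g = rel_ideal n r s +>\<^bsub>free_algebra (gens n)\<^esub> gen_free g"

definition omega :: "nat \<Rightarrow> 'k::field \<Rightarrow> 'k \<Rightarrow> nat \<Rightarrow> 'k Urs_elem" where
  "omega n r s j = gen_Urs n r s (Gen_a j) \<otimes>\<^bsub>Urs n r s\<^esub> gen_Urs n r s (Gen_b (j + 1))"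

definition omega' :: "nat \<Rightarrow> 'k::field \<Rightarrow> 'k \<Rightarrow> nat \<Rightarrow> 'k Urs_elem" where
  "omega' n r s j = gen_Urs n r s (Gen_a (j + 1)) \<otimes>\<^bsub>Urs n r s\<^esub> gen_Urs n r s (Gen_b j)"

definition Urs0 :: "nat \<Rightarrow> 'k::field \<Rightarrow> 'k \<Rightarrow> ('k, 'k Urs_elem) module" where
  "Urs0 n r s = generated_subalgebra (Urs n r s) (gen_Urs n r s ` torus_gens n)"

definition Urs_ge0 :: "nat \<Rightarrow> 'k::field \<Rightarrow> 'k \<Rightarrow> ('k, 'k Urs_elem) module" where
  "Urs_ge0 n r s = generated_subalgebra (Urs n r s) (gen_Urs n r s ` (torus_gens n \<union> Gen_e ` {1..<n}))"

text \<open>Homomorphisms characterised by their values on generators are made unique as total functions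
  by requiring them to be \<^const>\<open>extensional\<close>.\<close>

definition comult ::
    "nat \<Rightarrow> 'k::field \<Rightarrow> 'k \<Rightarrow> 'k Urs_elem \<Rightarrow> ('k Urs_elem \<times> 'k Urs_elem \<Rightarrow>\<^sub>0 int) set" where
  "comult n r s =
     (let u = gen_Urs n r s; UU = tensor_algebra (Urs n r s) (Urs n r s);
          pt = pure_tensor class_ring (Urs n r s) (Urs n r s); id1 = \<one>\<^bsub>Urs n r s\<^esub>
      in THE \<Delta>. \<Delta> \<in> algebra_hom (Urs n r s) UU \<inter> extensional (carrier (Urs n r s)) \<and>
           (\<forall>g\<in>torus_gens n. \<Delta> (u g) = pt (u g) (u g)) \<and>
           (\<forall>i\<in>{1..<n}. \<Delta> (u (Gen_e i)) = pt (u (Gen_e i)) id1 \<oplus>\<^bsub>UU\<^esub> pt (omega n r s i) (u (Gen_e i))) \<and>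
           (\<forall>i\<in>{1..<n}. \<Delta> (u (Gen_f i)) = pt id1 (u (Gen_f i)) \<oplus>\<^bsub>UU\<^esub> pt (u (Gen_f i)) (omega' n r s i)))"

definition Urs_tensor ::
    "nat \<Rightarrow> 'k::field \<Rightarrow> 'k \<Rightarrow> ('k Urs_elem, 'v) module \<Rightarrow> ('k Urs_elem, 'w) module \<Rightarrow>
      ('k Urs_elem, ('v \<times> 'w \<Rightarrow>\<^sub>0 int) set) module" where
  "Urs_tensor n r s V W = tensor_module (Urs n r s) (comult n r s) V W"


section \<open>Verma modules and their simple quotients\<close>

definition torus_chars :: "nat \<Rightarrow> 'k::field \<Rightarrow> 'k \<Rightarrow> ('k Urs_elem \<Rightarrow> 'k) set" where
  "torus_chars n r s = algebra_hom (Urs0 n r s) ground_algebra"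

definition weight_char ::
    "nat \<Rightarrow> 'k::field \<Rightarrow> 'k \<Rightarrow> (nat \<Rightarrow> int) \<Rightarrow> 'k Urs_elem \<Rightarrow> 'k" where
  "weight_char n r s lam =
     (THE h. h \<in> torus_chars n r s \<inter> extensional (carrier (Urs0 n r s)) \<and>
        (\<forall>i\<in>{1..n}. h (gen_Urs n r s (Gen_a i)) = r powi ip n (eps i) lam \<and>
                    h (gen_Urs n r s (Gen_b i)) = s powi ip n (eps i) lam))"

definition Urs_ge0_char ::
    "nat \<Rightarrow> 'k::field \<Rightarrow> 'k \<Rightarrow> ('k Urs_elem \<Rightarrow> 'k) \<Rightarrow> 'k Urs_elem \<Rightarrow> 'k" where
  "Urs_ge0_char n r s \<psi> =
     (THE h. h \<in> algebra_hom (Urs_ge0 n r s) ground_algebra \<inter> extensional (carrier (Urs_ge0 n r s)) \<and>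
        (\<forall>x\<in>carrier (Urs0 n r s). h x = \<psi> x) \<and> (\<forall>j\<in>{1..<n}. h (gen_Urs n r s (Gen_e j)) = 0))"

text \<open>\<open>V\<^sup>\<psi>\<close> on the ground field itself; a one-dimensional module is given by a character of
  \<open>Urs_ge0\<close>.\<close>

definition Vpsi ::
    "nat \<Rightarrow> 'k::field \<Rightarrow> 'k \<Rightarrow> ('k Urs_elem \<Rightarrow> 'k) \<Rightarrow> ('k Urs_elem, 'k) module" where
  "Vpsi n r s \<psi> =
     \<lparr>carrier = UNIV, monoid.mult = (*), one = 1, ring.zero = 0, ring.add = (+),
      module.smult = \<lambda>x v. Urs_ge0_char n r s \<psi> x * v\<rparr>"

type_synonym 'k verma_elem = "('k Urs_elem \<times> 'k \<Rightarrow>\<^sub>0 int) set"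

definition Verma ::
    "nat \<Rightarrow> 'k::field \<Rightarrow> 'k \<Rightarrow> ('k Urs_elem \<Rightarrow> 'k) \<Rightarrow> ('k Urs_elem, 'k verma_elem) module" where
  "Verma n r s \<psi> = induced_module (Urs n r s) (Urs_ge0 n r s) (Vpsi n r s \<psi>)"

definition Lsimple ::
    "nat \<Rightarrow> 'k::field \<Rightarrow> 'k \<Rightarrow> ('k Urs_elem \<Rightarrow> 'k) \<Rightarrow> ('k Urs_elem, 'k verma_elem set) module" where
  "Lsimple n r s \<psi> = quotient (Verma n r s \<psi>) (THE N. max_submodule (Urs n r s) (Verma n r s \<psi>) N)"

text \<open>The characters \<open>\<chi>\<close> for which \<open>Lsimple n r s \<chi>\<close> is the one-dimensional module \<open>L\<^sub>\<chi>\<close>.\<close>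

definition one_dim_chars :: "nat \<Rightarrow> 'k::field \<Rightarrow> 'k \<Rightarrow> ('k Urs_elem \<Rightarrow> 'k) set" where
  "one_dim_chars n r s =
     {\<chi> \<in> torus_chars n r s. \<forall>i\<in>{1..<n}. \<chi> (omega n r s i) = \<chi> (omega' n r s i)}"

end

theory Submission
  imports Defs
begin

text \<open>
  A module generated by a highest weight vector is the image of the free algebra on the letters
  \<open>f\<^sub>i\<close>, on which the generators act by explicit operators that satisfy the relations of the algebra
  modulo the Serre ideal. Hence two simple highest weight modules of the same weight are isomorphic,
  both being the quotient by the radical of vectors that never return to the vacuum.
  In a finite-dimensional simple module the torus has a common eigenvector, and raising operators move
  it through eigenvalues that are pairwise distinct because \<open>r/s\<close> is not a root of unity; so a highest
  weight vector exists, and nilpotency of each \<open>f\<^sub>k\<close> on it forces the weight to be a twist of a dominant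
  one. Conversely, a dominant weight occurs in an iterated tensor product of exterior powers, realised by
  a Fock-type model, which bounds the length of nonzero words in the \<open>f\<^sub>i\<close>.
\<close>

section \<open>Linear maps between free algebras\<close>

text \<open>A basis of the algebra is never constructed; the free space on words in the letters f
  stands in for it. There e_k is defined by being pushed to the right, and every relation holds
  exactly except those among the f, whose failure lies in an ideal of vectors without vacuum
  component. Hence the vacuum coefficient of p applied to the vacuum descends to a functional on
  \<open>Urs\<close>. This one functional does the work of a basis: on the torus it is the character
  with prescribed values, on the Borel part its extension by zero, and on the induced module it
  separates the highest weight vector from zero. Finite dimension is decided in the same space: a
  map out of words that is compatible with the torus, the e and the f has a stable kernel, hence a
  kernel inside the radical, so the tensor model is examined only for these compatibilities. A
  negative last coordinate of a weight is absorbed by the one-dimensional factor. The remaining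
  obstacle is the existence of the comultiplication, where the Serre relations for coproducts come
  down to explicit identities between noncommutative polynomials.\<close>

abbreviation sc :: "'k::field \<Rightarrow> 'g word \<Rightarrow>\<^sub>0 'k" where
  "sc c \<equiv> Poly_Mapping.single 0 c"

abbreviation var :: "'g \<Rightarrow> 'g word \<Rightarrow>\<^sub>0 'k::field" where
  "var g \<equiv> Poly_Mapping.single (Word [g]) 1"

lemma lookup_sc_mult [simp]:
  "Poly_Mapping.lookup (sc c * p) w = c * Poly_Mapping.lookup p w"
  by (simp add: mult_map_scale_conv_mult[symmetric] Poly_Mapping.map.rep_eq when_def)

lemma sc_mult_sc: "sc c * sc d = sc (c * d)"
  by (simp add: mult_single)

lemma sc_mult_sc_assoc: "sc c * (sc d * p) = sc (c * d) * p"
  by (rule poly_mapping_eqI) simp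

lemma single_eq_sc_mult: "Poly_Mapping.single w c = sc c * Poly_Mapping.single w 1"
  by (simp add: mult_single)

lemma single_Cons: "Poly_Mapping.single (Word (g # w)) c = var g * Poly_Mapping.single (Word w) c"
  by (simp add: mult_single plus_word_def)

lemma poly_mapping_sum_single:
  "p = (\<Sum>w\<in>Poly_Mapping.keys p. Poly_Mapping.single w (Poly_Mapping.lookup p w))"
  by (rule poly_mapping_eqI) (auto simp: lookup_sum lookup_single when_def in_keys_iff)

text \<open>The step keeps the information that \<open>w\<close> lies in the support of
  \<open>p\<close>, so that restrictions on letters or lengths of the words of \<open>p\<close>
  remain usable inside the induction.\<close>

lemma keys_single_sum_induct [case_names zero add]:
  fixes p :: "'a \<Rightarrow>\<^sub>0 'b::comm_monoid_add"
  assumes "P 0"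
    and "\<And>w x. w \<in> Poly_Mapping.keys p \<Longrightarrow> P x \<Longrightarrow> P (Poly_Mapping.single w (Poly_Mapping.lookup p w) + x)"
  shows "P p"
proof -
  have "P (\<Sum>w\<in>A. Poly_Mapping.single w (Poly_Mapping.lookup p w))"
    if "finite A" "A \<subseteq> Poly_Mapping.keys p" for A
    using that by (induction A rule: finite_induct) (use assms in auto)
  then have "P (\<Sum>w\<in>Poly_Mapping.keys p. Poly_Mapping.single w (Poly_Mapping.lookup p w))"
    by simp
  then show ?thesis
    using poly_mapping_sum_single[of p] by simp
qed

lemma mem_free_algebra: "p \<in> carrier (free_algebra G) \<longleftrightarrow> (\<forall>w\<in>Poly_Mapping.keys p. set (letters w) \<subseteq> G)"
  by (simp add: free_algebra_def)

lemma free_algebra_UNIV [simp]: "p \<in> carrier (free_algebra UNIV)"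
  by (simp add: mem_free_algebra)

lemma free_algebra_single:
  "set (letters w) \<subseteq> G \<Longrightarrow> Poly_Mapping.single w c \<in> carrier (free_algebra G)"
  by (simp add: mem_free_algebra)

lemma free_algebra_sc [simp]: "sc c \<in> carrier (free_algebra G)"
  by (simp add: free_algebra_single zero_word_def)

lemma free_algebra_zero [simp]: "0 \<in> carrier (free_algebra G)"
  by (simp add: mem_free_algebra)

lemma free_algebra_one [simp]: "1 \<in> carrier (free_algebra G)"
  using free_algebra_sc[of 1] by simp

lemma free_algebra_var: "g \<in> G \<Longrightarrow> var g \<in> carrier (free_algebra G)"
  by (simp add: free_algebra_single)

lemma free_algebra_add:
  "p \<in> carrier (free_algebra G) \<Longrightarrow> q \<in> carrier (free_algebra G) \<Longrightarrow> p + q \<in> carrier (free_algebra G)"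
  using keys_add[of p q] by (auto simp: mem_free_algebra)

lemma free_algebra_uminus:
  "p \<in> carrier (free_algebra G) \<Longrightarrow> - p \<in> carrier (free_algebra G)"
  by (auto simp: mem_free_algebra)

lemma free_algebra_diff:
  "p \<in> carrier (free_algebra G) \<Longrightarrow> q \<in> carrier (free_algebra G) \<Longrightarrow> p - q \<in> carrier (free_algebra G)"
  using free_algebra_add[of p G "- q"] free_algebra_uminus[of q G] by simp

lemma free_algebra_mult:
  "p \<in> carrier (free_algebra G) \<Longrightarrow> q \<in> carrier (free_algebra G) \<Longrightarrow> p * q \<in> carrier (free_algebra G)"
  using keys_mult[of p q] by (fastforce simp: mem_free_algebra plus_word_def)

lemma free_algebra_power:
  "p \<in> carrier (free_algebra G) \<Longrightarrow> p ^ m \<in> carrier (free_algebra G)"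
  by (induction m) (auto intro: free_algebra_mult)

lemmas free_algebra_closed =
  free_algebra_add free_algebra_diff free_algebra_uminus free_algebra_mult free_algebra_power free_algebra_var

text \<open>The operators below are all governed by what they do to a prepended letter. With this
  rule an operator identity is checked on scalars and then pushed past one letter.\<close>

lemma free_algebra_induct [consumes 1, case_names sc add var]:
  assumes "p \<in> carrier (free_algebra G)"
    and "\<And>c. P (sc c)"
    and "\<And>x y. P x \<Longrightarrow> P y \<Longrightarrow> P (x + y)"
    and "\<And>g x. g \<in> G \<Longrightarrow> x \<in> carrier (free_algebra G) \<Longrightarrow> P x \<Longrightarrow> P (var g * x)"
  shows "P p"
proof (induction rule: keys_single_sum_induct)
  case zero
  show ?case using assms(2)[of 0] by simp
next
  case (add w x)
  have "set ws \<subseteq> G \<Longrightarrow> P (Poly_Mapping.single (Word ws) c)" for ws c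
  proof (induction ws)
    case Nil
    then show ?case using assms(2)[of c] by (simp add: zero_word_def)
  next
    case (Cons g ws)
    have "P (var g * Poly_Mapping.single (Word ws) c)"
      using Cons by (intro assms(4)) (simp_all add: free_algebra_single)
    then show ?case
      by (simp add: single_Cons[of g ws])
  qed
  from this[of "letters w"] add assms show ?case
    by (auto simp: mem_free_algebra)
qed

lemmas free_induct = free_algebra_induct[where G = UNIV, OF free_algebra_UNIV, case_names sc add var]

lemma sc_commute: "p * sc c = sc c * p"
proof (induction p rule: keys_single_sum_induct)
  case (add w x)
  then show ?case
    by (simp add: distrib_left distrib_right mult_single mult.commute)
qed simp

lemma mult_sc_left_commute: "p * (sc c * x) = sc c * (p * x)"
  by (metis mult.assoc sc_commute)

lemmas var_sc_left_commute = mult_sc_left_commute[where p = "var g" for g]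

text \<open>Scalars are the central constants \<open>sc c\<close>, so linearity is stated through
  multiplication by them. Source and target may have different alphabets, because words in the f are
  later mapped to words whose letters are index sets.\<close>

definition wlin :: "(('g word \<Rightarrow>\<^sub>0 'k::field) \<Rightarrow> ('h word \<Rightarrow>\<^sub>0 'k)) \<Rightarrow> bool" where
  "wlin T \<longleftrightarrow> (\<forall>x y. T (x + y) = T x + T y) \<and> (\<forall>c x. T (sc c * x) = sc c * T x)"

lemma wlinI:
  assumes "\<And>x y. T (x + y) = T x + T y" "\<And>c x. T (sc c * x) = sc c * T x"
  shows "wlin T"
  using assms by (simp add: wlin_def)

lemma wlin_add: "wlin T \<Longrightarrow> T (x + y) = T x + T y"
  and wlin_sc: "wlin T \<Longrightarrow> T (sc c * x) = sc c * T x"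
  by (simp_all add: wlin_def)

lemma wlin_zero: "wlin T \<Longrightarrow> T 0 = 0"
  using wlin_sc[of T 0 0] by simp

lemma wlin_uminus: "wlin T \<Longrightarrow> T (- x) = - T x"
  using wlin_add[of T x "- x"] by (simp add: wlin_zero eq_neg_iff_add_eq_0 add.commute)

lemma wlin_diff: "wlin T \<Longrightarrow> T (x - y) = T x - T y"
  using wlin_add[of T x "- y"] by (simp add: wlin_uminus)

lemmas wlin_simps = wlin_add wlin_sc wlin_zero wlin_uminus wlin_diff

lemma wlin_mult_left: "wlin (\<lambda>x. p * x)"
  by (auto intro!: wlinI simp: distrib_left mult_sc_left_commute)

lemma wlin_mult_right: "wlin (\<lambda>x. x * p)"
  by (auto intro!: wlinI simp: distrib_right mult.assoc)

lemma wlin_comp: "wlin S \<Longrightarrow> wlin T \<Longrightarrow> wlin (\<lambda>x. S (T x))"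
  by (simp add: wlin_def)

lemma wlin_plus: "wlin S \<Longrightarrow> wlin T \<Longrightarrow> wlin (\<lambda>x. S x + T x)"
  by (simp add: wlin_def algebra_simps)

lemma wlin_minus: "wlin S \<Longrightarrow> wlin T \<Longrightarrow> wlin (\<lambda>x. S x - T x)"
  by (simp add: wlin_def algebra_simps)

lemma wlin_ext:
  assumes "wlin S" "wlin T" "\<And>w. S (Poly_Mapping.single w 1) = T (Poly_Mapping.single w 1)"
  shows "S p = T p"
proof (induction p rule: keys_single_sum_induct)
  case zero
  then show ?case using assms by (simp add: wlin_zero)
next
  case (add w x)
  then show ?case
    using assms by (simp add: wlin_add single_eq_sc_mult[of w "Poly_Mapping.lookup p w"] wlin_sc)
qed

definition lin_ext :: "('g word \<Rightarrow> ('h word \<Rightarrow>\<^sub>0 'k)) \<Rightarrow> ('g word \<Rightarrow>\<^sub>0 'k::field) \<Rightarrow> ('h word \<Rightarrow>\<^sub>0 'k)" where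
  "lin_ext f p = (\<Sum>w\<in>Poly_Mapping.keys p. sc (Poly_Mapping.lookup p w) * f w)"

lemma lin_ext_superset:
  assumes "finite A" "Poly_Mapping.keys p \<subseteq> A"
  shows "lin_ext f p = (\<Sum>w\<in>A. sc (Poly_Mapping.lookup p w) * f w)"
  unfolding lin_ext_def using assms by (intro sum.mono_neutral_left) (auto simp: in_keys_iff)

lemma wlin_lin_ext: "wlin (lin_ext f)"
proof (rule wlinI)
  fix x y :: "'a word \<Rightarrow>\<^sub>0 'b" and c
  let ?A = "Poly_Mapping.keys x \<union> Poly_Mapping.keys y"
  have "lin_ext f (x + y) = (\<Sum>w\<in>?A. sc (Poly_Mapping.lookup (x + y) w) * f w)"
    using keys_add[of x y] by (intro lin_ext_superset) auto
  also have "\<dots> = (\<Sum>w\<in>?A. sc (Poly_Mapping.lookup x w) * f w) + (\<Sum>w\<in>?A. sc (Poly_Mapping.lookup y w) * f w)"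
    by (simp add: lookup_add single_add distrib_right sum.distrib)
  finally show "lin_ext f (x + y) = lin_ext f x + lin_ext f y"
    using lin_ext_superset[of ?A x f] lin_ext_superset[of ?A y f] by simp
  have "lin_ext f (sc c * x) = (\<Sum>w\<in>Poly_Mapping.keys x. sc (Poly_Mapping.lookup (sc c * x) w) * f w)"
    by (intro lin_ext_superset) (auto simp: in_keys_iff)
  then show "lin_ext f (sc c * x) = sc c * lin_ext f x"
    by (simp add: lin_ext_def sum_distrib_left sc_mult_sc_assoc)
qed

lemma lin_ext_single: "lin_ext f (Poly_Mapping.single w c) = sc c * f w"
  by (simp add: lin_ext_def)

text \<open>The empty word is the vacuum, and \<open>Poly_Mapping.lookup x 0\<close> is the vacuum
  component of \<open>x\<close> everywhere below. Prepending a letter destroys that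
  component.\<close>

lemma lookup_var_mult_zero [simp]: "Poly_Mapping.lookup (var g * x) 0 = 0"
proof (induction x rule: keys_single_sum_induct)
  case (add w x)
  then show ?case
    by (simp add: distrib_left mult_single lookup_add lookup_single when_def plus_word_def zero_word_def)
qed simp

section \<open>The free Verma module\<close>

lemma ip_eps_alpha:
  assumes "i \<in> {1..n}"
  shows "ip n (eps i) (alpha j) = (if i = j then 1 else if i = Suc j then - 1 else 0)"
proof -
  have "ip n (eps i) (alpha j) = (\<Sum>k = 1..n. if k = i then alpha j k else 0)"
    unfolding ip_def by (intro sum.cong) (auto simp: eps_def)
  also have "\<dots> = alpha j i" using assms by simp
  finally show ?thesis by (auto simp: alpha_def eps_def)
qed

text \<open>\<open>dg c d\<close> multiplies a word by \<open>c\<close> and by \<open>d j\<close> for each of its letters \<open>j\<close>.\<close>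

definition dg :: "'k::field \<Rightarrow> ('g \<Rightarrow> 'k) \<Rightarrow> ('g word \<Rightarrow>\<^sub>0 'k) \<Rightarrow> ('g word \<Rightarrow>\<^sub>0 'k)" where
  "dg c d = lin_ext (\<lambda>w. Poly_Mapping.single w (c * prod_list (map d (letters w))))"

lemma wlin_dg: "wlin (dg c d)"
  by (simp add: dg_def wlin_lin_ext)

lemma dg_single: "dg c d (Poly_Mapping.single w k) = sc (c * prod_list (map d (letters w))) * Poly_Mapping.single w k"
  by (simp add: dg_def lin_ext_single mult_single mult.commute)

lemma dg_sc: "dg c d (sc k) = sc (c * k)"
  by (simp add: dg_single zero_word_def mult_single plus_word_def)

lemma dg_var: "dg c d (var j * x) = sc (d j) * (var j * dg c d x)"
  by (rule wlin_ext[of "\<lambda>x. dg c d (var j * x)"])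
     (auto intro!: wlin_comp[OF wlin_dg] wlin_comp[OF wlin_mult_left] wlin_dg wlin_mult_left
       simp: single_Cons[symmetric] dg_single mult_single plus_word_def zero_word_def mult_ac)

lemma dg_dg: "dg c d (dg c' d' x) = dg (c * c') (\<lambda>j. d j * d' j) x"
  by (induction x rule: free_induct)
     (simp_all add: dg_sc dg_var wlin_simps[OF wlin_dg] sc_mult_sc_assoc mult_ac)

lemma dg_commute: "dg c d (dg c' d' x) = dg c' d' (dg c d x)"
  by (simp add: dg_dg mult.commute)

text \<open>The constant \<open>c\<close> is charged once per word, namely for the vacuum at its
  right end; therefore it goes to the right factor and the left factor gets
  \<open>1\<close>.\<close>

lemma dg_mult: "dg c d (x * y) = dg 1 d x * dg c d y"
  by (induction x rule: free_induct)
     (simp_all add: dg_sc dg_var wlin_simps[OF wlin_dg] distrib_right mult.assoc)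

lemma dg_one_one: "dg 1 (\<lambda>j. 1) x = x"
  by (induction x rule: free_induct)
     (simp_all add: dg_sc dg_var wlin_simps[OF wlin_dg])

lemma lookup_dg_zero: "Poly_Mapping.lookup (dg c d x) 0 = c * Poly_Mapping.lookup x 0"
  by (induction x rule: free_induct)
     (simp_all add: dg_sc dg_var wlin_simps[OF wlin_dg] lookup_add distrib_left)

lemma keys_dg: "Poly_Mapping.keys (dg c d x) \<subseteq> Poly_Mapping.keys x"
proof -
  have "Poly_Mapping.lookup (dg c d x) w = c * prod_list (map d (letters w)) * Poly_Mapping.lookup x w" for w
  proof (induction x rule: keys_single_sum_induct)
    case (add v x)
    then show ?case
      by (simp add: wlin_simps[OF wlin_dg] dg_single lookup_add distrib_left)
         (simp add: lookup_single when_def)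
  qed (simp add: wlin_zero[OF wlin_dg])
  then show ?thesis by (auto simp: in_keys_iff)
qed

text \<open>\<open>\<alpha> i\<close> and \<open>\<beta> i\<close> are the eigenvalues of a_i and
  b_i on the vacuum. They are nonzero at every index, so the inverse torus operators can be written
  down without index conditions.\<close>

locale free_verma =
  fixes n :: nat and r s :: "'k::field" and \<alpha> \<beta> :: "nat \<Rightarrow> 'k"
  assumes r0: "r \<noteq> 0" and s0: "s \<noteq> 0" and rs: "r \<noteq> s"
    and q_root: "\<And>m::nat. m > 0 \<Longrightarrow> (r * inverse s) ^ m \<noteq> 1"
    and \<alpha>0: "\<And>i. \<alpha> i \<noteq> 0" and \<beta>0: "\<And>i. \<beta> i \<noteq> 0"
begin

text \<open>The scalar that appears when a_i (with \<open>x = r\<close>) or b_i (with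
  \<open>x = s\<close>) passes f_j from left to right, as in the relations R2 and R3.\<close>

definition wtr :: "'k \<Rightarrow> nat \<Rightarrow> nat \<Rightarrow> 'k" where
  "wtr x i j = x powi (- ip n (eps i) (alpha j))"

definition opA where "opA i = dg (\<alpha> i) (wtr r i)"
definition opB where "opB i = dg (\<beta> i) (wtr s i)"
definition opA' where "opA' i = dg (inverse (\<alpha> i)) (\<lambda>j. inverse (wtr r i j))"
definition opB' where "opB' i = dg (inverse (\<beta> i)) (\<lambda>j. inverse (wtr s i j))"

definition opH where
  "opH k x = sc (1 / (r - s)) * (opA k (opB (k + 1) x) - opA (k + 1) (opB k x))"

text \<open>This is e_k commuted to the right: past f_j it leaves the commutator prescribed by R4,
  which acts on the rest of the word, and at the right end it kills the vacuum.\<close>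

primrec opE_word :: "nat \<Rightarrow> nat list \<Rightarrow> (nat word \<Rightarrow>\<^sub>0 'k)" where
  "opE_word k [] = 0"
| "opE_word k (j # w) = var j * opE_word k w + (if j = k then opH k (Poly_Mapping.single (Word w) 1) else 0)"

definition opE where "opE k = lin_ext (\<lambda>w. opE_word k (letters w))"

fun op :: "gen \<Rightarrow> (nat word \<Rightarrow>\<^sub>0 'k) \<Rightarrow> (nat word \<Rightarrow>\<^sub>0 'k)" where
  "op (Gen_e i) = opE i"
| "op (Gen_f i) = (\<lambda>x. var i * x)"
| "op (Gen_a i) = opA i"
| "op (Gen_ai i) = opA' i"
| "op (Gen_b i) = opB i"
| "op (Gen_bi i) = opB' i"

lemma wtr_nonzero: "wtr r i j \<noteq> 0" "wtr s i j \<noteq> 0"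
  using r0 s0 by (simp_all add: wtr_def)

lemma wlin_opA: "wlin (opA i)" and wlin_opB: "wlin (opB i)"
  and wlin_opA': "wlin (opA' i)" and wlin_opB': "wlin (opB' i)"
  by (simp_all add: opA_def opB_def opA'_def opB'_def wlin_dg)

lemma wlin_opH: "wlin (opH k)"
  unfolding opH_def
  by (rule wlin_comp[OF wlin_mult_left]) (auto simp: wlin_def wlin_simps[OF wlin_opA] wlin_simps[OF wlin_opB] right_diff_distrib)

lemma wlin_opE: "wlin (opE k)"
  by (simp add: opE_def wlin_lin_ext)

lemma wlin_op: "wlin (op g)"
  by (cases g) (auto intro: wlin_mult_left wlin_opA wlin_opB wlin_opA' wlin_opB' wlin_opE)

lemmas op_simps = wlin_simps[OF wlin_opA] wlin_simps[OF wlin_opB] wlin_simps[OF wlin_opA']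
  wlin_simps[OF wlin_opB'] wlin_simps[OF wlin_opH] wlin_simps[OF wlin_opE] wlin_simps[OF wlin_op]

lemma opE_sc: "opE k (sc c) = 0"
  by (simp add: opE_def lin_ext_single zero_word_def)

lemma opE_var: "opE k (var j * x) = var j * opE k x + (if j = k then opH k x else 0)"
proof (rule wlin_ext[of "\<lambda>x. opE k (var j * x)"])
  have "wlin (\<lambda>x. if j = k then opH k x else 0)"
    by (auto simp: wlin_def op_simps)
  then show "wlin (\<lambda>x. var j * opE k x + (if j = k then opH k x else 0))"
    by (intro wlin_plus wlin_comp[OF wlin_mult_left] wlin_opE)
next
  fix w
  show "opE k (var j * Poly_Mapping.single w 1) =
      var j * opE k (Poly_Mapping.single w 1) + (if j = k then opH k (Poly_Mapping.single w 1) else 0)"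
    by (cases w) (simp add: single_Cons[symmetric] opE_def lin_ext_single)
qed (auto intro!: wlin_comp[OF wlin_opE] wlin_mult_left)

lemma opA_var: "opA i (var j * x) = sc (wtr r i j) * (var j * opA i x)"
  and opB_var: "opB i (var j * x) = sc (wtr s i j) * (var j * opB i x)"
  by (simp_all add: opA_def opB_def dg_var)

lemma opA_sc: "opA i (sc c) = sc (\<alpha> i * c)"
  and opB_sc: "opB i (sc c) = sc (\<beta> i * c)"
  by (simp_all add: opA_def opB_def dg_sc)

lemma opA_opA': "opA i (opA' i x) = x" and opB_opB': "opB i (opB' i x) = x"
  using \<alpha>0[of i] \<beta>0[of i] wtr_nonzero
  by (simp_all add: opA_def opA'_def opB_def opB'_def dg_dg dg_one_one)

lemma op_torus_commute:
  assumes "g \<in> torus_gens n" "h \<in> torus_gens n"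
  shows "op g (op h x) = op h (op g x)"
  using assms by (auto simp: torus_gens_def opA_def opA'_def opB_def opB'_def dg_commute)

lemma opH_dg: "opH k (dg c d x) = dg c d (opH k x)"
  by (simp add: opH_def opA_def opB_def wlin_simps[OF wlin_dg] dg_commute[of c d])

text \<open>e_k removes one letter \<open>k\<close> from a word and otherwise multiplies by scalars,
  so the diagonal eigenvalue loses exactly the factor \<open>d k\<close>.\<close>

lemma dg_opE:
  assumes "d k \<noteq> 0"
  shows "dg c d (opE k x) = sc (inverse (d k)) * opE k (dg c d x)"
proof (induction x rule: free_induct)
  case (sc c)
  then show ?case by (simp add: opE_sc dg_sc wlin_zero[OF wlin_dg])
next
  case (add x y)
  then show ?case by (simp add: wlin_simps[OF wlin_dg] op_simps distrib_left)
next
  case (var g x)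
  have "sc (d k * inverse (d k)) * y = y" for y :: "nat word \<Rightarrow>\<^sub>0 'k"
    using assms by simp
  then show ?case
    by (cases "g = k")
      (simp_all only: opE_var dg_var wlin_simps[OF wlin_dg] op_simps distrib_left opH_dg var(3)
        sc_mult_sc_assoc var_sc_left_commute if_True if_False simp_thms add_0_right mult.commute[of "inverse (d k)"])
qed

lemma opA_opE: "opA i (opE j x) = sc (inverse (wtr r i j)) * opE j (opA i x)"
  and opB_opE: "opB i (opE j x) = sc (inverse (wtr s i j)) * opE j (opB i x)"
  unfolding opA_def opB_def by (rule dg_opE, rule wtr_nonzero)+

end

section \<open>Relations among the raising operators on free words\<close>

context free_verma
begin

definition \<kappa> :: 'k where "\<kappa> = 1 / (r - s)"

definition opW where "opW k x = opA k (opB (k + 1) x)"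
definition opW' where "opW' k x = opA (k + 1) (opB k x)"

text \<open>\<open>dW k j\<close> and \<open>dW' k j\<close> are the scalars with which omega_k and
  omega_k' pass the letter f_j.\<close>

definition dW where "dW k j = wtr r k j * wtr s (k + 1) j"
definition dW' where "dW' k j = wtr r (k + 1) j * wtr s k j"

lemma opH_eq: "opH k x = sc \<kappa> * opW k x - sc \<kappa> * opW' k x"
  by (simp add: opH_def opW_def opW'_def \<kappa>_def right_diff_distrib)

lemma opW_dg: "opW k x = dg (\<alpha> k * \<beta> (k + 1)) (dW k) x"
  and opW'_dg: "opW' k x = dg (\<alpha> (k + 1) * \<beta> k) (dW' k) x"
  by (simp_all add: opW_def opW'_def opA_def opB_def dg_dg dW_def[abs_def] dW'_def[abs_def])

lemma wlin_opW: "wlin (opW k)" and wlin_opW': "wlin (opW' k)"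
  using wlin_dg by (auto simp: wlin_def opW_dg opW'_dg)

lemmas opW_simps = wlin_simps[OF wlin_opW] wlin_simps[OF wlin_opW']

lemma opW_var: "opW k (var j * x) = sc (dW k j) * (var j * opW k x)"
  and opW'_var: "opW' k (var j * x) = sc (dW' k j) * (var j * opW' k x)"
  by (simp_all add: opW_dg opW'_dg dg_var)

lemma dW_nonzero: "dW k j \<noteq> 0" "dW' k j \<noteq> 0"
  by (simp_all add: dW_def dW'_def wtr_nonzero)

lemma opW_opE: "opW k (opE j x) = sc (inverse (dW k j)) * opE j (opW k x)"
  and opW'_opE: "opW' k (opE j x) = sc (inverse (dW' k j)) * opE j (opW' k x)"
  unfolding opW_dg opW'_dg by (rule dg_opE, rule dW_nonzero)+

lemma wtr_eq:
  assumes "i \<in> {1..n}"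
  shows "wtr x i j = (if i = j then inverse x else if i = Suc j then x else 1)"
  unfolding wtr_def ip_eps_alpha[OF assms] by (simp add: power_int_minus)

lemma dW_values:
  assumes "k \<in> {1..<n}"
  shows "dW k k = s * inverse r" "dW' k k = r * inverse s"
    and "Suc k < n \<Longrightarrow> dW k (Suc k) = inverse s" "Suc k < n \<Longrightarrow> dW' k (Suc k) = inverse r"
    and "Suc k < n \<Longrightarrow> dW (Suc k) k = r" "Suc k < n \<Longrightarrow> dW' (Suc k) k = s"
    and "\<bar>int k - int j\<bar> > 1 \<Longrightarrow> dW k j = 1" "\<bar>int k - int j\<bar> > 1 \<Longrightarrow> dW' k j = 1"
  using assms by (auto simp: dW_def dW'_def wtr_eq)

text \<open>The only terms that could spoil commutation come from R4 at a letter \<open>i\<close> or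
  \<open>j\<close>, and there the torus part for one index passes the other raising operator with
  scalar 1, since the indices are far apart.\<close>

lemma opE_commute:
  assumes "i \<in> {1..<n}" "j \<in> {1..<n}" "\<bar>int i - int j\<bar> > 1"
  shows "opE i (opE j x) = opE j (opE i x)"
proof (induction x rule: free_induct)
  case (var g x)
  have "\<bar>int j - int i\<bar> > 1" "i \<noteq> j" using assms by auto
  with assms show ?case
    by (cases "g = i"; cases "g = j")
       (simp_all add: opE_var op_simps opH_eq opW_opE opW'_opE opW_simps dW_values var(3))
qed (simp_all add: opE_sc op_simps)

text \<open>The Serre polynomial in e commutes with every f_g. For \<open>g\<close> different from
  both indices each factor commutes separately; for the two others the torus terms left by R4 add up
  to zero by the values of \<open>dW\<close> and \<open>dW'\<close>.\<close>

lemma opE_serre_var: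
  assumes "i \<in> {1..<n}" "Suc i \<in> {1..<n}"
  shows "opE i (opE i (opE (Suc i) (var g * x))) - sc (r + s) * opE i (opE (Suc i) (opE i (var g * x)))
         + sc (r * s) * opE (Suc i) (opE i (opE i (var g * x)))
       = var g * (opE i (opE i (opE (Suc i) x)) - sc (r + s) * opE i (opE (Suc i) (opE i x))
         + sc (r * s) * opE (Suc i) (opE i (opE i x)))" (is ?A)
    and "opE i (opE (Suc i) (opE (Suc i) (var g * x))) - sc (r + s) * opE (Suc i) (opE i (opE (Suc i) (var g * x)))
         + sc (r * s) * opE (Suc i) (opE (Suc i) (opE i (var g * x)))
       = var g * (opE i (opE (Suc i) (opE (Suc i) x)) - sc (r + s) * opE (Suc i) (opE i (opE (Suc i) x))
         + sc (r * s) * opE (Suc i) (opE (Suc i) (opE i x)))" (is ?B)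
proof -
  have ni: "g \<noteq> i \<or> g \<noteq> Suc i" by auto
  have *: "Suc i < n" using assms by simp
  \<comment> \<open>These rules bring torus operators to the inside of the e and scalars to the
    front. The identity can then be compared word by word, where it is an identity in the
    field.\<close>
  note S = opE_var op_simps opH_eq opW_opE opW'_opE opW_simps dW_values[OF assms(1)] dW_values[OF assms(2)] *
     distrib_left right_diff_distrib var_sc_left_commute
  note L = lookup_add lookup_minus
  have "?A \<and> ?B" if "g = i"
    using that r0 s0 by (intro conjI; intro poly_mapping_eqI) (simp_all add: S L, simp_all add: field_simps)
  moreover have "?A \<and> ?B" if "g = Suc i"
    using that r0 s0 by (intro conjI; intro poly_mapping_eqI) (simp_all add: S L, simp_all add: field_simps)
  moreover have "?A \<and> ?B" if "g \<noteq> i" "g \<noteq> Suc i"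
    using that by (simp add: opE_var distrib_left right_diff_distrib var_sc_left_commute)
  ultimately show ?A ?B by blast+
qed

text \<open>An operator that commutes with all letters and kills the scalars is zero. So the raising
  Serre relations hold exactly on free words, in contrast to the lowering ones.\<close>

lemma opE_serre:
  assumes "i \<in> {1..<n}" "Suc i \<in> {1..<n}"
  shows "opE i (opE i (opE (Suc i) x)) - sc (r + s) * opE i (opE (Suc i) (opE i x))
         + sc (r * s) * opE (Suc i) (opE i (opE i x)) = 0"
    and "opE i (opE (Suc i) (opE (Suc i) x)) - sc (r + s) * opE (Suc i) (opE i (opE (Suc i) x))
         + sc (r * s) * opE (Suc i) (opE (Suc i) (opE i x)) = 0"
proof -
  let ?S = "\<lambda>x. opE i (opE i (opE (Suc i) x)) - sc (r + s) * opE i (opE (Suc i) (opE i x))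
         + sc (r * s) * opE (Suc i) (opE i (opE i x))"
  show "?S x = 0"
  proof (induction x rule: free_induct)
    case (add x y)
    have "?S (x + y) = ?S x + ?S y"
      by (simp add: op_simps distrib_left)
    with add show ?case by simp
  next
    case (var g x)
    then show ?case by (simp only: opE_serre_var[OF assms] mult_zero_right)
  qed (simp add: opE_sc op_simps)
  let ?T = "\<lambda>x. opE i (opE (Suc i) (opE (Suc i) x)) - sc (r + s) * opE (Suc i) (opE i (opE (Suc i) x))
         + sc (r * s) * opE (Suc i) (opE (Suc i) (opE i x))"
  show "?T x = 0"
  proof (induction x rule: free_induct)
    case (add x y)
    have "?T (x + y) = ?T x + ?T y"
      by (simp add: op_simps distrib_left)
    with add show ?case by simp
  next
    case (var g x)
    then show ?case by (simp only: opE_serre_var[OF assms] mult_zero_right)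
  qed (simp add: opE_sc op_simps)
qed

section \<open>The ideal of Serre relations in the lowering letters\<close>

inductive_set serre_f :: "(nat word \<Rightarrow>\<^sub>0 'k) set" where
  "\<lbrakk>i \<in> {1..<n}; j \<in> {1..<n}; \<bar>int i - int j\<bar> > 1\<rbrakk> \<Longrightarrow> var i * var j - var j * var i \<in> serre_f"
| "\<lbrakk>i \<in> {1..<n}; Suc i \<in> {1..<n}\<rbrakk> \<Longrightarrow>
    var i ^ 2 * var (Suc i) - sc (inverse r + inverse s) * var i * var (Suc i) * var i
      + sc (inverse r * inverse s) * var (Suc i) * var i ^ 2 \<in> serre_f"
| "\<lbrakk>i \<in> {1..<n}; Suc i \<in> {1..<n}\<rbrakk> \<Longrightarrow>
    var i * var (Suc i) ^ 2 - sc (inverse r + inverse s) * var (Suc i) * var i * var (Suc i)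
      + sc (inverse r * inverse s) * var (Suc i) ^ 2 * var i \<in> serre_f"

text \<open>Every Serre element is homogeneous: all its words have the same letters with the same
  multiplicities, and \<open>m\<close> is the product of \<open>d\<close> over them.\<close>

lemma dg_serre:
  assumes "t \<in> serre_f"
  obtains m where "dg 1 d t = sc m * t"
proof -
  have "\<exists>m. dg 1 d t = sc m * t"
    using assms
  proof cases
    case (1 i j)
    have "dg 1 d (sc 1) = sc 1" by (simp only: dg_sc) simp
    then have v: "dg 1 d (var i) = sc (d i) * var i" for i
      using dg_var[of 1 d i "sc 1"] by simp
    show ?thesis unfolding 1
      by (rule exI[of _ "d i * d j"])
         (simp add: dg_var v wlin_simps[OF wlin_dg] right_diff_distrib var_sc_left_commute sc_mult_sc_assoc mult_ac)
  next
    case (2 i)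
    have "dg 1 d (sc 1) = sc 1" by (simp only: dg_sc) simp
    then have v: "dg 1 d (var i) = sc (d i) * var i" for i
      using dg_var[of 1 d i "sc 1"] by simp
    show ?thesis unfolding 2
      by (rule exI[of _ "d i * d i * d (Suc i)"])
         (simp add: dg_var v wlin_simps[OF wlin_dg] right_diff_distrib distrib_left var_sc_left_commute sc_mult_sc_assoc
           power2_eq_square mult.assoc, simp add: algebra_simps)
  next
    case (3 i)
    have "dg 1 d (sc 1) = sc 1" by (simp only: dg_sc) simp
    then have v: "dg 1 d (var i) = sc (d i) * var i" for i
      using dg_var[of 1 d i "sc 1"] by simp
    show ?thesis unfolding 3
      by (rule exI[of _ "d i * d (Suc i) * d (Suc i)"])
         (simp add: dg_var v wlin_simps[OF wlin_dg] right_diff_distrib distrib_left var_sc_left_commute sc_mult_sc_assoc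
           power2_eq_square mult.assoc, simp add: algebra_simps)
  qed
  then show ?thesis using that by blast
qed

text \<open>The Serre elements are singular vectors: when e_k is pushed through one, the torus terms
  from R4 cancel, so nothing remains except e_k on the right. This happens already in the free
  algebra, for every \<open>k\<close>.\<close>

lemma opE_serre_f:
  assumes "t \<in> serre_f"
  shows "opE k (t * x) = t * opE k x"
  using assms
proof cases
  case (1 i j)
  have *: "\<bar>int j - int i\<bar> > 1" "i \<noteq> j" using 1 by auto
  show ?thesis unfolding 1
    using 1 *
    by (cases "k = i"; cases "k = j")
      (simp_all add: left_diff_distrib mult.assoc opE_var op_simps opH_eq opW_var opW'_var dW_values
         right_diff_distrib distrib_left var_sc_left_commute)
next
  case (2 i)
  have *: "Suc i < n" using 2 by simp
  note S = opE_var op_simps opH_eq opW_var opW'_var opW_simps dW_values[OF 2(2)] dW_values[OF 2(3)] *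
     distrib_left distrib_right left_diff_distrib right_diff_distrib var_sc_left_commute power2_eq_square mult.assoc
  note L = lookup_add lookup_minus
  show ?thesis unfolding 2
    using r0 s0
    by (cases "k = i"; cases "k = Suc i"; intro poly_mapping_eqI)
       (simp_all add: S L, simp_all add: field_simps)
next
  case (3 i)
  have *: "Suc i < n" using 3 by simp
  note S = opE_var op_simps opH_eq opW_var opW'_var opW_simps dW_values[OF 3(2)] dW_values[OF 3(3)] *
     distrib_left distrib_right left_diff_distrib right_diff_distrib var_sc_left_commute power2_eq_square mult.assoc
  note L = lookup_add lookup_minus
  show ?thesis unfolding 3
    using r0 s0
    by (cases "k = i"; cases "k = Suc i"; intro poly_mapping_eqI)
       (simp_all add: S L, simp_all add: field_simps)
qed

text \<open>The two-sided ideal generated by the Serre elements, with right multiplication built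
  into the base case and left multiplication added letter by letter. In this form its invariance
  under each operator is proved by induction over membership.\<close>

inductive_set serre_ideal :: "(nat word \<Rightarrow>\<^sub>0 'k) set" where
  zero: "0 \<in> serre_ideal"
| base: "t \<in> serre_f \<Longrightarrow> t * x \<in> serre_ideal"
| add: "x \<in> serre_ideal \<Longrightarrow> y \<in> serre_ideal \<Longrightarrow> x + y \<in> serre_ideal"
| sc: "x \<in> serre_ideal \<Longrightarrow> sc c * x \<in> serre_ideal"
| var: "x \<in> serre_ideal \<Longrightarrow> var j * x \<in> serre_ideal"

lemma serre_ideal_dg: "x \<in> serre_ideal \<Longrightarrow> dg c d x \<in> serre_ideal"
proof (induction rule: serre_ideal.induct)
  case (base t x)
  obtain m where "dg 1 d t = sc m * t" using dg_serre[OF base] .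
  then show ?case
    by (simp add: dg_mult mult.assoc) (intro serre_ideal.intros base)
qed (auto simp: wlin_simps[OF wlin_dg] dg_var intro: serre_ideal.intros)

lemma serre_ideal_opE: "x \<in> serre_ideal \<Longrightarrow> opE k x \<in> serre_ideal"
proof (induction rule: serre_ideal.induct)
  case (base t x)
  then show ?case by (simp add: opE_serre_f serre_ideal.base)
next
  case (var x j)
  have "opH k x = sc \<kappa> * opW k x + sc (- \<kappa>) * opW' k x"
    by (simp add: opH_eq single_uminus)
  also have "\<dots> \<in> serre_ideal"
    using var by (auto simp: opW_dg opW'_dg intro!: serre_ideal.intros serre_ideal_dg)
  finally show ?case
    using var by (auto simp: opE_var intro: serre_ideal.intros)
qed (auto simp: op_simps intro: serre_ideal.intros)

lemma serre_ideal_op: "x \<in> serre_ideal \<Longrightarrow> op g x \<in> serre_ideal"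
  by (cases g) (auto simp: opA_def opB_def opA'_def opB'_def intro: serre_ideal_dg serre_ideal_opE serre_ideal.var)

text \<open>All words in a Serre element have at least two letters, so its multiples have no vacuum
  component. This is what keeps the vacuum alive modulo the ideal.\<close>

lemma serre_ideal_vac: "x \<in> serre_ideal \<Longrightarrow> Poly_Mapping.lookup x 0 = 0"
proof (induction rule: serre_ideal.induct)
  case (base t x)
  then show ?case
    by cases (simp_all add: left_diff_distrib distrib_right mult.assoc power2_eq_square lookup_add lookup_minus)
qed (auto simp: lookup_add)

section \<open>The free algebra on all generators acting on words\<close>

definition act :: "(gen word \<Rightarrow>\<^sub>0 'k) \<Rightarrow> (nat word \<Rightarrow>\<^sub>0 'k) \<Rightarrow> (nat word \<Rightarrow>\<^sub>0 'k)" where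
  "act p x = lin_ext (\<lambda>w. foldr op (letters w) x) p"

lemma wlin_act_left: "wlin (\<lambda>p. act p x)"
  unfolding act_def by (rule wlin_lin_ext)

lemmas act_simps = wlin_simps[OF wlin_act_left]

lemma act_sc: "act (sc c) x = sc c * x"
  by (simp add: act_def lin_ext_single zero_word_def)

lemma act_var_mult: "act (var g * p) x = op g (act p x)"
proof (rule wlin_ext[of "\<lambda>p. act (var g * p) x"])
  show "wlin (\<lambda>p. act (var g * p) x)"
    by (rule wlin_comp[OF wlin_act_left wlin_mult_left])
  show "wlin (\<lambda>p. op g (act p x))"
    by (rule wlin_comp[OF wlin_op wlin_act_left])
  show "act (var g * Poly_Mapping.single w 1) x = op g (act (Poly_Mapping.single w 1) x)" for w
    by (cases w) (simp add: single_Cons[symmetric] act_def lin_ext_single)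
qed

lemma act_one: "act 1 x = x"
  using act_sc[of 1 x] by simp

lemma act_var: "act (var g) x = op g x"
  using act_var_mult[of g 1 x] by (simp add: act_one)

lemma act_mult: "act (p * q) x = act p (act q x)"
  by (induction p rule: free_induct) (simp_all add: act_simps act_sc distrib_right mult.assoc act_var_mult)

lemma wlin_act: "wlin (act p)"
proof (rule wlinI)
  show "act p (x + y) = act p x + act p y" for x y
    by (induction p rule: free_induct) (simp_all add: act_simps act_sc act_var_mult op_simps distrib_left)
  show "act p (sc c * x) = sc c * act p x" for c x
    by (induction p rule: free_induct)
       (simp_all add: act_simps act_sc act_var_mult op_simps distrib_left sc_mult_sc_assoc mult.commute)
qed

lemma act_serre_ideal: "x \<in> serre_ideal \<Longrightarrow> act p x \<in> serre_ideal"
  by (induction p rule: free_induct) (auto simp: act_sc act_simps act_var_mult intro: serre_ideal.intros serre_ideal_op)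

text \<open>The relators act by zero, apart from the relations between the f: those multiply
  \<open>x\<close> on the left by a Serre element and thus land in the ideal.\<close>

lemma act_relator:
  assumes "p \<in> relators n r s"
  shows "act p x \<in> serre_ideal"
proof -
  note S = act_simps act_mult act_var act_sc act_one power2_eq_square
  have wi: "inverse (wtr t i j) = t powi ip n (eps i) (alpha j)" for t i j
    by (simp add: wtr_def power_int_minus)
  show ?thesis using assms
  proof cases
    case (R4 i j)
    then show ?thesis
      by (simp add: S opE_var opH_def serre_ideal.zero)
  next
    case (R7_1 i)
    have "act p x = (var i ^ 2 * var (Suc i) - sc (inverse r + inverse s) * var i * var (Suc i) * var i
      + sc (inverse r * inverse s) * var (Suc i) * var i ^ 2) * x"
      unfolding R7_1 by (simp add: S left_diff_distrib distrib_right mult.assoc)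
    then show ?thesis using R7_1 serre_f.intros(2)[of i] by (auto intro: serre_ideal.base)
  next
    case (R7_2 i)
    have "act p x = (var i * var (Suc i) ^ 2 - sc (inverse r + inverse s) * var (Suc i) * var i * var (Suc i)
      + sc (inverse r * inverse s) * var (Suc i) ^ 2 * var i) * x"
      unfolding R7_2 by (simp add: S left_diff_distrib distrib_right mult.assoc)
    then show ?thesis using R7_2 serre_f.intros(3)[of i] by (auto intro: serre_ideal.base)
  next
    case (R5_f i j)
    have "act p x = (var i * var j - var j * var i) * x"
      unfolding R5_f by (simp add: S left_diff_distrib mult.assoc)
    then show ?thesis using R5_f serre_f.intros(1)[of i j] by (auto intro: serre_ideal.base)
  next
    case (R6_1 i)
    then show ?thesis
      using opE_serre(1)[of i x] by (simp add: S serre_ideal.zero)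
  next
    case (R6_2 i)
    then show ?thesis
      using opE_serre(2)[of i x] by (simp add: S serre_ideal.zero)
  next
    case (R1_comm x y)
    then show ?thesis
      using op_torus_commute by (simp add: S serre_ideal.zero)
  qed (auto simp: S serre_ideal.zero opA_opA' opB_opB' opA_opE opB_opE opA_var opB_var opE_commute wi,
       auto simp: wtr_def serre_ideal.zero)
qed

end

section \<open>The grading by length and the radical\<close>

context free_verma
begin

text \<open>The alphabet is all of \<open>nat\<close>, while f_j exists for
  \<open>j \<in> {1..<n}\<close> only. Words in these genuine letters are the ones that can be
  evaluated in a module.\<close>

definition Fn :: "(nat word \<Rightarrow>\<^sub>0 'k) set" where "Fn = carrier (free_algebra {1..<n})"
abbreviation "Pn \<equiv> carrier (free_algebra (gens n) :: ('k, gen word \<Rightarrow>\<^sub>0 'k) module)"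

lemma Fn_closed:
  "0 \<in> Fn" "1 \<in> Fn" "sc c \<in> Fn" "x \<in> Fn \<Longrightarrow> y \<in> Fn \<Longrightarrow> x + y \<in> Fn" "x \<in> Fn \<Longrightarrow> y \<in> Fn \<Longrightarrow> x - y \<in> Fn"
  "x \<in> Fn \<Longrightarrow> y \<in> Fn \<Longrightarrow> x * y \<in> Fn" "j \<in> {1..<n} \<Longrightarrow> var j \<in> Fn" "x \<in> Fn \<Longrightarrow> sc c * x \<in> Fn"
  "x \<in> Fn \<Longrightarrow> Suc 0 \<le> j \<Longrightarrow> j < n \<Longrightarrow> var j * x \<in> Fn"
  unfolding Fn_def by (auto intro!: free_algebra_closed)

lemma Fn_induct [consumes 1, case_names sc add var]:
  assumes "p \<in> Fn"
    and "\<And>c. P (sc c)"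
    and "\<And>x y. P x \<Longrightarrow> P y \<Longrightarrow> P (x + y)"
    and "\<And>g x. g \<in> {1..<n} \<Longrightarrow> x \<in> Fn \<Longrightarrow> P x \<Longrightarrow> P (var g * x)"
  shows "P p"
  using assms unfolding Fn_def by (rule free_algebra_induct)

lemma mem_Fn: "x \<in> Fn \<longleftrightarrow> (\<forall>w\<in>Poly_Mapping.keys x. set (letters w) \<subseteq> {1..<n})"
  by (simp add: Fn_def mem_free_algebra)

definition stable :: "(nat word \<Rightarrow>\<^sub>0 'k) set \<Rightarrow> bool" where
  "stable K \<longleftrightarrow> 0 \<in> K \<and> (\<forall>x\<in>K. \<forall>y\<in>K. x + y \<in> K) \<and> (\<forall>c. \<forall>x\<in>K. sc c * x \<in> K) \<and>
     (\<forall>g\<in>gens n. \<forall>x\<in>K. op g x \<in> K)"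

lemma stable_act:
  assumes "stable K" "p \<in> Pn" "x \<in> K"
  shows "act p x \<in> K"
  using assms(2) by (induction p rule: free_algebra_induct)
    (use assms in \<open>auto simp: stable_def act_sc act_simps act_var_mult\<close>)

lemma dg_Fn: "x \<in> Fn \<Longrightarrow> dg c d x \<in> Fn"
  using keys_dg[of c d x] by (auto simp: mem_Fn)

lemma opE_Fn: "x \<in> Fn \<Longrightarrow> opE k x \<in> Fn"
proof (induction x rule: Fn_induct)
  case (var g x)
  then show ?case
    by (auto simp: opE_var opH_def opA_def opB_def intro!: Fn_closed dg_Fn)
qed (auto simp: opE_sc op_simps intro: Fn_closed)

lemma op_Fn: "g \<in> gens n \<Longrightarrow> x \<in> Fn \<Longrightarrow> op g x \<in> Fn"
  by (auto simp: gens_def torus_gens_def opA_def opB_def opA'_def opB'_def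
      intro!: dg_Fn opE_Fn Fn_closed)

lemma stable_Fn: "stable Fn"
  by (auto simp: stable_def intro: Fn_closed op_Fn)

lemma act_Fn: "p \<in> Pn \<Longrightarrow> x \<in> Fn \<Longrightarrow> act p x \<in> Fn"
  using stable_act[OF stable_Fn] .

definition q :: 'k where "q = r * inverse s"

lemma q0: "q \<noteq> 0" using r0 s0 by (simp add: q_def)

lemma q_inj: "q ^ i = q ^ j \<Longrightarrow> i = j"
proof (induction i j rule: linorder_wlog)
  case (le i j)
  have "q ^ j = q ^ i * q ^ (j - i)"
    using le by (metis le_add_diff_inverse power_add)
  then have "q ^ (j - i) = 1" using q0 le by simp
  then show ?case using q_root[of "j - i"] le by (cases "j - i") (auto simp: q_def)
qed auto

text \<open>This is an unnormalised quantum integer. Multiplied by q - 1 it becomes q^(m+1) - 1,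
  which the root of unity assumption keeps away from zero in every characteristic.\<close>

lemma q_sum_nonzero: "(\<Sum>j\<le>m. q ^ j) \<noteq> 0"
proof
  assume "(\<Sum>j\<le>m. q ^ j) = 0"
  then have "(\<Sum>j<Suc m. q ^ j) = 0" by (simp add: lessThan_Suc_atMost)
  then have "q ^ Suc m - 1 = 0"
    using power_diff_1_eq[of q "Suc m"] by simp
  then show False using q_root[of "Suc m"] by (simp add: q_def)
qed

text \<open>The torus element \<open>\<Prod> (a\<^sub>i b\<^sub>i\<^sup>-\<^sup>1)\<^sup>n\<^sup>-\<^sup>i\<close> acts on words of length \<open>l\<close> by a constant times
  \<open>(r s\<^sup>-\<^sup>1)\<^sup>-\<^sup>l\<close>; it detects the grading by length.\<close>

primrec len_op :: "nat \<Rightarrow> (nat word \<Rightarrow>\<^sub>0 'k) \<Rightarrow> (nat word \<Rightarrow>\<^sub>0 'k)" where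
  "len_op 0 x = x"
| "len_op (Suc m) x = ((\<lambda>y. opA (Suc m) (opB' (Suc m) y)) ^^ (n - Suc m)) (len_op m x)"

text \<open>Letter \<open>j\<close> is scaled by the factor with index \<open>j\<close>, giving
  q^-(n-j), and by the factor with index j + 1, giving q^(n-j-1); together q^-1. The case
  distinction records the state after the first \<open>m\<close> factors, when a letter has seen
  none, one or both of them.\<close>

lemma len_op_dg:
  assumes "m \<le> n"
  shows "\<exists>c d. c \<noteq> 0 \<and> (\<forall>x. len_op m x = dg c d x) \<and>
    (\<forall>j\<in>{1..<n}. d j = (if m < j then 1 else if m = j then inverse q ^ (n - j) else inverse q))"
  using assms
proof (induction m)
  case 0
  then show ?case by (auto intro!: exI[of _ 1] exI[of _ "\<lambda>j. 1"] simp: dg_one_one)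
next
  case (Suc m)
  then obtain c d where cd: "c \<noteq> 0" "\<And>x. len_op m x = dg c d x"
    "\<And>j. j \<in> {1..<n} \<Longrightarrow> d j = (if m < j then 1 else if m = j then inverse q ^ (n - j) else inverse q)"
    by auto
  let ?c = "\<alpha> (Suc m) * inverse (\<beta> (Suc m))"
  let ?d = "\<lambda>j. wtr r (Suc m) j * inverse (wtr s (Suc m) j)"
  have pow: "((\<lambda>y. opA (Suc m) (opB' (Suc m) y)) ^^ l) x = dg (?c ^ l) (\<lambda>j. ?d j ^ l) x" for l x
    by (induction l) (auto simp: dg_one_one opA_def opB'_def dg_dg mult_ac)
  show ?case
  proof (intro exI conjI allI ballI)
    show "len_op (Suc m) x = dg (?c ^ (n - Suc m) * c) (\<lambda>j. ?d j ^ (n - Suc m) * d j) x" for x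
      by (simp only: len_op.simps pow cd dg_dg)
    show "?c ^ (n - Suc m) * c \<noteq> 0"
      using cd \<alpha>0 \<beta>0 by simp
    fix j assume j: "j \<in> {1..<n}"
    have "Suc m \<in> {1..n}" using Suc.prems by simp
    note w = wtr_eq[OF this]
    show "?d j ^ (n - Suc m) * d j = (if Suc m < j then 1 else if Suc m = j then inverse q ^ (n - j) else inverse q)"
    proof (cases "m = j")
      case True
      have "n - j = Suc (n - Suc j)" using j by auto
      then have "q ^ (n - Suc j) * inverse q ^ (n - j) = (q * inverse q) ^ (n - Suc j) * inverse q"
        by (simp only: power_mult_distrib power_Suc mult.assoc) (simp add: mult_ac)
      also have "\<dots> = inverse q" using q0 by simp
      finally show ?thesis
        using True w cd(3)[OF j] by (simp add: q_def)
    next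
      case False
      then show ?thesis using w cd(3)[OF j] by (auto simp: q_def)
    qed
  qed
qed

lemma len_op_eigen:
  obtains c where "c \<noteq> 0"
    "\<And>x w. x \<in> Fn \<Longrightarrow> Poly_Mapping.lookup (len_op n x) w =
       c * inverse q ^ length (letters w) * Poly_Mapping.lookup x w"
proof -
  obtain c d where cd: "c \<noteq> 0" "\<And>x. len_op n x = dg c d x"
    "\<And>j. j \<in> {1..<n} \<Longrightarrow> d j = inverse q"
    using len_op_dg[of n] by fastforce
  have "prod_list (map d w) = inverse q ^ length w" if "set w \<subseteq> {1..<n}" for w
    using that by (induction w) (auto simp: cd(3))
  then have dg1: "dg c d (Poly_Mapping.single w k) = Poly_Mapping.single w (c * inverse q ^ length (letters w) * k)"
    if "set (letters w) \<subseteq> {1..<n}" for w k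
    using that by (simp add: dg_single mult_single)
  have "Poly_Mapping.lookup (dg c d x) w = c * inverse q ^ length (letters w) * Poly_Mapping.lookup x w"
    if "x \<in> Fn" for x w
  proof (induction rule: keys_single_sum_induct)
    case (add v y)
    then have "set (letters v) \<subseteq> {1..<n}" using that by (auto simp: mem_Fn)
    then show ?case
      using add by (simp add: wlin_simps[OF wlin_dg] dg1 lookup_add distrib_left)
        (simp add: lookup_single when_def)
  qed (simp add: wlin_zero[OF wlin_dg])
  then show ?thesis
    using that[of c] cd by auto
qed

lemma stable_len_op:
  assumes "stable K" "x \<in> K"
  shows "len_op n x \<in> K"
proof -
  have *: "op (Gen_a i) x \<in> K" "op (Gen_bi i) x \<in> K" if "x \<in> K" "i \<in> {1..n}" for i x
    using assms(1) that unfolding stable_def gens_def torus_gens_def by blast+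
  have **: "((\<lambda>y. opA i (opB' i y)) ^^ l) x \<in> K" if "x \<in> K" "i \<in> {1..n}" for i l x
    using that by (induction l) (use * in auto)
  have "len_op m x \<in> K" if "m \<le> n" for m
    using that by (induction m) (use ** assms in auto)
  then show ?thesis by simp
qed

text \<open>Words of different length have different eigenvalues under \<open>len_op\<close>,
  because the powers of \<open>q\<close> are distinct. The longest words can therefore be removed
  one length at a time inside \<open>K\<close>, until only a nonzero multiple of the vacuum is
  left.\<close>

lemma stable_vac:
  assumes "stable K" "K \<subseteq> Fn" "x \<in> K" "Poly_Mapping.lookup x 0 \<noteq> 0"
  shows "1 \<in> K"
proof -
  obtain c where c: "c \<noteq> 0"
    "\<And>x w. x \<in> Fn \<Longrightarrow> Poly_Mapping.lookup (len_op n x) w =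
       c * inverse q ^ length (letters w) * Poly_Mapping.lookup x w"
    using len_op_eigen by blast
  have "1 \<in> K" if "x \<in> K" "\<forall>w\<in>Poly_Mapping.keys x. length (letters w) \<le> N" "Poly_Mapping.lookup x 0 \<noteq> 0" for N x
    using that
  proof (induction N arbitrary: x)
    case 0
    let ?c = "Poly_Mapping.lookup x 0"
    have "x = sc ?c"
    proof (rule poly_mapping_eqI)
      fix w
      show "Poly_Mapping.lookup x w = Poly_Mapping.lookup (sc ?c) w"
      proof (cases "w = 0")
        case False
        then have "w \<notin> Poly_Mapping.keys x"
          using 0(2) by (cases w) (auto simp: zero_word_def)
        then show ?thesis using False by (simp add: in_keys_iff lookup_single)
      qed simp
    qed
    then have "sc (inverse ?c) * x = 1"
      using 0(3) by (metis left_inverse sc_mult_sc single_one)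
    then show ?case using 0(1) assms(1) unfolding stable_def by metis
  next
    case (Suc N)
    \<comment> \<open>Subtracting the eigenvalue of length \<open>Suc N\<close> kills the words of
      that length, while the vacuum component is multiplied by c (1 - q^-(N+1)), which is not
      zero.\<close>
    let ?y = "len_op n x + sc (- (c * inverse q ^ Suc N)) * x"
    have x: "x \<in> Fn" using Suc assms by auto
    have l: "Poly_Mapping.lookup ?y w = c * (inverse q ^ length (letters w) - inverse q ^ Suc N) * Poly_Mapping.lookup x w" for w
      by (simp add: lookup_add c(2)[OF x] algebra_simps)
    have "inverse q ^ 0 \<noteq> inverse q ^ Suc N"
    proof
      assume "inverse q ^ 0 = inverse q ^ Suc N"
      then have "q ^ 0 = q ^ Suc N"
        by (simp only: power_inverse) (metis inverse_inverse_eq)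
      then show False using q_inj by blast
    qed
    then have "inverse q ^ length (letters (0 :: nat word)) - inverse q ^ Suc N \<noteq> 0"
      by (simp add: zero_word_def)
    then have "Poly_Mapping.lookup ?y 0 \<noteq> 0"
      unfolding l using c(1) Suc.prems(3) by simp
    moreover have "?y \<in> K"
      using assms(1) Suc.prems(1) stable_len_op[OF assms(1)] unfolding stable_def by blast
    moreover have "\<forall>w\<in>Poly_Mapping.keys ?y. length (letters w) \<le> N"
    proof
      fix w assume "w \<in> Poly_Mapping.keys ?y"
      then have "Poly_Mapping.lookup ?y w \<noteq> 0" by (simp add: in_keys_iff)
      then have "length (letters w) \<noteq> Suc N" "w \<in> Poly_Mapping.keys x"
        unfolding l by (auto simp: in_keys_iff)
      then show "length (letters w) \<le> N" using Suc.prems(2) by force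
    qed
    ultimately show ?case using Suc.IH by blast
  qed
  moreover have "\<forall>w\<in>Poly_Mapping.keys x. length (letters w) \<le> Max ((\<lambda>w. length (letters w)) ` Poly_Mapping.keys x)"
    by auto
  ultimately show ?thesis using assms by blast
qed

definition rad :: "(nat word \<Rightarrow>\<^sub>0 'k) set" where
  "rad = {x \<in> Fn. \<forall>p\<in>Pn. Poly_Mapping.lookup (act p x) 0 = 0}"

lemma stable_rad: "stable rad"
proof -
  have "op g x \<in> rad" if "g \<in> gens n" "x \<in> rad" for g x
  proof -
    have "Poly_Mapping.lookup (act p (op g x)) 0 = 0" if "p \<in> Pn" for p
      using \<open>x \<in> rad\<close> that \<open>g \<in> gens n\<close> free_algebra_mult[OF that free_algebra_var[of g]]
      by (auto simp: rad_def act_mult act_var dest!: bspec[of _ _ "p * var g"])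
    then show ?thesis using that by (auto simp: rad_def op_Fn)
  qed
  then show ?thesis
    by (auto simp: stable_def) (auto simp: rad_def wlin_simps[OF wlin_act] lookup_add intro!: Fn_closed)
qed

lemma one_notin_rad: "1 \<notin> rad"
  by (auto simp: rad_def act_one intro!: bexI[of _ 1])

text \<open>If some image of a member of \<open>K\<close> had a vacuum component, then separation by
  length would put the vacuum itself into \<open>K\<close>. So the radical is the largest stable
  subspace of \<open>Fn\<close> that avoids the vacuum.\<close>

lemma stable_subset_rad:
  assumes "stable K" "K \<subseteq> Fn" "1 \<notin> K"
  shows "K \<subseteq> rad"
  using assms stable_vac[OF assms(1,2)] stable_act[OF assms(1)] unfolding rad_def by blast

lemma serre_ideal_Null_relators: "p \<in> relators n r s \<Longrightarrow> Poly_Mapping.lookup (act p x) 0 = 0"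
  by (intro serre_ideal_vac act_relator)

section \<open>The computation for a single index\<close>

lemma opH_var_power: "opH k (var k ^ m) =
  sc (\<kappa> * (\<alpha> k * \<beta> (k + 1) * dW k k ^ m - \<alpha> (k + 1) * \<beta> k * dW' k k ^ m)) * var k ^ m"
proof -
  have "opW k (var k ^ m) = sc (\<alpha> k * \<beta> (k + 1) * dW k k ^ m) * var k ^ m"
  proof (induction m)
    case 0
    then show ?case using dg_sc[of _ _ 1] by (simp add: opW_dg)
  qed (simp add: opW_var var_sc_left_commute sc_mult_sc_assoc mult_ac)
  moreover have "opW' k (var k ^ m) = sc (\<alpha> (k + 1) * \<beta> k * dW' k k ^ m) * var k ^ m"
  proof (induction m)
    case 0
    then show ?case using dg_sc[of _ _ 1] by (simp add: opW'_dg)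
  qed (simp add: opW'_var var_sc_left_commute sc_mult_sc_assoc mult_ac)
  ultimately show ?thesis
    by (simp add: opH_eq sc_mult_sc_assoc right_diff_distrib single_diff left_diff_distrib)
qed

text \<open>The sl_2 formula for e f^(m+1) on a highest weight vector. The torus contributions at
  successive heights form a geometric sum, which leaves one quantum integer times a factor that sees
  the weight.\<close>

lemma opE_var_power:
  assumes "k \<in> {1..<n}"
  shows "opE k (var k ^ Suc m) =
    sc (\<kappa> * (\<Sum>j\<le>m. q ^ j) * (\<alpha> k * \<beta> (k + 1) * inverse q ^ m - \<alpha> (k + 1) * \<beta> k)) * var k ^ m"
proof (induction m)
  case 0
  then show ?case
    using opH_var_power[of k 0] opE_sc[of k 1] opE_var[of k k 1] by simp
next
  case (Suc m)
  have inv: "s * inverse r = inverse q" "r * inverse s = q" by (simp_all add: q_def mult.commute)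
  let ?w = "\<alpha> k * \<beta> (k + 1)" and ?w' = "\<alpha> (k + 1) * \<beta> k"
  have S: "(\<Sum>j\<le>m. q ^ j) * q ^ 0 * q + 1 = (\<Sum>j\<le>Suc m. q ^ j)"
    by (simp add: sum.atMost_Suc_shift[of _ m] sum_distrib_right del: sum.atMost_Suc) (simp add: mult_ac)
  have iq: "inverse q ^ m = q * inverse q ^ Suc m" using q0 by simp
  have "(\<Sum>j\<le>m. q ^ j) * (?w * inverse q ^ m - ?w') + (?w * inverse q ^ Suc m - ?w' * q ^ Suc m)
     = ?w * inverse q ^ Suc m * ((\<Sum>j\<le>m. q ^ j) * q + 1) - ?w' * ((\<Sum>j\<le>m. q ^ j) + q ^ Suc m)"
    unfolding iq by (simp add: algebra_simps del: power_Suc)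
  also have "\<dots> = (\<Sum>j\<le>Suc m. q ^ j) * (?w * inverse q ^ Suc m - ?w')"
    using S by (simp add: algebra_simps del: power_Suc)
  finally have *: "\<kappa> * (\<Sum>j\<le>m. q ^ j) * (?w * inverse q ^ m - ?w') + \<kappa> * (?w * inverse q ^ Suc m - ?w' * q ^ Suc m)
     = \<kappa> * (\<Sum>j\<le>Suc m. q ^ j) * (?w * inverse q ^ Suc m - ?w')"
    by (metis (no_types, lifting) distrib_left mult.assoc)
  have "opE k (var k ^ Suc (Suc m)) = var k * opE k (var k ^ Suc m) + opH k (var k ^ Suc m)"
    using opE_var[of k k "var k ^ Suc m"] by simp
  also have "\<dots> = sc (\<kappa> * (\<Sum>j\<le>m. q ^ j) * (?w * inverse q ^ m - ?w')) * var k ^ Suc m +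
      sc (\<kappa> * (?w * inverse q ^ Suc m - ?w' * q ^ Suc m)) * var k ^ Suc m"
    unfolding Suc.IH opH_var_power dW_values(1,2)[OF assms] inv
    by (simp add: mult_sc_left_commute)
  also have "\<dots> = sc (\<kappa> * (\<Sum>j\<le>Suc m. q ^ j) * (?w * inverse q ^ Suc m - ?w')) * var k ^ Suc m"
    unfolding distrib_right[symmetric] single_add[symmetric] * ..
  finally show ?case .
qed

text \<open>The coefficient at the word of \<open>m\<close> letters \<open>k\<close> isolates the
  scalar of the sl_2 formula. In it only the weight factor can vanish. The scalar \<open>c\<close>
  is a separate variable so that its vanishing can be proved inside a module.\<close>

lemma sl2_weight:
  assumes "k \<in> {1..<n}" "opE k (var k ^ Suc m) = sc c * var k ^ m" "c = 0"
  shows "\<alpha> k * \<beta> (k + 1) = q ^ m * (\<alpha> (k + 1) * \<beta> k)"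
proof -
  let ?c = "\<kappa> * (\<Sum>j\<le>m. q ^ j) * (\<alpha> k * \<beta> (k + 1) * inverse q ^ m - \<alpha> (k + 1) * \<beta> k)"
  have p: "var k ^ m = Poly_Mapping.single (Word (replicate m k)) (1 :: 'k)"
  proof (induction m)
    case 0
    then show ?case by (simp only: power_0 replicate_0 zero_word_def[symmetric] single_one)
  qed (simp add: single_Cons[symmetric])
  have "sc ?c * var k ^ m = 0"
    using assms opE_var_power[OF assms(1), of m] by simp
  then have "Poly_Mapping.lookup (sc ?c * var k ^ m) (Word (replicate m k)) = 0" by simp
  then have "?c = 0" unfolding p by simp
  then have "\<alpha> k * \<beta> (k + 1) * inverse q ^ m = \<alpha> (k + 1) * \<beta> k"
    using q_sum_nonzero[of m] rs by (simp add: \<kappa>_def)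
  then have "q ^ m * (\<alpha> (k + 1) * \<beta> k) = \<alpha> k * \<beta> (k + 1) * (inverse q * q) ^ m"
    by (simp add: power_mult_distrib mult_ac)
  then show ?thesis using q0 by simp
qed

text \<open>When omega_i and omega_i' agree on the vacuum, e_k f_k kills it, so no operator leads
  from longer words back to the vacuum. Everything without vacuum component is then in the radical,
  and the simple quotient is a line.\<close>

lemma one_dim_rad:
  assumes "\<And>i. i \<in> {1..<n} \<Longrightarrow> \<alpha> i * \<beta> (i + 1) = \<alpha> (i + 1) * \<beta> i"
  shows "{x \<in> Fn. Poly_Mapping.lookup x 0 = 0} \<subseteq> rad"
proof (rule stable_subset_rad)
  have E: "Poly_Mapping.lookup (opE k x) 0 = 0" if "k \<in> {1..<n}" for k x
  proof (induction x rule: free_induct)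
    case (var g x)
    then show ?case
      using assms[OF that]
      by (simp add: opE_var lookup_add opH_eq lookup_minus opW_dg opW'_dg lookup_dg_zero)
  qed (auto simp: opE_sc op_simps lookup_add)
  have "Poly_Mapping.lookup (op g x) 0 = 0" if "g \<in> gens n" "Poly_Mapping.lookup x 0 = 0" for g x
    using that E by (auto simp: gens_def torus_gens_def opA_def opB_def opA'_def opB'_def lookup_dg_zero)
  then show "stable {x \<in> Fn. Poly_Mapping.lookup x 0 = 0}"
    by (auto simp: stable_def lookup_add intro: Fn_closed op_Fn)
qed auto

end

section \<open>Finite-dimensional models\<close>

text \<open>Tensor products of a one-dimensional module, which sits on the empty word, with exterior powers
  of the natural module: a letter is a set of indices, and \<open>e\<^sub>i\<close>, \<open>f\<^sub>i\<close> move an element of it.\<close>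

locale fock_model = free_verma +
  fixes A0 B0 :: "nat \<Rightarrow> 'a" and hw :: "nat set list"
  assumes A0_B0: "\<And>i. i \<in> {1..<n} \<Longrightarrow> A0 i * B0 (i + 1) = A0 (i + 1) * B0 i"
    and \<alpha>_eq: "\<And>i. i \<in> {1..n} \<Longrightarrow> \<alpha> i = A0 i * prod_list (map (\<lambda>I. if i \<in> I then r else 1) hw)"
    and \<beta>_eq: "\<And>i. i \<in> {1..n} \<Longrightarrow> \<beta> i = B0 i * prod_list (map (\<lambda>I. if i \<in> I then s else 1) hw)"
    and hw_sets: "\<And>I. I \<in> set hw \<Longrightarrow> I \<subseteq> {1..n} \<and> (\<forall>i\<ge>1. Suc i \<in> I \<longrightarrow> i \<in> I)"
begin

definition lA where "lA i I = (if i \<in> I then r else 1)"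
definition lB where "lB i I = (if i \<in> I then s else 1)"

definition gA where "gA i = dg (A0 i) (lA i)"
definition gB where "gB i = dg (B0 i) (lB i)"

definition gW' where "gW' i x = gA (Suc i) (gB i x)"

text \<open>A set stands for the wedge of its elements in increasing order. Exchanging neighbouring
  indices preserves that order, which is why neither signs nor powers of \<open>r\<close> and
  \<open>s\<close> occur.\<close>

definition eI :: "nat \<Rightarrow> nat set \<Rightarrow> (nat set word \<Rightarrow>\<^sub>0 'a)" where
  "eI i I = (if Suc i \<in> I \<and> i \<notin> I then var (insert i (I - {Suc i})) else 0)"

definition fI :: "nat \<Rightarrow> nat set \<Rightarrow> (nat set word \<Rightarrow>\<^sub>0 'a)" where
  "fI i I = (if i \<in> I \<and> Suc i \<notin> I then var (insert (Suc i) (I - {i})) else 0)"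

text \<open>The coproduct of e_i unfolded from the left: the first letter is the left tensor factor,
  the remaining word the right one. The coefficient is the eigenvalue of omega_i on the letter, and
  the empty word is the one-dimensional factor, killed by e_i.\<close>

primrec gE_word :: "nat \<Rightarrow> nat set list \<Rightarrow> (nat set word \<Rightarrow>\<^sub>0 'a)" where
  "gE_word i [] = 0"
| "gE_word i (I # w) = eI i I * Poly_Mapping.single (Word w) 1 + sc (lA i I * lB (Suc i) I) * (var I * gE_word i w)"

text \<open>The same for f_i: either the tail is lowered and the first letter kept, or the letter is
  lowered and omega_i' acts on the whole tail, including the one-dimensional factor.\<close>

primrec gF_word :: "nat \<Rightarrow> nat set list \<Rightarrow> (nat set word \<Rightarrow>\<^sub>0 'a)" where
  "gF_word i [] = 0"
| "gF_word i (I # w) = var I * gF_word i w + fI i I * gW' i (Poly_Mapping.single (Word w) 1)"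

definition gE where "gE i = lin_ext (\<lambda>w. gE_word i (letters w))"
definition gF where "gF i = lin_ext (\<lambda>w. gF_word i (letters w))"

lemma wlin_gE: "wlin (gE i)" and wlin_gF: "wlin (gF i)"
  by (simp_all add: gE_def gF_def wlin_lin_ext)

lemma wlin_gA: "wlin (gA i)" and wlin_gB: "wlin (gB i)"
  by (simp_all add: gA_def gB_def wlin_dg)

lemma gW'_dg: "gW' i x = dg (A0 (Suc i) * B0 i) (\<lambda>I. lA (Suc i) I * lB i I) x"
  by (simp add: gW'_def gA_def gB_def dg_dg)

lemma wlin_gW': "wlin (gW' i)"
  using wlin_dg by (auto simp: wlin_def gW'_dg)

lemmas g_simps = wlin_simps[OF wlin_gE] wlin_simps[OF wlin_gF] wlin_simps[OF wlin_gA]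
  wlin_simps[OF wlin_gB] wlin_simps[OF wlin_gW']

lemma gE_sc: "gE i (sc c) = 0" and gF_sc: "gF i (sc c) = 0"
  by (simp_all add: gE_def gF_def lin_ext_single zero_word_def)

lemma gE_var: "gE i (var I * x) = eI i I * x + sc (lA i I * lB (Suc i) I) * (var I * gE i x)"
proof (rule wlin_ext[of "\<lambda>x. gE i (var I * x)"])
  show "gE i (var I * Poly_Mapping.single w 1) =
      eI i I * Poly_Mapping.single w 1 + sc (lA i I * lB (Suc i) I) * (var I * gE i (Poly_Mapping.single w 1))" for w
    by (cases w) (simp add: single_Cons[symmetric] gE_def lin_ext_single)
qed (auto intro!: wlin_plus wlin_mult_left wlin_comp[OF wlin_mult_left] wlin_gE wlin_comp[OF wlin_gE])

lemma gF_var: "gF i (var I * x) = var I * gF i x + fI i I * gW' i x"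
proof (rule wlin_ext[of "\<lambda>x. gF i (var I * x)"])
  show "gF i (var I * Poly_Mapping.single w 1) =
      var I * gF i (Poly_Mapping.single w 1) + fI i I * gW' i (Poly_Mapping.single w 1)" for w
    by (cases w) (simp add: single_Cons[symmetric] gF_def lin_ext_single)
qed (auto intro!: wlin_plus wlin_mult_left wlin_comp[OF wlin_mult_left] wlin_gF wlin_gW' wlin_comp[OF wlin_gF])

lemma dg_gF:
  assumes "\<And>I. i \<in> I \<Longrightarrow> Suc i \<notin> I \<Longrightarrow> d (insert (Suc i) (I - {i})) = m * d I"
  shows "dg c d (gF i x) = sc m * gF i (dg c d x)"
proof (induction x rule: free_induct)
  case (var I x)
  have 1: "dg c d (fI i I * y) = sc m * (sc (d I) * (fI i I * dg c d y))" for y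
    using assms[of I] by (simp add: fI_def dg_var sc_mult_sc_assoc wlin_zero[OF wlin_dg])
  show ?case
    by (simp only: gF_var dg_var wlin_simps[OF wlin_dg] g_simps distrib_left var(3) 1
          var_sc_left_commute sc_mult_sc_assoc gW'_dg dg_commute[of c d] mult.commute[of m])
qed (simp_all add: gF_sc dg_sc wlin_simps[OF wlin_dg] g_simps distrib_left)

lemma dg_gE:
  assumes "\<And>I. Suc i \<in> I \<Longrightarrow> i \<notin> I \<Longrightarrow> d (insert i (I - {Suc i})) = m * d I"
  shows "dg c d (gE i x) = sc m * gE i (dg c d x)"
proof (induction x rule: free_induct)
  case (var I x)
  have 1: "dg c d (eI i I * y) = sc m * (sc (d I) * (eI i I * dg c d y))" for y
    using assms[of I] by (simp add: eI_def dg_var sc_mult_sc_assoc wlin_zero[OF wlin_dg])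
  show ?case
    by (simp only: gE_var dg_var wlin_simps[OF wlin_dg] g_simps distrib_left var(3) 1
          var_sc_left_commute sc_mult_sc_assoc mult_ac)
qed (simp_all add: gE_sc dg_sc wlin_simps[OF wlin_dg] g_simps distrib_left)

lemma gA_gF: "k \<in> {1..n} \<Longrightarrow> gA k (gF i x) = sc (wtr r k i) * gF i (gA k x)"
  and gB_gF: "k \<in> {1..n} \<Longrightarrow> gB k (gF i x) = sc (wtr s k i) * gF i (gB k x)"
proof -
  assume "k \<in> {1..n}"
  then have A: "lA k (insert (Suc i) (I - {i})) = wtr r k i * lA k I"
    and B: "lB k (insert (Suc i) (I - {i})) = wtr s k i * lB k I" if "i \<in> I" "Suc i \<notin> I" for I
    using r0 s0 that by (cases "k = i"; cases "k = Suc i"; simp add: wtr_eq lA_def lB_def)+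
  show "gA k (gF i x) = sc (wtr r k i) * gF i (gA k x)"
    unfolding gA_def by (rule dg_gF) (rule A)
  show "gB k (gF i x) = sc (wtr s k i) * gF i (gB k x)"
    unfolding gB_def by (rule dg_gF) (rule B)
qed

text \<open>For neighbouring \<open>i\<close> and \<open>j\<close> both sides vanish, because the
  first move either takes the element that the second needs or occupies its target. In the remaining
  cases the moves concern disjoint pairs of indices.\<close>

lemma moves_commute:
  assumes "i \<noteq> j"
  shows "(if j \<in> I \<and> Suc j \<notin> I then eI i (insert (Suc j) (I - {j})) else 0)
       = (if Suc i \<in> I \<and> i \<notin> I then fI j (insert i (I - {Suc i})) else 0)"
proof -
  have "insert i (insert (Suc j) (I - {j}) - {Suc i}) = insert (Suc j) (insert i (I - {Suc i}) - {j})"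
    if "Suc i \<in> I" "i \<notin> I" "j \<in> I" "Suc j \<notin> I" "Suc i \<noteq> j" "Suc j \<noteq> i"
    using assms that by auto
  then show ?thesis
    using assms by (auto simp: eI_def fI_def)
qed

text \<open>The two scalars agree because omega_j' passes e_i with the same factor by which lowering
  a letter by f_j changes its eigenvalue under omega_i. This lets the mixed terms of the coproducts
  of e_i and f_j cancel.\<close>

lemma gW'_gE:
  assumes "i \<in> {1..<n}" "j \<in> {1..<n}" "j \<in> I" "Suc j \<notin> I"
  shows "sc (lA i I * lB (Suc i) I) * gW' j (gE i x) =
    sc (lA i (insert (Suc j) (I - {j})) * lB (Suc i) (insert (Suc j) (I - {j}))) * gE i (gW' j x)"
proof -
  \<comment> \<open>The change of the eigenvalue of omega_j' when i + 1 is replaced by i in a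
    letter: for i = j it loses a factor r and gains s, for neighbouring indices only one of the two
    factors is affected.\<close>
  define m where "m = (if i = j then s / r else if j = Suc i then 1 / s else if i = Suc j then r else 1)"
  have "gW' j (gE i x) = sc m * gE i (gW' j x)"
    unfolding gW'_dg using r0 s0 by (intro dg_gE) (auto simp: m_def lA_def lB_def)
  moreover have "lA i I * lB (Suc i) I * m = lA i (insert (Suc j) (I - {j})) * lB (Suc i) (insert (Suc j) (I - {j}))"
    using assms r0 s0 by (auto simp: m_def lA_def lB_def)
  ultimately show ?thesis by (simp only: sc_mult_sc_assoc)
qed

definition gH where "gH i x = sc \<kappa> * gA i (gB (Suc i) x) - sc \<kappa> * gW' i x"

text \<open>On the empty word both sides vanish or agree by \<open>A0_B0\<close>. For a word with
  first letter \<open>I\<close>, the commutator is omega_i times the commutator on the tail plus the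
  commutator on the letter times omega_j' on the tail, and these recombine to \<open>gH\<close> of
  the whole word.\<close>

lemma gE_gF:
  assumes "i \<in> {1..<n}" "j \<in> {1..<n}"
  shows "gE i (gF j x) = gF j (gE i x) + (if i = j then gH i x else 0)"
proof (induction x rule: free_induct)
  case (sc c)
  have "gA i (gB (Suc i) (sc c)) = gW' i (sc c)"
    using A0_B0[OF assms(1)] by (simp add: gW'_def gA_def gB_def dg_sc mult.assoc[symmetric])
  then show ?case by (auto simp: gE_sc gF_sc g_simps gH_def)
next
  case (add x y)
  then show ?case by (auto simp: g_simps gH_def distrib_left)
next
  case (var I x)
  let ?J = "insert (Suc j) (I - {j})" and ?K = "insert i (I - {Suc i})" and ?o = "lA i I * lB (Suc i) I"
  have 1: "gE i (fI j I * gW' j x) = (if j \<in> I \<and> Suc j \<notin> I then eI i ?J * gW' j x else 0)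
      + sc ?o * (fI j I * gW' j (gE i x))"
    using gW'_gE[OF assms, of I x] by (simp add: fI_def gE_var g_simps var_sc_left_commute[symmetric])
  have 2: "gF j (eI i I * x) = eI i I * gF j x + (if Suc i \<in> I \<and> i \<notin> I then fI j ?K * gW' j x else 0)"
    by (auto simp: eI_def gF_var g_simps)
  have "gE i (gF j (var I * x)) - gF j (gE i (var I * x)) =
     sc ?o * (var I * (if i = j then gH i x else 0)) +
     ((if j \<in> I \<and> Suc j \<notin> I then eI i ?J else 0) - (if Suc i \<in> I \<and> i \<notin> I then fI j ?K else 0)) * gW' j x"
    by (simp add: gE_var gF_var g_simps 1 2 var distrib_left left_diff_distrib)
  also have "\<dots> = (if i = j then gH i (var I * x) else 0)"
  proof (cases "i = j")
    case True
    have k: "\<kappa> * r = \<kappa> * s + 1" using rs by (simp add: \<kappa>_def field_simps)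
    have s1: "insert j (I - {j}) = I" if "j \<in> I" for j using that by auto
    have J: "insert j (insert (Suc j) (I - {j}) - {Suc j}) = I" if "j \<in> I" "Suc j \<notin> I"
      using that by auto
    have K: "insert (Suc j) (insert j (I - {Suc j}) - {j}) = I" if "Suc j \<in> I" "j \<notin> I"
      using that by auto
    \<comment> \<open>The eigenvalue of the commutator of e_j and f_j on a single letter. It equals
      (omega_j - omega_j') / (r - s) there, since the pair of eigenvalues is (r, s), (s, r) or two
      equal numbers.\<close>
    define \<epsilon> where "\<epsilon> = (if j \<in> I \<and> Suc j \<notin> I then 1 else if Suc j \<in> I \<and> j \<notin> I then - 1 else (0 :: 'a))"
    have "(if j \<in> I \<and> Suc j \<notin> I then eI i ?J else 0) - (if Suc i \<in> I \<and> i \<notin> I then fI j ?K else 0) = sc \<epsilon> * var I"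
      using True J K by (auto simp: eI_def fI_def \<epsilon>_def single_uminus)
    moreover have "\<epsilon> - ?o * \<kappa> = - (\<kappa> * (lA (Suc j) I * lB j I))"
    proof -
      have "1 - r * \<kappa> = - (\<kappa> * s)" "- 1 - s * \<kappa> = - (\<kappa> * r)"
        using k by (simp_all add: mult.commute)
      then show ?thesis
        using True by (simp add: \<epsilon>_def lA_def lB_def mult_ac)
    qed
    moreover have "gA j (gB (Suc j) (var I * x)) = sc ?o * (var I * gA j (gB (Suc j) x))"
      using True by (simp add: gA_def gB_def dg_var wlin_simps[OF wlin_dg] sc_mult_sc_assoc mult.commute)
    moreover have "gW' j (var I * x) = sc (lA (Suc j) I * lB j I) * (var I * gW' j x)"
      by (simp add: gW'_dg dg_var)
    moreover have "sc ?o * (var I * (sc \<kappa> * X - sc \<kappa> * Y)) + sc \<epsilon> * var I * Y =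
        sc (?o * \<kappa>) * (var I * X) + sc (\<epsilon> - ?o * \<kappa>) * (var I * Y)" for X Y
      by (simp add: right_diff_distrib left_diff_distrib var_sc_left_commute sc_mult_sc_assoc single_diff mult.assoc)
    ultimately show ?thesis
      using True by (simp add: gH_def sc_mult_sc_assoc mult.commute single_uminus)
  next
    case False
    then show ?thesis using moves_commute[OF False, of I] by simp
  qed
  finally show ?case by (simp add: algebra_simps)
qed

section \<open>The map from words to the tensor model\<close>

definition gpi :: "(nat word \<Rightarrow>\<^sub>0 'a) \<Rightarrow> (nat set word \<Rightarrow>\<^sub>0 'a)" where
  "gpi = lin_ext (\<lambda>w. foldr gF (letters w) (Poly_Mapping.single (Word hw) 1))"

lemma wlin_gpi: "wlin gpi" by (simp add: gpi_def wlin_lin_ext)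

lemma gpi_sc: "gpi (sc c) = sc c * Poly_Mapping.single (Word hw) 1"
  by (simp add: gpi_def lin_ext_single zero_word_def)

lemma gpi_var: "gpi (var j * x) = gF j (gpi x)"
proof (rule wlin_ext[of "\<lambda>x. gpi (var j * x)"])
  show "gpi (var j * Poly_Mapping.single w 1) = gF j (gpi (Poly_Mapping.single w 1))" for w
    by (cases w) (simp add: single_Cons[symmetric] gpi_def lin_ext_single)
qed (auto intro!: wlin_comp[OF wlin_gpi] wlin_mult_left wlin_comp[OF wlin_gF] wlin_gpi)

lemma gpi_opA: "i \<in> {1..n} \<Longrightarrow> gpi (opA i x) = gA i (gpi x)"
  and gpi_opB: "i \<in> {1..n} \<Longrightarrow> gpi (opB i x) = gB i (gpi x)"
proof -
  show "gpi (opA i x) = gA i (gpi x)" if "i \<in> {1..n}"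
  proof (induction x rule: free_induct)
    case (sc c)
    then show ?case
      by (simp add: opA_sc gpi_sc g_simps \<alpha>_eq[OF that])
         (simp add: gA_def dg_single lA_def[abs_def] sc_mult_sc_assoc mult_ac)
  qed (simp_all add: op_simps g_simps wlin_simps[OF wlin_gpi] opA_var gpi_var gA_gF[OF that])
  show "gpi (opB i x) = gB i (gpi x)" if "i \<in> {1..n}"
  proof (induction x rule: free_induct)
    case (sc c)
    then show ?case
      by (simp add: opB_sc gpi_sc g_simps \<beta>_eq[OF that])
         (simp add: gB_def dg_single lB_def[abs_def] sc_mult_sc_assoc mult_ac)
  qed (simp_all add: op_simps g_simps wlin_simps[OF wlin_gpi] opB_var gpi_var gB_gF[OF that])
qed

text \<open>The letters of \<open>hw\<close> contain i whenever they contain i + 1, so e_i finds no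
  element that it could move.\<close>

lemma gE_hw:
  assumes "i \<in> {1..<n}"
  shows "gE i (Poly_Mapping.single (Word hw) 1) = 0"
proof -
  have "gE i (Poly_Mapping.single (Word w) 1) = 0" if "set w \<subseteq> set hw" for w
    using that
  proof (induction w)
    case (Cons I w)
    then have "eI i I = 0" using hw_sets[of I] assms by (auto simp: eI_def)
    with Cons show ?case by (simp add: single_Cons[of I w] gE_var)
  qed (simp add: gE_sc[of i 1, unfolded zero_word_def])
  then show ?thesis by simp
qed

lemma gpi_opH:
  assumes "k \<in> {1..<n}"
  shows "gpi (opH k x) = gH k (gpi x)"
  using assms by (simp add: opH_def gH_def gW'_def \<kappa>_def wlin_simps[OF wlin_gpi] gpi_opA gpi_opB right_diff_distrib)

lemma gpi_opE:
  assumes "k \<in> {1..<n}" "x \<in> Fn"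
  shows "gpi (opE k x) = gE k (gpi x)"
  using assms(2)
proof (induction x rule: Fn_induct)
  case (sc c)
  then show ?case by (simp add: opE_sc gpi_sc g_simps wlin_simps[OF wlin_gpi] gE_hw[OF assms(1)])
next
  case (var j x)
  then show ?case
    using assms by (auto simp: opE_var wlin_simps[OF wlin_gpi] gpi_var gE_gF gpi_opH)
qed (simp add: op_simps g_simps wlin_simps[OF wlin_gpi])

text \<open>Compatibility with the torus, the e and the f makes the kernel stable, and the highest
  vector of the model is not zero. The radical contains every such stable set.\<close>

lemma gpi_kernel: "{x \<in> Fn. gpi x = 0} \<subseteq> rad"
proof (rule stable_subset_rad)
  have "gpi (op g x) = 0" if "g \<in> gens n" "x \<in> Fn" "gpi x = 0" for g x
  proof -
    \<comment> \<open>Inverse torus generators are handled by injectivity: \<open>gA\<close> and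
      \<open>gB\<close> are invertible diagonal operators, and they send the vectors in question to
      the image of \<open>x\<close>, which is zero.\<close>
    have inv: "gpi (opA' i x) = 0" "gpi (opB' i x) = 0" if "i \<in> {1..n}" for i
    proof -
      have "gA i (gpi (opA' i x)) = gpi x" "gB i (gpi (opB' i x)) = gpi x"
        using gpi_opA[OF that, of "opA' i x"] gpi_opB[OF that, of "opB' i x"] by (simp_all only: opA_opA' opB_opB')
      then have 0: "gA i (gpi (opA' i x)) = 0" "gB i (gpi (opB' i x)) = 0"
        using \<open>gpi x = 0\<close> by simp_all
      have nz: "A0 i \<noteq> 0" "B0 i \<noteq> 0"
        using \<alpha>0[of i] \<beta>0[of i] \<alpha>_eq[OF that] \<beta>_eq[OF that] by auto
      have "y = 0" if "gA i y = 0 \<or> gB i y = 0" for y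
      proof -
        have "inverse (lA i I) * lA i I = 1" "inverse (lB i I) * lB i I = 1" for I
          using r0 s0 by (auto simp: lA_def lB_def)
        then have "dg (inverse (A0 i)) (\<lambda>I. inverse (lA i I)) (gA i y) = y"
          "dg (inverse (B0 i)) (\<lambda>I. inverse (lB i I)) (gB i y) = y"
          using nz by (simp_all add: gA_def gB_def dg_dg dg_one_one)
        with that show ?thesis by (metis wlin_dg wlin_zero)
      qed
      with 0 show "gpi (opA' i x) = 0" "gpi (opB' i x) = 0" by blast+
    qed
    show ?thesis
      using that inv by (auto simp: gens_def torus_gens_def gpi_opA gpi_opB gpi_opE gpi_var g_simps)
  qed
  then show "stable {x \<in> Fn. gpi x = 0}"
    by (auto simp: stable_def wlin_simps[OF wlin_gpi] intro: Fn_closed op_Fn)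
  have "Poly_Mapping.lookup (gpi 1) (Word hw) = 1"
    using gpi_sc[of 1] by simp
  then show "1 \<notin> {x \<in> Fn. gpi x = 0}" by auto
qed auto

text \<open>\<open>E\<close> is an energy, the sum of all indices in all letters. Lowering replaces
  some j by j + 1 and raises the energy by exactly one, whereas length and index range, both
  preserved, bound it.\<close>

definition lev :: "nat \<Rightarrow> nat \<Rightarrow> (nat set word \<Rightarrow>\<^sub>0 'a) \<Rightarrow> bool" where
  "lev m E x \<longleftrightarrow> (\<forall>w\<in>Poly_Mapping.keys x. length (letters w) = m \<and> (\<forall>I\<in>set (letters w). I \<subseteq> {1..n}) \<and>
     sum_list (map (\<lambda>I. \<Sum>I) (letters w)) = E)"

lemma lev_zero: "lev m E 0" by (simp add: lev_def)

lemma lev_add: "lev m E x \<Longrightarrow> lev m E y \<Longrightarrow> lev m E (x + y)"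
  using keys_add[of x y] by (auto simp: lev_def)

lemma lev_sc: "lev m E x \<Longrightarrow> lev m E (sc c * x)"
proof -
  have "Poly_Mapping.keys (sc c * x) \<subseteq> Poly_Mapping.keys x" by (auto simp: in_keys_iff)
  then show "lev m E x \<Longrightarrow> lev m E (sc c * x)" unfolding lev_def by blast
qed

lemma lev_dg: "lev m E x \<Longrightarrow> lev m E (dg c d x)"
  using keys_dg[of c d x] by (auto simp: lev_def)

lemma lev_var: "lev m E x \<Longrightarrow> I \<subseteq> {1..n} \<Longrightarrow> lev (Suc m) (\<Sum>I + E) (var I * x)"
  using keys_mult[of "var I" x] by (fastforce simp: lev_def plus_word_def)

lemma lev_gF:
  assumes "lev m E x" "j \<in> {1..<n}"
  shows "lev m (Suc E) (gF j x)"
proof -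
  have w: "lev (length w) (Suc (sum_list (map (\<lambda>I. \<Sum>I) w))) (gF j (Poly_Mapping.single (Word w) 1))"
    if "\<forall>I\<in>set w. I \<subseteq> {1..n}" for w
    using that
  proof (induction w)
    case Nil
    then show ?case using gF_sc[of j 1] by (simp add: zero_word_def lev_zero)
  next
    case (Cons I w)
    let ?x = "Poly_Mapping.single (Word w) (1::'a)" and ?J = "insert (Suc j) (I - {j})"
    have 1: "lev (length w) (sum_list (map (\<lambda>I. \<Sum>I) w)) ?x"
      using Cons by (auto simp: lev_def)
    have "lev (Suc (length w)) (Suc (\<Sum>I + sum_list (map (\<lambda>I. \<Sum>I) w))) (fI j I * gW' j ?x)"
    proof (cases "j \<in> I \<and> Suc j \<notin> I")
      case True
      have fin: "finite I" using Cons by (auto intro: finite_subset)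
      have "\<Sum>?J = Suc j + \<Sum>(I - {j})"
        using True fin by (subst sum.insert) auto
      also have "\<dots> = Suc (\<Sum>I)"
        using True fin by (simp add: sum.remove[of I j])
      finally show ?thesis
        using True lev_var[OF lev_dg[OF 1], of ?J] Cons assms(2) by (auto simp: fI_def gW'_dg)
    qed (auto simp: fI_def lev_zero)
    then show ?case
      using lev_add[OF lev_var[OF Cons.IH, of I]] Cons by (simp add: single_Cons[of I w] gF_var)
  qed
  show ?thesis
  proof (induction x rule: keys_single_sum_induct)
    case zero
    then show ?case by (simp add: g_simps lev_zero)
  next
    case (add v y)
    then have "lev m (Suc E) (gF j (Poly_Mapping.single v 1))"
      using w[of "letters v"] assms(1) by (auto simp: lev_def)
    with add show ?case
      unfolding single_eq_sc_mult[of v "Poly_Mapping.lookup x v"] g_simps by (intro lev_add lev_sc)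
  qed
qed

text \<open>A word of length l raises the energy of the highest vector by l. Beyond the maximal
  energy the image in the tensor model has to be zero, and the kernel lies in the radical.\<close>

lemma long_words_rad:
  obtains N where "\<And>w. set w \<subseteq> {1..<n} \<Longrightarrow> N < length w \<Longrightarrow> Poly_Mapping.single (Word w) 1 \<in> rad"
proof
  fix w assume w: "set w \<subseteq> {1..<n}" "length hw * (n * n) < length w"
  have "lev (length hw) (length w + sum_list (map (\<lambda>I. \<Sum>I) hw)) (gpi (Poly_Mapping.single (Word w) 1))"
    using w(1)
  proof (induction w)
    case Nil
    then show ?case
      using hw_sets gpi_sc[of 1] by (simp add: lev_def zero_word_def mult_single plus_word_def)
  next
    case (Cons j w)
    then show ?case by (simp add: single_Cons[of j w] gpi_var lev_gF)
  qed
  moreover have "\<not> (length v = length hw \<and> (\<forall>I\<in>set v. I \<subseteq> {1..n}) \<and>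
      sum_list (map (\<lambda>I. \<Sum>I) v) = length w + k)" for v k
  proof
    assume v: "length v = length hw \<and> (\<forall>I\<in>set v. I \<subseteq> {1..n}) \<and> sum_list (map (\<lambda>I. \<Sum>I) v) = length w + k"
    \<comment> \<open>A crude bound is enough: a letter has at most n elements, each at most n. It
      explains the threshold \<open>length hw * (n * n)\<close>.\<close>
    have "\<Sum>I \<le> n * n" if "I \<subseteq> {1..n}" for I
    proof -
      have "\<Sum>I \<le> \<Sum>{1..n}" using that by (intro sum_mono2) auto
      also have "\<dots> \<le> (\<Sum>i=1..n. n)" by (intro sum_mono) auto
      finally show ?thesis by simp
    qed
    then have "sum_list (map (\<lambda>I. \<Sum>I) v) \<le> sum_list (map (\<lambda>I. n * n) v)"
      using v by (intro sum_list_mono) auto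
    then show False using v w(2) by (simp add: sum_list_triv)
  qed
  ultimately have "gpi (Poly_Mapping.single (Word w) 1) = 0"
    unfolding lev_def by (metis equals0I keys_eq_empty)
  then show "Poly_Mapping.single (Word w) 1 \<in> rad"
    by (intro subsetD[OF gpi_kernel]) (use w(1) in \<open>auto simp: mem_Fn\<close>)
qed

end

section \<open>Quotients and vector spaces\<close>

lemma quotient_simps [simp]:
  "carrier (quotient M N) = a_rcosets\<^bsub>M\<^esub> N"
  "ring.zero (quotient M N) = N"
  "ring.add (quotient M N) = set_add M"
  "monoid.mult (quotient M N) = rcoset_mult M N"
  "one (quotient M N) = N +>\<^bsub>M\<^esub> \<one>\<^bsub>M\<^esub>"
  "c \<odot>\<^bsub>quotient M N\<^esub> Y = (\<Union>x\<in>Y. N +>\<^bsub>M\<^esub> (c \<odot>\<^bsub>M\<^esub> x))"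
  by (simp_all add: quotient_def FactRing_def ring.defs module.defs)

lemma (in abelian_subgroup) coset_eq_iff:
  assumes "x \<in> carrier G" "y \<in> carrier G"
  shows "H +> x = H +> y \<longleftrightarrow> x \<ominus> y \<in> H"
  using assms a_rcos_module[OF assms(2,1)] a_rcos_self a_repr_independence'
  by (metis a_minus_def)

lemma quotient_carrier:
  fixes G :: "('b, 'a) module" (structure)
  shows "carrier (quotient G H) = (\<lambda>x. H +> x) ` carrier G"
  by (auto simp: A_RCOSETS_def')

lemma quotient_abelian_group:
  fixes G :: "('b, 'a) module" (structure)
  assumes "abelian_subgroup H G"
  shows "abelian_group (quotient G H)"
proof (rule abelian_groupI)
  interpret abelian_subgroup H G by fact
  fix X Y Z
  assume X: "X \<in> carrier (quotient G H)" and Y: "Y \<in> carrier (quotient G H)"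
  then obtain x y where xy: "X = H +> x" "Y = H +> y" "x \<in> carrier G" "y \<in> carrier G"
    unfolding quotient_carrier by auto
  then show "X \<oplus>\<^bsub>quotient G H\<^esub> Y \<in> carrier (quotient G H)"
    unfolding quotient_carrier by (auto simp: a_rcos_sum)
  show "X \<oplus>\<^bsub>quotient G H\<^esub> Y = Y \<oplus>\<^bsub>quotient G H\<^esub> X"
    using xy by (simp add: a_rcos_sum a_comm)
  assume "Z \<in> carrier (quotient G H)"
  then obtain z where "Z = H +> z" "z \<in> carrier G"
    unfolding quotient_carrier by auto
  then show "X \<oplus>\<^bsub>quotient G H\<^esub> Y \<oplus>\<^bsub>quotient G H\<^esub> Z = X \<oplus>\<^bsub>quotient G H\<^esub> (Y \<oplus>\<^bsub>quotient G H\<^esub> Z)"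
    using xy by (simp add: a_rcos_sum a_assoc)
next
  interpret abelian_subgroup H G by fact
  have z: "H +> \<zero> = H" using a_coset_add_zero a_subset by simp
  then show "\<zero>\<^bsub>quotient G H\<^esub> \<in> carrier (quotient G H)"
    unfolding quotient_carrier by (metis imageI quotient_simps(2) zero_closed)
  fix X assume "X \<in> carrier (quotient G H)"
  then obtain x where x: "X = H +> x" "x \<in> carrier G"
    unfolding quotient_carrier by auto
  then have "\<zero>\<^bsub>quotient G H\<^esub> \<oplus>\<^bsub>quotient G H\<^esub> X = (H +> \<zero>) <+> (H +> x)"
    using z by simp
  also have "\<dots> = X" using x by (simp only: a_rcos_sum zero_closed l_zero)
  finally show "\<zero>\<^bsub>quotient G H\<^esub> \<oplus>\<^bsub>quotient G H\<^esub> X = X" .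
  have "(H +> \<ominus> x) <+> (H +> x) = H +> \<zero>"
    using x by (simp only: a_rcos_sum a_inv_closed l_neg)
  then show "\<exists>Y\<in>carrier (quotient G H). Y \<oplus>\<^bsub>quotient G H\<^esub> X = \<zero>\<^bsub>quotient G H\<^esub>"
    using x z unfolding quotient_carrier by (intro bexI[of _ "H +> \<ominus> x"]) auto
qed

text \<open>The action on a quotient is a union over all representatives of a coset. Stability of
  \<open>H\<close> makes every set in that union the same coset, so the union collapses to
  it.\<close>

lemma quotient_smult:
  fixes M :: "('b, 'a) module"
  assumes "abelian_subgroup H M" "x \<in> carrier M"
    and cl: "\<And>x. x \<in> carrier M \<Longrightarrow> c \<odot>\<^bsub>M\<^esub> x \<in> carrier M"
    and add: "\<And>x y. x \<in> carrier M \<Longrightarrow> y \<in> carrier M \<Longrightarrow> c \<odot>\<^bsub>M\<^esub> (x \<oplus>\<^bsub>M\<^esub> y) = c \<odot>\<^bsub>M\<^esub> x \<oplus>\<^bsub>M\<^esub> c \<odot>\<^bsub>M\<^esub> y"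
    and H: "\<And>x. x \<in> H \<Longrightarrow> c \<odot>\<^bsub>M\<^esub> x \<in> H"
  shows "c \<odot>\<^bsub>quotient M H\<^esub> (H +>\<^bsub>M\<^esub> x) = H +>\<^bsub>M\<^esub> (c \<odot>\<^bsub>M\<^esub> x)"
proof -
  interpret abelian_subgroup H M by fact
  have "H +>\<^bsub>M\<^esub> (c \<odot>\<^bsub>M\<^esub> y) = H +>\<^bsub>M\<^esub> (c \<odot>\<^bsub>M\<^esub> x)" if "y \<in> H +>\<^bsub>M\<^esub> x" for y
  proof -
    obtain h where h: "h \<in> H" "y = h \<oplus>\<^bsub>M\<^esub> x"
      using \<open>y \<in> H +>\<^bsub>M\<^esub> x\<close> by (auto simp: a_r_coset_def')
    have hM: "h \<in> carrier M" using h a_subset by auto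
    have "c \<odot>\<^bsub>M\<^esub> y = c \<odot>\<^bsub>M\<^esub> h \<oplus>\<^bsub>M\<^esub> c \<odot>\<^bsub>M\<^esub> x"
      unfolding h(2) by (rule add[OF hM assms(2)])
    then have "c \<odot>\<^bsub>M\<^esub> y \<in> H +>\<^bsub>M\<^esub> (c \<odot>\<^bsub>M\<^esub> x)"
      using H[OF h(1)] unfolding a_r_coset_def' by blast
    then show ?thesis
      by (rule a_repr_independence'[OF _ cl[OF assms(2)], symmetric])
  qed
  then show ?thesis
    using a_rcos_self[OF assms(2)] unfolding quotient_simps by blast
qed

section \<open>Vector spaces whose scalars are a field type, with linear extension from
  words\<close>

locale kspace = abelian_group M for M :: "('k::field, 'v) module" (structure) +
  assumes ks_closed [simp]: "x \<in> carrier M \<Longrightarrow> c \<odot> x \<in> carrier M"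
    and ks_r_distr: "x \<in> carrier M \<Longrightarrow> y \<in> carrier M \<Longrightarrow> c \<odot> (x \<oplus> y) = c \<odot> x \<oplus> c \<odot> y"
    and ks_l_distr: "x \<in> carrier M \<Longrightarrow> (c + d) \<odot> x = c \<odot> x \<oplus> d \<odot> x"
    and ks_assoc: "x \<in> carrier M \<Longrightarrow> c \<odot> (d \<odot> x) = (c * d) \<odot> x"
    and ks_one [simp]: "x \<in> carrier M \<Longrightarrow> 1 \<odot> x = x"
begin

lemma ks_zero [simp]: "x \<in> carrier M \<Longrightarrow> 0 \<odot> x = \<zero>"
  using ks_l_distr[of x 0 0] by simp

lemma ks_zero_right [simp]: "c \<odot> \<zero> = \<zero>"
  using ks_r_distr[of \<zero> \<zero> c] by simp

lemma ks_minus: "x \<in> carrier M \<Longrightarrow> (- c) \<odot> x = \<ominus> (c \<odot> x)"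
  using ks_l_distr[of x "- c" c] by (simp add: minus_equality)

lemma ks_minus_one: "x \<in> carrier M \<Longrightarrow> (- 1) \<odot> x = \<ominus> x"
  by (simp add: ks_minus)

lemma ks_cancel: "x \<in> carrier M \<Longrightarrow> c \<odot> x = \<zero> \<Longrightarrow> c \<noteq> 0 \<Longrightarrow> x = \<zero>"
  using ks_assoc[of x "inverse c" c] by simp

definition lext :: "('g word \<Rightarrow> 'v) \<Rightarrow> ('g word \<Rightarrow>\<^sub>0 'k) \<Rightarrow> 'v" where
  "lext f p = (\<Oplus>w\<in>Poly_Mapping.keys p. Poly_Mapping.lookup p w \<odot> f w)"

context
  fixes f :: "'g word \<Rightarrow> 'v"
  assumes f: "\<And>w. f w \<in> carrier M"
begin

lemma lext_closed [simp]: "lext f p \<in> carrier M"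
  by (simp add: lext_def f)

lemma lext_superset:
  assumes "finite A" "Poly_Mapping.keys p \<subseteq> A"
  shows "lext f p = (\<Oplus>w\<in>A. Poly_Mapping.lookup p w \<odot> f w)"
  unfolding lext_def using assms
  by (intro add.finprod_mono_neutral_cong_left) (auto simp: f in_keys_iff)

lemma lext_add: "lext f (x + y) = lext f x \<oplus> lext f y"
proof -
  let ?A = "Poly_Mapping.keys x \<union> Poly_Mapping.keys y"
  have "lext f (x + y) = (\<Oplus>w\<in>?A. Poly_Mapping.lookup (x + y) w \<odot> f w)"
    using keys_add[of x y] by (intro lext_superset) auto
  also have "\<dots> = (\<Oplus>w\<in>?A. Poly_Mapping.lookup x w \<odot> f w \<oplus> Poly_Mapping.lookup y w \<odot> f w)"
    by (intro finsum_cong') (auto simp: f lookup_add ks_l_distr)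
  also have "\<dots> = lext f x \<oplus> lext f y"
    by (subst finsum_addf) (auto simp: f lext_superset[of ?A])
  finally show ?thesis .
qed

lemma lext_single: "lext f (Poly_Mapping.single w c) = c \<odot> f w"
  by (cases "c = 0") (simp_all add: lext_def f)

lemma lext_sc: "lext f (sc c * p) = c \<odot> lext f p"
proof (induction p rule: keys_single_sum_induct)
  case zero
  show ?case by (simp add: lext_def)
next
  case (add w x)
  then show ?case
    by (simp add: distrib_left mult_single lext_add lext_single ks_r_distr ks_assoc f)
qed

end

end

section \<open>Algebras\<close>

locale kalgebra = kspace A + ring A for A :: "('k::field, 'a) module" (structure) +
  assumes ks_mult_left: "x \<in> carrier A \<Longrightarrow> y \<in> carrier A \<Longrightarrow> (c \<odot> x) \<otimes> y = c \<odot> (x \<otimes> y)"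
    and ks_mult_right: "x \<in> carrier A \<Longrightarrow> y \<in> carrier A \<Longrightarrow> x \<otimes> (c \<odot> y) = c \<odot> (x \<otimes> y)"
begin

lemma ks_eq_mult: "x \<in> carrier A \<Longrightarrow> c \<odot> x = (c \<odot> \<one>) \<otimes> x"
  by (simp add: ks_mult_left)

definition evw :: "('g \<Rightarrow> 'a) \<Rightarrow> 'g word \<Rightarrow> 'a" where
  "evw u w = foldr (\<lambda>g x. u g \<otimes> x) (letters w) \<one>"

definition ev :: "('g \<Rightarrow> 'a) \<Rightarrow> ('g word \<Rightarrow>\<^sub>0 'k) \<Rightarrow> 'a" where
  "ev u = lext (evw u)"

context
  fixes u :: "'g \<Rightarrow> 'a"
  assumes u: "\<And>g. u g \<in> carrier A"
begin

lemma evw_closed: "evw u w \<in> carrier A"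
proof -
  have "foldr (\<lambda>g x. u g \<otimes> x) w \<one> \<in> carrier A" for w
    by (induction w) (auto simp: u)
  then show ?thesis by (simp add: evw_def)
qed

lemma ev_closed [simp]: "ev u p \<in> carrier A"
  by (simp add: ev_def evw_closed)

lemma ev_add: "ev u (p + p') = ev u p \<oplus> ev u p'"
  by (simp add: ev_def lext_add evw_closed)

lemma ev_sc_mult: "ev u (sc c * p) = c \<odot> ev u p"
  by (simp add: ev_def lext_sc evw_closed)

lemma ev_sc: "ev u (sc c) = c \<odot> \<one>"
  by (simp add: ev_def lext_single evw_closed) (simp add: evw_def zero_word_def)

lemma ev_zero: "ev u 0 = \<zero>" by (simp add: ev_def lext_def)

lemma ev_one: "ev u 1 = \<one>"
  using ev_sc[of 1] by simp

lemma ev_uminus: "ev u (- p) = \<ominus> ev u p"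
  using ev_sc_mult[of "- 1" p] by (simp add: single_uminus ks_minus)

lemma ev_diff: "ev u (p - p') = ev u p \<ominus> ev u p'"
  using ev_add[of p "- p'"] by (simp add: ev_uminus a_minus_def)

lemma ev_var_mult: "ev u (var g * p) = u g \<otimes> ev u p"
proof (induction p rule: keys_single_sum_induct)
  case zero
  show ?case by (simp add: ev_zero u)
next
  case (add w p)
  have "ev u (var g * Poly_Mapping.single w c) = u g \<otimes> ev u (Poly_Mapping.single w c)" for c
  proof (cases w)
    case (Word ws)
    have "evw u (Word (g # ws)) = u g \<otimes> evw u (Word ws)" by (simp add: evw_def)
    then show ?thesis
      by (simp add: Word single_Cons[symmetric] ev_def lext_single evw_closed ks_mult_right u)
  qed
  with add show ?case by (simp add: distrib_left ev_add r_distr u)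
qed

lemma ev_var: "ev u (var g) = u g"
  using ev_var_mult[of g 1] by (simp add: ev_one u)

lemma ev_mult: "ev u (p * p') = ev u p \<otimes> ev u p'"
proof (induction p rule: free_induct)
  case (sc c)
  then show ?case by (simp add: ev_sc ev_sc_mult ks_mult_left)
next
  case (add x y)
  then show ?case by (simp add: distrib_right ev_add l_distr)
next
  case (var g x)
  then show ?case by (simp add: mult.assoc ev_var_mult m_assoc u)
qed

lemmas ev_simps = ev_add ev_diff ev_uminus ev_mult ev_sc ev_var ev_one ev_zero

end

end

lemma free_algebra_simps [simp]:
  "p \<otimes>\<^bsub>free_algebra G\<^esub> p' = p * p'" "\<one>\<^bsub>free_algebra G\<^esub> = 1" "\<zero>\<^bsub>free_algebra G\<^esub> = 0"
  "p \<oplus>\<^bsub>free_algebra G\<^esub> p' = p + p'" "c \<odot>\<^bsub>free_algebra G\<^esub> p = sc c * p"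
  by (simp_all add: free_algebra_def)

lemma abelian_group_free_algebra: "abelian_group (free_algebra G :: ('k::field, 'g word \<Rightarrow>\<^sub>0 'k) module)"
proof (rule abelian_groupI)
  show "\<exists>y\<in>carrier (free_algebra G). y \<oplus>\<^bsub>free_algebra G\<^esub> x = \<zero>\<^bsub>free_algebra G\<^esub>"
    if "x \<in> carrier (free_algebra G)" for x :: "'g word \<Rightarrow>\<^sub>0 'k"
    using that by (intro bexI[of _ "- x"]) (auto intro: free_algebra_closed)
qed (auto intro: free_algebra_closed simp: add_ac)

lemma kalgebra_free_algebra: "kalgebra (free_algebra G)"
proof -
  let ?F = "free_algebra G :: ('b, 'a word \<Rightarrow>\<^sub>0 'b) module"
  have "monoid ?F"
    by (rule monoidI) (simp_all add: free_algebra_mult mult.assoc)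
  then have ring: "ring ?F"
    by (rule ringI[OF abelian_group_free_algebra]) (simp_all add: distrib_left distrib_right)
  have "kspace ?F"
    by (rule kspace.intro[OF abelian_group_free_algebra], rule kspace_axioms.intro)
       (simp_all add: distrib_left distrib_right single_add sc_mult_sc_assoc free_algebra_mult)
  then show ?thesis
    by (rule kalgebra.intro[OF _ ring], intro kalgebra_axioms.intro)
       (simp_all add: mult.assoc, metis mult_sc_left_commute)
qed

lemma free_algebra_a_inv [simp]:
  assumes "p \<in> carrier (free_algebra G)"
  shows "\<ominus>\<^bsub>free_algebra G\<^esub> p = - p"
proof -
  interpret kalgebra "free_algebra G :: ('b, 'a word \<Rightarrow>\<^sub>0 'b) module" by (rule kalgebra_free_algebra)
  show ?thesis using assms by (intro minus_equality) (auto intro: free_algebra_closed)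
qed

lemma free_algebra_minus [simp]:
  "p' \<in> carrier (free_algebra G) \<Longrightarrow> p \<ominus>\<^bsub>free_algebra G\<^esub> p' = p - p'"
  by (simp add: a_minus_def)

section \<open>Presentation of the algebra\<close>

locale urs =
  fixes n :: nat and r s :: "'k::field"
begin

abbreviation "P \<equiv> (free_algebra (gens n) :: ('k, gen word \<Rightarrow>\<^sub>0 'k) module)"
abbreviation "I \<equiv> rel_ideal n r s"
abbreviation "U \<equiv> Urs n r s"
abbreviation "u \<equiv> gen_Urs n r s"

definition cls :: "(gen word \<Rightarrow>\<^sub>0 'k) \<Rightarrow> 'k Urs_elem" where
  "cls p = I +>\<^bsub>P\<^esub> p"

lemma relators_closed: "p \<in> relators n r s \<Longrightarrow> p \<in> carrier P"
  by (cases rule: relators.cases, assumption)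
     (auto intro!: free_algebra_closed simp: gens_def torus_gens_def)

sublocale P: kalgebra P by (rule kalgebra_free_algebra)

lemma ideal_I: "ideal I P"
  unfolding rel_ideal_def by (rule P.genideal_ideal) (auto intro: relators_closed)

sublocale I: ideal I P by (rule ideal_I)

lemma abelian_subgroup_I: "abelian_subgroup I P"
  by (rule abelian_subgroupI3) (unfold_locales)

lemma I_sc: "p \<in> I \<Longrightarrow> sc c * p \<in> I"
  using I.I_l_closed[of p "sc c"] by simp

lemma cls_carrier: "carrier U = cls ` carrier P"
  unfolding Urs_def cls_def by (rule quotient_carrier)

lemma cls_closed [simp]: "p \<in> carrier P \<Longrightarrow> cls p \<in> carrier U"
  by (simp add: cls_carrier)

lemma cls_eq_iff: "p \<in> carrier P \<Longrightarrow> p' \<in> carrier P \<Longrightarrow> cls p = cls p' \<longleftrightarrow> p - p' \<in> I"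
  unfolding cls_def by (subst abelian_subgroup.coset_eq_iff[OF abelian_subgroup_I]) auto

lemma cls_add: "p \<in> carrier P \<Longrightarrow> p' \<in> carrier P \<Longrightarrow> cls p \<oplus>\<^bsub>U\<^esub> cls p' = cls (p + p')"
  using abelian_subgroup.a_rcos_sum[OF abelian_subgroup_I, of p p'] by (simp add: Urs_def cls_def)

lemma cls_mult: "p \<in> carrier P \<Longrightarrow> p' \<in> carrier P \<Longrightarrow> cls p \<otimes>\<^bsub>U\<^esub> cls p' = cls (p * p')"
  using I.rcoset_mult_add[of p p'] by (simp add: Urs_def cls_def)

lemma cls_sc: "p \<in> carrier P \<Longrightarrow> c \<odot>\<^bsub>U\<^esub> cls p = cls (sc c * p)"
  unfolding Urs_def cls_def
  by (subst quotient_smult[OF abelian_subgroup_I])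
     (auto intro!: free_algebra_closed I_sc simp: distrib_left)

lemma cls_one: "\<one>\<^bsub>U\<^esub> = cls 1" and cls_zero: "\<zero>\<^bsub>U\<^esub> = cls 0"
  by (simp add: Urs_def cls_def)
     (metis I.a_subset P.a_coset_add_zero Urs_def cls_def free_algebra_simps(3) quotient_simps(2))

lemma cls_var: "u g = cls (var g)"
  by (simp add: gen_Urs_def cls_def)

lemma ring_U: "ring U"
proof (rule ringI)
  show "abelian_group U"
    unfolding Urs_def by (rule quotient_abelian_group[OF abelian_subgroup_I])
  show "monoid U"
    by (rule monoidI) (auto simp: cls_carrier cls_mult cls_one free_algebra_mult mult.assoc)
qed (auto simp: cls_carrier cls_mult cls_add free_algebra_mult free_algebra_add algebra_simps)

sublocale U: kalgebra U
proof -
  interpret ring U by (rule ring_U)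
  have "kspace U"
    by (rule kspace.intro[OF abelian_group_axioms], rule kspace_axioms.intro)
      (auto simp: cls_carrier cls_sc cls_add free_algebra_closed distrib_left distrib_right single_add sc_mult_sc_assoc)
  moreover have "(c \<odot>\<^bsub>U\<^esub> x) \<otimes>\<^bsub>U\<^esub> y = c \<odot>\<^bsub>U\<^esub> (x \<otimes>\<^bsub>U\<^esub> y) \<and> x \<otimes>\<^bsub>U\<^esub> (c \<odot>\<^bsub>U\<^esub> y) = c \<odot>\<^bsub>U\<^esub> (x \<otimes>\<^bsub>U\<^esub> y)"
    if xy: "x \<in> carrier U" "y \<in> carrier U" for c x y
  proof -
    obtain p p' where "p \<in> carrier P" "x = cls p" "p' \<in> carrier P" "y = cls p'"
      using xy unfolding cls_carrier by blast
    then show ?thesis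
      by (simp add: cls_sc cls_mult free_algebra_mult mult.assoc mult_sc_left_commute[of p])
  qed
  ultimately show "kalgebra U"
    by (intro kalgebra.intro kalgebra_axioms.intro) (simp_all add: ring_axioms)
qed

lemma u_closed [simp]: "g \<in> gens n \<Longrightarrow> u g \<in> carrier U"
  by (simp add: cls_var free_algebra_var)

lemma U_induct [consumes 1, case_names sc add gen]:
  assumes "x \<in> carrier U"
    and "\<And>c. Q (c \<odot>\<^bsub>U\<^esub> \<one>\<^bsub>U\<^esub>)"
    and "\<And>x y. x \<in> carrier U \<Longrightarrow> y \<in> carrier U \<Longrightarrow> Q x \<Longrightarrow> Q y \<Longrightarrow> Q (x \<oplus>\<^bsub>U\<^esub> y)"
    and "\<And>g x. g \<in> gens n \<Longrightarrow> x \<in> carrier U \<Longrightarrow> Q x \<Longrightarrow> Q (u g \<otimes>\<^bsub>U\<^esub> x)"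
  shows "Q x"
proof -
  obtain p where p: "p \<in> carrier P" "x = cls p" using assms(1) by (auto simp: cls_carrier)
  have "p \<in> carrier P \<and> Q (cls p)"
    using p(1)
  proof (induction p rule: free_algebra_induct)
    case (sc c)
    then show ?case using assms(2)[of c] by (simp add: cls_one cls_sc)
  next
    case (add x y)
    then show ?case using assms(3)[of "cls x" "cls y"] by (simp add: cls_add free_algebra_add)
  next
    case (var g x)
    then show ?case using assms(4)[of g "cls x"]
      by (simp add: cls_var cls_mult free_algebra_mult free_algebra_var)
  qed
  with p show ?thesis by simp
qed

lemma relator_zero: "p \<in> relators n r s \<Longrightarrow> cls p = \<zero>\<^bsub>U\<^esub>"
  using P.genideal_self[of "relators n r s"] relators_closed
  by (auto simp: cls_zero cls_eq_iff rel_ideal_def)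

text \<open>The kernel of evaluation is a two-sided ideal that contains the relators, hence the
  relation ideal. The images \<open>b\<close> are given on all symbols, so that evaluation is a
  total map; only those in \<open>gens n\<close> survive in the conclusion.\<close>

lemma U_universal:
  assumes "kalgebra B" and b: "\<And>g. b g \<in> carrier B"
    and rel: "\<And>p. p \<in> relators n r s \<Longrightarrow> kalgebra.ev B b p = \<zero>\<^bsub>B\<^esub>"
  shows "\<exists>h\<in>algebra_hom U B. \<forall>g\<in>gens n. h (u g) = b g"
proof -
  interpret B: kalgebra B by fact
  let ?ev = "B.ev b"
  have "ideal {p \<in> carrier P. ?ev p = \<zero>\<^bsub>B\<^esub>} P"
  proof (rule idealI[OF P.ring_axioms])
    show "subgroup {p \<in> carrier P. ?ev p = \<zero>\<^bsub>B\<^esub>} (add_monoid P)"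
      by (rule P.add.subgroupI)
         (auto simp: B.ev_simps[OF b] free_algebra_add free_algebra_uminus a_inv_def[symmetric] intro!: exI[of _ 0])
  qed (auto simp: B.ev_simps[OF b] free_algebra_mult B.ev_closed[OF b])
  then have "I \<subseteq> {p \<in> carrier P. ?ev p = \<zero>\<^bsub>B\<^esub>}"
    unfolding rel_ideal_def by (rule P.genideal_minimal) (auto simp: rel relators_closed)
  then have wd: "?ev p = ?ev p'" if "p \<in> carrier P" "p' \<in> carrier P" "cls p = cls p'" for p p'
  proof -
    have "?ev (p - p') = \<zero>\<^bsub>B\<^esub>" using that \<open>I \<subseteq> _\<close> by (auto simp: cls_eq_iff)
    then show ?thesis
      by (simp add: B.ev_simps[OF b] B.ev_closed[OF b])
  qed
  \<comment> \<open>An arbitrary representative is chosen in each class; \<open>wd\<close> makes the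
    value independent of the choice.\<close>
  define h where "h Y = ?ev (SOME p. p \<in> carrier P \<and> cls p = Y)" for Y
  have h: "h (cls p) = ?ev p" if "p \<in> carrier P" for p
    unfolding h_def using someI[of "\<lambda>p'. p' \<in> carrier P \<and> cls p' = cls p" p] that
    by (intro wd) auto
  have "h \<in> algebra_hom U B"
    unfolding algebra_hom_def
  proof (intro CollectI conjI allI ballI)
    show "h \<in> Ring.ring_hom U B"
      by (rule ring_hom_memI)
         (auto simp: cls_carrier h B.ev_closed[OF b] cls_mult cls_add cls_one free_algebra_closed B.ev_simps[OF b])
    show "h (c \<odot>\<^bsub>U\<^esub> x) = c \<odot>\<^bsub>B\<^esub> h x" if "x \<in> carrier U" for c x
      using that by (auto simp: cls_carrier h cls_sc free_algebra_closed B.ev_sc_mult[OF b])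
  qed
  moreover have "h (u g) = b g" if "g \<in> gens n" for g
    using that by (simp add: cls_var h free_algebra_var B.ev_var[OF b])
  ultimately show ?thesis by blast
qed

end

section \<open>Tensor products of modules\<close>

lemma frag_carrier_induct [consumes 1, case_names zero diff gen]:
  assumes "t \<in> carrier (free_Abelian_group S)"
    and "Q 0"
    and "\<And>x y. x \<in> carrier (free_Abelian_group S) \<Longrightarrow> y \<in> carrier (free_Abelian_group S) \<Longrightarrow> Q x \<Longrightarrow> Q y \<Longrightarrow> Q (x - y)"
    and "\<And>a. a \<in> S \<Longrightarrow> Q (frag_of a)"
  shows "Q t"
  using assms(1) free_Abelian_group_induct[of t S Q] assms(2-4) by simp

definition balanced_map ::
    "('b, 'c) ring_scheme \<Rightarrow> ('b, 'm) module \<Rightarrow> ('b, 'n) module \<Rightarrow> ('g, 'x) monoid_scheme \<Rightarrow> ('m \<Rightarrow> 'n \<Rightarrow> 'g) \<Rightarrow> bool" where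
  "balanced_map B M N C f \<longleftrightarrow>
     (\<forall>x\<in>carrier M. \<forall>y\<in>carrier N. f x y \<in> carrier C) \<and>
     (\<forall>x\<in>carrier M. \<forall>x'\<in>carrier M. \<forall>y\<in>carrier N. f (x \<oplus>\<^bsub>M\<^esub> x') y = f x y \<otimes>\<^bsub>C\<^esub> f x' y) \<and>
     (\<forall>x\<in>carrier M. \<forall>y\<in>carrier N. \<forall>y'\<in>carrier N. f x (y \<oplus>\<^bsub>N\<^esub> y') = f x y \<otimes>\<^bsub>C\<^esub> f x y') \<and>
     (\<forall>b\<in>carrier B. \<forall>x\<in>carrier M. \<forall>y\<in>carrier N. f (b \<odot>\<^bsub>M\<^esub> x) y = f x (b \<odot>\<^bsub>N\<^esub> y))"

lemma balanced_mapD: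
  assumes "balanced_map B M N C f"
  shows "x \<in> carrier M \<Longrightarrow> y \<in> carrier N \<Longrightarrow> f x y \<in> carrier C"
    and "x \<in> carrier M \<Longrightarrow> x' \<in> carrier M \<Longrightarrow> y \<in> carrier N \<Longrightarrow> f (x \<oplus>\<^bsub>M\<^esub> x') y = f x y \<otimes>\<^bsub>C\<^esub> f x' y"
    and "x \<in> carrier M \<Longrightarrow> y \<in> carrier N \<Longrightarrow> y' \<in> carrier N \<Longrightarrow> f x (y \<oplus>\<^bsub>N\<^esub> y') = f x y \<otimes>\<^bsub>C\<^esub> f x y'"
    and "b \<in> carrier B \<Longrightarrow> x \<in> carrier M \<Longrightarrow> y \<in> carrier N \<Longrightarrow> f (b \<odot>\<^bsub>M\<^esub> x) y = f x (b \<odot>\<^bsub>N\<^esub> y)"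
  using assms unfolding balanced_map_def by blast+

text \<open>Formulated with closure under scalars only, so that it covers both tensor products over
  the field and the induced module over the noncommutative subalgebra
  \<open>Urs_ge0\<close>.\<close>

locale tensor_data = M: abelian_group M + N: abelian_group N
  for B :: "('b, 'c) ring_scheme" and M :: "('b, 'm) module" and N :: "('b, 'n) module" +
  assumes M_smult: "b \<in> carrier B \<Longrightarrow> x \<in> carrier M \<Longrightarrow> b \<odot>\<^bsub>M\<^esub> x \<in> carrier M"
    and N_smult: "b \<in> carrier B \<Longrightarrow> y \<in> carrier N \<Longrightarrow> b \<odot>\<^bsub>N\<^esub> y \<in> carrier N"
begin

abbreviation "F \<equiv> free_Abelian_group (carrier M \<times> carrier N)"
abbreviation "H \<equiv> tensor_subgroup B M N"
abbreviation "T \<equiv> tensor_group B M N"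
abbreviation "tcls \<equiv> tensor_class B M N"
abbreviation "pt \<equiv> pure_tensor B M N"

sublocale F: comm_group F by (rule abelian_free_Abelian_group)

lemma relators_sub: "tensor_relators B M N \<subseteq> carrier F"
proof -
  have "frag_of p - frag_of q - frag_of r \<in> carrier F" "frag_of p - frag_of q \<in> carrier F"
    if "p \<in> carrier M \<times> carrier N" "q \<in> carrier M \<times> carrier N" "r \<in> carrier M \<times> carrier N" for p q r
  proof -
    have "frag_of p - frag_of q = frag_of p \<otimes>\<^bsub>F\<^esub> inv\<^bsub>F\<^esub> frag_of q"
      "frag_of p - frag_of q - frag_of r = frag_of p \<otimes>\<^bsub>F\<^esub> inv\<^bsub>F\<^esub> frag_of q \<otimes>\<^bsub>F\<^esub> inv\<^bsub>F\<^esub> frag_of r"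
      using that by (simp_all add: inv_free_Abelian_group)
    moreover have "frag_of p \<in> carrier F" "frag_of q \<in> carrier F" "frag_of r \<in> carrier F"
      using that by simp_all
    ultimately show "frag_of p - frag_of q - frag_of r \<in> carrier F" "frag_of p - frag_of q \<in> carrier F"
      by (metis F.inv_closed F.m_closed)+
  qed
  then show ?thesis
    unfolding tensor_relators_def using M_smult N_smult by (auto simp del: carrier_free_Abelian_group_iff)
qed

lemma H_subgroup: "subgroup H F"
  unfolding tensor_subgroup_def by (rule F.generate_is_subgroup[OF relators_sub])

sublocale H: normal H F
  using H_subgroup F.normal_iff_subgroup by blast

sublocale T: comm_group T
  unfolding tensor_group_def by (rule F.abelian_FactGroup[OF H_subgroup])

lemma T_carrier: "carrier T = tcls ` carrier F"
  by (auto simp: tensor_group_def tensor_class_def FactGroup_def RCOSETS_def)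

lemma T_one: "\<one>\<^bsub>T\<^esub> = H" by (simp add: tensor_group_def)

lemma tcls_closed: "t \<in> carrier F \<Longrightarrow> tcls t \<in> carrier T" by (auto simp: T_carrier)

lemma tcls_add: "t \<in> carrier F \<Longrightarrow> t' \<in> carrier F \<Longrightarrow> tcls t \<otimes>\<^bsub>T\<^esub> tcls t' = tcls (t + t')"
  using H.rcos_sum[of t t'] by (simp add: tensor_group_def tensor_class_def)

lemma tcls_zero: "tcls 0 = \<one>\<^bsub>T\<^esub>"
  using F.coset_mult_one[of H] H.subset by (simp add: tensor_class_def T_one)

lemma F_diff: "t \<in> carrier F \<Longrightarrow> t' \<in> carrier F \<Longrightarrow> t - t' \<in> carrier F"
  using F.m_closed[of t "inv\<^bsub>F\<^esub> t'"] F.inv_closed[of t'] by (simp add: inv_free_Abelian_group)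

lemma F_uminus: "t \<in> carrier F \<Longrightarrow> - t \<in> carrier F"
  using F_diff[of 0 t] by simp

lemma tcls_uminus: "t \<in> carrier F \<Longrightarrow> tcls (- t) = inv\<^bsub>T\<^esub> tcls t"
  using tcls_add[of "- t" t] F_uminus[of t]
  by (intro T.inv_equality[symmetric]) (auto simp: tcls_zero tcls_closed)

lemma tcls_diff: "t \<in> carrier F \<Longrightarrow> t' \<in> carrier F \<Longrightarrow> tcls (t - t') = tcls t \<otimes>\<^bsub>T\<^esub> inv\<^bsub>T\<^esub> tcls t'"
  using tcls_add[of t "- t'"] F_uminus[of t'] by (simp add: tcls_uminus)

lemma tcls_H: "t \<in> H \<Longrightarrow> tcls t = \<one>\<^bsub>T\<^esub>"
  unfolding tensor_class_def T_one
  by (rule F.coset_join2[OF _ H_subgroup]) (use H.subset in blast)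

lemma tcls_self: "t \<in> carrier F \<Longrightarrow> t \<in> tcls t"
  unfolding tensor_class_def by (rule F.rcos_self[OF _ H_subgroup])

lemma mem_tcls: "t \<in> carrier F \<Longrightarrow> t' \<in> tcls t \<Longrightarrow> t' \<in> carrier F \<and> tcls t' = tcls t"
proof -
  assume t: "t \<in> carrier F" "t' \<in> tcls t"
  then have sub: "tcls t \<subseteq> carrier F"
    unfolding tensor_class_def by (intro F.r_coset_subset_G H.subset)
  have "tcls t = tcls t'"
    using t(2) F.repr_independence[OF _ t(1) H_subgroup, of t'] unfolding tensor_class_def by blast
  then show ?thesis using subsetD[OF sub t(2)] by blast
qed

lemma F_pure: "x \<in> carrier M \<Longrightarrow> y \<in> carrier N \<Longrightarrow> frag_of (x, y) \<in> carrier F"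
  by simp

lemma pt_closed [simp]: "x \<in> carrier M \<Longrightarrow> y \<in> carrier N \<Longrightarrow> pt x y \<in> carrier T"
  by (simp add: pure_tensor_def tcls_closed)

lemma relator_H: "t \<in> tensor_relators B M N \<Longrightarrow> t \<in> H"
  unfolding tensor_subgroup_def by (rule generate.incl)

lemma balanced_pt: "balanced_map B M N T pt"
proof -
  have 1: "pt (x \<oplus>\<^bsub>M\<^esub> x') y = pt x y \<otimes>\<^bsub>T\<^esub> pt x' y" if "x \<in> carrier M" "x' \<in> carrier M" "y \<in> carrier N" for x x' y
  proof -
    let ?t = "frag_of (x \<oplus>\<^bsub>M\<^esub> x', y) - frag_of (x, y) - frag_of (x', y)"
    have "?t \<in> H" by (rule relator_H) (use that in \<open>auto simp: tensor_relators_def\<close>)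
    then have "tcls (?t + (frag_of (x, y) + frag_of (x', y))) = tcls (frag_of (x, y) + frag_of (x', y))"
      using tcls_add[of ?t "frag_of (x, y) + frag_of (x', y)"] that H.subset
         F.m_closed[OF F_pure[of x y] F_pure[of x' y]] by (auto simp: tcls_H tcls_closed simp del: carrier_free_Abelian_group_iff)
    then show ?thesis
      using that tcls_add[OF F_pure[of x y] F_pure[of x' y]] by (simp add: pure_tensor_def algebra_simps)
  qed
  have 2: "pt x (y \<oplus>\<^bsub>N\<^esub> y') = pt x y \<otimes>\<^bsub>T\<^esub> pt x y'" if "x \<in> carrier M" "y \<in> carrier N" "y' \<in> carrier N" for x y y'
  proof -
    let ?t = "frag_of (x, y \<oplus>\<^bsub>N\<^esub> y') - frag_of (x, y) - frag_of (x, y')"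
    have "?t \<in> H" by (rule relator_H) (use that in \<open>auto simp: tensor_relators_def\<close>)
    then have "tcls (?t + (frag_of (x, y) + frag_of (x, y'))) = tcls (frag_of (x, y) + frag_of (x, y'))"
      using tcls_add[of ?t "frag_of (x, y) + frag_of (x, y')"] that H.subset
         F.m_closed[OF F_pure[of x y] F_pure[of x y']] by (auto simp: tcls_H tcls_closed simp del: carrier_free_Abelian_group_iff)
    then show ?thesis
      using that tcls_add[OF F_pure[of x y] F_pure[of x y']] by (simp add: pure_tensor_def algebra_simps)
  qed
  have 3: "pt (b \<odot>\<^bsub>M\<^esub> x) y = pt x (b \<odot>\<^bsub>N\<^esub> y)" if "b \<in> carrier B" "x \<in> carrier M" "y \<in> carrier N" for b x y
  proof -
    let ?t = "frag_of (b \<odot>\<^bsub>M\<^esub> x, y) - frag_of (x, b \<odot>\<^bsub>N\<^esub> y)"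
    have "?t \<in> H" by (rule relator_H) (use that in \<open>auto simp: tensor_relators_def\<close>)
    then have "tcls (?t + frag_of (x, b \<odot>\<^bsub>N\<^esub> y)) = tcls (frag_of (x, b \<odot>\<^bsub>N\<^esub> y))"
      using tcls_add[of ?t "frag_of (x, b \<odot>\<^bsub>N\<^esub> y)"] that H.subset F_pure[of x "b \<odot>\<^bsub>N\<^esub> y"] N_smult
      by (auto simp: tcls_H tcls_closed simp del: carrier_free_Abelian_group_iff)
    then show ?thesis by (simp add: pure_tensor_def)
  qed
  show ?thesis unfolding balanced_map_def using 1 2 3 by auto
qed

lemmas pt_simps = balanced_mapD(2-4)[OF balanced_pt]

lemma pt_zero_left: "y \<in> carrier N \<Longrightarrow> pt \<zero>\<^bsub>M\<^esub> y = \<one>\<^bsub>T\<^esub>"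
  using pt_simps(1)[of "\<zero>\<^bsub>M\<^esub>" "\<zero>\<^bsub>M\<^esub>" y] by simp

lemma pt_zero_right: "x \<in> carrier M \<Longrightarrow> pt x \<zero>\<^bsub>N\<^esub> = \<one>\<^bsub>T\<^esub>"
  using pt_simps(2)[of x "\<zero>\<^bsub>N\<^esub>" "\<zero>\<^bsub>N\<^esub>"] by simp

lemma pt_minus_left: "x \<in> carrier M \<Longrightarrow> y \<in> carrier N \<Longrightarrow> pt (\<ominus>\<^bsub>M\<^esub> x) y = inv\<^bsub>T\<^esub> pt x y"
  using pt_simps(1)[of "\<ominus>\<^bsub>M\<^esub> x" x y]
  by (intro T.inv_equality[symmetric]) (auto simp: M.l_neg pt_zero_left)

text \<open>Sums of pure tensors suffice without a case for negatives, since minus a pure tensor is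
  again pure.\<close>

lemma T_induct [consumes 1, case_names pt add]:
  assumes "z \<in> carrier T"
    and "\<And>x y. x \<in> carrier M \<Longrightarrow> y \<in> carrier N \<Longrightarrow> Q (pt x y)"
    and "\<And>z z'. z \<in> carrier T \<Longrightarrow> z' \<in> carrier T \<Longrightarrow> Q z \<Longrightarrow> Q z' \<Longrightarrow> Q (z \<otimes>\<^bsub>T\<^esub> z')"
  shows "Q z"
proof -
  obtain t where t: "z = tcls t" "t \<in> carrier F"
    using assms(1) unfolding T_carrier by (rule imageE)
  \<comment> \<open>Induction over the free abelian group proceeds by differences, hence
    \<open>Q\<close> is carried along for \<open>t\<close> and \<open>- t\<close>
    simultaneously.\<close>
  have "t \<in> carrier F \<and> Q (tcls t) \<and> Q (tcls (- t))"
    using t(2)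
  proof (induction t rule: frag_carrier_induct)
    case zero
    then show ?case
      using assms(2)[of "\<zero>\<^bsub>M\<^esub>" "\<zero>\<^bsub>N\<^esub>"] by (simp add: tcls_zero pt_zero_left)
  next
    case (diff x y)
    note xy = diff(1,2)
    note c = F_uminus[OF xy(1)] F_uminus[OF xy(2)]
    have "Q (tcls x \<otimes>\<^bsub>T\<^esub> tcls (- y))" "Q (tcls y \<otimes>\<^bsub>T\<^esub> tcls (- x))"
      using diff xy c by (auto intro!: assms(3) tcls_closed simp del: carrier_free_Abelian_group_iff)
    then show ?case
      using F_diff[OF xy] tcls_add[OF xy(1) c(2)] tcls_add[OF xy(2) c(1)] by simp
  next
    case (gen a)
    then obtain x y where a: "a = (x, y)" "x \<in> carrier M" "y \<in> carrier N" by auto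
    have "tcls (- frag_of a) = pt (\<ominus>\<^bsub>M\<^esub> x) y"
      using a tcls_uminus[OF F_pure] by (simp add: pt_minus_left) (simp add: pure_tensor_def)
    then show ?case
      using a assms(2)[of x y] assms(2)[of "\<ominus>\<^bsub>M\<^esub> x" y] by (simp add: pure_tensor_def)
  qed
  with t show ?thesis by simp
qed

lemma T_universal:
  assumes "comm_group C" "balanced_map B M N C f"
  shows "\<exists>h\<in>hom T C. \<forall>x\<in>carrier M. \<forall>y\<in>carrier N. h (pt x y) = f x y"
proof -
  interpret C: comm_group C by fact
  note f = balanced_mapD[OF assms(2)]
  have "(\<lambda>(x, y). f x y) ` (carrier M \<times> carrier N) \<subseteq> carrier C"
    using f(1) by auto
  from C.free_Abelian_group_universal[OF this] obtain h0
    where h0: "h0 \<in> hom F C" "\<And>p. p \<in> carrier M \<times> carrier N \<Longrightarrow> h0 (frag_of p) = (case p of (x, y) \<Rightarrow> f x y)"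
    by blast
  interpret h0: group_hom F C h0
    by unfold_locales (rule h0)
  have diff: "h0 (a - b) = h0 a \<otimes>\<^bsub>C\<^esub> inv\<^bsub>C\<^esub> h0 b" if "a \<in> carrier F" "b \<in> carrier F" for a b
  proof -
    have ab: "a - b = a \<otimes>\<^bsub>F\<^esub> inv\<^bsub>F\<^esub> b" using that by (simp add: inv_free_Abelian_group)
    show ?thesis unfolding ab using h0.hom_mult[OF that(1) F.inv_closed[OF that(2)]] h0.hom_inv[OF that(2)] by simp
  qed
  have rel: "h0 t = \<one>\<^bsub>C\<^esub>" if "t \<in> tensor_relators B M N" for t
  proof -
    have p: "h0 (frag_of (x, y)) = f x y" if "x \<in> carrier M" "y \<in> carrier N" for x y
      using h0(2)[of "(x, y)"] that by simp
    show ?thesis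
      using that unfolding tensor_relators_def
    proof (elim UnE CollectE exE conjE)
      fix x x' y assume t: "t = frag_of (x \<oplus>\<^bsub>M\<^esub> x', y) - frag_of (x, y) - frag_of (x', y)"
        and x: "x \<in> carrier M" "x' \<in> carrier M" "y \<in> carrier N"
      have "h0 t = h0 (frag_of (x \<oplus>\<^bsub>M\<^esub> x', y)) \<otimes>\<^bsub>C\<^esub> inv\<^bsub>C\<^esub> h0 (frag_of (x, y)) \<otimes>\<^bsub>C\<^esub> inv\<^bsub>C\<^esub> h0 (frag_of (x', y))"
        unfolding t using x by (simp add: diff F_diff F_pure del: carrier_free_Abelian_group_iff)
      also have "\<dots> = \<one>\<^bsub>C\<^esub>"
        using x by (simp add: p f C.m_ac)
      finally show ?thesis .
    next
      fix x y y' assume t: "t = frag_of (x, y \<oplus>\<^bsub>N\<^esub> y') - frag_of (x, y) - frag_of (x, y')"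
        and x: "x \<in> carrier M" "y \<in> carrier N" "y' \<in> carrier N"
      have "h0 t = h0 (frag_of (x, y \<oplus>\<^bsub>N\<^esub> y')) \<otimes>\<^bsub>C\<^esub> inv\<^bsub>C\<^esub> h0 (frag_of (x, y)) \<otimes>\<^bsub>C\<^esub> inv\<^bsub>C\<^esub> h0 (frag_of (x, y'))"
        unfolding t using x by (simp add: diff F_diff F_pure del: carrier_free_Abelian_group_iff)
      also have "\<dots> = \<one>\<^bsub>C\<^esub>"
        using x by (simp add: p f C.m_ac)
      finally show ?thesis .
    next
      fix b x y assume t: "t = frag_of (b \<odot>\<^bsub>M\<^esub> x, y) - frag_of (x, b \<odot>\<^bsub>N\<^esub> y)"
        and x: "b \<in> carrier B" "x \<in> carrier M" "y \<in> carrier N"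
      show ?thesis
        unfolding t using x M_smult N_smult by (subst diff) (auto simp: p f)
    qed
  qed
  have H1: "h0 t = \<one>\<^bsub>C\<^esub>" if "t \<in> H" for t
  proof -
    have "subgroup (kernel F C h0) F" by (rule h0.subgroup_kernel)
    moreover have "tensor_relators B M N \<subseteq> kernel F C h0"
      using rel relators_sub by (auto simp: kernel_def simp del: carrier_free_Abelian_group_iff)
    ultimately have "H \<subseteq> kernel F C h0"
      unfolding tensor_subgroup_def using F.generate_subgroup_incl by blast
    then show ?thesis using that by (auto simp: kernel_def)
  qed
  have wd: "h0 t = h0 t'" if "t \<in> carrier F" "t' \<in> tcls t" for t t'
  proof -
    obtain k where k: "k \<in> H" "t' = k \<otimes>\<^bsub>F\<^esub> t"
      using \<open>t' \<in> tcls t\<close> unfolding tensor_class_def r_coset_def by blast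
    have "k \<in> carrier F" using k(1) H.subset by blast
    then have "h0 t' = h0 k \<otimes>\<^bsub>C\<^esub> h0 t"
      unfolding k(2) by (rule h0.hom_mult[OF _ that(1)])
    then show ?thesis using H1[OF k(1)] C.l_one[OF h0.hom_closed[OF that(1)]] by simp
  qed
  define h where "h Y = h0 (SOME t. t \<in> Y)" for Y
  have h: "h (tcls t) = h0 t" if "t \<in> carrier F" for t
    unfolding h_def by (rule wd[OF that someI[of "\<lambda>t'. t' \<in> tcls t", OF tcls_self[OF that]], symmetric])
  have "h \<in> hom T C"
  proof (rule homI)
    show "h z \<in> carrier C" if "z \<in> carrier T" for z
      using that h0.hom_closed by (auto simp: T_carrier h simp del: carrier_free_Abelian_group_iff)
    show "h (z \<otimes>\<^bsub>T\<^esub> z') = h z \<otimes>\<^bsub>C\<^esub> h z'" if zz: "z \<in> carrier T" "z' \<in> carrier T" for z z'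
    proof -
      obtain t where "z = tcls t" "t \<in> carrier F"
        using zz(1) unfolding T_carrier by (rule imageE)
      moreover obtain t' where "z' = tcls t'" "t' \<in> carrier F"
        using zz(2) unfolding T_carrier by (rule imageE)
      ultimately show ?thesis
        using h0.hom_mult[of t t'] F.m_closed[of t t'] by (simp add: tcls_add h del: carrier_free_Abelian_group_iff)
    qed
  qed
  moreover have "h (pt x y) = f x y" if "x \<in> carrier M" "y \<in> carrier N" for x y
    using that h0(2)[of "(x, y)"] h[OF F_pure[OF that]] unfolding pure_tensor_def by simp
  ultimately show ?thesis by (intro bexI[of _ h] ballI) simp_all
qed

lemma T_hom_eq:
  assumes "comm_group C" "h \<in> hom T C" "h' \<in> hom T C" "z \<in> carrier T"
    and "\<And>x y. x \<in> carrier M \<Longrightarrow> y \<in> carrier N \<Longrightarrow> h (pt x y) = h' (pt x y)"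
  shows "h z = h' z"
  using assms(4)
proof (induction z rule: T_induct)
  case (add z z')
  then show ?case using hom_mult[OF assms(2)] hom_mult[OF assms(3)] by simp
qed (rule assms(5))

lemma T_abelian_group:
  assumes "carrier R = carrier T" "ring.zero R = \<one>\<^bsub>T\<^esub>" "ring.add R = monoid.mult T"
  shows "abelian_group R"
proof (rule abelian_groupI)
  show "\<exists>y\<in>carrier R. y \<oplus>\<^bsub>R\<^esub> x = \<zero>\<^bsub>R\<^esub>" if "x \<in> carrier R" for x
    using that T.l_inv[of x] T.inv_closed[of x] unfolding assms by blast
qed (simp_all add: assms T.m_assoc, rule T.m_comm)

text \<open>Operations on tensors are defined as unions over representatives. Once a homomorphism
  \<open>h\<close> with the right values on pure tensors is known to exist, every representative
  yields the same class, and the union is the value of \<open>h\<close>.\<close>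

lemma frag_extend_tcls:
  assumes "tensor_data B' M' N'" "h \<in> hom T (tensor_group B' M' N')"
    and E: "\<And>x y. x \<in> carrier M \<Longrightarrow> y \<in> carrier N \<Longrightarrow> E (x, y) \<in> carrier (free_Abelian_group (carrier M' \<times> carrier N'))"
    and hE: "\<And>x y. x \<in> carrier M \<Longrightarrow> y \<in> carrier N \<Longrightarrow> h (pt x y) = tensor_class B' M' N' (E (x, y))"
    and z: "z \<in> carrier T"
  shows "(\<Union>t\<in>z. tensor_class B' M' N' (frag_extend E t)) = h z"
proof -
  interpret D: tensor_data B' M' N' by fact
  interpret h: group_hom T D.T h
    using assms by unfold_locales auto
  have E': "frag_extend E t \<in> carrier D.F \<and> D.tcls (frag_extend E t) = h (tcls t)" if "t \<in> carrier F" for t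
    using that
  proof (induction t rule: frag_carrier_induct)
    case zero
    then show ?case using h.hom_one by (simp add: tcls_zero D.tcls_zero)
  next
    case (diff x y)
    then show ?case
      using h.hom_inv[OF tcls_closed[of y]]
      by (simp add: frag_extend_diff D.F_diff D.tcls_diff tcls_diff tcls_closed del: carrier_free_Abelian_group_iff)
  next
    case (gen a)
    then show ?case using E hE by (auto simp: pure_tensor_def simp del: carrier_free_Abelian_group_iff)
  qed
  obtain t where t': "z = tcls t" "t \<in> carrier F"
    using z unfolding T_carrier by (rule imageE)
  note t = t'(2,1)
  have "D.tcls (frag_extend E t') = h z" if "t' \<in> z" for t'
  proof -
    have m: "t' \<in> carrier F" "tcls t' = tcls t" using mem_tcls[OF t(1)] that t(2) by blast+
    show ?thesis using E'[OF m(1)] unfolding m(2) t(2) by blast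
  qed
  moreover have "t \<in> z" using t tcls_self by simp
  ultimately show ?thesis by blast
qed

end

text \<open>Maps that are biadditive on a product of two tensor products.\<close>

lemma tensor_bihom:
  assumes "tensor_data B1 M1 N1" "tensor_data B2 M2 N2" "comm_group C"
    and b1: "\<And>x x'. x \<in> carrier M1 \<Longrightarrow> x' \<in> carrier N1 \<Longrightarrow> balanced_map B2 M2 N2 C (g x x')"
    and b2: "\<And>y y'. y \<in> carrier M2 \<Longrightarrow> y' \<in> carrier N2 \<Longrightarrow> balanced_map B1 M1 N1 C (\<lambda>x x'. g x x' y y')"
  obtains \<Phi> where "\<And>s. s \<in> carrier (tensor_group B1 M1 N1) \<Longrightarrow> \<Phi> s \<in> hom (tensor_group B2 M2 N2) C"
    "\<And>t. t \<in> carrier (tensor_group B2 M2 N2) \<Longrightarrow> (\<lambda>s. \<Phi> s t) \<in> hom (tensor_group B1 M1 N1) C"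
    "\<And>x x' y y'. x \<in> carrier M1 \<Longrightarrow> x' \<in> carrier N1 \<Longrightarrow> y \<in> carrier M2 \<Longrightarrow> y' \<in> carrier N2 \<Longrightarrow>
       \<Phi> (pure_tensor B1 M1 N1 x x') (pure_tensor B2 M2 N2 y y') = g x x' y y'"
proof -
  interpret D1: tensor_data B1 M1 N1 by fact
  interpret D2: tensor_data B2 M2 N2 by fact
  interpret C: comm_group C by fact
  have "\<forall>x x'. \<exists>h. x \<in> carrier M1 \<longrightarrow> x' \<in> carrier N1 \<longrightarrow>
      h \<in> hom D2.T C \<and> (\<forall>y\<in>carrier M2. \<forall>y'\<in>carrier N2. h (D2.pt y y') = g x x' y y')"
    using D2.T_universal[OF assms(3) b1] by blast
  then obtain L where L: "x \<in> carrier M1 \<Longrightarrow> x' \<in> carrier N1 \<Longrightarrow> L x x' \<in> hom D2.T C"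
    "x \<in> carrier M1 \<Longrightarrow> x' \<in> carrier N1 \<Longrightarrow> y \<in> carrier M2 \<Longrightarrow> y' \<in> carrier N2 \<Longrightarrow> L x x' (D2.pt y y') = g x x' y y'"
    for x x' y y'
    by metis
  have Lc: "L x x' z \<in> carrier C" if "x \<in> carrier M1" "x' \<in> carrier N1" "z \<in> carrier D2.T" for x x' z
    using L(1)[OF that(1,2)] that(3) by (rule hom_in_carrier)
  have hm: "(\<lambda>z. h z \<otimes>\<^bsub>C\<^esub> h' z) \<in> hom D2.T C" if "h \<in> hom D2.T C" "h' \<in> hom D2.T C" for h h'
    using that by (auto simp: hom_def Pi_iff C.m_ac)
  \<comment> \<open>Both sides of each balance equation are homomorphisms in \<open>z\<close>, so
    the equations are inherited from pure tensors, where they are the assumption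
    \<open>b2\<close>.\<close>
  have bal: "balanced_map B1 M1 N1 C (\<lambda>x x'. L x x' z)" if z: "z \<in> carrier D2.T" for z
    unfolding balanced_map_def
  proof (intro conjI ballI)
    fix x x' y assume x: "x \<in> carrier M1" "x' \<in> carrier M1" "y \<in> carrier N1"
    show "L (x \<oplus>\<^bsub>M1\<^esub> x') y z = L x y z \<otimes>\<^bsub>C\<^esub> L x' y z"
    proof (rule D2.T_hom_eq[OF assms(3) _ _ z, where h' = "\<lambda>z. L x y z \<otimes>\<^bsub>C\<^esub> L x' y z"])
      show "L (x \<oplus>\<^bsub>M1\<^esub> x') y \<in> hom D2.T C" using x by (intro L(1)) auto
      show "(\<lambda>z. L x y z \<otimes>\<^bsub>C\<^esub> L x' y z) \<in> hom D2.T C" using x by (intro hm L(1))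
      fix w w' assume w: "w \<in> carrier M2" "w' \<in> carrier N2"
      show "L (x \<oplus>\<^bsub>M1\<^esub> x') y (D2.pt w w') = L x y (D2.pt w w') \<otimes>\<^bsub>C\<^esub> L x' y (D2.pt w w')"
        using balanced_mapD(2)[OF b2[OF w] x] x w by (simp add: L(2))
    qed
  next
    fix x y y' assume x: "x \<in> carrier M1" "y \<in> carrier N1" "y' \<in> carrier N1"
    show "L x (y \<oplus>\<^bsub>N1\<^esub> y') z = L x y z \<otimes>\<^bsub>C\<^esub> L x y' z"
    proof (rule D2.T_hom_eq[OF assms(3) _ _ z, where h' = "\<lambda>z. L x y z \<otimes>\<^bsub>C\<^esub> L x y' z"])
      show "L x (y \<oplus>\<^bsub>N1\<^esub> y') \<in> hom D2.T C" using x by (intro L(1)) auto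
      show "(\<lambda>z. L x y z \<otimes>\<^bsub>C\<^esub> L x y' z) \<in> hom D2.T C" using x by (intro hm L(1))
      fix w w' assume w: "w \<in> carrier M2" "w' \<in> carrier N2"
      show "L x (y \<oplus>\<^bsub>N1\<^esub> y') (D2.pt w w') = L x y (D2.pt w w') \<otimes>\<^bsub>C\<^esub> L x y' (D2.pt w w')"
        using balanced_mapD(3)[OF b2[OF w] x] x w by (simp add: L(2))
    qed
  next
    fix b x y assume x: "b \<in> carrier B1" "x \<in> carrier M1" "y \<in> carrier N1"
    show "L (b \<odot>\<^bsub>M1\<^esub> x) y z = L x (b \<odot>\<^bsub>N1\<^esub> y) z"
    proof (rule D2.T_hom_eq[OF assms(3) _ _ z])
      show "L (b \<odot>\<^bsub>M1\<^esub> x) y \<in> hom D2.T C" "L x (b \<odot>\<^bsub>N1\<^esub> y) \<in> hom D2.T C"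
        using x by (simp_all add: L(1) D1.M_smult D1.N_smult)
      fix w w' assume w: "w \<in> carrier M2" "w' \<in> carrier N2"
      show "L (b \<odot>\<^bsub>M1\<^esub> x) y (D2.pt w w') = L x (b \<odot>\<^bsub>N1\<^esub> y) (D2.pt w w')"
        using balanced_mapD(4)[OF b2[OF w] x] x w by (simp add: L(2) D1.M_smult D1.N_smult)
    qed
  qed (use Lc z in auto)
  have "\<forall>z. \<exists>h. z \<in> carrier D2.T \<longrightarrow>
      h \<in> hom D1.T C \<and> (\<forall>x\<in>carrier M1. \<forall>x'\<in>carrier N1. h (D1.pt x x') = L x x' z)"
    using D1.T_universal[OF assms(3) bal] by blast
  then obtain K where K: "z \<in> carrier D2.T \<Longrightarrow> K z \<in> hom D1.T C"
    "z \<in> carrier D2.T \<Longrightarrow> x \<in> carrier M1 \<Longrightarrow> x' \<in> carrier N1 \<Longrightarrow> K z (D1.pt x x') = L x x' z" for z x x'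
    by metis
  have Kc: "K z t \<in> carrier C" if "z \<in> carrier D2.T" "t \<in> carrier D1.T" for z t
    using K(1)[OF that(1)] that(2) by (rule hom_in_carrier)
  show ?thesis
  proof (rule that[of "\<lambda>s t. K t s"])
    show "(\<lambda>t. K t s) \<in> hom D2.T C" if s: "s \<in> carrier D1.T" for s
    proof (rule homI)
      fix t t' assume t: "t \<in> carrier D2.T" "t' \<in> carrier D2.T"
      show "K (t \<otimes>\<^bsub>D2.T\<^esub> t') s = K t s \<otimes>\<^bsub>C\<^esub> K t' s"
      proof (rule D1.T_hom_eq[OF assms(3) _ _ s, where h' = "\<lambda>s. K t s \<otimes>\<^bsub>C\<^esub> K t' s"])
        show "K (t \<otimes>\<^bsub>D2.T\<^esub> t') \<in> hom D1.T C" using t by (intro K(1)) auto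
        show "(\<lambda>s. K t s \<otimes>\<^bsub>C\<^esub> K t' s) \<in> hom D1.T C"
          using K(1)[OF t(1)] K(1)[OF t(2)] by (auto simp: hom_def Pi_iff C.m_ac)
        fix x x' assume x: "x \<in> carrier M1" "x' \<in> carrier N1"
        show "K (t \<otimes>\<^bsub>D2.T\<^esub> t') (D1.pt x x') = K t (D1.pt x x') \<otimes>\<^bsub>C\<^esub> K t' (D1.pt x x')"
          using x t hom_mult[OF L(1)[OF x] t] by (simp add: K(2))
      qed
    qed (use Kc s in auto)
  qed (auto simp: K L)
qed

text \<open>The biadditive counterpart of \<open>frag_extend_tcls\<close>: it evaluates the unions
  in the product of the tensor square and in its action on a tensor product of modules.\<close>

lemma frag_extend2_tcls:
  assumes "tensor_data B1 M1 N1" "tensor_data B2 M2 N2" "tensor_data B3 M3 N3"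
    and \<Phi>: "\<And>s. s \<in> carrier (tensor_group B1 M1 N1) \<Longrightarrow> \<Phi> s \<in> hom (tensor_group B2 M2 N2) (tensor_group B3 M3 N3)"
    "\<And>t. t \<in> carrier (tensor_group B2 M2 N2) \<Longrightarrow> (\<lambda>s. \<Phi> s t) \<in> hom (tensor_group B1 M1 N1) (tensor_group B3 M3 N3)"
    and f: "\<And>x x' y y'. x \<in> carrier M1 \<Longrightarrow> x' \<in> carrier N1 \<Longrightarrow> y \<in> carrier M2 \<Longrightarrow> y' \<in> carrier N2 \<Longrightarrow>
       f (x, x') (y, y') \<in> carrier M3 \<times> carrier N3 \<and>
       \<Phi> (pure_tensor B1 M1 N1 x x') (pure_tensor B2 M2 N2 y y') = tensor_class B3 M3 N3 (frag_of (f (x, x') (y, y')))"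
    and z: "z \<in> carrier (tensor_group B1 M1 N1)" "z' \<in> carrier (tensor_group B2 M2 N2)"
  shows "(\<Union>s\<in>z. \<Union>t\<in>z'. tensor_class B3 M3 N3 (frag_extend2 f s t)) = \<Phi> z z'"
proof -
  interpret D1: tensor_data B1 M1 N1 by fact
  interpret D2: tensor_data B2 M2 N2 by fact
  interpret D3: tensor_data B3 M3 N3 by fact
  have 1: "frag_extend (\<lambda>q. frag_of (f p q)) t \<in> carrier D3.F \<and>
      D3.tcls (frag_extend (\<lambda>q. frag_of (f p q)) t) = \<Phi> (D1.tcls (frag_of p)) (D2.tcls t)"
    if "t \<in> carrier D2.F" "p \<in> carrier M1 \<times> carrier N1" for t p
    using that(1)
  proof (induction t rule: frag_carrier_induct)
    case zero
    interpret h: group_hom D2.T D3.T "\<Phi> (D1.tcls (frag_of p))"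
      using that by unfold_locales (auto intro!: \<Phi> D1.tcls_closed)
    show ?case using h.hom_one by (simp add: D2.tcls_zero D3.tcls_zero)
  next
    case (diff x y)
    interpret h: group_hom D2.T D3.T "\<Phi> (D1.tcls (frag_of p))"
      using that by unfold_locales (auto intro!: \<Phi> D1.tcls_closed)
    from diff show ?case
      using h.hom_inv[OF D2.tcls_closed[of y]]
      by (simp add: frag_extend_diff D3.F_diff D3.tcls_diff D2.tcls_diff D2.tcls_closed del: carrier_free_Abelian_group_iff)
  next
    case (gen q)
    with that f show ?case by (auto simp: pure_tensor_def)
  qed
  have 2: "frag_extend2 f s t \<in> carrier D3.F \<and> D3.tcls (frag_extend2 f s t) = \<Phi> (D1.tcls s) (D2.tcls t)"
    if "s \<in> carrier D1.F" "t \<in> carrier D2.F" for s t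
    using that(1)
  proof (induction s rule: frag_carrier_induct)
    case zero
    interpret h: group_hom D1.T D3.T "\<lambda>s. \<Phi> s (D2.tcls t)"
      using that by unfold_locales (auto intro!: \<Phi> D2.tcls_closed)
    show ?case using h.hom_one by (simp add: frag_extend2_def D1.tcls_zero D3.tcls_zero)
  next
    case (diff x y)
    interpret h: group_hom D1.T D3.T "\<lambda>s. \<Phi> s (D2.tcls t)"
      using that by unfold_locales (auto intro!: \<Phi> D2.tcls_closed)
    from diff show ?case
      using h.hom_inv[OF D1.tcls_closed[of y]]
      by (simp add: frag_extend2_def frag_extend_diff D3.F_diff D3.tcls_diff D1.tcls_diff D1.tcls_closed
          del: carrier_free_Abelian_group_iff)
  next
    case (gen p)
    with 1[OF that(2)] show ?case by (simp add: frag_extend2_def del: carrier_free_Abelian_group_iff)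
  qed
  obtain s where s: "z = D1.tcls s" "s \<in> carrier D1.F"
    using z(1) unfolding D1.T_carrier by (rule imageE)
  obtain t where t: "z' = D2.tcls t" "t \<in> carrier D2.F"
    using z(2) unfolding D2.T_carrier by (rule imageE)
  note st = s(2,1) t(2,1)
  have "D3.tcls (frag_extend2 f s' t') = \<Phi> z z'" if "s' \<in> z" "t' \<in> z'" for s' t'
  proof -
    have m: "s' \<in> carrier D1.F" "D1.tcls s' = D1.tcls s" "t' \<in> carrier D2.F" "D2.tcls t' = D2.tcls t"
      using D1.mem_tcls[OF st(1)] D2.mem_tcls[OF st(3)] that st(2,4) by blast+
    show ?thesis using 2[OF m(1,3)] unfolding m(2,4) st(2,4) by blast
  qed
  moreover have "s \<in> z" "t \<in> z'" using st D1.tcls_self D2.tcls_self by simp_all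
  ultimately show ?thesis by blast
qed

section \<open>The tensor product of two actions\<close>

locale kaction = A: kalgebra A + V: kspace V
  for A :: "('k::field, 'a) module" and V :: "('k, 'v) module" +
  fixes av :: "'a \<Rightarrow> 'v \<Rightarrow> 'v"
  assumes av_closed [simp]: "a \<in> carrier A \<Longrightarrow> v \<in> carrier V \<Longrightarrow> av a v \<in> carrier V"
    and av_add_left: "a \<in> carrier A \<Longrightarrow> b \<in> carrier A \<Longrightarrow> v \<in> carrier V \<Longrightarrow> av (a \<oplus>\<^bsub>A\<^esub> b) v = av a v \<oplus>\<^bsub>V\<^esub> av b v"
    and av_add_right: "a \<in> carrier A \<Longrightarrow> v \<in> carrier V \<Longrightarrow> w \<in> carrier V \<Longrightarrow> av a (v \<oplus>\<^bsub>V\<^esub> w) = av a v \<oplus>\<^bsub>V\<^esub> av a w"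
    and av_sc_left: "a \<in> carrier A \<Longrightarrow> v \<in> carrier V \<Longrightarrow> av (c \<odot>\<^bsub>A\<^esub> a) v = c \<odot>\<^bsub>V\<^esub> av a v"
    and av_sc_right: "a \<in> carrier A \<Longrightarrow> v \<in> carrier V \<Longrightarrow> av a (c \<odot>\<^bsub>V\<^esub> v) = c \<odot>\<^bsub>V\<^esub> av a v"
    and av_mult: "a \<in> carrier A \<Longrightarrow> b \<in> carrier A \<Longrightarrow> v \<in> carrier V \<Longrightarrow> av (a \<otimes>\<^bsub>A\<^esub> b) v = av a (av b v)"
    and av_one: "v \<in> carrier V \<Longrightarrow> av \<one>\<^bsub>A\<^esub> v = v"

lemma (in kalgebra) kaction_self: "kaction A A (\<otimes>)"
  by (intro kaction.intro kaction_axioms.intro kalgebra_axioms kspace_axioms)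
     (simp_all add: l_distr r_distr ks_mult_left ks_mult_right m_assoc)

lemma tensor_data_kspace:
  assumes "kspace V" "kspace W"
  shows "tensor_data class_ring V W"
proof -
  interpret V: kspace V by fact
  interpret W: kspace W by fact
  show ?thesis by (intro tensor_data.intro tensor_data_axioms.intro V.abelian_group_axioms W.abelian_group_axioms) simp_all
qed

locale bi_action = V: kaction A V av + W: kaction A W aw
  for A :: "('k::field, 'a) module" and V :: "('k, 'v) module" and av
    and W :: "('k, 'w) module" and aw
begin

lemma DA: "tensor_data class_ring A A" and DV: "tensor_data class_ring V W"
  by (intro tensor_data_kspace V.A.kspace_axioms V.V.kspace_axioms W.V.kspace_axioms)+

sublocale DA: tensor_data class_ring A A by (rule DA)
sublocale DV: tensor_data class_ring V W by (rule DV)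

definition bact where
  "bact S T = (\<Union>s\<in>S. \<Union>t\<in>T. DV.tcls (frag_extend2 (\<lambda>(x, x') (v, w). (av x v, aw x' w)) s t))"

lemma bact_props:
  "S \<in> carrier DA.T \<Longrightarrow> (\<lambda>T. bact S T) \<in> hom DV.T DV.T"
  "T \<in> carrier DV.T \<Longrightarrow> (\<lambda>S. bact S T) \<in> hom DA.T DV.T"
  "x \<in> carrier A \<Longrightarrow> x' \<in> carrier A \<Longrightarrow> v \<in> carrier V \<Longrightarrow> w \<in> carrier W \<Longrightarrow>
    bact (DA.pt x x') (DV.pt v w) = DV.pt (av x v) (aw x' w)"
proof -
  let ?g = "\<lambda>x x' v w. DV.pt (av x v) (aw x' w)"
  have b1: "balanced_map class_ring V W DV.T (?g x x')" if "x \<in> carrier A" "x' \<in> carrier A" for x x'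
    unfolding balanced_map_def using that
    by (simp add: V.av_add_right W.av_add_right DV.pt_simps(1,2) V.av_sc_right W.av_sc_right)
       (simp add: DV.pt_simps(3) class_ring_simps)
  have b2: "balanced_map class_ring A A DV.T (\<lambda>x x'. ?g x x' v w)" if "v \<in> carrier V" "w \<in> carrier W" for v w
    unfolding balanced_map_def using that
    by (simp add: V.av_add_left W.av_add_left DV.pt_simps(1,2) V.av_sc_left W.av_sc_left)
       (simp add: DV.pt_simps(3) class_ring_simps)
  obtain \<Phi> where \<Phi>: "\<And>s. s \<in> carrier DA.T \<Longrightarrow> \<Phi> s \<in> hom DV.T DV.T"
    "\<And>t. t \<in> carrier DV.T \<Longrightarrow> (\<lambda>s. \<Phi> s t) \<in> hom DA.T DV.T"
    "\<And>x x' y y'. x \<in> carrier A \<Longrightarrow> x' \<in> carrier A \<Longrightarrow> y \<in> carrier V \<Longrightarrow> y' \<in> carrier W \<Longrightarrow>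
       \<Phi> (DA.pt x x') (DV.pt y y') = ?g x x' y y'"
    using tensor_bihom[OF DA DV DV.T.comm_group_axioms, of ?g, OF b1 b2] by blast
  have eq: "bact S T = \<Phi> S T" if "S \<in> carrier DA.T" "T \<in> carrier DV.T" for S T
    unfolding bact_def
  proof (rule frag_extend2_tcls[OF DA DV DV])
    fix x x' y y'
    assume x: "x \<in> carrier A" "x' \<in> carrier A" "y \<in> carrier V" "y' \<in> carrier W"
    show "(case (x, x') of (x, x') \<Rightarrow> \<lambda>(v, w). (av x v, aw x' w)) (y, y') \<in> carrier V \<times> carrier W \<and>
       \<Phi> (DA.pt x x') (DV.pt y y') = DV.tcls (frag_of ((case (x, x') of (x, x') \<Rightarrow> \<lambda>(v, w). (av x v, aw x' w)) (y, y')))"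
      using x by (simp add: \<Phi>(3)) (simp add: pure_tensor_def)
  qed (use \<Phi> that in blast)+
  show "(\<lambda>T. bact S T) \<in> hom DV.T DV.T" if S: "S \<in> carrier DA.T"
    using \<Phi>(1)[OF S] eq[OF S] by (simp add: hom_def Pi_iff)
  show "(\<lambda>S. bact S T) \<in> hom DA.T DV.T" if T: "T \<in> carrier DV.T"
    using \<Phi>(2)[OF T] eq[OF _ T] by (simp add: hom_def Pi_iff)
  show "x \<in> carrier A \<Longrightarrow> x' \<in> carrier A \<Longrightarrow> v \<in> carrier V \<Longrightarrow> w \<in> carrier W \<Longrightarrow>
    bact (DA.pt x x') (DV.pt v w) = DV.pt (av x v) (aw x' w)"
    by (simp add: eq \<Phi>(3))
qed

lemma bact_closed: "S \<in> carrier DA.T \<Longrightarrow> T \<in> carrier DV.T \<Longrightarrow> bact S T \<in> carrier DV.T"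
  by (rule hom_in_carrier[OF bact_props(1)])

lemma bact_add_right:
  "S \<in> carrier DA.T \<Longrightarrow> T \<in> carrier DV.T \<Longrightarrow> T' \<in> carrier DV.T \<Longrightarrow>
    bact S (T \<otimes>\<^bsub>DV.T\<^esub> T') = bact S T \<otimes>\<^bsub>DV.T\<^esub> bact S T'"
  using hom_mult[OF bact_props(1)] by blast

lemma bact_add_left:
  "S \<in> carrier DA.T \<Longrightarrow> S' \<in> carrier DA.T \<Longrightarrow> T \<in> carrier DV.T \<Longrightarrow>
    bact (S \<otimes>\<^bsub>DA.T\<^esub> S') T = bact S T \<otimes>\<^bsub>DV.T\<^esub> bact S' T"
  using hom_mult[OF bact_props(2)] by blast

lemma bact_one:
  assumes "T \<in> carrier DV.T"
  shows "bact (DA.pt \<one>\<^bsub>A\<^esub> \<one>\<^bsub>A\<^esub>) T = T"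
  using assms
proof (induction T rule: DV.T_induct)
  case (pt x y)
  then show ?case by (simp add: bact_props(3) V.av_one W.av_one)
next
  case (add z z')
  then show ?case by (simp add: bact_add_right)
qed

end

text \<open>The product of the tensor square is its action on itself, with the algebra acting on
  both factors by left multiplication.\<close>

sublocale bi_action \<subseteq> AA: bi_action A A "(\<otimes>\<^bsub>A\<^esub>)" A "(\<otimes>\<^bsub>A\<^esub>)"
  by (intro bi_action.intro V.A.kaction_self)

context bi_action
begin

text \<open>Proved on pure tensors and extended three times. It gives associativity of the tensor
  square and the module law for tensor products of modules in one statement.\<close>

lemma bact_bact:
  assumes "S \<in> carrier DA.T" "S' \<in> carrier DA.T" "T \<in> carrier DV.T"
  shows "bact (AA.bact S S') T = bact S (bact S' T)"
  using assms(1)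
proof (induction S rule: DA.T_induct)
  case (pt x x')
  show ?case
    using assms(2)
  proof (induction S' rule: DA.T_induct)
    case (pt y y')
    show ?case
      using assms(3)
    proof (induction T rule: DV.T_induct)
      case (pt v w)
      with \<open>x \<in> _\<close> \<open>x' \<in> _\<close> \<open>y \<in> _\<close> \<open>y' \<in> _\<close> show ?case
        by (simp add: bact_props(3) AA.bact_props(3) V.av_mult W.av_mult)
    next
      case (add z z')
      with \<open>x \<in> _\<close> \<open>x' \<in> _\<close> \<open>y \<in> _\<close> \<open>y' \<in> _\<close> show ?case
        by (simp add: bact_add_right bact_closed AA.bact_closed)
    qed
  next
    case (add z z')
    with pt assms(3) show ?case
      by (simp add: bact_add_right bact_add_left AA.bact_add_right bact_closed AA.bact_closed)
  qed
next
  case (add z z')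
  with assms(2,3) show ?case
    by (simp add: bact_add_left AA.bact_add_left bact_closed AA.bact_closed)
qed

end

section \<open>The tensor square of an algebra\<close>

locale tensor_square = kalgebra A for A :: "('k::field, 'a) module" (structure)
begin

sublocale bi: bi_action A A "(\<otimes>)" A "(\<otimes>)"
  by (intro bi_action.intro kaction_self)

abbreviation "AA \<equiv> tensor_algebra A A"
abbreviation "TG \<equiv> tensor_group class_ring A A"
abbreviation "pp \<equiv> pure_tensor class_ring A A"

lemma AA_simps:
  "carrier AA = carrier TG" "ring.zero AA = \<one>\<^bsub>TG\<^esub>" "x \<oplus>\<^bsub>AA\<^esub> y = x \<otimes>\<^bsub>TG\<^esub> y"
  "\<one>\<^bsub>AA\<^esub> = pp \<one> \<one>" "S \<otimes>\<^bsub>AA\<^esub> S' = bi.bact S S'"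
  by (simp_all add: tensor_algebra_def bi.bact_def)

lemma AA_smult:
  "T \<in> carrier TG \<Longrightarrow> c \<odot>\<^bsub>AA\<^esub> T \<in> carrier TG"
  "T \<in> carrier TG \<Longrightarrow> T' \<in> carrier TG \<Longrightarrow> c \<odot>\<^bsub>AA\<^esub> (T \<otimes>\<^bsub>TG\<^esub> T') = (c \<odot>\<^bsub>AA\<^esub> T) \<otimes>\<^bsub>TG\<^esub> (c \<odot>\<^bsub>AA\<^esub> T')"
  "x \<in> carrier A \<Longrightarrow> x' \<in> carrier A \<Longrightarrow> c \<odot>\<^bsub>AA\<^esub> pp x x' = pp (c \<odot> x) x'"
proof -
  have "balanced_map class_ring A A TG (\<lambda>x x'. pp (c \<odot> x) x')"
    unfolding balanced_map_def
    by (simp add: ks_r_distr bi.DA.pt_simps(1,2))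
       (simp add: bi.DA.pt_simps(3)[symmetric] class_ring_simps ks_assoc mult.commute)
  from bi.DA.T_universal[OF bi.DA.T.comm_group_axioms this]
  obtain h where h: "h \<in> hom TG TG"
    "\<And>x x'. x \<in> carrier A \<Longrightarrow> x' \<in> carrier A \<Longrightarrow> h (pp x x') = pp (c \<odot> x) x'" by blast
  have eq: "c \<odot>\<^bsub>AA\<^esub> T = h T" if "T \<in> carrier TG" for T
  proof -
    have "(\<Union>t\<in>T. bi.DA.tcls (frag_extend (\<lambda>(x, x'). frag_of (c \<odot> x, x')) t)) = h T"
      by (rule bi.DA.frag_extend_tcls[OF bi.DA h(1) _ _ that])
         (simp_all only: prod.case h(2), simp_all add: pure_tensor_def)
    then show ?thesis by (simp add: tensor_algebra_def)
  qed
  show "T \<in> carrier TG \<Longrightarrow> c \<odot>\<^bsub>AA\<^esub> T \<in> carrier TG"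
    by (simp add: eq hom_in_carrier[OF h(1)])
  show "T \<in> carrier TG \<Longrightarrow> T' \<in> carrier TG \<Longrightarrow> c \<odot>\<^bsub>AA\<^esub> (T \<otimes>\<^bsub>TG\<^esub> T') = (c \<odot>\<^bsub>AA\<^esub> T) \<otimes>\<^bsub>TG\<^esub> (c \<odot>\<^bsub>AA\<^esub> T')"
    by (simp add: eq hom_mult[OF h(1)])
  show "x \<in> carrier A \<Longrightarrow> x' \<in> carrier A \<Longrightarrow> c \<odot>\<^bsub>AA\<^esub> pp x x' = pp (c \<odot> x) x'"
    by (simp add: eq h(2))
qed

lemma bact_smult:
  assumes "T \<in> carrier TG" "T' \<in> carrier TG"
  shows "bi.bact (c \<odot>\<^bsub>AA\<^esub> T) T' = c \<odot>\<^bsub>AA\<^esub> bi.bact T T'"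
    and "bi.bact T (c \<odot>\<^bsub>AA\<^esub> T') = c \<odot>\<^bsub>AA\<^esub> bi.bact T T'"
proof -
  have "bi.bact (c \<odot>\<^bsub>AA\<^esub> T) T' = c \<odot>\<^bsub>AA\<^esub> bi.bact T T' \<and> bi.bact T (c \<odot>\<^bsub>AA\<^esub> T') = c \<odot>\<^bsub>AA\<^esub> bi.bact T T'"
    using assms(1)
  proof (induction T rule: bi.DA.T_induct)
    case (pt x x')
    show ?case
      using assms(2)
    proof (induction T' rule: bi.DA.T_induct)
      case (pt y y')
      with \<open>x \<in> _\<close> \<open>x' \<in> _\<close> show ?case
        by (simp add: AA_smult bi.bact_props(3) ks_mult_left ks_mult_right)
    next
      case (add z z')
      with \<open>x \<in> _\<close> \<open>x' \<in> _\<close> show ?case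
        by (simp add: AA_smult bi.bact_add_right bi.bact_closed)
    qed
  next
    case (add z z')
    with assms(2) show ?case
      by (simp add: AA_smult bi.bact_add_left bi.bact_closed)
  qed
  then show "bi.bact (c \<odot>\<^bsub>AA\<^esub> T) T' = c \<odot>\<^bsub>AA\<^esub> bi.bact T T'"
    and "bi.bact T (c \<odot>\<^bsub>AA\<^esub> T') = c \<odot>\<^bsub>AA\<^esub> bi.bact T T'" by blast+
qed

lemma abelian_group_AA: "abelian_group AA"
  by (rule bi.DA.T_abelian_group) (simp_all add: tensor_algebra_def)

lemma kalgebra_AA: "kalgebra AA"
proof -
  have right_one: "bi.bact T (pp \<one> \<one>) = T" if "T \<in> carrier TG" for T
    using that
  proof (induction T rule: bi.DA.T_induct)
    case (pt x x')
    then show ?case by (simp add: bi.bact_props(3))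
  next
    case (add z z')
    then show ?case by (simp add: bi.bact_add_left)
  qed
  have "monoid AA"
    by (rule monoidI) (simp_all add: AA_simps bi.bact_closed bi.bact_bact bi.bact_one right_one)
  then have ring: "ring AA"
    by (intro ringI abelian_group_AA) (simp_all add: AA_simps bi.bact_add_left bi.bact_add_right)
  have l: "(c + d) \<odot>\<^bsub>AA\<^esub> T = (c \<odot>\<^bsub>AA\<^esub> T) \<otimes>\<^bsub>TG\<^esub> (d \<odot>\<^bsub>AA\<^esub> T) \<and> c \<odot>\<^bsub>AA\<^esub> (d \<odot>\<^bsub>AA\<^esub> T) = (c * d) \<odot>\<^bsub>AA\<^esub> T \<and> 1 \<odot>\<^bsub>AA\<^esub> T = T"
    if "T \<in> carrier TG" for c d T
    using that
  proof (induction T rule: bi.DA.T_induct)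
    case (pt x x')
    then show ?case by (simp add: AA_smult ks_l_distr bi.DA.pt_simps(1) ks_assoc)
  next
    case (add z z')
    then show ?case
      by (simp add: AA_smult) (simp add: AA_smult bi.DA.T.m_ac)
  qed
  have "kspace AA"
    by (intro kspace.intro kspace_axioms.intro abelian_group_AA) (simp_all add: AA_simps AA_smult l)
  then show ?thesis
    by (intro kalgebra.intro kalgebra_axioms.intro ring) (simp_all add: AA_simps bact_smult)
qed

sublocale AA: kalgebra AA by (rule kalgebra_AA)

lemma pp_closed: "x \<in> carrier A \<Longrightarrow> y \<in> carrier A \<Longrightarrow> pp x y \<in> carrier AA"
  by (simp add: AA_simps)

lemma pp_mult:
  "x \<in> carrier A \<Longrightarrow> x' \<in> carrier A \<Longrightarrow> y \<in> carrier A \<Longrightarrow> y' \<in> carrier A \<Longrightarrow>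
    pp x x' \<otimes>\<^bsub>AA\<^esub> pp y y' = pp (x \<otimes> y) (x' \<otimes> y')"
  by (simp add: AA_simps bi.bact_props(3))

lemma pp_add_left: "x \<in> carrier A \<Longrightarrow> x' \<in> carrier A \<Longrightarrow> y \<in> carrier A \<Longrightarrow> pp (x \<oplus> x') y = pp x y \<oplus>\<^bsub>AA\<^esub> pp x' y"
  and pp_add_right: "x \<in> carrier A \<Longrightarrow> y \<in> carrier A \<Longrightarrow> y' \<in> carrier A \<Longrightarrow> pp x (y \<oplus> y') = pp x y \<oplus>\<^bsub>AA\<^esub> pp x y'"
  by (simp_all add: AA_simps bi.DA.pt_simps)

lemma pp_sc_left: "x \<in> carrier A \<Longrightarrow> y \<in> carrier A \<Longrightarrow> pp (c \<odot> x) y = c \<odot>\<^bsub>AA\<^esub> pp x y"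
  and pp_sc_right: "x \<in> carrier A \<Longrightarrow> y \<in> carrier A \<Longrightarrow> pp x (c \<odot> y) = c \<odot>\<^bsub>AA\<^esub> pp x y"
  by (simp_all add: AA_smult) (simp add: bi.DA.pt_simps(3) class_ring_simps)

lemma pp_zero: "x \<in> carrier A \<Longrightarrow> pp x \<zero> = \<zero>\<^bsub>AA\<^esub>" "x \<in> carrier A \<Longrightarrow> pp \<zero> x = \<zero>\<^bsub>AA\<^esub>"
  by (simp_all add: AA_simps bi.DA.pt_zero_left bi.DA.pt_zero_right)

lemma pp_uminus: "x \<in> carrier A \<Longrightarrow> y \<in> carrier A \<Longrightarrow> pp (\<ominus> x) y = \<ominus>\<^bsub>AA\<^esub> pp x y"
  "x \<in> carrier A \<Longrightarrow> y \<in> carrier A \<Longrightarrow> pp x (\<ominus> y) = \<ominus>\<^bsub>AA\<^esub> pp x y"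
  by (simp_all add: ks_minus_one[symmetric] AA.ks_minus_one[symmetric] pp_closed pp_sc_left pp_sc_right)

lemma pp_minus: "x \<in> carrier A \<Longrightarrow> x' \<in> carrier A \<Longrightarrow> y \<in> carrier A \<Longrightarrow> pp (x \<ominus> x') y = pp x y \<ominus>\<^bsub>AA\<^esub> pp x' y"
  "x \<in> carrier A \<Longrightarrow> y \<in> carrier A \<Longrightarrow> y' \<in> carrier A \<Longrightarrow> pp x (y \<ominus> y') = pp x y \<ominus>\<^bsub>AA\<^esub> pp x y'"
  by (simp_all add: a_minus_def pp_add_left pp_add_right pp_uminus)

end

section \<open>Serre relations for sums of q-commuting elements\<close>

text \<open>The four letters stand for e_i (x) 1, omega_i (x) e_i, e_(i+1) (x) 1 and omega_(i+1) (x)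
  e_(i+1), and \<open>R1\<close> to \<open>R4\<close> measure their failure to q-commute. Each
  bracket of the right side collects one multidegree: pure in \<open>X\<close>, \<open>Z\<close>;
  pure in \<open>Y\<close>, \<open>W\<close>; then \<open>XXW\<close>, \<open>XYZ\<close>,
  \<open>XYW\<close> and \<open>YYZ\<close>. Stated in a free algebra, the identity is decided by
  comparing coefficients.\<close>

lemma serre1_certificate:
  fixes \<rho> \<sigma> :: "'k::field" and X Y Z W :: "nat word \<Rightarrow>\<^sub>0 'k"
  assumes nz: "\<rho> \<noteq> 0" "\<sigma> \<noteq> 0"
    and "R1 = Y * X - sc (\<rho> / \<sigma>) * (X * Y)" "R2 = Y * Z - sc \<sigma> * (Z * Y)"
    and "R3 = W * X - sc (1 / \<rho>) * (X * W)" "R4 = W * Z - sc (\<rho> / \<sigma>) * (Z * W)"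
    and XYZW: "X = var 0" "Y = var 1" "Z = var 2" "W = var 3"
  shows "(X + Y) * (X + Y) * (Z + W) - sc (\<rho> + \<sigma>) * (X + Y) * (Z + W) * (X + Y) + sc (\<rho> * \<sigma>) * (Z + W) * ((X + Y) * (X + Y))
    = (X * X * Z - sc (\<rho> + \<sigma>) * X * Z * X + sc (\<rho> * \<sigma>) * Z * (X * X))
    + (Y * Y * W - sc (\<rho> + \<sigma>) * Y * W * Y + sc (\<rho> * \<sigma>) * W * (Y * Y))
    + (sc (\<rho> * \<sigma>) * (R3 * X) - sc \<rho> * (X * R3))
    + (sc (1 + \<rho> / \<sigma>) * (X * R2) + R1 * Z - sc (\<rho> + \<sigma>) * (R2 * X) - sc (\<sigma> * \<sigma>) * (Z * R1))
    + (- sc (\<sigma> / \<rho>) * (R1 * W) - sc (\<rho> + \<sigma>) * (Y * R3) + sc (\<rho> * \<sigma> + \<rho> * \<rho>) * (R3 * Y) + sc (\<rho> * \<sigma>) * (W * R1))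
    + (Y * R2 - sc \<rho> * (R2 * Y))"
  unfolding assms(3-6)
proof (rule poly_mapping_eqI)
  have v: "X * (sc c * p) = sc c * (X * p)" "Y * (sc c * p) = sc c * (Y * p)"
    "Z * (sc c * p) = sc c * (Z * p)" "W * (sc c * p) = sc c * (W * p)" for c p
    unfolding XYZW by (rule var_sc_left_commute)+
  fix w
  show "Poly_Mapping.lookup ((X + Y) * (X + Y) * (Z + W) - sc (\<rho> + \<sigma>) * (X + Y) * (Z + W) * (X + Y) + sc (\<rho> * \<sigma>) * (Z + W) * ((X + Y) * (X + Y))) w
    = Poly_Mapping.lookup ((X * X * Z - sc (\<rho> + \<sigma>) * X * Z * X + sc (\<rho> * \<sigma>) * Z * (X * X))
    + (Y * Y * W - sc (\<rho> + \<sigma>) * Y * W * Y + sc (\<rho> * \<sigma>) * W * (Y * Y))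
    + (sc (\<rho> * \<sigma>) * ((W * X - sc (1 / \<rho>) * (X * W)) * X) - sc \<rho> * (X * (W * X - sc (1 / \<rho>) * (X * W))))
    + (sc (1 + \<rho> / \<sigma>) * (X * (Y * Z - sc \<sigma> * (Z * Y))) + (Y * X - sc (\<rho> / \<sigma>) * (X * Y)) * Z - sc (\<rho> + \<sigma>) * ((Y * Z - sc \<sigma> * (Z * Y)) * X) - sc (\<sigma> * \<sigma>) * (Z * (Y * X - sc (\<rho> / \<sigma>) * (X * Y))))
    + (- sc (\<sigma> / \<rho>) * ((Y * X - sc (\<rho> / \<sigma>) * (X * Y)) * W) - sc (\<rho> + \<sigma>) * (Y * (W * X - sc (1 / \<rho>) * (X * W))) + sc (\<rho> * \<sigma> + \<rho> * \<rho>) * ((W * X - sc (1 / \<rho>) * (X * W)) * Y) + sc (\<rho> * \<sigma>) * (W * (Y * X - sc (\<rho> / \<sigma>) * (X * Y))))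
    + (Y * (Y * Z - sc \<sigma> * (Z * Y)) - sc \<rho> * ((Y * Z - sc \<sigma> * (Z * Y)) * Y))) w"
    using nz by (simp add: mult.assoc distrib_left distrib_right right_diff_distrib left_diff_distrib v lookup_add lookup_minus
        del: single_diff single_add single_uminus) (simp add: field_simps)
qed

text \<open>The second Serre relation, with the mixed brackets now of multidegree
  \<open>XZW\<close>, \<open>XWW\<close>, \<open>YZZ\<close> and \<open>YZW\<close>.\<close>

lemma serre2_certificate:
  fixes \<rho> \<sigma> :: "'k::field" and X Y Z W :: "nat word \<Rightarrow>\<^sub>0 'k"
  assumes nz: "\<rho> \<noteq> 0" "\<sigma> \<noteq> 0"
    and "R1 = Y * X - sc (\<rho> / \<sigma>) * (X * Y)" "R2 = Y * Z - sc \<sigma> * (Z * Y)"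
    and "R3 = W * X - sc (1 / \<rho>) * (X * W)" "R4 = W * Z - sc (\<rho> / \<sigma>) * (Z * W)"
    and XYZW: "X = var 0" "Y = var 1" "Z = var 2" "W = var 3"
  shows "(X + Y) * ((Z + W) * (Z + W)) - sc (\<rho> + \<sigma>) * (Z + W) * (X + Y) * (Z + W) + sc (\<rho> * \<sigma>) * ((Z + W) * (Z + W)) * (X + Y)
    = (X * (Z * Z) - sc (\<rho> + \<sigma>) * Z * X * Z + sc (\<rho> * \<sigma>) * (Z * Z) * X)
    + (Y * (W * W) - sc (\<rho> + \<sigma>) * W * Y * W + sc (\<rho> * \<sigma>) * (W * W) * Y)
    + (- sc (\<sigma> / \<rho>) * (X * R4) - sc (\<rho> + \<sigma>) * (R3 * Z) + sc (\<rho> * \<sigma> + \<rho> * \<rho>) * (Z * R3) + sc (\<rho> * \<sigma>) * (R4 * X))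
    + (sc (\<rho> * \<sigma>) * (W * R3) - sc \<rho> * (R3 * W))
    + (R2 * Z - sc \<rho> * (Z * R2))
    + (sc (1 + \<rho> / \<sigma>) * (R2 * W) + Y * R4 - sc (\<rho> + \<sigma>) * (W * R2) - sc (\<sigma> * \<sigma>) * (R4 * Y))"
  unfolding assms(3-6)
proof (rule poly_mapping_eqI)
  have v: "X * (sc c * p) = sc c * (X * p)" "Y * (sc c * p) = sc c * (Y * p)"
    "Z * (sc c * p) = sc c * (Z * p)" "W * (sc c * p) = sc c * (W * p)" for c p
    unfolding XYZW by (rule var_sc_left_commute)+
  fix w
  show "Poly_Mapping.lookup ((X + Y) * ((Z + W) * (Z + W)) - sc (\<rho> + \<sigma>) * (Z + W) * (X + Y) * (Z + W) + sc (\<rho> * \<sigma>) * ((Z + W) * (Z + W)) * (X + Y)) w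
    = Poly_Mapping.lookup ((X * (Z * Z) - sc (\<rho> + \<sigma>) * Z * X * Z + sc (\<rho> * \<sigma>) * (Z * Z) * X)
    + (Y * (W * W) - sc (\<rho> + \<sigma>) * W * Y * W + sc (\<rho> * \<sigma>) * (W * W) * Y)
    + (- sc (\<sigma> / \<rho>) * (X * (W * Z - sc (\<rho> / \<sigma>) * (Z * W))) - sc (\<rho> + \<sigma>) * ((W * X - sc (1 / \<rho>) * (X * W)) * Z) + sc (\<rho> * \<sigma> + \<rho> * \<rho>) * (Z * (W * X - sc (1 / \<rho>) * (X * W))) + sc (\<rho> * \<sigma>) * ((W * Z - sc (\<rho> / \<sigma>) * (Z * W)) * X))
    + (sc (\<rho> * \<sigma>) * (W * (W * X - sc (1 / \<rho>) * (X * W))) - sc \<rho> * ((W * X - sc (1 / \<rho>) * (X * W)) * W))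
    + ((Y * Z - sc \<sigma> * (Z * Y)) * Z - sc \<rho> * (Z * (Y * Z - sc \<sigma> * (Z * Y))))
    + (sc (1 + \<rho> / \<sigma>) * ((Y * Z - sc \<sigma> * (Z * Y)) * W) + Y * (W * Z - sc (\<rho> / \<sigma>) * (Z * W)) - sc (\<rho> + \<sigma>) * (W * (Y * Z - sc \<sigma> * (Z * Y))) - sc (\<sigma> * \<sigma>) * ((W * Z - sc (\<rho> / \<sigma>) * (Z * W)) * Y))) w"
    using nz by (simp add: mult.assoc distrib_left distrib_right right_diff_distrib left_diff_distrib v lookup_add lookup_minus
        del: single_diff single_add single_uminus) (simp add: field_simps)
qed

context kalgebra
begin

text \<open>Scalars are kept as products with \<open>p \<odot> \<one>\<close>, since this is the
  shape in which evaluation of a relator delivers them.\<close>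

definition serre1 :: "'k \<Rightarrow> 'k \<Rightarrow> 'a \<Rightarrow> 'a \<Rightarrow> 'a" where
  "serre1 p t x z = x \<otimes> x \<otimes> z \<ominus> (p \<odot> \<one>) \<otimes> x \<otimes> z \<otimes> x \<oplus> (t \<odot> \<one>) \<otimes> z \<otimes> (x \<otimes> x)"

definition serre2 :: "'k \<Rightarrow> 'k \<Rightarrow> 'a \<Rightarrow> 'a \<Rightarrow> 'a" where
  "serre2 p t x z = x \<otimes> (z \<otimes> z) \<ominus> (p \<odot> \<one>) \<otimes> z \<otimes> x \<otimes> z \<oplus> (t \<odot> \<one>) \<otimes> (z \<otimes> z) \<otimes> x"

text \<open>The certificates are evaluated at the given elements: the q-commutators become zero and
  the two pure Serre expressions vanish by assumption.\<close>

lemma serre_sum: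
  assumes "\<rho> \<noteq> 0" "\<sigma> \<noteq> 0" and c: "X \<in> carrier A" "Y \<in> carrier A" "Z \<in> carrier A" "W \<in> carrier A"
    and q: "Y \<otimes> X = (\<rho> / \<sigma>) \<odot> (X \<otimes> Y)" "Y \<otimes> Z = \<sigma> \<odot> (Z \<otimes> Y)"
      "W \<otimes> X = (1 / \<rho>) \<odot> (X \<otimes> W)" "W \<otimes> Z = (\<rho> / \<sigma>) \<odot> (Z \<otimes> W)"
  shows "serre1 (\<rho> + \<sigma>) (\<rho> * \<sigma>) X Z = \<zero> \<Longrightarrow> serre1 (\<rho> + \<sigma>) (\<rho> * \<sigma>) Y W = \<zero> \<Longrightarrow>
      serre1 (\<rho> + \<sigma>) (\<rho> * \<sigma>) (X \<oplus> Y) (Z \<oplus> W) = \<zero>"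
    and "serre2 (\<rho> + \<sigma>) (\<rho> * \<sigma>) X Z = \<zero> \<Longrightarrow> serre2 (\<rho> + \<sigma>) (\<rho> * \<sigma>) Y W = \<zero> \<Longrightarrow>
      serre2 (\<rho> + \<sigma>) (\<rho> * \<sigma>) (X \<oplus> Y) (Z \<oplus> W) = \<zero>"
proof -
  define u :: "nat \<Rightarrow> 'a" where "u i = (if i = 0 then X else if i = 1 then Y else if i = 2 then Z else W)" for i
  have u: "u i \<in> carrier A" for i using c by (simp add: u_def)
  note e = ev_simps[of u, OF u]
  define x y z w :: "nat word \<Rightarrow>\<^sub>0 'k" where xyzw: "x = var 0" "y = var 1" "z = var 2" "w = var 3"
  have ex: "ev u x = X" "ev u y = Y" "ev u z = Z" "ev u w = W"
    unfolding xyzw by (simp_all only: ev_var[of u, OF u]) (simp_all add: u_def)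
  define R1 R2 R3 R4 where R: "R1 = y * x - sc (\<rho> / \<sigma>) * (x * y)" "R2 = y * z - sc \<sigma> * (z * y)"
    "R3 = w * x - sc (1 / \<rho>) * (x * w)" "R4 = w * z - sc (\<rho> / \<sigma>) * (z * w)"
  have eR: "ev u R1 = \<zero>" "ev u R2 = \<zero>" "ev u R3 = \<zero>" "ev u R4 = \<zero>"
    unfolding R using c by (simp_all add: e ex q ks_mult_left r_right_minus_eq)
  have ec [simp]: "ev u p \<in> carrier A" for p by (simp add: ev_closed[of u, OF u])
  note [simp del] = single_add single_diff single_uminus
  show "serre1 (\<rho> + \<sigma>) (\<rho> * \<sigma>) (X \<oplus> Y) (Z \<oplus> W) = \<zero>"
    if "serre1 (\<rho> + \<sigma>) (\<rho> * \<sigma>) X Z = \<zero>" "serre1 (\<rho> + \<sigma>) (\<rho> * \<sigma>) Y W = \<zero>"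
  proof -
    have "serre1 (\<rho> + \<sigma>) (\<rho> * \<sigma>) (X \<oplus> Y) (Z \<oplus> W) = ev u ((x + y) * (x + y) * (z + w) -
        sc (\<rho> + \<sigma>) * (x + y) * (z + w) * (x + y) + sc (\<rho> * \<sigma>) * (z + w) * ((x + y) * (x + y)))"
      by (simp only: serre1_def e ex)
    also have "\<dots> = \<zero>"
      unfolding serre1_certificate[OF assms(1,2) R xyzw]
      using that c unfolding serre1_def by (simp only: e ex eR) (simp add: minus_eq)
    finally show ?thesis .
  qed
  show "serre2 (\<rho> + \<sigma>) (\<rho> * \<sigma>) (X \<oplus> Y) (Z \<oplus> W) = \<zero>"
    if "serre2 (\<rho> + \<sigma>) (\<rho> * \<sigma>) X Z = \<zero>" "serre2 (\<rho> + \<sigma>) (\<rho> * \<sigma>) Y W = \<zero>"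
  proof -
    have "serre2 (\<rho> + \<sigma>) (\<rho> * \<sigma>) (X \<oplus> Y) (Z \<oplus> W) = ev u ((x + y) * ((z + w) * (z + w)) -
        sc (\<rho> + \<sigma>) * (z + w) * (x + y) * (z + w) + sc (\<rho> * \<sigma>) * ((z + w) * (z + w)) * (x + y))"
      by (simp only: serre2_def e ex)
    also have "\<dots> = \<zero>"
      unfolding serre2_certificate[OF assms(1,2) R xyzw]
      using that c unfolding serre2_def by (simp only: e ex eR) (simp add: minus_eq)
    finally show ?thesis .
  qed
qed

lemma q_commute_mult:
  assumes "a \<in> carrier A" "b \<in> carrier A" "x \<in> carrier A" "a \<otimes> x = c \<odot> (x \<otimes> a)" "b \<otimes> x = d \<odot> (x \<otimes> b)"
  shows "(a \<otimes> b) \<otimes> x = (c * d) \<odot> (x \<otimes> (a \<otimes> b))"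
proof -
  have "(a \<otimes> b) \<otimes> x = a \<otimes> (b \<otimes> x)" using assms by (simp add: m_assoc)
  also have "\<dots> = d \<odot> ((a \<otimes> x) \<otimes> b)"
    unfolding assms(5) using assms(1-3) by (simp add: ks_mult_right m_assoc)
  also have "\<dots> = (c * d) \<odot> (x \<otimes> (a \<otimes> b))"
    unfolding assms(4) using assms(1-3) by (simp add: ks_mult_left ks_assoc m_assoc mult.commute)
  finally show ?thesis .
qed

lemma commute_mult:
  assumes "x \<in> carrier A" "y \<in> carrier A" "z \<in> carrier A" "x \<otimes> y = y \<otimes> x" "x \<otimes> z = z \<otimes> x"
  shows "x \<otimes> (y \<otimes> z) = (y \<otimes> z) \<otimes> x"
proof -
  have "x \<otimes> (y \<otimes> z) = (y \<otimes> x) \<otimes> z" using m_assoc[OF assms(1-3)] assms(4) by simp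
  also have "\<dots> = y \<otimes> (z \<otimes> x)" using m_assoc[OF assms(2,1,3)] assms(5) by simp
  also have "\<dots> = (y \<otimes> z) \<otimes> x" using m_assoc[OF assms(2,3,1)] by simp
  finally show ?thesis .
qed

end

context tensor_square
begin

text \<open>If one tensor slot holds commuting elements, it contributes the same monomial to all
  terms of the Serre expression, which can then be factored out.\<close>

lemma serre_pp_left:
  assumes c: "w \<in> carrier A" "w' \<in> carrier A" "x \<in> carrier A" "z \<in> carrier A" and w: "w \<otimes> w' = w' \<otimes> w"
  shows "AA.serre1 p t (pp w x) (pp w' z) = pp (w \<otimes> w \<otimes> w') (serre1 p t x z)"
    and "AA.serre2 p t (pp w x) (pp w' z) = pp (w \<otimes> w' \<otimes> w') (serre2 p t x z)"
    and "AA.serre1 p t (pp x w) (pp z w') = pp (serre1 p t x z) (w \<otimes> w \<otimes> w')"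
    and "AA.serre2 p t (pp x w) (pp z w') = pp (serre2 p t x z) (w \<otimes> w' \<otimes> w')"
proof -
  have 1: "w \<otimes> (w' \<otimes> w) = w \<otimes> (w \<otimes> w')" using w by simp
  have 2: "w' \<otimes> (w \<otimes> w) = w \<otimes> (w \<otimes> w')" using c w by (metis m_assoc)
  have 3: "w' \<otimes> (w \<otimes> w') = w \<otimes> (w' \<otimes> w')" using c w by (metis m_assoc)
  have 4: "w' \<otimes> (w' \<otimes> w) = w \<otimes> (w' \<otimes> w')" using c w by (metis m_assoc)
  note S = AA.serre1_def serre1_def AA.serre2_def serre2_def AA_simps(4)[symmetric]
    AA.ks_mult_left AA.ks_mult_right ks_mult_left pp_closed pp_mult m_assoc 1 2 3 4
    pp_add_right pp_add_left pp_minus pp_sc_right pp_sc_left AA.l_one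
  show "AA.serre1 p t (pp w x) (pp w' z) = pp (w \<otimes> w \<otimes> w') (serre1 p t x z)"
    and "AA.serre2 p t (pp w x) (pp w' z) = pp (w \<otimes> w' \<otimes> w') (serre2 p t x z)"
    and "AA.serre1 p t (pp x w) (pp z w') = pp (serre1 p t x z) (w \<otimes> w \<otimes> w')"
    and "AA.serre2 p t (pp x w) (pp z w') = pp (serre2 p t x z) (w \<otimes> w' \<otimes> w')"
    using c by (simp_all add: S)
qed

end

section \<open>Relations and comultiplication\<close>

locale urs_nz = urs +
  assumes r_nz: "r \<noteq> 0" and s_nz: "s \<noteq> 0"
begin

lemma gens_mem:
  "i \<in> {1..<n} \<Longrightarrow> Gen_e i \<in> gens n" "i \<in> {1..<n} \<Longrightarrow> Gen_f i \<in> gens n"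
  "i \<in> {1..n} \<Longrightarrow> Gen_a i \<in> gens n" "i \<in> {1..n} \<Longrightarrow> Gen_b i \<in> gens n"
  "i \<in> {1..n} \<Longrightarrow> Gen_ai i \<in> gens n" "i \<in> {1..n} \<Longrightarrow> Gen_bi i \<in> gens n"
  "g \<in> torus_gens n \<Longrightarrow> g \<in> gens n"
  "i \<in> {1..n} \<Longrightarrow> Gen_a i \<in> torus_gens n" "i \<in> {1..n} \<Longrightarrow> Gen_b i \<in> torus_gens n"
  "i \<in> {1..n} \<Longrightarrow> Gen_ai i \<in> torus_gens n" "i \<in> {1..n} \<Longrightarrow> Gen_bi i \<in> torus_gens n"
  by (auto simp: gens_def torus_gens_def)

lemma gens_iff:
  "Gen_e i \<in> gens n \<longleftrightarrow> i \<in> {1..<n}" "Gen_f i \<in> gens n \<longleftrightarrow> i \<in> {1..<n}"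
  "Gen_a i \<in> gens n \<longleftrightarrow> i \<in> {1..n}" "Gen_b i \<in> gens n \<longleftrightarrow> i \<in> {1..n}"
  "Gen_ai i \<in> gens n \<longleftrightarrow> i \<in> {1..n}" "Gen_bi i \<in> gens n \<longleftrightarrow> i \<in> {1..n}"
  by (auto simp: gens_def torus_gens_def)

text \<open>Evaluation wants an image in the carrier for every symbol, whereas \<open>u\<close> is
  meaningful only on \<open>gens n\<close>; all other symbols are sent to zero.\<close>

definition u0 :: "gen \<Rightarrow> 'a Urs_elem" where
  "u0 g = (if g \<in> gens n then u g else \<zero>\<^bsub>U\<^esub>)"

lemma u0_closed: "u0 g \<in> carrier U" by (simp add: u0_def)

lemma ev_cls:
  assumes "p \<in> carrier P"
  shows "U.ev u0 p = cls p"
proof -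
  have "p \<in> carrier P \<and> U.ev u0 p = cls p"
    using assms
  proof (induction p rule: free_algebra_induct)
    case (sc c)
    then show ?case by (simp add: U.ev_simps[of u0, OF u0_closed] cls_one cls_sc)
  next
    case (add x y)
    then show ?case
      by (simp add: U.ev_add[of u0, OF u0_closed] cls_add free_algebra_add)
  next
    case (var g x)
    then have "U.ev u0 (var g * x) = u g \<otimes>\<^bsub>U\<^esub> cls x"
      by (simp add: U.ev_var_mult[of u0, OF u0_closed]) (simp add: u0_def)
    with var show ?case by (simp add: cls_var cls_mult free_algebra_var free_algebra_mult)
  qed
  then show ?thesis by blast
qed

lemma relation:
  assumes "p \<in> relators n r s"
  shows "U.ev u0 p = \<zero>\<^bsub>U\<^esub>"
  using relator_zero[OF assms] ev_cls[OF relators_closed[OF assms]] by simp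

lemmas evU = U.ev_simps[of u0, OF u0_closed]

lemma u0_eq: "g \<in> gens n \<Longrightarrow> u0 g = u g"
  by (simp add: u0_def)

lemma u0_gens:
  "i \<in> {1..<n} \<Longrightarrow> u0 (Gen_e i) = u (Gen_e i)" "i \<in> {1..<n} \<Longrightarrow> u0 (Gen_f i) = u (Gen_f i)"
  "i \<in> {1..n} \<Longrightarrow> u0 (Gen_a i) = u (Gen_a i)" "i \<in> {1..n} \<Longrightarrow> u0 (Gen_b i) = u (Gen_b i)"
  "i \<in> {1..n} \<Longrightarrow> u0 (Gen_ai i) = u (Gen_ai i)" "i \<in> {1..n} \<Longrightarrow> u0 (Gen_bi i) = u (Gen_bi i)"
  by (rule u0_eq, simp only: gens_iff)+

lemma u_gens_closed:
  "i \<in> {1..<n} \<Longrightarrow> u (Gen_e i) \<in> carrier U" "i \<in> {1..<n} \<Longrightarrow> u (Gen_f i) \<in> carrier U"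
  "i \<in> {1..n} \<Longrightarrow> u (Gen_a i) \<in> carrier U" "i \<in> {1..n} \<Longrightarrow> u (Gen_b i) \<in> carrier U"
  "i \<in> {1..n} \<Longrightarrow> u (Gen_ai i) \<in> carrier U" "i \<in> {1..n} \<Longrightarrow> u (Gen_bi i) \<in> carrier U"
  by (rule u_closed, simp only: gens_iff)+

lemma relation_eq:
  assumes "p \<in> relators n r s" "U.ev u0 p = x \<ominus>\<^bsub>U\<^esub> y" "x \<in> carrier U" "y \<in> carrier U"
  shows "x = y"
  using relation[OF assms(1)] assms(2-4) U.r_right_minus_eq by simp

lemma torus_commute:
  assumes "g \<in> torus_gens n" "h \<in> torus_gens n"
  shows "u g \<otimes>\<^bsub>U\<^esub> u h = u h \<otimes>\<^bsub>U\<^esub> u g"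
  by (rule relation_eq[OF R1_comm[OF assms]]) (use assms in \<open>simp_all add: evU u0_eq gens_mem gens_iff\<close>)

lemma a_inverse: "i \<in> {1..n} \<Longrightarrow> u (Gen_a i) \<otimes>\<^bsub>U\<^esub> u (Gen_ai i) = \<one>\<^bsub>U\<^esub>"
  by (rule relation_eq[OF R1_a[where i = i]]) (simp_all only: evU u0_gens U.ks_mult_left u_gens_closed U.l_one U.one_closed U.ks_closed U.m_closed)

lemma b_inverse: "i \<in> {1..n} \<Longrightarrow> u (Gen_b i) \<otimes>\<^bsub>U\<^esub> u (Gen_bi i) = \<one>\<^bsub>U\<^esub>"
  by (rule relation_eq[OF R1_b[where i = i]]) (simp_all only: evU u0_gens U.ks_mult_left u_gens_closed U.l_one U.one_closed U.ks_closed U.m_closed)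

lemma a_e: "i \<in> {1..n} \<Longrightarrow> j \<in> {1..<n} \<Longrightarrow>
    u (Gen_a i) \<otimes>\<^bsub>U\<^esub> u (Gen_e j) = (r powi ip n (eps i) (alpha j)) \<odot>\<^bsub>U\<^esub> (u (Gen_e j) \<otimes>\<^bsub>U\<^esub> u (Gen_a i))"
  by (rule relation_eq[OF R2_e[where i = i and j = j]]) (simp_all only: evU u0_gens U.ks_mult_left u_gens_closed U.l_one U.one_closed U.ks_closed U.m_closed)

lemma a_f: "i \<in> {1..n} \<Longrightarrow> j \<in> {1..<n} \<Longrightarrow>
    u (Gen_a i) \<otimes>\<^bsub>U\<^esub> u (Gen_f j) = (r powi (- ip n (eps i) (alpha j))) \<odot>\<^bsub>U\<^esub> (u (Gen_f j) \<otimes>\<^bsub>U\<^esub> u (Gen_a i))"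
  by (rule relation_eq[OF R2_f[where i = i and j = j]]) (simp_all only: evU u0_gens U.ks_mult_left u_gens_closed U.l_one U.one_closed U.ks_closed U.m_closed)

lemma b_e: "i \<in> {1..n} \<Longrightarrow> j \<in> {1..<n} \<Longrightarrow>
    u (Gen_b i) \<otimes>\<^bsub>U\<^esub> u (Gen_e j) = (s powi ip n (eps i) (alpha j)) \<odot>\<^bsub>U\<^esub> (u (Gen_e j) \<otimes>\<^bsub>U\<^esub> u (Gen_b i))"
  by (rule relation_eq[OF R3_e[where i = i and j = j]]) (simp_all only: evU u0_gens U.ks_mult_left u_gens_closed U.l_one U.one_closed U.ks_closed U.m_closed)

lemma b_f: "i \<in> {1..n} \<Longrightarrow> j \<in> {1..<n} \<Longrightarrow>
    u (Gen_b i) \<otimes>\<^bsub>U\<^esub> u (Gen_f j) = (s powi (- ip n (eps i) (alpha j))) \<odot>\<^bsub>U\<^esub> (u (Gen_f j) \<otimes>\<^bsub>U\<^esub> u (Gen_b i))"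
  by (rule relation_eq[OF R3_f[where i = i and j = j]]) (simp_all only: evU u0_gens U.ks_mult_left u_gens_closed U.l_one U.one_closed U.ks_closed U.m_closed)

lemma e_f:
  assumes "i \<in> {1..<n}" "j \<in> {1..<n}"
  shows "u (Gen_e i) \<otimes>\<^bsub>U\<^esub> u (Gen_f j) \<ominus>\<^bsub>U\<^esub> u (Gen_f j) \<otimes>\<^bsub>U\<^esub> u (Gen_e i) =
    ((if i = j then 1 else 0) / (r - s)) \<odot>\<^bsub>U\<^esub> (omega n r s i \<ominus>\<^bsub>U\<^esub> omega' n r s i)"
proof -
  have "i \<in> {1..n}" "i + 1 \<in> {1..n}" using assms by auto
  note i = this
  show ?thesis
    unfolding omega_def omega'_def
    by (rule relation_eq[OF R4[OF assms]])
       (use assms i in \<open>simp_all only: evU u0_gens U.ks_mult_left u_gens_closed U.l_one U.one_closed U.ks_closed U.m_closed U.minus_closed\<close>)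
qed

lemma e_commute:
  assumes "i \<in> {1..<n}" "j \<in> {1..<n}" "\<bar>int i - int j\<bar> > 1"
  shows "u (Gen_e i) \<otimes>\<^bsub>U\<^esub> u (Gen_e j) = u (Gen_e j) \<otimes>\<^bsub>U\<^esub> u (Gen_e i)"
    and "u (Gen_f i) \<otimes>\<^bsub>U\<^esub> u (Gen_f j) = u (Gen_f j) \<otimes>\<^bsub>U\<^esub> u (Gen_f i)"
proof -
  show "u (Gen_e i) \<otimes>\<^bsub>U\<^esub> u (Gen_e j) = u (Gen_e j) \<otimes>\<^bsub>U\<^esub> u (Gen_e i)"
    by (rule relation_eq[OF R5_e[OF assms]])
      (use assms(1,2) in \<open>simp_all only: evU u0_gens u_gens_closed U.m_closed\<close>)
  show "u (Gen_f i) \<otimes>\<^bsub>U\<^esub> u (Gen_f j) = u (Gen_f j) \<otimes>\<^bsub>U\<^esub> u (Gen_f i)"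
    by (rule relation_eq[OF R5_f[OF assms]])
      (use assms(1,2) in \<open>simp_all only: evU u0_gens u_gens_closed U.m_closed\<close>)
qed

lemma serre_U:
  assumes "i \<in> {1..<n}" "i + 1 \<in> {1..<n}"
  shows "U.serre1 (r + s) (r * s) (u (Gen_e i)) (u (Gen_e (i + 1))) = \<zero>\<^bsub>U\<^esub>"
    and "U.serre2 (r + s) (r * s) (u (Gen_e i)) (u (Gen_e (i + 1))) = \<zero>\<^bsub>U\<^esub>"
    and "U.serre1 (inverse r + inverse s) (inverse r * inverse s) (u (Gen_f i)) (u (Gen_f (i + 1))) = \<zero>\<^bsub>U\<^esub>"
    and "U.serre2 (inverse r + inverse s) (inverse r * inverse s) (u (Gen_f i)) (u (Gen_f (i + 1))) = \<zero>\<^bsub>U\<^esub>"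
proof -
  have e: "u0 (Gen_e i) = u (Gen_e i)" "u0 (Gen_e (i + 1)) = u (Gen_e (i + 1))"
    "u0 (Gen_f i) = u (Gen_f i)" "u0 (Gen_f (i + 1)) = u (Gen_f (i + 1))"
    by (rule u0_eq, rule gens_mem, rule assms)+
  show "U.serre1 (r + s) (r * s) (u (Gen_e i)) (u (Gen_e (i + 1))) = \<zero>\<^bsub>U\<^esub>"
    using relation[OF R6_1[OF assms]] by (simp only: power2_eq_square evU e U.serre1_def)
  show "U.serre2 (r + s) (r * s) (u (Gen_e i)) (u (Gen_e (i + 1))) = \<zero>\<^bsub>U\<^esub>"
    using relation[OF R6_2[OF assms]] by (simp only: power2_eq_square evU e U.serre2_def)
  show "U.serre1 (inverse r + inverse s) (inverse r * inverse s) (u (Gen_f i)) (u (Gen_f (i + 1))) = \<zero>\<^bsub>U\<^esub>"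
    using relation[OF R7_1[OF assms]] by (simp only: power2_eq_square evU e U.serre1_def)
  show "U.serre2 (inverse r + inverse s) (inverse r * inverse s) (u (Gen_f i)) (u (Gen_f (i + 1))) = \<zero>\<^bsub>U\<^esub>"
    using relation[OF R7_2[OF assms]] by (simp only: power2_eq_square evU e U.serre2_def)
qed

definition cw :: "nat \<Rightarrow> nat \<Rightarrow> 'a" where
  "cw i j = r powi ip n (eps i) (alpha j) * s powi ip n (eps (i + 1)) (alpha j)"
definition cw' :: "nat \<Rightarrow> nat \<Rightarrow> 'a" where
  "cw' i j = r powi ip n (eps (i + 1)) (alpha j) * s powi ip n (eps i) (alpha j)"

abbreviation "om \<equiv> omega n r s"
abbreviation "om' \<equiv> omega' n r s"

lemma omega_gens:
  assumes "i \<in> {1..<n}"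
  shows "Gen_a i \<in> torus_gens n" "Gen_b (i + 1) \<in> torus_gens n" "Gen_a (i + 1) \<in> torus_gens n" "Gen_b i \<in> torus_gens n"
    and "i \<in> {1..n}" "i + 1 \<in> {1..n}"
  using assms by (auto simp: torus_gens_def)

lemma omega_closed [simp]: "i \<in> {1..<n} \<Longrightarrow> om i \<in> carrier U" "i \<in> {1..<n} \<Longrightarrow> om' i \<in> carrier U"
  unfolding omega_def omega'_def using omega_gens[of i] gens_mem(7) u_closed U.m_closed by blast+

lemma omega_e_f:
  assumes "i \<in> {1..<n}" "j \<in> {1..<n}"
  shows "om i \<otimes>\<^bsub>U\<^esub> u (Gen_e j) = cw i j \<odot>\<^bsub>U\<^esub> (u (Gen_e j) \<otimes>\<^bsub>U\<^esub> om i)"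
    and "om i \<otimes>\<^bsub>U\<^esub> u (Gen_f j) = inverse (cw i j) \<odot>\<^bsub>U\<^esub> (u (Gen_f j) \<otimes>\<^bsub>U\<^esub> om i)"
    and "om' i \<otimes>\<^bsub>U\<^esub> u (Gen_e j) = cw' i j \<odot>\<^bsub>U\<^esub> (u (Gen_e j) \<otimes>\<^bsub>U\<^esub> om' i)"
    and "om' i \<otimes>\<^bsub>U\<^esub> u (Gen_f j) = inverse (cw' i j) \<odot>\<^bsub>U\<^esub> (u (Gen_f j) \<otimes>\<^bsub>U\<^esub> om' i)"
proof -
  note g = omega_gens[OF assms(1)] and m = gens_mem(1,2)[OF assms(2)]
  have c: "u (Gen_a i) \<in> carrier U" "u (Gen_b (i + 1)) \<in> carrier U" "u (Gen_a (i + 1)) \<in> carrier U" "u (Gen_b i) \<in> carrier U"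
    "u (Gen_e j) \<in> carrier U" "u (Gen_f j) \<in> carrier U"
    using g m by (blast intro: u_closed gens_mem(7))+
  have inv: "inverse (cw i j) = r powi (- ip n (eps i) (alpha j)) * s powi (- ip n (eps (i + 1)) (alpha j))"
    "inverse (cw' i j) = r powi (- ip n (eps (i + 1)) (alpha j)) * s powi (- ip n (eps i) (alpha j))"
    by (simp_all add: cw_def cw'_def power_int_minus)
  show "om i \<otimes>\<^bsub>U\<^esub> u (Gen_e j) = cw i j \<odot>\<^bsub>U\<^esub> (u (Gen_e j) \<otimes>\<^bsub>U\<^esub> om i)"
    unfolding omega_def cw_def by (rule U.q_commute_mult[OF c(1,2,5) a_e[OF g(5) assms(2)] b_e[OF g(6) assms(2)]])
  show "om i \<otimes>\<^bsub>U\<^esub> u (Gen_f j) = inverse (cw i j) \<odot>\<^bsub>U\<^esub> (u (Gen_f j) \<otimes>\<^bsub>U\<^esub> om i)"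
    unfolding omega_def inv by (rule U.q_commute_mult[OF c(1,2,6) a_f[OF g(5) assms(2)] b_f[OF g(6) assms(2)]])
  show "om' i \<otimes>\<^bsub>U\<^esub> u (Gen_e j) = cw' i j \<odot>\<^bsub>U\<^esub> (u (Gen_e j) \<otimes>\<^bsub>U\<^esub> om' i)"
    unfolding omega'_def cw'_def by (rule U.q_commute_mult[OF c(3,4,5) a_e[OF g(6) assms(2)] b_e[OF g(5) assms(2)]])
  show "om' i \<otimes>\<^bsub>U\<^esub> u (Gen_f j) = inverse (cw' i j) \<odot>\<^bsub>U\<^esub> (u (Gen_f j) \<otimes>\<^bsub>U\<^esub> om' i)"
    unfolding omega'_def inv by (rule U.q_commute_mult[OF c(3,4,6) a_f[OF g(6) assms(2)] b_f[OF g(5) assms(2)]])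
qed

lemma torus_omega:
  assumes "i \<in> {1..<n}" "g \<in> torus_gens n"
  shows "u g \<otimes>\<^bsub>U\<^esub> om i = om i \<otimes>\<^bsub>U\<^esub> u g" "u g \<otimes>\<^bsub>U\<^esub> om' i = om' i \<otimes>\<^bsub>U\<^esub> u g"
proof -
  note g = omega_gens[OF assms(1)]
  have c: "x \<in> torus_gens n \<Longrightarrow> u x \<in> carrier U" for x by (intro u_closed gens_mem(7))
  show "u g \<otimes>\<^bsub>U\<^esub> om i = om i \<otimes>\<^bsub>U\<^esub> u g"
    unfolding omega_def
    by (rule U.commute_mult[OF c[OF assms(2)] c[OF g(1)] c[OF g(2)] torus_commute[OF assms(2) g(1)] torus_commute[OF assms(2) g(2)]])
  show "u g \<otimes>\<^bsub>U\<^esub> om' i = om' i \<otimes>\<^bsub>U\<^esub> u g"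
    unfolding omega'_def
    by (rule U.commute_mult[OF c[OF assms(2)] c[OF g(3)] c[OF g(4)] torus_commute[OF assms(2) g(3)] torus_commute[OF assms(2) g(4)]])
qed

lemma omega_omega:
  assumes "i \<in> {1..<n}" "j \<in> {1..<n}"
  shows "om i \<otimes>\<^bsub>U\<^esub> om j = om j \<otimes>\<^bsub>U\<^esub> om i" "om' i \<otimes>\<^bsub>U\<^esub> om' j = om' j \<otimes>\<^bsub>U\<^esub> om' i"
proof -
  note g = omega_gens[OF assms(1)]
  have c: "x \<in> torus_gens n \<Longrightarrow> u x \<in> carrier U" for x by (intro u_closed gens_mem(7))
  show "om i \<otimes>\<^bsub>U\<^esub> om j = om j \<otimes>\<^bsub>U\<^esub> om i"
    unfolding omega_def[of n r s i]
    by (rule U.commute_mult[OF omega_closed(1)[OF assms(2)] c[OF g(1)] c[OF g(2)]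
       torus_omega(1)[OF assms(2) g(1), symmetric] torus_omega(1)[OF assms(2) g(2), symmetric], symmetric])
  show "om' i \<otimes>\<^bsub>U\<^esub> om' j = om' j \<otimes>\<^bsub>U\<^esub> om' i"
    unfolding omega'_def[of n r s i]
    by (rule U.commute_mult[OF omega_closed(2)[OF assms(2)] c[OF g(3)] c[OF g(4)]
       torus_omega(2)[OF assms(2) g(3), symmetric] torus_omega(2)[OF assms(2) g(4), symmetric], symmetric])
qed

lemma cw_values:
  assumes "i \<in> {1..<n}" "i + 1 \<in> {1..<n}"
  shows "cw i i = r / s" "cw (i + 1) (i + 1) = r / s" "cw i (i + 1) = s" "cw (i + 1) i = 1 / r"
    and "cw' i i = s / r" "cw' (i + 1) (i + 1) = s / r" "cw' i (i + 1) = r" "cw' (i + 1) i = 1 / s"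
proof -
  have "i \<in> {1..n}" "i + 1 \<in> {1..n}" "i + 1 + 1 \<in> {1..n}" using assms by auto
  note ip = this[THEN ip_eps_alpha]
  show "cw i i = r / s" "cw (i + 1) (i + 1) = r / s" "cw i (i + 1) = s" "cw (i + 1) i = 1 / r"
    and "cw' i i = s / r" "cw' (i + 1) (i + 1) = s / r" "cw' i (i + 1) = r" "cw' (i + 1) i = 1 / s"
    unfolding cw_def cw'_def ip by (simp_all add: power_int_minus divide_inverse)
qed

lemma cw_far:
  assumes "i \<in> {1..<n}" "j \<in> {1..<n}" "\<bar>int i - int j\<bar> > 1"
  shows "cw i j = 1" "cw' i j = 1"
proof -
  have "i \<in> {1..n}" "i + 1 \<in> {1..n}" using assms by auto
  note ip = this[THEN ip_eps_alpha]
  show "cw i j = 1" "cw' i j = 1"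
    unfolding cw_def cw'_def ip using assms(3) by auto
qed

text \<open>omega_i passes f_j with the same scalar as omega_j' passes e_i. This duality of the two
  torus families is what the commutator of coproducts rests on.\<close>

lemma cw_dual:
  assumes "i \<in> {1..<n}" "j \<in> {1..<n}"
  shows "inverse (cw i j) = cw' j i"
proof -
  have "i \<in> {1..n}" "i + 1 \<in> {1..n}" "j \<in> {1..n}" "j + 1 \<in> {1..n}" using assms by auto
  note ip = this[THEN ip_eps_alpha]
  show ?thesis
    unfolding cw_def cw'_def ip using r_nz s_nz by (auto simp: power_int_minus)
qed

end

lemma (in abelian_group) commutator_rearrange:
  assumes c: "a \<in> carrier G" "b \<in> carrier G" "c \<in> carrier G" "d \<in> carrier G" "b' \<in> carrier G" "c' \<in> carrier G"
  shows "((a \<oplus> b) \<oplus> (c \<oplus> d)) \<ominus> ((a \<oplus> c') \<oplus> (b' \<oplus> d)) = (b \<ominus> b') \<oplus> (c \<ominus> c')"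
proof -
  define x where "x = b \<ominus> b'"
  define y where "y = c \<ominus> c'"
  have xy: "x \<in> carrier G" "y \<in> carrier G" using c by (simp_all add: x_def y_def)
  have b: "b = x \<oplus> b'" and cc: "c = y \<oplus> c'"
    using c by (simp_all add: x_def y_def minus_eq a_assoc l_neg)
  have "(a \<oplus> b) \<oplus> (c \<oplus> d) = (x \<oplus> y) \<oplus> ((a \<oplus> c') \<oplus> (b' \<oplus> d))"
    unfolding b cc using c xy by (simp add: a_ac)
  then have "((a \<oplus> b) \<oplus> (c \<oplus> d)) \<ominus> ((a \<oplus> c') \<oplus> (b' \<oplus> d)) = x \<oplus> y"
    using c xy by (simp add: minus_eq a_assoc r_neg del: add.right_cancel)
  then show ?thesis by (simp add: x_def y_def)
qed

section \<open>Coproducts of raising and lowering elements in a tensor square\<close>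

context tensor_square
begin

abbreviation "De w e \<equiv> pp e \<one> \<oplus>\<^bsub>AA\<^esub> pp w e"
abbreviation "Df w f \<equiv> pp \<one> f \<oplus>\<^bsub>AA\<^esub> pp f w"

lemmas D_simps = AA.l_distr AA.r_distr pp_closed pp_mult AA.a_closed AA.m_closed

lemma q_commute_De:
  assumes "t \<in> carrier A" "e \<in> carrier A" "w \<in> carrier A" "t \<otimes> e = c \<odot> (e \<otimes> t)" "t \<otimes> w = w \<otimes> t"
  shows "pp t t \<otimes>\<^bsub>AA\<^esub> De w e = c \<odot>\<^bsub>AA\<^esub> (De w e \<otimes>\<^bsub>AA\<^esub> pp t t)"
  using assms(1-3) by (simp add: D_simps assms(4,5) pp_sc_left pp_sc_right AA.ks_r_distr)

lemma q_commute_Df: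
  assumes "t \<in> carrier A" "e \<in> carrier A" "w \<in> carrier A" "t \<otimes> e = c \<odot> (e \<otimes> t)" "t \<otimes> w = w \<otimes> t"
  shows "pp t t \<otimes>\<^bsub>AA\<^esub> Df w e = c \<odot>\<^bsub>AA\<^esub> (Df w e \<otimes>\<^bsub>AA\<^esub> pp t t)"
  using assms(1-3) by (simp add: D_simps assms(4,5) pp_sc_left pp_sc_right AA.ks_r_distr)

text \<open>The cross terms w f (x) e w' and f w (x) w' e coincide because both exchanges produce
  the same scalar \<open>k\<close>. What is left is the commutator in one slot next to
  \<open>w'\<close> or \<open>w\<close> in the other.\<close>

lemma De_Df_commutator:
  assumes c: "e \<in> carrier A" "f \<in> carrier A" "w \<in> carrier A" "w' \<in> carrier A"
    and q: "w \<otimes> f = k \<odot> (f \<otimes> w)" "w' \<otimes> e = k \<odot> (e \<otimes> w')"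
  shows "De w e \<otimes>\<^bsub>AA\<^esub> Df w' f \<ominus>\<^bsub>AA\<^esub> Df w' f \<otimes>\<^bsub>AA\<^esub> De w e =
    pp (e \<otimes> f \<ominus> f \<otimes> e) w' \<oplus>\<^bsub>AA\<^esub> pp w (e \<otimes> f \<ominus> f \<otimes> e)"
proof -
  have 1: "De w e \<otimes>\<^bsub>AA\<^esub> Df w' f =
      (pp e f \<oplus>\<^bsub>AA\<^esub> pp (e \<otimes> f) w') \<oplus>\<^bsub>AA\<^esub> (pp w (e \<otimes> f) \<oplus>\<^bsub>AA\<^esub> pp (w \<otimes> f) (e \<otimes> w'))"
    using c by (simp add: D_simps AA.a_ac)
  have 2: "Df w' f \<otimes>\<^bsub>AA\<^esub> De w e =
      (pp e f \<oplus>\<^bsub>AA\<^esub> pp w (f \<otimes> e)) \<oplus>\<^bsub>AA\<^esub> (pp (f \<otimes> e) w' \<oplus>\<^bsub>AA\<^esub> pp (f \<otimes> w) (w' \<otimes> e))"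
    using c by (simp add: D_simps AA.a_ac)
  have 3: "pp (f \<otimes> w) (w' \<otimes> e) = pp (w \<otimes> f) (e \<otimes> w')"
    using c by (simp add: q pp_sc_left pp_sc_right)
  show ?thesis
    unfolding 1 2 3 using c by (subst AA.commutator_rearrange) (simp_all add: pp_closed pp_minus)
qed

lemma De_commute:
  assumes c: "e \<in> carrier A" "f \<in> carrier A" "w \<in> carrier A" "w' \<in> carrier A"
    and q: "w \<otimes> f = f \<otimes> w" "w' \<otimes> e = e \<otimes> w'" "e \<otimes> f = f \<otimes> e" "w \<otimes> w' = w' \<otimes> w"
  shows "De w e \<otimes>\<^bsub>AA\<^esub> De w' f = De w' f \<otimes>\<^bsub>AA\<^esub> De w e"
    and "Df w e \<otimes>\<^bsub>AA\<^esub> Df w' f = Df w' f \<otimes>\<^bsub>AA\<^esub> Df w e"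
  using c by (simp_all add: D_simps AA.a_ac q)

text \<open>Each coproduct is a sum of two elements that q-commute as \<open>serre_sum\<close>
  demands, and the pure parts reduce to the Serre relation in one slot. For \<open>Df\<close> the
  same scalars occur with the two slots exchanged.\<close>

lemma De_serre:
  assumes c: "e \<in> carrier A" "f \<in> carrier A" "w \<in> carrier A" "w' \<in> carrier A" and nz: "\<rho> \<noteq> 0" "\<sigma> \<noteq> 0"
    and q: "w \<otimes> e = (\<rho> / \<sigma>) \<odot> (e \<otimes> w)" "w \<otimes> f = \<sigma> \<odot> (f \<otimes> w)"
      "w' \<otimes> e = (1 / \<rho>) \<odot> (e \<otimes> w')" "w' \<otimes> f = (\<rho> / \<sigma>) \<odot> (f \<otimes> w')" "w \<otimes> w' = w' \<otimes> w"
  shows "serre1 (\<rho> + \<sigma>) (\<rho> * \<sigma>) e f = \<zero> \<Longrightarrow> AA.serre1 (\<rho> + \<sigma>) (\<rho> * \<sigma>) (De w e) (De w' f) = \<zero>\<^bsub>AA\<^esub>"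
    and "serre2 (\<rho> + \<sigma>) (\<rho> * \<sigma>) e f = \<zero> \<Longrightarrow> AA.serre2 (\<rho> + \<sigma>) (\<rho> * \<sigma>) (De w e) (De w' f) = \<zero>\<^bsub>AA\<^esub>"
    and "serre1 (\<rho> + \<sigma>) (\<rho> * \<sigma>) e f = \<zero> \<Longrightarrow> AA.serre1 (\<rho> + \<sigma>) (\<rho> * \<sigma>) (Df w e) (Df w' f) = \<zero>\<^bsub>AA\<^esub>"
    and "serre2 (\<rho> + \<sigma>) (\<rho> * \<sigma>) e f = \<zero> \<Longrightarrow> AA.serre2 (\<rho> + \<sigma>) (\<rho> * \<sigma>) (Df w e) (Df w' f) = \<zero>\<^bsub>AA\<^esub>"
proof -
  note cl = pp_closed[OF c(1) one_closed] pp_closed[OF c(3,1)] pp_closed[OF c(2) one_closed] pp_closed[OF c(4,2)]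
    pp_closed[OF one_closed c(1)] pp_closed[OF c(1,3)] pp_closed[OF one_closed c(2)] pp_closed[OF c(2,4)]
  have qe: "pp w e \<otimes>\<^bsub>AA\<^esub> pp e \<one> = (\<rho> / \<sigma>) \<odot>\<^bsub>AA\<^esub> (pp e \<one> \<otimes>\<^bsub>AA\<^esub> pp w e)"
    "pp w e \<otimes>\<^bsub>AA\<^esub> pp f \<one> = \<sigma> \<odot>\<^bsub>AA\<^esub> (pp f \<one> \<otimes>\<^bsub>AA\<^esub> pp w e)"
    "pp w' f \<otimes>\<^bsub>AA\<^esub> pp e \<one> = (1 / \<rho>) \<odot>\<^bsub>AA\<^esub> (pp e \<one> \<otimes>\<^bsub>AA\<^esub> pp w' f)"
    "pp w' f \<otimes>\<^bsub>AA\<^esub> pp f \<one> = (\<rho> / \<sigma>) \<odot>\<^bsub>AA\<^esub> (pp f \<one> \<otimes>\<^bsub>AA\<^esub> pp w' f)"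
    using c by (simp_all add: pp_mult q pp_sc_left)
  have qf: "pp e w \<otimes>\<^bsub>AA\<^esub> pp \<one> e = (\<rho> / \<sigma>) \<odot>\<^bsub>AA\<^esub> (pp \<one> e \<otimes>\<^bsub>AA\<^esub> pp e w)"
    "pp e w \<otimes>\<^bsub>AA\<^esub> pp \<one> f = \<sigma> \<odot>\<^bsub>AA\<^esub> (pp \<one> f \<otimes>\<^bsub>AA\<^esub> pp e w)"
    "pp f w' \<otimes>\<^bsub>AA\<^esub> pp \<one> e = (1 / \<rho>) \<odot>\<^bsub>AA\<^esub> (pp \<one> e \<otimes>\<^bsub>AA\<^esub> pp f w')"
    "pp f w' \<otimes>\<^bsub>AA\<^esub> pp \<one> f = (\<rho> / \<sigma>) \<odot>\<^bsub>AA\<^esub> (pp \<one> f \<otimes>\<^bsub>AA\<^esub> pp f w')"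
    using c by (simp_all add: pp_mult q pp_sc_right)
  have o: "\<one> \<otimes> \<one> = \<one> \<otimes> \<one>" by simp
  show "AA.serre1 (\<rho> + \<sigma>) (\<rho> * \<sigma>) (De w e) (De w' f) = \<zero>\<^bsub>AA\<^esub>" if "serre1 (\<rho> + \<sigma>) (\<rho> * \<sigma>) e f = \<zero>"
    by (rule AA.serre_sum(1)[OF nz cl(1-4) qe])
       (simp_all only: serre_pp_left(3)[OF one_closed one_closed c(1,2) o] serre_pp_left(1)[OF c(3,4,1,2) q(5)] that pp_zero c
          m_closed one_closed)
  show "AA.serre2 (\<rho> + \<sigma>) (\<rho> * \<sigma>) (De w e) (De w' f) = \<zero>\<^bsub>AA\<^esub>" if "serre2 (\<rho> + \<sigma>) (\<rho> * \<sigma>) e f = \<zero>"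
    by (rule AA.serre_sum(2)[OF nz cl(1-4) qe])
       (simp_all only: serre_pp_left(4)[OF one_closed one_closed c(1,2) o] serre_pp_left(2)[OF c(3,4,1,2) q(5)] that pp_zero c
          m_closed one_closed)
  show "AA.serre1 (\<rho> + \<sigma>) (\<rho> * \<sigma>) (Df w e) (Df w' f) = \<zero>\<^bsub>AA\<^esub>" if "serre1 (\<rho> + \<sigma>) (\<rho> * \<sigma>) e f = \<zero>"
    by (rule AA.serre_sum(1)[OF nz cl(5-8) qf])
       (simp_all only: serre_pp_left(1)[OF one_closed one_closed c(1,2) o] serre_pp_left(3)[OF c(3,4,1,2) q(5)] that pp_zero c
          m_closed one_closed)
  show "AA.serre2 (\<rho> + \<sigma>) (\<rho> * \<sigma>) (Df w e) (Df w' f) = \<zero>\<^bsub>AA\<^esub>" if "serre2 (\<rho> + \<sigma>) (\<rho> * \<sigma>) e f = \<zero>"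
    by (rule AA.serre_sum(2)[OF nz cl(5-8) qf])
       (simp_all only: serre_pp_left(2)[OF one_closed one_closed c(1,2) o] serre_pp_left(4)[OF c(3,4,1,2) q(5)] that pp_zero c
          m_closed one_closed)
qed

end

section \<open>Existence and uniqueness of the comultiplication\<close>

context urs_nz
begin

sublocale UU: tensor_square U ..

abbreviation "B \<equiv> tensor_algebra U U"
abbreviation "pp \<equiv> pure_tensor class_ring U U"

text \<open>The intended images of the generators under the comultiplication, extended by zero to
  the other symbols as the universal property requires.\<close>

definition bD :: "gen \<Rightarrow> ('a Urs_elem \<times> 'a Urs_elem \<Rightarrow>\<^sub>0 int) set" where
  "bD g = (if g \<in> gens n then (case g of Gen_e i \<Rightarrow> UU.De (om i) (u (Gen_e i)) | Gen_f i \<Rightarrow> UU.Df (om' i) (u (Gen_f i))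
     | _ \<Rightarrow> pp (u g) (u g)) else \<zero>\<^bsub>B\<^esub>)"

lemma bD_torus: "g \<in> torus_gens n \<Longrightarrow> bD g = pp (u g) (u g)"
  using gens_mem(7)[of g] by (auto simp: bD_def torus_gens_def)

lemma bD_e: "i \<in> {1..<n} \<Longrightarrow> bD (Gen_e i) = UU.De (om i) (u (Gen_e i))"
  and bD_f: "i \<in> {1..<n} \<Longrightarrow> bD (Gen_f i) = UU.Df (om' i) (u (Gen_f i))"
  by (simp_all add: bD_def gens_iff)

lemma bD_ab: "i \<in> {1..n} \<Longrightarrow> bD (Gen_a i) = pp (u (Gen_a i)) (u (Gen_a i))"
  "i \<in> {1..n} \<Longrightarrow> bD (Gen_b i) = pp (u (Gen_b i)) (u (Gen_b i))"
  "i \<in> {1..n} \<Longrightarrow> bD (Gen_ai i) = pp (u (Gen_ai i)) (u (Gen_ai i))"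
  "i \<in> {1..n} \<Longrightarrow> bD (Gen_bi i) = pp (u (Gen_bi i)) (u (Gen_bi i))"
  by (rule bD_torus, simp add: torus_gens_def)+

lemma bD_closed: "bD g \<in> carrier B"
proof (cases "g \<in> gens n")
  case True
  then show ?thesis
    by (cases g) (simp_all add: bD_def UU.pp_closed gens_iff u_gens_closed)
qed (simp add: bD_def)

lemmas evB = UU.AA.ev_simps[of bD, OF bD_closed]

lemma B_minus_eq: "x = y \<Longrightarrow> x \<in> carrier B \<Longrightarrow> x \<ominus>\<^bsub>B\<^esub> y = \<zero>\<^bsub>B\<^esub>"
  using UU.AA.r_right_minus_eq by blast

lemma bD_q_commute:
  assumes "g \<in> torus_gens n" "j \<in> {1..<n}"
  shows "u g \<otimes>\<^bsub>U\<^esub> u (Gen_e j) = c \<odot>\<^bsub>U\<^esub> (u (Gen_e j) \<otimes>\<^bsub>U\<^esub> u g) \<Longrightarrow>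
      bD g \<otimes>\<^bsub>B\<^esub> bD (Gen_e j) \<ominus>\<^bsub>B\<^esub> (c \<odot>\<^bsub>B\<^esub> \<one>\<^bsub>B\<^esub>) \<otimes>\<^bsub>B\<^esub> bD (Gen_e j) \<otimes>\<^bsub>B\<^esub> bD g = \<zero>\<^bsub>B\<^esub>"
    and "u g \<otimes>\<^bsub>U\<^esub> u (Gen_f j) = c \<odot>\<^bsub>U\<^esub> (u (Gen_f j) \<otimes>\<^bsub>U\<^esub> u g) \<Longrightarrow>
      bD g \<otimes>\<^bsub>B\<^esub> bD (Gen_f j) \<ominus>\<^bsub>B\<^esub> (c \<odot>\<^bsub>B\<^esub> \<one>\<^bsub>B\<^esub>) \<otimes>\<^bsub>B\<^esub> bD (Gen_f j) \<otimes>\<^bsub>B\<^esub> bD g = \<zero>\<^bsub>B\<^esub>"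
proof -
  have g: "u g \<in> carrier U" using assms(1) by (intro u_closed gens_mem(7))
  have sc: "(c \<odot>\<^bsub>B\<^esub> \<one>\<^bsub>B\<^esub>) \<otimes>\<^bsub>B\<^esub> bD h \<otimes>\<^bsub>B\<^esub> bD g = c \<odot>\<^bsub>B\<^esub> (bD h \<otimes>\<^bsub>B\<^esub> bD g)" for h
    using bD_closed by (simp add: UU.AA.ks_mult_left)
  show "bD g \<otimes>\<^bsub>B\<^esub> bD (Gen_e j) \<ominus>\<^bsub>B\<^esub> (c \<odot>\<^bsub>B\<^esub> \<one>\<^bsub>B\<^esub>) \<otimes>\<^bsub>B\<^esub> bD (Gen_e j) \<otimes>\<^bsub>B\<^esub> bD g = \<zero>\<^bsub>B\<^esub>"
    if "u g \<otimes>\<^bsub>U\<^esub> u (Gen_e j) = c \<odot>\<^bsub>U\<^esub> (u (Gen_e j) \<otimes>\<^bsub>U\<^esub> u g)"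
    unfolding sc
  proof (rule B_minus_eq)
    show "bD g \<otimes>\<^bsub>B\<^esub> bD (Gen_e j) = c \<odot>\<^bsub>B\<^esub> (bD (Gen_e j) \<otimes>\<^bsub>B\<^esub> bD g)"
      unfolding bD_torus[OF assms(1)] bD_e[OF assms(2)]
      by (rule UU.q_commute_De[OF g u_gens_closed(1)[OF assms(2)] omega_closed(1)[OF assms(2)] that torus_omega(1)[OF assms(2,1)]])
  qed (simp add: bD_closed)
  show "bD g \<otimes>\<^bsub>B\<^esub> bD (Gen_f j) \<ominus>\<^bsub>B\<^esub> (c \<odot>\<^bsub>B\<^esub> \<one>\<^bsub>B\<^esub>) \<otimes>\<^bsub>B\<^esub> bD (Gen_f j) \<otimes>\<^bsub>B\<^esub> bD g = \<zero>\<^bsub>B\<^esub>"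
    if "u g \<otimes>\<^bsub>U\<^esub> u (Gen_f j) = c \<odot>\<^bsub>U\<^esub> (u (Gen_f j) \<otimes>\<^bsub>U\<^esub> u g)"
    unfolding sc
  proof (rule B_minus_eq)
    show "bD g \<otimes>\<^bsub>B\<^esub> bD (Gen_f j) = c \<odot>\<^bsub>B\<^esub> (bD (Gen_f j) \<otimes>\<^bsub>B\<^esub> bD g)"
      unfolding bD_torus[OF assms(1)] bD_f[OF assms(2)]
      by (rule UU.q_commute_Df[OF g u_gens_closed(2)[OF assms(2)] omega_closed(2)[OF assms(2)] that torus_omega(2)[OF assms(2,1)]])
  qed (simp add: bD_closed)
qed

lemma bD_commutator:
  assumes i: "i \<in> {1..<n}" and j: "j \<in> {1..<n}"
  shows "bD (Gen_e i) \<otimes>\<^bsub>B\<^esub> bD (Gen_f j) \<ominus>\<^bsub>B\<^esub> bD (Gen_f j) \<otimes>\<^bsub>B\<^esub> bD (Gen_e i) =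
    ((if i = j then 1 else 0) / (r - s)) \<odot>\<^bsub>B\<^esub> (bD (Gen_a i) \<otimes>\<^bsub>B\<^esub> bD (Gen_b (i + 1)) \<ominus>\<^bsub>B\<^esub> bD (Gen_a (i + 1)) \<otimes>\<^bsub>B\<^esub> bD (Gen_b i))"
proof -
  let ?k = "(if i = j then 1 else 0) / (r - s)"
  have ii: "i \<in> {1..n}" "i + 1 \<in> {1..n}" using i by auto
  note c = u_gens_closed(1)[OF i] u_gens_closed(2)[OF j] omega_closed(1)[OF i] omega_closed(2)[OF j] omega_closed(2)[OF i]
  have q: "om i \<otimes>\<^bsub>U\<^esub> u (Gen_f j) = cw' j i \<odot>\<^bsub>U\<^esub> (u (Gen_f j) \<otimes>\<^bsub>U\<^esub> om i)"
    using omega_e_f(2)[OF i j] cw_dual[OF i j] by simp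
  have "bD (Gen_e i) \<otimes>\<^bsub>B\<^esub> bD (Gen_f j) \<ominus>\<^bsub>B\<^esub> bD (Gen_f j) \<otimes>\<^bsub>B\<^esub> bD (Gen_e i) =
      pp (?k \<odot>\<^bsub>U\<^esub> (om i \<ominus>\<^bsub>U\<^esub> om' i)) (om' j) \<oplus>\<^bsub>B\<^esub> pp (om i) (?k \<odot>\<^bsub>U\<^esub> (om i \<ominus>\<^bsub>U\<^esub> om' i))"
    unfolding bD_e[OF i] bD_f[OF j] UU.De_Df_commutator[OF c(1-4) q omega_e_f(3)[OF j i]] e_f[OF i j] ..
  also have "\<dots> = ?k \<odot>\<^bsub>B\<^esub> ((pp (om i) (om' j) \<ominus>\<^bsub>B\<^esub> pp (om' i) (om' j)) \<oplus>\<^bsub>B\<^esub> (pp (om i) (om i) \<ominus>\<^bsub>B\<^esub> pp (om i) (om' i)))"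
    using c by (simp only: UU.pp_sc_left UU.pp_sc_right UU.pp_minus UU.AA.ks_r_distr UU.pp_closed U.minus_closed UU.AA.minus_closed)
  also have "\<dots> = ?k \<odot>\<^bsub>B\<^esub> (pp (om i) (om i) \<ominus>\<^bsub>B\<^esub> pp (om' i) (om' i))"
  \<comment> \<open>For \<open>i = j\<close> the mixed tensor omega_i (x) omega_i' occurs with both
    signs and cancels; otherwise the scalar in front is zero.\<close>
  proof (cases "i = j")
    case True
    define x y z where "x = pp (om j) (om' j)" "y = pp (om' j) (om' j)" "z = pp (om j) (om j)"
    have xyz: "x \<in> carrier B" "y \<in> carrier B" "z \<in> carrier B"
      unfolding x_y_z_def using c True by (simp_all add: UU.pp_closed)
    have "(x \<ominus>\<^bsub>B\<^esub> y) \<oplus>\<^bsub>B\<^esub> (z \<ominus>\<^bsub>B\<^esub> x) = z \<ominus>\<^bsub>B\<^esub> y"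
    proof -
      have "(x \<ominus>\<^bsub>B\<^esub> y) \<oplus>\<^bsub>B\<^esub> (z \<ominus>\<^bsub>B\<^esub> x) = (z \<ominus>\<^bsub>B\<^esub> y) \<oplus>\<^bsub>B\<^esub> (x \<oplus>\<^bsub>B\<^esub> (\<ominus>\<^bsub>B\<^esub> x))"
        using xyz by (simp only: UU.AA.minus_eq UU.AA.a_ac UU.AA.a_inv_closed UU.AA.a_closed)
      then show ?thesis using xyz by (simp add: UU.AA.r_neg)
    qed
    then show ?thesis unfolding x_y_z_def True by simp
  next
    case False
    then show ?thesis using c by (simp add: UU.pp_closed)
  qed
  also have "pp (om i) (om i) = bD (Gen_a i) \<otimes>\<^bsub>B\<^esub> bD (Gen_b (i + 1))"
    using ii by (simp only: bD_ab UU.pp_mult u_gens_closed omega_def)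
  also have "pp (om' i) (om' i) = bD (Gen_a (i + 1)) \<otimes>\<^bsub>B\<^esub> bD (Gen_b i)"
    using ii by (simp only: bD_ab UU.pp_mult u_gens_closed omega'_def)
  finally show ?thesis .
qed

lemma bD_serre:
  assumes i: "i \<in> {1..<n}" and j: "i + 1 \<in> {1..<n}"
  shows "UU.AA.serre1 (r + s) (r * s) (bD (Gen_e i)) (bD (Gen_e (i + 1))) = \<zero>\<^bsub>B\<^esub>"
    and "UU.AA.serre2 (r + s) (r * s) (bD (Gen_e i)) (bD (Gen_e (i + 1))) = \<zero>\<^bsub>B\<^esub>"
    and "UU.AA.serre1 (inverse r + inverse s) (inverse r * inverse s) (bD (Gen_f i)) (bD (Gen_f (i + 1))) = \<zero>\<^bsub>B\<^esub>"
    and "UU.AA.serre2 (inverse r + inverse s) (inverse r * inverse s) (bD (Gen_f i)) (bD (Gen_f (i + 1))) = \<zero>\<^bsub>B\<^esub>"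
proof -
  note ce = u_gens_closed(1)[OF i] u_gens_closed(1)[OF j] omega_closed(1)[OF i] omega_closed(1)[OF j]
  note cf = u_gens_closed(2)[OF i] u_gens_closed(2)[OF j] omega_closed(2)[OF i] omega_closed(2)[OF j]
  note v = cw_values[OF i j]
  note qe = omega_e_f(1)[OF i i, unfolded v] omega_e_f(1)[OF i j, unfolded v]
    omega_e_f(1)[OF j i, unfolded v] omega_e_f(1)[OF j j, unfolded v] omega_omega(1)[OF i j]
  show "UU.AA.serre1 (r + s) (r * s) (bD (Gen_e i)) (bD (Gen_e (i + 1))) = \<zero>\<^bsub>B\<^esub>"
    unfolding bD_e[OF i] bD_e[OF j] by (rule UU.De_serre(1)[OF ce r_nz s_nz qe serre_U(1)[OF i j]])
  show "UU.AA.serre2 (r + s) (r * s) (bD (Gen_e i)) (bD (Gen_e (i + 1))) = \<zero>\<^bsub>B\<^esub>"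
    unfolding bD_e[OF i] bD_e[OF j] by (rule UU.De_serre(2)[OF ce r_nz s_nz qe serre_U(2)[OF i j]])
  \<comment> \<open>For the f the parameters are \<rho> = 1/s and \<sigma> = 1/r, in this order:
    omega_i' passes f_i with r/s = \<rho>/\<sigma>, f_(i+1) with 1/r = \<sigma>, and omega_(i+1)'
    passes f_i with s = 1/\<rho>.\<close>
  have inv: "inverse (s / r) = inverse s / inverse r" "inverse (1 / s) = 1 / inverse s"
    by (simp_all add: divide_inverse mult.commute)
  have nz: "inverse s \<noteq> 0" "inverse r \<noteq> 0" using r_nz s_nz by simp_all
  note qf = omega_e_f(4)[OF i i, unfolded v inv] omega_e_f(4)[OF i j, unfolded v]
    omega_e_f(4)[OF j i, unfolded v inv] omega_e_f(4)[OF j j, unfolded v inv] omega_omega(2)[OF i j]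
  show "UU.AA.serre1 (inverse r + inverse s) (inverse r * inverse s) (bD (Gen_f i)) (bD (Gen_f (i + 1))) = \<zero>\<^bsub>B\<^esub>"
    unfolding bD_f[OF i] bD_f[OF j]
    using UU.De_serre(3)[OF cf nz qf] serre_U(3)[OF i j] by (simp only: add.commute[of "inverse r"] mult.commute[of "inverse r"])
  show "UU.AA.serre2 (inverse r + inverse s) (inverse r * inverse s) (bD (Gen_f i)) (bD (Gen_f (i + 1))) = \<zero>\<^bsub>B\<^esub>"
    unfolding bD_f[OF i] bD_f[OF j]
    using UU.De_serre(4)[OF cf nz qf] serre_U(4)[OF i j] by (simp only: add.commute[of "inverse r"] mult.commute[of "inverse r"])
qed

lemma bD_relators:
  assumes "p \<in> relators n r s"
  shows "UU.AA.ev bD p = \<zero>\<^bsub>B\<^esub>"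
  using assms
proof cases
  case (R1_comm x y)
  have "pp (u x) (u x) \<otimes>\<^bsub>B\<^esub> pp (u y) (u y) = pp (u y) (u y) \<otimes>\<^bsub>B\<^esub> pp (u x) (u x)"
    using R1_comm(2,3) by (simp only: UU.pp_mult u_closed gens_mem(7) torus_commute[of x y])
  then show ?thesis
    unfolding R1_comm(1) evB by (intro B_minus_eq) (simp_all add: bD_torus R1_comm bD_closed[unfolded bD_def] UU.pp_closed gens_mem(7))
next
  case (R1_a i)
  have "pp (u (Gen_a i)) (u (Gen_a i)) \<otimes>\<^bsub>B\<^esub> pp (u (Gen_ai i)) (u (Gen_ai i)) = \<one>\<^bsub>B\<^esub>"
    using R1_a(2) by (simp only: UU.pp_mult u_gens_closed a_inverse UU.AA_simps(4))
  then show ?thesis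
    unfolding R1_a(1) evB bD_ab[OF R1_a(2)] by (intro B_minus_eq) simp_all
next
  case (R1_b i)
  have "pp (u (Gen_b i)) (u (Gen_b i)) \<otimes>\<^bsub>B\<^esub> pp (u (Gen_bi i)) (u (Gen_bi i)) = \<one>\<^bsub>B\<^esub>"
    using R1_b(2) by (simp only: UU.pp_mult u_gens_closed b_inverse UU.AA_simps(4))
  then show ?thesis
    unfolding R1_b(1) evB bD_ab[OF R1_b(2)] by (intro B_minus_eq) simp_all
next
  case (R2_e i j)
  show ?thesis unfolding R2_e(1) evB by (rule bD_q_commute(1)[OF gens_mem(8)[OF R2_e(2)] R2_e(3) a_e[OF R2_e(2,3)]])
next
  case (R2_f i j)
  show ?thesis unfolding R2_f(1) evB by (rule bD_q_commute(2)[OF gens_mem(8)[OF R2_f(2)] R2_f(3) a_f[OF R2_f(2,3)]])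
next
  case (R3_e i j)
  show ?thesis unfolding R3_e(1) evB by (rule bD_q_commute(1)[OF gens_mem(9)[OF R3_e(2)] R3_e(3) b_e[OF R3_e(2,3)]])
next
  case (R3_f i j)
  show ?thesis unfolding R3_f(1) evB by (rule bD_q_commute(2)[OF gens_mem(9)[OF R3_f(2)] R3_f(3) b_f[OF R3_f(2,3)]])
next
  case (R4 i j)
  show ?thesis
    unfolding R4(1) evB bD_commutator[OF R4(2,3)]
    by (rule B_minus_eq) (simp_all add: bD_closed UU.AA.ks_mult_left)
next
  case (R5_e i j)
  have "\<bar>int j - int i\<bar> > 1" using R5_e(4) by simp
  note f = cw_far(1)[OF R5_e(2,3,4)] cw_far(1)[OF R5_e(3,2) this]
  note w = omega_e_f(1)[OF R5_e(2,3)] omega_e_f(1)[OF R5_e(3,2)]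
  show ?thesis
    unfolding R5_e(1) evB bD_e[OF R5_e(2)] bD_e[OF R5_e(3)]
    by (rule B_minus_eq, rule UU.De_commute(1))
       (use R5_e w e_commute(1)[OF R5_e(2,3,4)] omega_omega(1)[OF R5_e(2,3)] in
         \<open>simp_all add: f u_gens_closed UU.pp_closed del: One_nat_def\<close>)
next
  case (R5_f i j)
  have "\<bar>int j - int i\<bar> > 1" using R5_f(4) by simp
  note f = cw_far(2)[OF R5_f(2,3,4)] cw_far(2)[OF R5_f(3,2) this]
  note w = omega_e_f(4)[OF R5_f(2,3)] omega_e_f(4)[OF R5_f(3,2)]
  show ?thesis
    unfolding R5_f(1) evB bD_f[OF R5_f(2)] bD_f[OF R5_f(3)]
    by (rule B_minus_eq, rule UU.De_commute(2))
       (use R5_f w e_commute(2)[OF R5_f(2,3,4)] omega_omega(2)[OF R5_f(2,3)] in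
         \<open>simp_all add: f u_gens_closed UU.pp_closed del: One_nat_def\<close>)
next
  case (R6_1 i)
  show ?thesis unfolding R6_1(1) power2_eq_square evB
    using bD_serre(1)[OF R6_1(2,3)] by (simp only: UU.AA.serre1_def)
next
  case (R6_2 i)
  show ?thesis unfolding R6_2(1) power2_eq_square evB
    using bD_serre(2)[OF R6_2(2,3)] by (simp only: UU.AA.serre2_def)
next
  case (R7_1 i)
  show ?thesis unfolding R7_1(1) power2_eq_square evB
    using bD_serre(3)[OF R7_1(2,3)] by (simp only: UU.AA.serre1_def)
next
  case (R7_2 i)
  show ?thesis unfolding R7_2(1) power2_eq_square evB
    using bD_serre(4)[OF R7_2(2,3)] by (simp only: UU.AA.serre2_def)
qed

abbreviation "\<Delta> \<equiv> comult n r s"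

text \<open>The predicate under the definite description in \<open>comult\<close>, named so that
  existence and uniqueness can be stated.\<close>

definition is_comult where
  "is_comult D \<longleftrightarrow> D \<in> algebra_hom U B \<inter> extensional (carrier U) \<and>
     (\<forall>g\<in>torus_gens n. D (u g) = pp (u g) (u g)) \<and>
     (\<forall>i\<in>{1..<n}. D (u (Gen_e i)) = UU.De (om i) (u (Gen_e i))) \<and>
     (\<forall>i\<in>{1..<n}. D (u (Gen_f i)) = UU.Df (om' i) (u (Gen_f i)))"

lemma algebra_homD:
  assumes "h \<in> algebra_hom A C"
  shows "x \<in> carrier A \<Longrightarrow> h x \<in> carrier C"
    and "x \<in> carrier A \<Longrightarrow> y \<in> carrier A \<Longrightarrow> h (x \<otimes>\<^bsub>A\<^esub> y) = h x \<otimes>\<^bsub>C\<^esub> h y"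
    and "x \<in> carrier A \<Longrightarrow> y \<in> carrier A \<Longrightarrow> h (x \<oplus>\<^bsub>A\<^esub> y) = h x \<oplus>\<^bsub>C\<^esub> h y"
    and "h \<one>\<^bsub>A\<^esub> = \<one>\<^bsub>C\<^esub>" and "x \<in> carrier A \<Longrightarrow> h (c \<odot>\<^bsub>A\<^esub> x) = c \<odot>\<^bsub>C\<^esub> h x"
  using assms by (auto simp: algebra_hom_def Ring.ring_hom_def)

lemma gens_cases:
  assumes "g \<in> gens n"
  obtains "g \<in> torus_gens n" | i where "i \<in> {1..<n}" "g = Gen_e i" | i where "i \<in> {1..<n}" "g = Gen_f i"
  using assms unfolding gens_def by blast

text \<open>Existence is the universal property applied to \<open>bD\<close>. Uniqueness holds
  because a homomorphism is fixed by the generators and extensionality fixes it outside the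
  carrier.\<close>

lemma is_comult_comult: "is_comult \<Delta>"
proof -
  obtain h where h: "h \<in> algebra_hom U B" "\<forall>g\<in>gens n. h (u g) = bD g"
    using U_universal[OF UU.kalgebra_AA, of bD, OF bD_closed bD_relators] by blast
  have "restrict h (carrier U) \<in> algebra_hom U B"
    using h(1) unfolding algebra_hom_def Ring.ring_hom_def by auto
  then have ex: "is_comult (restrict h (carrier U))"
    unfolding is_comult_def using h(2) gens_mem u_gens_closed u_closed
    by (simp add: bD_torus bD_e bD_f gens_iff)
  have un: "D = restrict h (carrier U)" if D: "is_comult D" for D
  proof
    fix x
    have D1: "D \<in> algebra_hom U B" "D \<in> extensional (carrier U)" using D by (auto simp: is_comult_def)
    have g: "D (u g) = h (u g)" if "g \<in> gens n" for g
      using that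
    proof (cases rule: gens_cases)
      case 1
      then show ?thesis using D h(2) that by (simp add: is_comult_def bD_torus)
    next
      case (2 i)
      then show ?thesis using D h(2) that bD_e[of i] unfolding is_comult_def by metis
    next
      case (3 i)
      then show ?thesis using D h(2) that bD_f[of i] unfolding is_comult_def by metis
    qed
    show "D x = restrict h (carrier U) x"
    proof (cases "x \<in> carrier U")
      case True
      then have "D x = h x"
      proof (induction x rule: U_induct)
        case (sc c)
        show ?case using algebra_homD(4,5)[OF D1(1)] algebra_homD(4,5)[OF h(1)] by simp
      next
        case (add x y)
        then show ?case using algebra_homD(3)[OF D1(1)] algebra_homD(3)[OF h(1)] by simp
      next
        case (gen k x)
        then show ?case using algebra_homD(2)[OF D1(1)] algebra_homD(2)[OF h(1)] g by simp
      qed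
      with True show ?thesis by simp
    next
      case False
      then show ?thesis using D1(2) by (simp add: extensional_def)
    qed
  qed
  have "\<Delta> = (THE D. is_comult D)"
    unfolding comult_def Let_def is_comult_def ..
  also have "\<dots> = restrict h (carrier U)"
    by (rule the_equality[of is_comult, OF ex un])
  finally show ?thesis using ex by simp
qed

lemma comult_hom: "\<Delta> \<in> algebra_hom U B"
  and comult_torus: "g \<in> torus_gens n \<Longrightarrow> \<Delta> (u g) = pp (u g) (u g)"
  and comult_e: "i \<in> {1..<n} \<Longrightarrow> \<Delta> (u (Gen_e i)) = UU.De (om i) (u (Gen_e i))"
  and comult_f: "i \<in> {1..<n} \<Longrightarrow> \<Delta> (u (Gen_f i)) = UU.Df (om' i) (u (Gen_f i))"
  using is_comult_comult unfolding is_comult_def by blast+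

end

section \<open>Modules\<close>

lemma submoduleD:
  assumes "Module.submodule N R M"
  shows "N \<subseteq> carrier M" "\<zero>\<^bsub>M\<^esub> \<in> N" "x \<in> N \<Longrightarrow> y \<in> N \<Longrightarrow> x \<oplus>\<^bsub>M\<^esub> y \<in> N" "a \<in> carrier R \<Longrightarrow> x \<in> N \<Longrightarrow> a \<odot>\<^bsub>M\<^esub> x \<in> N"
    and "subgroup N (add_monoid M)"
  using subgroup.subset[OF Module.submodule.axioms(1)[OF assms]] subgroup.one_closed[OF Module.submodule.axioms(1)[OF assms]]
    subgroup.m_closed[OF Module.submodule.axioms(1)[OF assms]] Module.submodule.smult_closed[OF assms] Module.submodule.axioms(1)[OF assms]
  by simp_all

locale umod = urs_nz n r s for n :: nat and r s :: "'k::field" +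
  fixes M :: "('k Urs_elem, 'v) module"
  assumes lm: "left_module (Urs n r s) M"
begin

sublocale M: abelian_group M using lm by (rule left_module.axioms(2))

lemma act_closed [simp]: "a \<in> carrier U \<Longrightarrow> x \<in> carrier M \<Longrightarrow> a \<odot>\<^bsub>M\<^esub> x \<in> carrier M"
  and act_add_left: "a \<in> carrier U \<Longrightarrow> b \<in> carrier U \<Longrightarrow> x \<in> carrier M \<Longrightarrow> (a \<oplus>\<^bsub>U\<^esub> b) \<odot>\<^bsub>M\<^esub> x = (a \<odot>\<^bsub>M\<^esub> x) \<oplus>\<^bsub>M\<^esub> (b \<odot>\<^bsub>M\<^esub> x)"
  and act_add_right: "a \<in> carrier U \<Longrightarrow> x \<in> carrier M \<Longrightarrow> y \<in> carrier M \<Longrightarrow> a \<odot>\<^bsub>M\<^esub> (x \<oplus>\<^bsub>M\<^esub> y) = (a \<odot>\<^bsub>M\<^esub> x) \<oplus>\<^bsub>M\<^esub> (a \<odot>\<^bsub>M\<^esub> y)"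
  and act_mult: "a \<in> carrier U \<Longrightarrow> b \<in> carrier U \<Longrightarrow> x \<in> carrier M \<Longrightarrow> (a \<otimes>\<^bsub>U\<^esub> b) \<odot>\<^bsub>M\<^esub> x = a \<odot>\<^bsub>M\<^esub> (b \<odot>\<^bsub>M\<^esub> x)"
  and act_one: "x \<in> carrier M \<Longrightarrow> \<one>\<^bsub>U\<^esub> \<odot>\<^bsub>M\<^esub> x = x"
  by (rule left_module.smult_closed[OF lm] left_module.smult_l_distr[OF lm] left_module.smult_r_distr[OF lm]
    left_module.smult_assoc1[OF lm] left_module.smult_one[OF lm]; assumption)+

definition sm :: "'k \<Rightarrow> 'v \<Rightarrow> 'v" where "sm c x = (c \<odot>\<^bsub>U\<^esub> \<one>\<^bsub>U\<^esub>) \<odot>\<^bsub>M\<^esub> x"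

abbreviation "vs \<equiv> underlying_space U M"

lemma vs_simps [simp]:
  "carrier vs = carrier M" "ring.add vs = ring.add M" "ring.zero vs = ring.zero M" "c \<odot>\<^bsub>vs\<^esub> x = sm c x"
  by (simp_all add: underlying_space_def sm_def)

lemma sm_closed [simp]: "x \<in> carrier M \<Longrightarrow> sm c x \<in> carrier M"
  by (simp add: sm_def)

lemma act_sm_left: "a \<in> carrier U \<Longrightarrow> x \<in> carrier M \<Longrightarrow> (c \<odot>\<^bsub>U\<^esub> a) \<odot>\<^bsub>M\<^esub> x = sm c (a \<odot>\<^bsub>M\<^esub> x)"
  using act_mult[of "c \<odot>\<^bsub>U\<^esub> \<one>\<^bsub>U\<^esub>" a x] U.ks_eq_mult[of a c] by (simp add: sm_def)

lemma act_sm: "a \<in> carrier U \<Longrightarrow> x \<in> carrier M \<Longrightarrow> a \<odot>\<^bsub>M\<^esub> (sm c x) = sm c (a \<odot>\<^bsub>M\<^esub> x)"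
  using act_mult[of a "c \<odot>\<^bsub>U\<^esub> \<one>\<^bsub>U\<^esub>" x] act_sm_left[of a x c] U.ks_mult_right[of a "\<one>\<^bsub>U\<^esub>" c] by (simp add: sm_def)

lemma vs_abelian: "abelian_group vs"
proof (rule abelian_groupI, unfold vs_simps)
  show "\<exists>y\<in>carrier M. y \<oplus>\<^bsub>M\<^esub> x = \<zero>\<^bsub>M\<^esub>" if "x \<in> carrier M" for x
    using M.l_neg[OF that] M.a_inv_closed[OF that] by blast
qed (rule M.a_closed M.zero_closed M.a_assoc M.a_comm M.l_zero; assumption)+

lemma kspace_vs: "kspace vs"
proof (rule kspace.intro[OF vs_abelian], rule kspace_axioms.intro)
  fix x c d assume "x \<in> carrier vs"
  then have x: "x \<in> carrier M" by simp
  have c: "c \<odot>\<^bsub>U\<^esub> \<one>\<^bsub>U\<^esub> \<in> carrier U" "d \<odot>\<^bsub>U\<^esub> \<one>\<^bsub>U\<^esub> \<in> carrier U" by simp_all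
  show "c \<odot>\<^bsub>vs\<^esub> x \<in> carrier vs" using x by simp
  show "1 \<odot>\<^bsub>vs\<^esub> x = x" using act_one[OF x] by (simp add: sm_def)
  show "(c + d) \<odot>\<^bsub>vs\<^esub> x = (c \<odot>\<^bsub>vs\<^esub> x) \<oplus>\<^bsub>vs\<^esub> (d \<odot>\<^bsub>vs\<^esub> x)"
    using act_add_left[OF c x] U.ks_l_distr[of "\<one>\<^bsub>U\<^esub>" c d] by (simp add: sm_def)
  show "c \<odot>\<^bsub>vs\<^esub> (d \<odot>\<^bsub>vs\<^esub> x) = (c * d) \<odot>\<^bsub>vs\<^esub> x"
    using act_sm_left[OF c(2) x, of c] U.ks_assoc[of "\<one>\<^bsub>U\<^esub>" c d] by (simp add: sm_def)
  fix y assume "y \<in> carrier vs"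
  then show "c \<odot>\<^bsub>vs\<^esub> (x \<oplus>\<^bsub>vs\<^esub> y) = (c \<odot>\<^bsub>vs\<^esub> x) \<oplus>\<^bsub>vs\<^esub> (c \<odot>\<^bsub>vs\<^esub> y)"
    using act_add_right[OF c(1) x, of y] by (simp add: sm_def)
qed

sublocale K: kspace vs by (rule kspace_vs)

lemma sm_simps:
  "x \<in> carrier M \<Longrightarrow> y \<in> carrier M \<Longrightarrow> sm c (x \<oplus>\<^bsub>M\<^esub> y) = sm c x \<oplus>\<^bsub>M\<^esub> sm c y"
  "x \<in> carrier M \<Longrightarrow> sm (c + d) x = sm c x \<oplus>\<^bsub>M\<^esub> sm d x"
  "x \<in> carrier M \<Longrightarrow> sm c (sm d x) = sm (c * d) x"
  "x \<in> carrier M \<Longrightarrow> sm 1 x = x" "x \<in> carrier M \<Longrightarrow> sm 0 x = \<zero>\<^bsub>M\<^esub>" "sm c \<zero>\<^bsub>M\<^esub> = \<zero>\<^bsub>M\<^esub>"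
  using K.ks_r_distr[of x y c] K.ks_l_distr[of x c d] K.ks_assoc[of x c d] K.ks_one[of x] K.ks_zero[of x] K.ks_zero_right[of c]
  by simp_all

lemma sm_cancel: "x \<in> carrier M \<Longrightarrow> sm c x = \<zero>\<^bsub>M\<^esub> \<Longrightarrow> c \<noteq> 0 \<Longrightarrow> x = \<zero>\<^bsub>M\<^esub>"
  using K.ks_cancel[of x c] by simp

lemma sm_minus_one: "x \<in> carrier M \<Longrightarrow> \<ominus>\<^bsub>M\<^esub> x = sm (- 1) x"
  using sm_simps(2)[of x "- 1" 1] sm_simps(4,5)[of x] by (simp add: M.minus_equality)

lemma act_zero [simp]: "a \<in> carrier U \<Longrightarrow> a \<odot>\<^bsub>M\<^esub> \<zero>\<^bsub>M\<^esub> = \<zero>\<^bsub>M\<^esub>"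
  using act_sm[of a "\<zero>\<^bsub>M\<^esub>" 0] sm_simps(5,6) by simp

lemma kaction_vs: "kaction U vs (\<lambda>a x. a \<odot>\<^bsub>M\<^esub> x)"
  by (intro kaction.intro kaction_axioms.intro U.kalgebra_axioms kspace_vs)
     (simp_all add: act_add_left act_add_right act_sm_left act_sm act_mult act_one)

lemma act_induct:
  assumes x: "x \<in> carrier M" and a: "a \<in> carrier U"
    and "\<And>c. Q (sm c x)" "\<And>y z. y \<in> carrier M \<Longrightarrow> z \<in> carrier M \<Longrightarrow> Q y \<Longrightarrow> Q z \<Longrightarrow> Q (y \<oplus>\<^bsub>M\<^esub> z)"
    and "\<And>g y. g \<in> gens n \<Longrightarrow> y \<in> carrier M \<Longrightarrow> Q y \<Longrightarrow> Q (u g \<odot>\<^bsub>M\<^esub> y)"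
  shows "Q (a \<odot>\<^bsub>M\<^esub> x)"
  using a
proof (induction a rule: U_induct)
  case (sc c)
  then show ?case using assms(3)[of c] by (simp add: sm_def)
next
  case (add a b)
  then show ?case using x assms(4) by (simp add: act_add_left)
next
  case (gen g a)
  then show ?case using x assms(5) by (simp add: act_mult)
qed

lemma submoduleI_gens:
  assumes "N \<subseteq> carrier M" "\<zero>\<^bsub>M\<^esub> \<in> N"
    and add: "\<And>x y. x \<in> N \<Longrightarrow> y \<in> N \<Longrightarrow> x \<oplus>\<^bsub>M\<^esub> y \<in> N"
    and sm: "\<And>c x. x \<in> N \<Longrightarrow> sm c x \<in> N"
    and g: "\<And>g x. g \<in> gens n \<Longrightarrow> x \<in> N \<Longrightarrow> u g \<odot>\<^bsub>M\<^esub> x \<in> N"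
  shows "Module.submodule N U M"
proof (intro Module.submodule.intro Module.submodule_axioms.intro)
  show "subgroup N (add_monoid M)"
  proof (rule subgroup.intro)
    show "N \<subseteq> carrier (add_monoid M)" "\<one>\<^bsub>add_monoid M\<^esub> \<in> N" using assms(1,2) by simp_all
    show "x \<otimes>\<^bsub>add_monoid M\<^esub> y \<in> N" if "x \<in> N" "y \<in> N" for x y using add[OF that] by simp
    fix x assume x: "x \<in> N"
    then have "\<ominus>\<^bsub>M\<^esub> x \<in> N"
      using subsetD[OF assms(1) x] sm[of x "- 1"] by (simp add: sm_minus_one)
    then show "inv\<^bsub>add_monoid M\<^esub> x \<in> N" by (simp add: a_inv_def)
  qed
next
  fix a x assume a: "a \<in> carrier U" and x: "x \<in> N"
  show "a \<odot>\<^bsub>M\<^esub> x \<in> N"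
    by (rule act_induct[of x a "\<lambda>y. y \<in> N", OF subsetD[OF assms(1) x] a sm[OF x] add g])
qed

lemma submodule_sm: "Module.submodule N U M \<Longrightarrow> x \<in> N \<Longrightarrow> sm c x \<in> N"
  unfolding sm_def by (rule submoduleD(4)[OF _ U.ks_closed[OF U.one_closed]])

end

lemma umodI: "left_module (Urs n r s) M \<Longrightarrow> r \<noteq> 0 \<Longrightarrow> s \<noteq> 0 \<Longrightarrow> umod n r s M"
  by (intro umod.intro urs_nz.intro umod_axioms.intro)

section \<open>Tensor products with a one-dimensional module\<close>

locale tensor_umod = V: umod n r s V + W: umod n r s W
  for n :: nat and r s :: "'k::field" and V :: "('k Urs_elem, 'v) module" and W :: "('k Urs_elem, 'w) module"
begin

sublocale bi: bi_action V.U V.vs "\<lambda>a x. a \<odot>\<^bsub>V\<^esub> x" W.vs "\<lambda>a x. a \<odot>\<^bsub>W\<^esub> x"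
  by (intro bi_action.intro V.kaction_vs W.kaction_vs)

abbreviation "TT \<equiv> Urs_tensor n r s V W"
abbreviation "TG \<equiv> tensor_group class_ring V.vs W.vs"
abbreviation "pt \<equiv> pure_tensor class_ring V.vs W.vs"

lemma TT_simps:
  "carrier TT = carrier TG" "ring.zero TT = \<one>\<^bsub>TG\<^esub>" "ring.add TT = monoid.mult TG"
  "a \<odot>\<^bsub>TT\<^esub> t = bi.bact (V.\<Delta> a) t"
  by (simp_all add: Urs_tensor_def tensor_module_def Let_def bi.bact_def)

lemma Delta_closed: "a \<in> carrier V.U \<Longrightarrow> V.\<Delta> a \<in> carrier (tensor_group class_ring V.U V.U)"
  using V.algebra_homD(1)[OF V.comult_hom] by (simp add: V.UU.AA_simps)

lemma left_module_TT: "left_module V.U TT"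
proof (intro left_module.intro left_module_axioms.intro V.ring_U)
  show "abelian_group TT" by (rule bi.DV.T_abelian_group) (simp_all only: TT_simps)
  note h = V.algebra_homD[OF V.comult_hom]
  show "\<one>\<^bsub>V.U\<^esub> \<odot>\<^bsub>TT\<^esub> t = t" if "t \<in> carrier TT" for t
    using that h(4) by (simp add: TT_simps V.UU.AA_simps bi.bact_one)
  fix a b t t'
  assume a: "a \<in> carrier V.U" and t: "t \<in> carrier TT"
  show "a \<odot>\<^bsub>TT\<^esub> t \<in> carrier TT" using a t by (simp add: TT_simps bi.bact_closed Delta_closed)
  { assume "t' \<in> carrier TT"
    then show "a \<odot>\<^bsub>TT\<^esub> (t \<oplus>\<^bsub>TT\<^esub> t') = (a \<odot>\<^bsub>TT\<^esub> t) \<oplus>\<^bsub>TT\<^esub> (a \<odot>\<^bsub>TT\<^esub> t')"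
      using a t by (simp add: TT_simps bi.bact_add_right Delta_closed) }
  { assume b: "b \<in> carrier V.U"
    show "(a \<oplus>\<^bsub>V.U\<^esub> b) \<odot>\<^bsub>TT\<^esub> t = (a \<odot>\<^bsub>TT\<^esub> t) \<oplus>\<^bsub>TT\<^esub> (b \<odot>\<^bsub>TT\<^esub> t)"
      using a b t h(3)[OF a b] by (simp add: TT_simps V.UU.AA_simps bi.bact_add_left Delta_closed)
    show "(a \<otimes>\<^bsub>V.U\<^esub> b) \<odot>\<^bsub>TT\<^esub> t = a \<odot>\<^bsub>TT\<^esub> (b \<odot>\<^bsub>TT\<^esub> t)"
      using a b t h(2)[OF a b] by (simp add: TT_simps V.UU.AA_simps bi.bact_bact Delta_closed) }
qed

sublocale TT: umod n r s TT
  by (rule umodI[OF left_module_TT V.r_nz V.s_nz])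

lemma pt_closed [simp]: "v \<in> carrier V \<Longrightarrow> w \<in> carrier W \<Longrightarrow> pt v w \<in> carrier TT"
  by (simp add: TT_simps)

lemma pt_act_pp:
  "x \<in> carrier V.U \<Longrightarrow> y \<in> carrier V.U \<Longrightarrow> v \<in> carrier V \<Longrightarrow> w \<in> carrier W \<Longrightarrow>
    bi.bact (V.pp x y) (pt v w) = pt (x \<odot>\<^bsub>V\<^esub> v) (y \<odot>\<^bsub>W\<^esub> w)"
  using bi.bact_props(3)[of x y v w] by simp

lemma pt_act_pp2:
  "x \<in> carrier V.U \<Longrightarrow> y \<in> carrier V.U \<Longrightarrow> x' \<in> carrier V.U \<Longrightarrow> y' \<in> carrier V.U \<Longrightarrow> v \<in> carrier V \<Longrightarrow> w \<in> carrier W \<Longrightarrow>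
    bi.bact (V.pp x y \<oplus>\<^bsub>V.B\<^esub> V.pp x' y') (pt v w) = pt (x \<odot>\<^bsub>V\<^esub> v) (y \<odot>\<^bsub>W\<^esub> w) \<oplus>\<^bsub>TT\<^esub> pt (x' \<odot>\<^bsub>V\<^esub> v) (y' \<odot>\<^bsub>W\<^esub> w)"
  using bi.bact_add_left[of "V.pp x y" "V.pp x' y'" "pt v w"]
  by (simp add: V.UU.AA_simps(3) TT_simps(3) pt_act_pp)

lemma act_torus:
  "g \<in> torus_gens n \<Longrightarrow> v \<in> carrier V \<Longrightarrow> w \<in> carrier W \<Longrightarrow> V.u g \<odot>\<^bsub>TT\<^esub> pt v w = pt (V.u g \<odot>\<^bsub>V\<^esub> v) (V.u g \<odot>\<^bsub>W\<^esub> w)"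
  unfolding TT_simps V.comult_torus by (rule pt_act_pp) (simp_all add: V.gens_mem(7))

lemma act_e:
  "i \<in> {1..<n} \<Longrightarrow> v \<in> carrier V \<Longrightarrow> w \<in> carrier W \<Longrightarrow>
    V.u (Gen_e i) \<odot>\<^bsub>TT\<^esub> pt v w = pt (V.u (Gen_e i) \<odot>\<^bsub>V\<^esub> v) w \<oplus>\<^bsub>TT\<^esub> pt (V.om i \<odot>\<^bsub>V\<^esub> v) (V.u (Gen_e i) \<odot>\<^bsub>W\<^esub> w)"
  unfolding TT_simps(4) V.comult_e by (subst pt_act_pp2) (simp_all add: W.act_one V.gens_iff)

lemma act_f:
  "i \<in> {1..<n} \<Longrightarrow> v \<in> carrier V \<Longrightarrow> w \<in> carrier W \<Longrightarrow>
    V.u (Gen_f i) \<odot>\<^bsub>TT\<^esub> pt v w = pt v (V.u (Gen_f i) \<odot>\<^bsub>W\<^esub> w) \<oplus>\<^bsub>TT\<^esub> pt (V.u (Gen_f i) \<odot>\<^bsub>V\<^esub> v) (V.om' i \<odot>\<^bsub>W\<^esub> w)"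
  unfolding TT_simps(4) V.comult_f by (subst pt_act_pp2) (simp_all add: V.act_one V.gens_iff)

lemma pt_add: "v \<in> carrier V \<Longrightarrow> v' \<in> carrier V \<Longrightarrow> w \<in> carrier W \<Longrightarrow> pt (v \<oplus>\<^bsub>V\<^esub> v') w = pt v w \<oplus>\<^bsub>TT\<^esub> pt v' w"
  "v \<in> carrier V \<Longrightarrow> w \<in> carrier W \<Longrightarrow> w' \<in> carrier W \<Longrightarrow> pt v (w \<oplus>\<^bsub>W\<^esub> w') = pt v w \<oplus>\<^bsub>TT\<^esub> pt v w'"
  "v \<in> carrier V \<Longrightarrow> w \<in> carrier W \<Longrightarrow> pt (V.sm c v) w = pt v (W.sm c w)"
  using bi.DV.pt_simps(1)[of v v' w] bi.DV.pt_simps(2)[of v w w'] bi.DV.pt_simps(3)[of c v w]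
  by (simp_all add: TT_simps class_ring_simps)

lemma pt_zero: "v \<in> carrier V \<Longrightarrow> pt v \<zero>\<^bsub>W\<^esub> = \<zero>\<^bsub>TT\<^esub>" "w \<in> carrier W \<Longrightarrow> pt \<zero>\<^bsub>V\<^esub> w = \<zero>\<^bsub>TT\<^esub>"
  using bi.DV.pt_zero_left[of w] bi.DV.pt_zero_right[of v] by (simp_all add: TT_simps)

lemma pt_sm: "v \<in> carrier V \<Longrightarrow> w \<in> carrier W \<Longrightarrow> TT.sm c (pt v w) = pt v (W.sm c w)"
proof -
  assume v: "v \<in> carrier V" "w \<in> carrier W"
  have "V.\<Delta> (c \<odot>\<^bsub>V.U\<^esub> \<one>\<^bsub>V.U\<^esub>) = V.pp (c \<odot>\<^bsub>V.U\<^esub> \<one>\<^bsub>V.U\<^esub>) \<one>\<^bsub>V.U\<^esub>"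
    using V.algebra_homD(4,5)[OF V.comult_hom] by (simp add: V.UU.pp_sc_left) (simp add: V.UU.AA_simps(4))
  then have "TT.sm c (pt v w) = pt (V.sm c v) w"
    using v by (simp add: TT.sm_def TT_simps(4) pt_act_pp W.act_one) (simp add: V.sm_def)
  then show ?thesis using v by (simp add: pt_add(3))
qed

context
  fixes v0 assumes v0: "v0 \<in> carrier V" "v0 \<noteq> \<zero>\<^bsub>V\<^esub>" and one_dim: "carrier V \<subseteq> range (\<lambda>c. V.sm c v0)"
begin

text \<open>Scalars move across the tensor sign, so with a line on the left every pure tensor, and
  then every sum of them, can be written with \<open>v0\<close> in front.\<close>

lemma TT_pt: "carrier TT = pt v0 ` carrier W"
proof
  show "pt v0 ` carrier W \<subseteq> carrier TT" using v0 by auto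
  have "t \<in> pt v0 ` carrier W" if "t \<in> carrier TG" for t
    using that
  proof (induction t rule: bi.DV.T_induct)
    case (pt x y)
    then obtain c where "x = V.sm c v0" using one_dim by auto
    then show ?case using pt v0 by (simp add: pt_add(3))
  next
    case (add z z')
    then obtain w w' where w: "w \<in> carrier W" "w' \<in> carrier W" "z = pt v0 w" "z' = pt v0 w'" by blast
    then have "z \<otimes>\<^bsub>TG\<^esub> z' = pt v0 (w \<oplus>\<^bsub>W\<^esub> w')"
      using pt_add(2)[OF v0(1) w(1,2)] by (simp add: TT_simps(3))
    then show ?case using W.M.a_closed[OF w(1,2)] by blast
  qed
  then show "carrier TT \<subseteq> pt v0 ` carrier W" by (auto simp: TT_simps)
qed

text \<open>A left inverse is built: with \<open>k\<close> the coordinate with respect to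
  \<open>v0\<close>, the assignment v (x) w to k(v) w is balanced and returns \<open>w\<close> on v0
  (x) w.\<close>

lemma pt_inj: "inj_on (pt v0) (carrier W)"
proof -
  have ex: "\<exists>c. v = V.sm c v0" if "v \<in> carrier V" for v using one_dim that by auto
  have inj: "c = d" if "V.sm c v0 = V.sm d v0" for c d
  proof (rule ccontr)
    assume "c \<noteq> d"
    have "V.sm (c - d) v0 \<oplus>\<^bsub>V\<^esub> V.sm d v0 = V.sm c v0"
      using v0 V.sm_simps(2)[of v0 "c - d" d] by simp
    then have "V.sm (c - d) v0 = \<zero>\<^bsub>V\<^esub>"
      using that v0 by simp
    then show False using V.sm_cancel[of v0 "c - d"] v0 \<open>c \<noteq> d\<close> by auto
  qed
  define k where "k v = (THE c. v = V.sm c v0)" for v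
  have k: "k (V.sm c v0) = c" for c
    unfolding k_def by (rule the_equality) (use inj in auto)
  have bal: "balanced_map class_ring V.vs W.vs (add_monoid W) (\<lambda>v w. W.sm (k v) w)"
    unfolding balanced_map_def
  proof (intro conjI ballI)
    fix x x' y assume x: "x \<in> carrier V.vs" "x' \<in> carrier V.vs" "y \<in> carrier W.vs"
    obtain c d where "x = V.sm c v0" "x' = V.sm d v0" using ex[of x] ex[of x'] x(1,2) by auto
    moreover from this have "x \<oplus>\<^bsub>V\<^esub> x' = V.sm (c + d) v0" using v0 by (simp add: V.sm_simps)
    ultimately show "W.sm (k (x \<oplus>\<^bsub>V.vs\<^esub> x')) y = W.sm (k x) y \<otimes>\<^bsub>add_monoid W\<^esub> W.sm (k x') y"
      using x by (simp add: k W.sm_simps)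
  next
    fix b x y assume x: "b \<in> carrier (class_ring :: 'k ring)" "x \<in> carrier V.vs" "y \<in> carrier W.vs"
    obtain c where "x = V.sm c v0" using ex[of x] x(2) by auto
    then show "W.sm (k (b \<odot>\<^bsub>V.vs\<^esub> x)) y = W.sm (k x) (b \<odot>\<^bsub>W.vs\<^esub> y)"
      using x v0 by (simp add: k V.sm_simps W.sm_simps mult.commute)
  qed (simp_all add: W.sm_simps)
  obtain h where h: "\<And>v w. v \<in> carrier V \<Longrightarrow> w \<in> carrier W \<Longrightarrow> h (pt v w) = W.sm (k v) w"
    using bi.DV.T_universal[OF W.M.a_comm_group bal] unfolding V.vs_simps W.vs_simps by blast
  have "k v0 = 1" using k[of 1] v0 by (simp add: V.sm_simps)
  then have "h (pt v0 w) = w" if "w \<in> carrier W" for w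
    using h[OF v0(1) that] W.sm_simps(4)[OF that] by simp
  then show ?thesis by (rule inj_on_inverseI)
qed

end

end

section \<open>Highest weight modules\<close>

context free_verma
begin

lemma stableD:
  assumes "stable K"
  shows "0 \<in> K" "x \<in> K \<Longrightarrow> y \<in> K \<Longrightarrow> x + y \<in> K" "x \<in> K \<Longrightarrow> sc c * x \<in> K" "g \<in> gens n \<Longrightarrow> x \<in> K \<Longrightarrow> op g x \<in> K"
  using assms by (simp_all add: stable_def)

end

locale hw_mod = fv: free_verma n r s \<alpha> \<beta> + umod n r s M
  for n :: nat and r s :: "'k::field" and \<alpha> \<beta> :: "nat \<Rightarrow> 'k" and M :: "('k Urs_elem, 'v) module" +
  fixes v :: 'v
  assumes v_closed: "v \<in> carrier M" and v_nonzero: "v \<noteq> \<zero>\<^bsub>M\<^esub>"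
    and v_e: "\<And>j. j \<in> {1..<n} \<Longrightarrow> u (Gen_e j) \<odot>\<^bsub>M\<^esub> v = \<zero>\<^bsub>M\<^esub>"
    and v_a: "\<And>i. i \<in> {1..n} \<Longrightarrow> u (Gen_a i) \<odot>\<^bsub>M\<^esub> v = sm (\<alpha> i) v"
    and v_b: "\<And>i. i \<in> {1..n} \<Longrightarrow> u (Gen_b i) \<odot>\<^bsub>M\<^esub> v = sm (\<beta> i) v"

context umod
begin

lemma act_q_commute:
  assumes "a \<in> carrier U" "b \<in> carrier U" "y \<in> carrier M" "a \<otimes>\<^bsub>U\<^esub> b = c \<odot>\<^bsub>U\<^esub> (b \<otimes>\<^bsub>U\<^esub> a)"
  shows "a \<odot>\<^bsub>M\<^esub> (b \<odot>\<^bsub>M\<^esub> y) = sm c (b \<odot>\<^bsub>M\<^esub> (a \<odot>\<^bsub>M\<^esub> y))"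
proof -
  have "a \<odot>\<^bsub>M\<^esub> (b \<odot>\<^bsub>M\<^esub> y) = (c \<odot>\<^bsub>U\<^esub> (b \<otimes>\<^bsub>U\<^esub> a)) \<odot>\<^bsub>M\<^esub> y"
    using act_mult[OF assms(1-3)] assms(4) by simp
  also have "\<dots> = sm c (b \<odot>\<^bsub>M\<^esub> (a \<odot>\<^bsub>M\<^esub> y))"
    using act_sm_left[OF U.m_closed[OF assms(2,1)] assms(3)] act_mult[OF assms(2,1,3)] by simp
  finally show ?thesis .
qed

lemma act_e_f:
  assumes i: "i \<in> {1..<n}" and j: "j \<in> {1..<n}" and y: "y \<in> carrier M"
  shows "u (Gen_e i) \<odot>\<^bsub>M\<^esub> (u (Gen_f j) \<odot>\<^bsub>M\<^esub> y) = (u (Gen_f j) \<odot>\<^bsub>M\<^esub> (u (Gen_e i) \<odot>\<^bsub>M\<^esub> y)) \<oplus>\<^bsub>M\<^esub>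
    sm ((if i = j then 1 else 0) / (r - s)) ((u (Gen_a i) \<odot>\<^bsub>M\<^esub> (u (Gen_b (i + 1)) \<odot>\<^bsub>M\<^esub> y)) \<oplus>\<^bsub>M\<^esub>
      sm (- 1) (u (Gen_a (i + 1)) \<odot>\<^bsub>M\<^esub> (u (Gen_b i) \<odot>\<^bsub>M\<^esub> y)))"
proof -
  let ?k = "(if i = j then 1 else 0) / (r - s)"
  note c = u_gens_closed(1)[OF i] u_gens_closed(2)[OF j] omega_closed(1)[OF i] omega_closed(2)[OF i]
  note g = omega_gens[OF i]
  have ef: "u (Gen_e i) \<otimes>\<^bsub>U\<^esub> u (Gen_f j) = (u (Gen_f j) \<otimes>\<^bsub>U\<^esub> u (Gen_e i)) \<oplus>\<^bsub>U\<^esub> ?k \<odot>\<^bsub>U\<^esub> (om i \<oplus>\<^bsub>U\<^esub> (- 1) \<odot>\<^bsub>U\<^esub> om' i)"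
  proof -
    have "u (Gen_e i) \<otimes>\<^bsub>U\<^esub> u (Gen_f j) = (u (Gen_f j) \<otimes>\<^bsub>U\<^esub> u (Gen_e i)) \<oplus>\<^bsub>U\<^esub>
        (u (Gen_e i) \<otimes>\<^bsub>U\<^esub> u (Gen_f j) \<ominus>\<^bsub>U\<^esub> u (Gen_f j) \<otimes>\<^bsub>U\<^esub> u (Gen_e i))"
      using c by (simp add: U.minus_eq U.a_lcomm U.r_neg)
    moreover have "om i \<ominus>\<^bsub>U\<^esub> om' i = om i \<oplus>\<^bsub>U\<^esub> (- 1) \<odot>\<^bsub>U\<^esub> om' i"
      unfolding U.ks_minus_one[OF c(4)] U.minus_eq ..
    ultimately show ?thesis unfolding e_f[OF i j] by (simp only:)
  qed
  have "u (Gen_e i) \<odot>\<^bsub>M\<^esub> (u (Gen_f j) \<odot>\<^bsub>M\<^esub> y) = (u (Gen_e i) \<otimes>\<^bsub>U\<^esub> u (Gen_f j)) \<odot>\<^bsub>M\<^esub> y"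
    using act_mult[OF c(1,2) y] by simp
  also have "\<dots> = (u (Gen_f j) \<odot>\<^bsub>M\<^esub> (u (Gen_e i) \<odot>\<^bsub>M\<^esub> y)) \<oplus>\<^bsub>M\<^esub> sm ?k ((om i \<odot>\<^bsub>M\<^esub> y) \<oplus>\<^bsub>M\<^esub> sm (- 1) (om' i \<odot>\<^bsub>M\<^esub> y))"
    unfolding ef using c y
    by (simp only: act_add_left act_sm_left act_mult U.m_closed U.ks_closed U.a_closed)
  finally show ?thesis
    unfolding omega_def omega'_def
    by (simp only: act_mult[OF u_gens_closed(3)[OF g(5)] u_gens_closed(4)[OF g(6)] y]
       act_mult[OF u_gens_closed(3)[OF g(6)] u_gens_closed(4)[OF g(5)] y])
qed

lemma diff_eq_zero_iff:
  assumes "x \<in> carrier M" "y \<in> carrier M"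
  shows "x \<oplus>\<^bsub>M\<^esub> sm (- 1) y = \<zero>\<^bsub>M\<^esub> \<longleftrightarrow> x = y"
proof
  assume "x \<oplus>\<^bsub>M\<^esub> sm (- 1) y = \<zero>\<^bsub>M\<^esub>"
  then have "x \<oplus>\<^bsub>M\<^esub> \<ominus>\<^bsub>M\<^esub> y = \<zero>\<^bsub>M\<^esub>" using assms by (simp add: sm_minus_one)
  then have "\<ominus>\<^bsub>M\<^esub> (\<ominus>\<^bsub>M\<^esub> y) = x" using assms by (intro M.minus_equality) simp_all
  then show "x = y" using assms by simp
next
  assume "x = y"
  then show "x \<oplus>\<^bsub>M\<^esub> sm (- 1) y = \<zero>\<^bsub>M\<^esub>" using assms M.r_neg[of y] by (simp add: sm_minus_one)
qed

lemma vectorspace_vs: "vectorspace (class_ring :: 'k ring) vs"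
proof (rule vectorspace.intro)
  show "field (class_ring :: 'k ring)" by (rule class_field.field_axioms)
  have "Module.module (class_ring :: 'k ring) vs"
    by (rule moduleI)
       (use K.ks_l_distr K.ks_r_distr in \<open>simp_all add: class_cring.cring_axioms vs_abelian class_ring_simps sm_simps\<close>)
  then show "Module.module (class_ring :: 'k ring) vs" .
qed

text \<open>Spanning is phrased as generation under addition and scalars, which fits inductive
  arguments better than linear combinations; the span is one of the closed sets
  \<open>N\<close>.\<close>

lemma fin_dimI:
  assumes "finite S" "S \<subseteq> carrier M"
    and gen: "\<And>N. S \<subseteq> N \<Longrightarrow> \<zero>\<^bsub>M\<^esub> \<in> N \<Longrightarrow> (\<And>x y. x \<in> N \<Longrightarrow> y \<in> N \<Longrightarrow> x \<oplus>\<^bsub>M\<^esub> y \<in> N) \<Longrightarrow> (\<And>c x. x \<in> N \<Longrightarrow> sm c x \<in> N) \<Longrightarrow> carrier M \<subseteq> N"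
  shows "fin_dim_module U M"
proof -
  interpret VS: vectorspace "class_ring :: 'k ring" vs by (rule vectorspace_vs)
  have S: "S \<subseteq> carrier vs" using assms(2) by simp
  interpret sp: LinearCombinations.submodule "class_ring :: 'k ring" "VS.span S" vs
    by (rule VS.span_is_submodule[OF S])
  have "carrier M \<subseteq> VS.span S"
  proof (rule gen)
    show "S \<subseteq> VS.span S" by (rule VS.in_own_span[OF S])
    show "\<zero>\<^bsub>M\<^esub> \<in> VS.span S" using sp.zero_closed by simp
    show "x \<oplus>\<^bsub>M\<^esub> y \<in> VS.span S" if "x \<in> VS.span S" "y \<in> VS.span S" for x y using sp.m_closed[OF that] by simp
    show "sm c x \<in> VS.span S" if "x \<in> VS.span S" for c x using sp.smult_closed[of c x] that by (simp add: class_ring_simps)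
  qed
  moreover have "VS.span S \<subseteq> carrier vs" by (rule VS.span_is_subset2[OF S])
  ultimately have "VS.span S = carrier vs" by auto
  then show ?thesis
    unfolding fin_dim_module_def VS.fin_dim_def using assms(1) S by blast
qed

end

section \<open>The map from free words to a module with a highest weight vector\<close>

context hw_mod
begin

text \<open>Letters that are not generators are sent to zero, so that \<open>fw\<close> stays in the
  carrier on every word. Only words in \<open>Fn\<close> carry meaning.\<close>

definition fw :: "nat word \<Rightarrow> 'v" where
  "fw w = foldr (\<lambda>j x. if j \<in> {1..<n} then u (Gen_f j) \<odot>\<^bsub>M\<^esub> x else \<zero>\<^bsub>M\<^esub>) (letters w) v"

lemma fw_closed: "fw w \<in> carrier M"
proof -
  have "foldr (\<lambda>j x. if j \<in> {1..<n} then u (Gen_f j) \<odot>\<^bsub>M\<^esub> x else \<zero>\<^bsub>M\<^esub>) w v \<in> carrier M" for w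
  proof (induction w)
    case (Cons j w)
    then show ?case using u_gens_closed(2)[of j] by (simp del: One_nat_def)
  qed (simp add: v_closed)
  then show ?thesis by (simp add: fw_def)
qed

lemma fw_closed': "fw w \<in> carrier vs" using fw_closed by simp

definition pi :: "(nat word \<Rightarrow>\<^sub>0 'k) \<Rightarrow> 'v" where "pi = K.lext fw"

lemma pi_closed [simp]: "pi x \<in> carrier M"
  using K.lext_closed[of fw, OF fw_closed'] by (simp add: pi_def)

lemma pi_add: "pi (x + y) = pi x \<oplus>\<^bsub>M\<^esub> pi y"
  using K.lext_add[of fw, OF fw_closed', of x y] by (simp add: pi_def)

lemma pi_sc_mult: "pi (sc c * x) = sm c (pi x)"
  using K.lext_sc[of fw, OF fw_closed', of c x] by (simp add: pi_def)

lemma pi_single: "pi (Poly_Mapping.single w c) = sm c (fw w)"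
  using K.lext_single[of fw, OF fw_closed', of w c] by (simp add: pi_def)

lemma pi_sc: "pi (sc c) = sm c v"
  by (simp add: pi_single) (simp add: fw_def zero_word_def)

lemma pi_zero: "pi 0 = \<zero>\<^bsub>M\<^esub>" using pi_sc[of 0] v_closed by (simp add: sm_simps)

lemma pi_one: "pi 1 = v" using pi_sc[of 1] v_closed by (simp add: sm_simps)

lemma pi_diff: "pi (x - y) = pi x \<oplus>\<^bsub>M\<^esub> sm (- 1) (pi y)"
  using pi_add[of x "sc (- 1) * y"] by (simp add: pi_sc_mult[symmetric] single_uminus)

lemma pi_var:
  assumes j: "j \<in> {1..<n}"
  shows "pi (var j * x) = u (Gen_f j) \<odot>\<^bsub>M\<^esub> pi x"
proof (induction x rule: keys_single_sum_induct)
  case zero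
  then show ?case using u_gens_closed(2)[OF j] by (simp add: pi_zero)
next
  case (add w y)
  have "pi (var j * Poly_Mapping.single w c) = u (Gen_f j) \<odot>\<^bsub>M\<^esub> pi (Poly_Mapping.single w c)" for c
  proof (cases w)
    case (Word ws)
    have "fw (Word (j # ws)) = u (Gen_f j) \<odot>\<^bsub>M\<^esub> fw (Word ws)" using j by (simp add: fw_def del: One_nat_def)
    then show ?thesis
      unfolding Word single_Cons[symmetric] pi_single using act_sm[OF u_gens_closed(2)[OF j] fw_closed] by simp
  qed
  then show ?case
    using add act_add_right[OF u_gens_closed(2)[OF j]] by (simp add: distrib_left pi_add)
qed

lemma pi_opA:
  assumes i: "i \<in> {1..n}" and x: "x \<in> fv.Fn"
  shows "pi (fv.opA i x) = u (Gen_a i) \<odot>\<^bsub>M\<^esub> pi x"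
  using x
proof (induction x rule: fv.Fn_induct)
  case (sc c)
  have "u (Gen_a i) \<odot>\<^bsub>M\<^esub> sm c v = sm c (sm (\<alpha> i) v)"
    using act_sm[OF u_gens_closed(3)[OF i] v_closed] v_a[OF i] by simp
  then show ?case using v_closed by (simp add: fv.opA_sc pi_sc sm_simps mult.commute)
next
  case (add x y)
  then show ?case using act_add_right[OF u_gens_closed(3)[OF i]] by (simp add: fv.op_simps pi_add)
next
  case (var j x)
  have "u (Gen_a i) \<odot>\<^bsub>M\<^esub> (u (Gen_f j) \<odot>\<^bsub>M\<^esub> pi x) = sm (fv.wtr r i j) (u (Gen_f j) \<odot>\<^bsub>M\<^esub> (u (Gen_a i) \<odot>\<^bsub>M\<^esub> pi x))"
    using act_q_commute[OF u_gens_closed(3)[OF i] u_gens_closed(2)[OF var(1)] pi_closed a_f[OF i var(1)]]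
    by (simp add: fv.wtr_def)
  then show ?case using var by (simp only: fv.opA_var pi_sc_mult pi_var)
qed

lemma pi_opB:
  assumes i: "i \<in> {1..n}" and x: "x \<in> fv.Fn"
  shows "pi (fv.opB i x) = u (Gen_b i) \<odot>\<^bsub>M\<^esub> pi x"
  using x
proof (induction x rule: fv.Fn_induct)
  case (sc c)
  have "u (Gen_b i) \<odot>\<^bsub>M\<^esub> sm c v = sm c (sm (\<beta> i) v)"
    using act_sm[OF u_gens_closed(4)[OF i] v_closed] v_b[OF i] by simp
  then show ?case using v_closed by (simp add: fv.opB_sc pi_sc sm_simps mult.commute)
next
  case (add x y)
  then show ?case using act_add_right[OF u_gens_closed(4)[OF i]] by (simp add: fv.op_simps pi_add)
next
  case (var j x)
  have "u (Gen_b i) \<odot>\<^bsub>M\<^esub> (u (Gen_f j) \<odot>\<^bsub>M\<^esub> pi x) = sm (fv.wtr s i j) (u (Gen_f j) \<odot>\<^bsub>M\<^esub> (u (Gen_b i) \<odot>\<^bsub>M\<^esub> pi x))"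
    using act_q_commute[OF u_gens_closed(4)[OF i] u_gens_closed(2)[OF var(1)] pi_closed b_f[OF i var(1)]]
    by (simp add: fv.wtr_def)
  then show ?case using var by (simp only: fv.opB_var pi_sc_mult pi_var)
qed

lemma opAB_Fn: "x \<in> fv.Fn \<Longrightarrow> fv.opA i x \<in> fv.Fn" "x \<in> fv.Fn \<Longrightarrow> fv.opB i x \<in> fv.Fn"
  "x \<in> fv.Fn \<Longrightarrow> fv.opA' i x \<in> fv.Fn" "x \<in> fv.Fn \<Longrightarrow> fv.opB' i x \<in> fv.Fn"
  unfolding fv.opA_def fv.opB_def fv.opA'_def fv.opB'_def by (rule fv.dg_Fn, assumption)+

lemma pi_opE:
  assumes k: "k \<in> {1..<n}" and x: "x \<in> fv.Fn"
  shows "pi (fv.opE k x) = u (Gen_e k) \<odot>\<^bsub>M\<^esub> pi x"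
  using x
proof (induction x rule: fv.Fn_induct)
  case (sc c)
  show ?case
    using act_sm[OF u_gens_closed(1)[OF k] v_closed] v_e[OF k] by (simp add: fv.opE_sc pi_zero pi_sc sm_simps)
next
  case (add x y)
  then show ?case using act_add_right[OF u_gens_closed(1)[OF k]] by (simp add: fv.op_simps pi_add)
next
  case (var j x)
  note g = omega_gens[OF k]
  have H: "pi (if j = k then fv.opH k x else 0) = sm ((if k = j then 1 else 0) / (r - s)) ((u (Gen_a k) \<odot>\<^bsub>M\<^esub> (u (Gen_b (k + 1)) \<odot>\<^bsub>M\<^esub> pi x)) \<oplus>\<^bsub>M\<^esub>
      sm (- 1) (u (Gen_a (k + 1)) \<odot>\<^bsub>M\<^esub> (u (Gen_b k) \<odot>\<^bsub>M\<^esub> pi x)))"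
  proof (cases "j = k")
    case True
    then have "(if j = k then fv.opH k x else 0) = fv.opH k x" "(if k = j then 1 else 0) = (1::'k)" by simp_all
    then show ?thesis
      by (simp only: fv.opH_def pi_sc_mult pi_diff pi_opA[OF g(5) opAB_Fn(2)[OF var(2)]]
        pi_opA[OF g(6) opAB_Fn(2)[OF var(2)]] pi_opB[OF g(6) var(2)] pi_opB[OF g(5) var(2)])
  next
    case False
    then show ?thesis using u_gens_closed(3,4) g(5,6) by (simp add: pi_zero sm_simps del: One_nat_def)
  qed
  show ?case
    unfolding fv.opE_var pi_add H pi_var[OF var(1)] var(3) act_e_f[OF k var(1) pi_closed] ..
qed

text \<open>Restricted to \<open>Fn\<close>, since the relations between f_j and the other
  generators exist only for genuine indices. It transports every fact about free words to the
  module.\<close>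

lemma pi_op:
  assumes "g \<in> gens n" and x: "x \<in> fv.Fn"
  shows "pi (fv.op g x) = u g \<odot>\<^bsub>M\<^esub> pi x"
proof -
  \<comment> \<open>For inverse torus generators the claim follows from the invertible one: apply
    \<open>a\<close> to the candidate and cancel with \<open>b\<close>.\<close>
  have inv: "pi y = b \<odot>\<^bsub>M\<^esub> pi x"
    if "a \<odot>\<^bsub>M\<^esub> pi y = pi x" "a \<in> carrier U" "b \<in> carrier U" "a \<otimes>\<^bsub>U\<^esub> b = \<one>\<^bsub>U\<^esub>" "a \<otimes>\<^bsub>U\<^esub> b = b \<otimes>\<^bsub>U\<^esub> a" for a b y
  proof -
    have "b \<odot>\<^bsub>M\<^esub> pi x = (b \<otimes>\<^bsub>U\<^esub> a) \<odot>\<^bsub>M\<^esub> pi y"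
      using act_mult[OF that(3,2) pi_closed[of y]] that(1) by simp
    then show ?thesis using that(4,5) act_one[OF pi_closed[of y]] by simp
  qed
  show ?thesis
  proof (cases g)
    case (Gen_e i)
    then show ?thesis using pi_opE[OF _ x] assms(1) by (simp only: fv.op.simps gens_iff)
  next
    case (Gen_f i)
    then show ?thesis using pi_var assms(1) by (simp only: fv.op.simps gens_iff)
  next
    case (Gen_a i)
    then show ?thesis using pi_opA[OF _ x] assms(1) by (simp only: fv.op.simps gens_iff)
  next
    case (Gen_b i)
    then show ?thesis using pi_opB[OF _ x] assms(1) by (simp only: fv.op.simps gens_iff)
  next
    case (Gen_ai i)
    then have i: "i \<in> {1..n}" using assms(1) by (simp only: gens_iff)
    have "u (Gen_a i) \<odot>\<^bsub>M\<^esub> pi (fv.opA' i x) = pi x"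
      using pi_opA[OF i opAB_Fn(3)[OF x, of i]] by (simp only: fv.opA_opA')
    from inv[OF this u_gens_closed(3,5)[OF i] a_inverse[OF i] torus_commute[OF gens_mem(8,10)[OF i]]]
    show ?thesis unfolding Gen_ai by simp
  next
    case (Gen_bi i)
    then have i: "i \<in> {1..n}" using assms(1) by (simp only: gens_iff)
    have "u (Gen_b i) \<odot>\<^bsub>M\<^esub> pi (fv.opB' i x) = pi x"
      using pi_opB[OF i opAB_Fn(4)[OF x, of i]] by (simp only: fv.opB_opB')
    from inv[OF this u_gens_closed(4,6)[OF i] b_inverse[OF i] torus_commute[OF gens_mem(9,11)[OF i]]]
    show ?thesis unfolding Gen_bi by simp
  qed
qed

lemma image_submodule:
  assumes "fv.stable S" "S \<subseteq> fv.Fn"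
  shows "Module.submodule (pi ` S) U M"
proof (rule submoduleI_gens)
  show "pi ` S \<subseteq> carrier M" by auto
  show "\<zero>\<^bsub>M\<^esub> \<in> pi ` S" using imageI[OF fv.stableD(1)[OF assms(1)], of pi] unfolding pi_zero .
  show "y \<oplus>\<^bsub>M\<^esub> z \<in> pi ` S" if yz: "y \<in> pi ` S" "z \<in> pi ` S" for y z
  proof -
    obtain a b where ab: "a \<in> S" "b \<in> S" "y = pi a" "z = pi b" using yz by blast
    show ?thesis unfolding ab(3,4) pi_add[symmetric] by (rule imageI[OF fv.stableD(2)[OF assms(1) ab(1,2)]])
  qed
  show "sm c y \<in> pi ` S" if y: "y \<in> pi ` S" for c y
  proof -
    obtain a where a: "a \<in> S" "y = pi a" using y by blast
    show ?thesis unfolding a(2) pi_sc_mult[symmetric] by (rule imageI[OF fv.stableD(3)[OF assms(1) a(1)]])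
  qed
  show "u g \<odot>\<^bsub>M\<^esub> y \<in> pi ` S" if g: "g \<in> gens n" and y: "y \<in> pi ` S" for g y
  proof -
    obtain a where a: "a \<in> S" "y = pi a" using y by blast
    then have "pi (fv.op g a) = u g \<odot>\<^bsub>M\<^esub> y" using pi_op[OF g] assms(2) by blast
    moreover have "fv.op g a \<in> S" by (rule fv.stableD(4)[OF assms(1) g a(1)])
    ultimately show ?thesis using imageI[of "fv.op g a" S pi] by simp
  qed
qed

lemma preimage_stable:
  assumes "Module.submodule N U M"
  shows "fv.stable {x \<in> fv.Fn. pi x \<in> N}"
proof -
  note N = submoduleD[OF assms]
  show ?thesis
    unfolding fv.stable_def
  proof (intro conjI ballI allI)
    show "0 \<in> {x \<in> fv.Fn. pi x \<in> N}" using N(2) by (simp add: pi_zero fv.Fn_closed)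
    show "x + y \<in> {x \<in> fv.Fn. pi x \<in> N}" if "x \<in> {x \<in> fv.Fn. pi x \<in> N}" "y \<in> {x \<in> fv.Fn. pi x \<in> N}" for x y
      using that N(3) by (simp add: pi_add fv.Fn_closed)
    show "sc c * x \<in> {x \<in> fv.Fn. pi x \<in> N}" if "x \<in> {x \<in> fv.Fn. pi x \<in> N}" for c x
      using that submodule_sm[OF assms] by (simp add: pi_sc_mult fv.Fn_closed)
    show "fv.op g x \<in> {x \<in> fv.Fn. pi x \<in> N}" if "g \<in> gens n" "x \<in> {x \<in> fv.Fn. pi x \<in> N}" for g x
      using that N(4)[OF u_closed] by (simp add: pi_op fv.op_Fn)
  qed
qed

text \<open>A submodule without the highest weight vector pulls back to a stable set without the
  vacuum, and those lie in the radical.\<close>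

lemma preimage_rad:
  assumes "Module.submodule N U M" "v \<notin> N"
  shows "{x \<in> fv.Fn. pi x \<in> N} \<subseteq> fv.rad"
  by (rule fv.stable_subset_rad[OF preimage_stable[OF assms(1)]]) (use assms(2) in \<open>auto simp: pi_one\<close>)

lemma zero_submodule: "Module.submodule {\<zero>\<^bsub>M\<^esub>} U M"
  by (rule submoduleI_gens) (simp_all add: sm_simps)

lemma kernel_rad: "x \<in> fv.Fn \<Longrightarrow> pi x = \<zero>\<^bsub>M\<^esub> \<Longrightarrow> x \<in> fv.rad"
  using preimage_rad[OF zero_submodule] v_nonzero by auto

lemma rad_sub: "fv.rad \<subseteq> fv.Fn" by (auto simp: fv.rad_def)

text \<open>If \<open>v\<close> came from a radical vector \<open>x\<close>, then
  \<open>1 - x\<close> would lie in the kernel of \<open>pi\<close>, hence in the radical, and the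
  vacuum would follow.\<close>

lemma v_notin_rad: "v \<notin> pi ` fv.rad"
proof
  assume "v \<in> pi ` fv.rad"
  then obtain x where x: "v = pi x" "x \<in> fv.rad" by blast
  have "pi (1 - x) = \<zero>\<^bsub>M\<^esub>"
    using x(1) v_closed sm_minus_one[of v] M.r_neg[OF v_closed] by (simp add: pi_diff pi_one)
  then have "1 - x \<in> fv.rad" using x rad_sub by (intro kernel_rad fv.Fn_closed) auto
  then have "(1 - x) + x \<in> fv.rad" using x(2) by (rule fv.stableD(2)[OF fv.stable_rad])
  then show False using fv.one_notin_rad by simp
qed

lemma rad_submodule: "Module.submodule (pi ` fv.rad) U M"
  by (rule image_submodule[OF fv.stable_rad rad_sub])

lemma Fn_submodule: "Module.submodule (pi ` fv.Fn) U M"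
  by (rule image_submodule[OF fv.stable_Fn]) simp

lemma v_in_Fn: "v \<in> pi ` fv.Fn" using imageI[OF fv.Fn_closed(2), of pi] unfolding pi_one .

lemma submodule_rad:
  assumes "Module.submodule N U M" "v \<notin> N" "pi ` fv.Fn = carrier M"
  shows "N \<subseteq> pi ` fv.rad"
proof
  fix y assume "y \<in> N"
  then obtain x where "x \<in> fv.Fn" "y = pi x" using submoduleD(1)[OF assms(1)] assms(3) by blast
  then show "y \<in> pi ` fv.rad" using preimage_rad[OF assms(1,2)] \<open>y \<in> N\<close> by blast
qed

text \<open>Simplicity makes the image of \<open>Fn\<close> everything, because it contains
  \<open>v\<close>, and the image of the radical zero, because it does not.\<close>

lemma simple_pi:
  assumes "simple_module U M"
  shows "pi ` fv.Fn = carrier M" and "x \<in> fv.rad \<Longrightarrow> pi x = \<zero>\<^bsub>M\<^esub>"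
proof -
  have s: "N = {\<zero>\<^bsub>M\<^esub>} \<or> N = carrier M" if "Module.submodule N U M" for N
    using assms that unfolding simple_module_def by blast
  show "pi ` fv.Fn = carrier M" using s[OF Fn_submodule] v_in_Fn v_nonzero by auto
  show "x \<in> fv.rad \<Longrightarrow> pi x = \<zero>\<^bsub>M\<^esub>" using s[OF rad_submodule] v_notin_rad v_closed by auto
qed

lemma v_generates:
  assumes "Module.submodule N U M" "v \<in> N" "pi ` fv.Fn = carrier M"
  shows "N = carrier M"
proof -
  have "1 \<in> {x \<in> fv.Fn. pi x \<in> N}" using assms(2) by (simp add: pi_one fv.Fn_closed)
  have "pi x \<in> N" if "x \<in> fv.Fn" for x
    using that
  proof (induction x rule: fv.Fn_induct)
    case (sc c)
    then show ?case using submodule_sm[OF assms(1,2)] by (simp add: pi_sc)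
  next
    case (add x y)
    then show ?case using submoduleD(3)[OF assms(1)] by (simp add: pi_add)
  next
    case (var j x)
    then show ?case using submoduleD(4)[OF assms(1) u_gens_closed(2)[OF var(1)]] by (simp only: pi_var)
  qed
  then have "pi ` fv.Fn \<subseteq> N" by (rule image_subsetI)
  then have "carrier M \<subseteq> N" unfolding assms(3) .
  with submoduleD(1)[OF assms(1)] show ?thesis by (rule subset_antisym)
qed

lemma simple_fin_dim:
  assumes "simple_module U M"
    and long: "\<And>w. set w \<subseteq> {1..<n} \<Longrightarrow> L < length w \<Longrightarrow> Poly_Mapping.single (Word w) 1 \<in> fv.rad"
  shows "fin_dim_module U M"
proof (rule fin_dimI)
  let ?S = "(\<lambda>w. pi (Poly_Mapping.single (Word w) 1)) ` {w. set w \<subseteq> {1..<n} \<and> length w \<le> L}"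
  show "finite ?S" by (intro finite_imageI finite_lists_length_le) simp
  show "?S \<subseteq> carrier M" by auto
  fix N assume N: "?S \<subseteq> N" "\<zero>\<^bsub>M\<^esub> \<in> N" "\<And>x y. x \<in> N \<Longrightarrow> y \<in> N \<Longrightarrow> x \<oplus>\<^bsub>M\<^esub> y \<in> N" "\<And>c x. x \<in> N \<Longrightarrow> sm c x \<in> N"
  have "pi x \<in> N" if x: "x \<in> fv.Fn" for x
  proof (induction rule: keys_single_sum_induct)
    case zero
    then show ?case using N(2) by (simp add: pi_zero)
  next
    case (add w y)
    have w: "set (letters w) \<subseteq> {1..<n}" using add(1) x by (simp only: fv.mem_Fn)
    have "pi (Poly_Mapping.single (Word (letters w)) 1) \<in> N"
    proof (cases "length (letters w) \<le> L")
      case True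
      then show ?thesis using N(1) w by blast
    next
      case False
      then show ?thesis using simple_pi(2)[OF assms(1) long[OF w]] N(2) by simp
    qed
    then have "pi (sc (Poly_Mapping.lookup x w) * Poly_Mapping.single w 1) \<in> N"
      using N(4) by (simp only: pi_sc_mult) simp
    then show ?case using add(2) N(3) by (simp only: pi_add single_eq_sc_mult[of w "Poly_Mapping.lookup x w"])
  qed
  then have "pi ` fv.Fn \<subseteq> N" by (rule image_subsetI)
  then show "carrier M \<subseteq> N" unfolding simple_pi(1)[OF assms(1)] .
qed

end

text \<open>In both modules two words have equal images exactly when their difference lies in the
  radical, which depends only on the weight. The isomorphism goes back to a word and forward
  again.\<close>

lemma hw_simple_isomorphic:
  assumes "hw_mod n r s \<alpha> \<beta> M v" "hw_mod n r s \<alpha> \<beta> N w" "simple_module (Urs n r s) M" "simple_module (Urs n r s) N"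
  shows "isomorphic_modules (Urs n r s) M N"
proof -
  interpret M: hw_mod n r s \<alpha> \<beta> M v by fact
  interpret N: hw_mod n r s \<alpha> \<beta> N w by fact
  define g where "g y = (SOME x. x \<in> M.fv.Fn \<and> M.pi x = y)" for y
  have g: "g y \<in> M.fv.Fn" "M.pi (g y) = y" if "y \<in> carrier M" for y
  proof -
    have "\<exists>x. x \<in> M.fv.Fn \<and> M.pi x = y"
      using that unfolding M.simple_pi(1)[OF assms(3), symmetric] by (auto elim: imageE)
    from someI_ex[OF this] show "g y \<in> M.fv.Fn" "M.pi (g y) = y" unfolding g_def by simp_all
  qed
  have eq: "M.pi x = M.pi y \<longleftrightarrow> N.pi x = N.pi y" if xy: "x \<in> M.fv.Fn" "y \<in> M.fv.Fn" for x y
  proof -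
    have d: "x - y \<in> M.fv.Fn" using xy by (rule M.fv.Fn_closed)
    have "M.pi x = M.pi y \<longleftrightarrow> M.pi (x - y) = \<zero>\<^bsub>M\<^esub>"
      using M.diff_eq_zero_iff[of "M.pi x" "M.pi y"] by (simp add: M.pi_diff)
    also have "\<dots> \<longleftrightarrow> x - y \<in> M.fv.rad" using M.kernel_rad[OF d] M.simple_pi(2)[OF assms(3)] by blast
    also have "\<dots> \<longleftrightarrow> N.pi (x - y) = \<zero>\<^bsub>N\<^esub>" using N.kernel_rad[OF d] N.simple_pi(2)[OF assms(4)] by blast
    also have "\<dots> \<longleftrightarrow> N.pi x = N.pi y"
      using N.diff_eq_zero_iff[of "N.pi x" "N.pi y"] by (simp add: N.pi_diff)
    finally show ?thesis .
  qed
  define \<phi> where "\<phi> y = N.pi (g y)" for y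
  have \<phi>: "\<phi> (M.pi x) = N.pi x" if "x \<in> M.fv.Fn" for x
    unfolding \<phi>_def using eq[OF g(1)[OF M.pi_closed[of x]] that] g(2)[OF M.pi_closed[of x]] by simp
  have pre: "\<exists>x. x \<in> M.fv.Fn \<and> y = M.pi x" if "y \<in> carrier M" for y
    using that unfolding M.simple_pi(1)[OF assms(3), symmetric] by (auto elim: imageE)
  have preN: "\<exists>x. x \<in> M.fv.Fn \<and> y = N.pi x" if "y \<in> carrier N" for y
    using that unfolding N.simple_pi(1)[OF assms(4), symmetric] by (auto elim: imageE)
  have closed: "\<phi> y \<in> carrier N" for y by (simp add: \<phi>_def)
  have add: "\<phi> (y \<oplus>\<^bsub>M\<^esub> z) = \<phi> y \<oplus>\<^bsub>N\<^esub> \<phi> z" if yz: "y \<in> carrier M" "z \<in> carrier M" for y z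
  proof -
    obtain a where a: "a \<in> M.fv.Fn" "y = M.pi a" using pre[OF yz(1)] by blast
    obtain b where b: "b \<in> M.fv.Fn" "z = M.pi b" using pre[OF yz(2)] by blast
    note ab = a b
    then show ?thesis using \<phi>[OF M.fv.Fn_closed(4)[OF ab(1,3)]] by (simp add: \<phi> M.pi_add N.pi_add)
  qed
  have sm: "\<phi> (M.sm c y) = N.sm c (\<phi> y)" if y: "y \<in> carrier M" for c y
  proof -
    obtain a where a: "a \<in> M.fv.Fn" "y = M.pi a" using pre[OF y] by blast
    then show ?thesis using \<phi>[OF M.fv.Fn_closed(8)[OF a(1), of c]] by (simp add: \<phi> M.pi_sc_mult N.pi_sc_mult)
  qed
  have gen: "\<phi> (M.u k \<odot>\<^bsub>M\<^esub> y) = M.u k \<odot>\<^bsub>N\<^esub> \<phi> y" if k: "k \<in> gens n" and y: "y \<in> carrier M" for k y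
  proof -
    obtain a where a: "a \<in> M.fv.Fn" "y = M.pi a" using pre[OF y] by blast
    then show ?thesis
      using \<phi>[OF M.fv.op_Fn[OF k a(1)]] M.pi_op[OF k a(1)] N.pi_op[OF k a(1)] \<phi>[OF a(1)] by simp
  qed
  have act: "\<phi> (a \<odot>\<^bsub>M\<^esub> y) = a \<odot>\<^bsub>N\<^esub> \<phi> y" if a: "a \<in> carrier (Urs n r s)" and y: "y \<in> carrier M" for a y
    using a
  proof (induction a rule: M.U_induct)
    case (sc c)
    then show ?case using sm[OF y, of c] by (simp add: M.sm_def N.sm_def)
  next
    case (add a b)
    then show ?case using y closed by (simp add: M.act_add_left N.act_add_left \<open>\<And>z y. y \<in> carrier M \<Longrightarrow> z \<in> carrier M \<Longrightarrow> \<phi> (y \<oplus>\<^bsub>M\<^esub> z) = \<phi> y \<oplus>\<^bsub>N\<^esub> \<phi> z\<close>)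
  next
    case (gen k a)
    then show ?case using y closed \<open>\<And>y k. k \<in> gens n \<Longrightarrow> y \<in> carrier M \<Longrightarrow> \<phi> (M.u k \<odot>\<^bsub>M\<^esub> y) = M.u k \<odot>\<^bsub>N\<^esub> \<phi> y\<close>
      by (simp add: M.act_mult N.act_mult)
  qed
  have "\<phi> \<in> module_hom (Urs n r s) M N"
    unfolding module_hom_def using closed add act by auto
  moreover have "bij_betw \<phi> (carrier M) (carrier N)"
  proof (rule bij_betw_imageI)
    show "inj_on \<phi> (carrier M)"
    proof (rule inj_onI)
      fix y z assume yz: "y \<in> carrier M" "z \<in> carrier M" and eq': "\<phi> y = \<phi> z"
      obtain a where a: "a \<in> M.fv.Fn" "y = M.pi a" using pre[OF yz(1)] by blast
      obtain b where b: "b \<in> M.fv.Fn" "z = M.pi b" using pre[OF yz(2)] by blast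
      show "y = z" using eq[OF a(1) b(1)] eq' unfolding a(2) b(2) \<phi>[OF a(1)] \<phi>[OF b(1)] by blast
    qed
    show "\<phi> ` carrier M = carrier N"
    proof (rule subset_antisym)
      show "\<phi> ` carrier M \<subseteq> carrier N" using closed by (rule image_subsetI)
      show "carrier N \<subseteq> \<phi> ` carrier M"
      proof
        fix y assume y: "y \<in> carrier N"
        obtain x where x: "x \<in> M.fv.Fn" "y = N.pi x" using preN[OF y] by blast
        show "y \<in> \<phi> ` carrier M" unfolding x(2) \<phi>[OF x(1), symmetric] by (rule imageI[OF M.pi_closed])
      qed
    qed
  qed
  ultimately show ?thesis unfolding isomorphic_modules_def by blast
qed

section \<open>Characters of the torus\<close>

text \<open>Negatives need no case of their own: they are products with the scalar -1, which belongs
  to the generating set.\<close>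

lemma (in kalgebra) generated_subalgebra_induct [consumes 2, case_names sc gen add mult]:
  assumes S: "S \<subseteq> carrier A" and x: "x \<in> carrier (generated_subalgebra A S)"
    and sc: "\<And>c. Q (c \<odot> \<one>)" and gen: "\<And>x. x \<in> S \<Longrightarrow> Q x"
    and add: "\<And>x y. x \<in> carrier A \<Longrightarrow> y \<in> carrier A \<Longrightarrow> x \<in> carrier (generated_subalgebra A S) \<Longrightarrow>
      y \<in> carrier (generated_subalgebra A S) \<Longrightarrow> Q x \<Longrightarrow> Q y \<Longrightarrow> Q (x \<oplus> y)"
    and mult: "\<And>x y. x \<in> carrier A \<Longrightarrow> y \<in> carrier A \<Longrightarrow> x \<in> carrier (generated_subalgebra A S) \<Longrightarrow>
      y \<in> carrier (generated_subalgebra A S) \<Longrightarrow> Q x \<Longrightarrow> Q y \<Longrightarrow> Q (x \<otimes> y)"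
  shows "Q x"
proof -
  let ?G = "S \<union> range (\<lambda>c. c \<odot> \<one>)"
  have G: "?G \<subseteq> carrier A" using S by auto
  have c: "carrier (generated_subalgebra A S) = generate_ring A ?G" by (simp add: generated_subalgebra_def)
  have "x \<in> generate_ring A ?G" using x c by simp
  then have "x \<in> carrier A \<and> Q x"
  proof (induction rule: generate_ring.induct)
    case one
    show ?case using sc[of 1] by simp
  next
    case (incl h)
    then show ?case using sc gen G by auto
  next
    case (a_inv h)
    have "\<ominus> h = ((- 1) \<odot> \<one>) \<otimes> h" using a_inv ks_minus_one[of h] ks_eq_mult[of h "- 1"] by simp
    moreover have "(- 1) \<odot> \<one> \<in> generate_ring A ?G" by (rule generate_ring.incl) blast
    ultimately show ?case using a_inv mult[of "(- 1) \<odot> \<one>" h] sc[of "- 1"] c by simp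
  next
    case (eng_add x y)
    then show ?case using add[of x y] c by simp
  next
    case (eng_mult x y)
    then show ?case using mult[of x y] c by simp
  qed
  then show ?thesis ..
qed

lemma generated_subalgebra_simps [simp]:
  "monoid.mult (generated_subalgebra A S) = monoid.mult A" "one (generated_subalgebra A S) = one A"
  "ring.add (generated_subalgebra A S) = ring.add A" "ring.zero (generated_subalgebra A S) = ring.zero A"
  "module.smult (generated_subalgebra A S) = module.smult A"
  by (simp_all add: generated_subalgebra_def)

lemma ground_homD:
  assumes "h \<in> algebra_hom A C"
  shows "x \<in> carrier A \<Longrightarrow> y \<in> carrier A \<Longrightarrow> h (x \<otimes>\<^bsub>A\<^esub> y) = h x \<otimes>\<^bsub>C\<^esub> h y"
    and "x \<in> carrier A \<Longrightarrow> y \<in> carrier A \<Longrightarrow> h (x \<oplus>\<^bsub>A\<^esub> y) = h x \<oplus>\<^bsub>C\<^esub> h y"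
    and "h \<one>\<^bsub>A\<^esub> = \<one>\<^bsub>C\<^esub>" and "x \<in> carrier A \<Longrightarrow> h (c \<odot>\<^bsub>A\<^esub> x) = c \<odot>\<^bsub>C\<^esub> h x"
  using assms by (auto simp: algebra_hom_def Ring.ring_hom_def)

lemma ground_algebra_simps [simp]:
  "carrier ground_algebra = UNIV" "monoid.mult ground_algebra = times" "one ground_algebra = 1"
  "ring.add ground_algebra = (+)" "ring.zero ground_algebra = 0" "module.smult ground_algebra = times"
  by (simp_all add: ground_algebra_def)

context kalgebra
begin

lemma generated_subalgebra_sub: "S \<subseteq> carrier A \<Longrightarrow> carrier (generated_subalgebra A S) \<subseteq> carrier A"
  using generated_subalgebra_induct[of S _ "\<lambda>x. x \<in> carrier A"] by auto

lemma generated_subalgebra_closed: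
  "c \<odot> \<one> \<in> carrier (generated_subalgebra A S)" "\<one> \<in> carrier (generated_subalgebra A S)"
  "x \<in> S \<Longrightarrow> x \<in> carrier (generated_subalgebra A S)"
  "x \<in> carrier (generated_subalgebra A S) \<Longrightarrow> y \<in> carrier (generated_subalgebra A S) \<Longrightarrow> x \<oplus> y \<in> carrier (generated_subalgebra A S)"
  "x \<in> carrier (generated_subalgebra A S) \<Longrightarrow> y \<in> carrier (generated_subalgebra A S) \<Longrightarrow> x \<otimes> y \<in> carrier (generated_subalgebra A S)"
  by (auto simp: generated_subalgebra_def intro: generate_ring.intros)

lemma generated_subalgebra_smult:
  assumes "S \<subseteq> carrier A" "x \<in> carrier (generated_subalgebra A S)"
  shows "c \<odot> x \<in> carrier (generated_subalgebra A S)"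
  using ks_eq_mult[of x c] generated_subalgebra_sub[OF assms(1)] assms(2)
    generated_subalgebra_closed(5)[OF generated_subalgebra_closed(1)[of c S] assms(2)] by auto

lemma restrict_char:
  assumes "S \<subseteq> carrier A" "h \<in> algebra_hom (generated_subalgebra A S) ground_algebra"
  shows "restrict h (carrier (generated_subalgebra A S)) \<in> algebra_hom (generated_subalgebra A S) ground_algebra"
  using assms(2) generated_subalgebra_closed generated_subalgebra_smult[OF assms(1)]
  unfolding algebra_hom_def Ring.ring_hom_def by simp

lemma char_eq:
  assumes S: "S \<subseteq> carrier A" and h: "h \<in> algebra_hom (generated_subalgebra A S) ground_algebra"
    and h': "h' \<in> algebra_hom (generated_subalgebra A S) ground_algebra"
    and eq: "\<And>x. x \<in> S \<Longrightarrow> h x = h' x" and x: "x \<in> carrier (generated_subalgebra A S)"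
  shows "h x = h' x"
  using S x
proof (induction x rule: generated_subalgebra_induct)
  case (sc c)
  show ?case
    using ground_homD(3,4)[OF h] ground_homD(3,4)[OF h'] generated_subalgebra_closed(2)[of S] by simp
next
  case (gen x)
  then show ?case by (rule eq)
next
  case (add x y)
  then show ?case using ground_homD(2)[OF h] ground_homD(2)[OF h'] by simp
next
  case (mult x y)
  then show ?case using ground_homD(1)[OF h] ground_homD(1)[OF h'] by simp
qed

end

context urs_nz
begin

abbreviation "U0 \<equiv> Urs0 n r s"
abbreviation "Ug \<equiv> Urs_ge0 n r s"

lemma torus_sub: "u ` torus_gens n \<subseteq> carrier U" and borel_sub: "u ` (torus_gens n \<union> Gen_e ` {1..<n}) \<subseteq> carrier U"
  using gens_mem(1,7) by auto

lemma U0_gen: "g \<in> torus_gens n \<Longrightarrow> u g \<in> carrier U0"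
  unfolding Urs0_def by (rule U.generated_subalgebra_closed(3)) simp

lemma U0_closed: "\<one>\<^bsub>U\<^esub> \<in> carrier U0" "x \<in> carrier U0 \<Longrightarrow> y \<in> carrier U0 \<Longrightarrow> x \<oplus>\<^bsub>U\<^esub> y \<in> carrier U0"
  "x \<in> carrier U0 \<Longrightarrow> y \<in> carrier U0 \<Longrightarrow> x \<otimes>\<^bsub>U\<^esub> y \<in> carrier U0"
  and U0_simps: "monoid.mult U0 = monoid.mult U" "one U0 = one U" "ring.add U0 = ring.add U" "module.smult U0 = module.smult U"
  and Ug_closed: "\<one>\<^bsub>U\<^esub> \<in> carrier Ug" "c \<odot>\<^bsub>U\<^esub> \<one>\<^bsub>U\<^esub> \<in> carrier Ug"
  and Ug_simps: "monoid.mult Ug = monoid.mult U" "one Ug = one U" "ring.add Ug = ring.add U" "module.smult Ug = module.smult U"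
  unfolding Urs0_def Urs_ge0_def by (simp_all add: U.generated_subalgebra_closed)

lemma U0_omega: "i \<in> {1..<n} \<Longrightarrow> om i \<in> carrier U0" "i \<in> {1..<n} \<Longrightarrow> om' i \<in> carrier U0"
  unfolding omega_def omega'_def by (intro U0_closed(3) U0_gen omega_gens; assumption)+

lemma Ug_sub: "carrier Ug \<subseteq> carrier U"
  unfolding Urs_ge0_def by (rule U.generated_subalgebra_sub[OF borel_sub])

lemma U0_Ug: "carrier U0 \<subseteq> carrier Ug"
proof
  fix x assume "x \<in> carrier U0"
  with torus_sub show "x \<in> carrier Ug"
    unfolding Urs0_def
  proof (induction x rule: U.generated_subalgebra_induct)
    case (gen x)
    then show ?case unfolding Urs_ge0_def by (intro U.generated_subalgebra_closed(3)) auto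
  qed (unfold Urs_ge0_def, auto intro: U.generated_subalgebra_closed)
qed

lemma char_mult:
  assumes "h \<in> torus_chars n r s"
  shows "x \<in> carrier U0 \<Longrightarrow> y \<in> carrier U0 \<Longrightarrow> h (x \<otimes>\<^bsub>U\<^esub> y) = h x * h y" and "h \<one>\<^bsub>U\<^esub> = 1"
  using algebra_homD(2,4)[OF assms[unfolded torus_chars_def]] U0_simps by simp_all

lemma char_inverse:
  assumes "h \<in> torus_chars n r s" "i \<in> {1..n}"
  shows "h (u (Gen_a i)) * h (u (Gen_ai i)) = 1" "h (u (Gen_b i)) * h (u (Gen_bi i)) = 1"
  using char_mult(1)[OF assms(1) U0_gen[OF gens_mem(8)[OF assms(2)]] U0_gen[OF gens_mem(10)[OF assms(2)]]]
    char_mult(1)[OF assms(1) U0_gen[OF gens_mem(9)[OF assms(2)]] U0_gen[OF gens_mem(11)[OF assms(2)]]]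
    char_mult(2)[OF assms(1)] a_inverse[OF assms(2)] b_inverse[OF assms(2)] by simp_all

text \<open>The values on a_i^-1 and b_i^-1 are forced, since an inverse in the field is
  unique.\<close>

lemma torus_char_eq:
  assumes h: "h \<in> torus_chars n r s" "h' \<in> torus_chars n r s"
    and a: "\<And>i. i \<in> {1..n} \<Longrightarrow> h (u (Gen_a i)) = h' (u (Gen_a i))"
    and b: "\<And>i. i \<in> {1..n} \<Longrightarrow> h (u (Gen_b i)) = h' (u (Gen_b i))"
    and x: "x \<in> carrier U0"
  shows "h x = h' x"
proof (rule U.char_eq[OF torus_sub h[unfolded torus_chars_def Urs0_def] _ x[unfolded Urs0_def]])
  fix y assume "y \<in> u ` torus_gens n"
  then obtain g where g: "g \<in> torus_gens n" "y = u g" by blast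
  have inv: "z = z'" if "c * z = 1" "c * z' = 1" for c z z' :: 'a
    using that by (metis mult.left_commute mult.right_neutral)
  have ai: "h (u (Gen_ai i)) = h' (u (Gen_ai i))" "h (u (Gen_bi i)) = h' (u (Gen_bi i))" if i: "i \<in> {1..n}" for i
    using inv[OF char_inverse(1)[OF h(1) i] char_inverse(1)[OF h(2) i, folded a[OF i]]]
      inv[OF char_inverse(2)[OF h(1) i] char_inverse(2)[OF h(2) i, folded b[OF i]]] .
  from g(1) show "h y = h' y"
    unfolding g(2) torus_gens_def using a b ai by blast
qed

end

section \<open>The vacuum functional on the algebra\<close>

locale verma_data = fv: free_verma n r s \<alpha> \<beta> + urs_nz n r s
  for n :: nat and r s :: "'k::field" and \<alpha> \<beta> :: "nat \<Rightarrow> 'k"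
begin

definition vac :: "(gen word \<Rightarrow>\<^sub>0 'k) \<Rightarrow> 'k" where "vac p = Poly_Mapping.lookup (fv.act p 1) 0"

text \<open>The elements that send every word into the Serre ideal form a two-sided ideal: right
  multiples because the vector is arbitrary, left multiples because the Serre ideal is invariant. It
  contains the relators.\<close>

lemma act_I:
  assumes "p \<in> I"
  shows "fv.act p x \<in> fv.serre_ideal"
proof -
  let ?J = "{p \<in> carrier P. \<forall>x. fv.act p x \<in> fv.serre_ideal}"
  have m: "- y \<in> fv.serre_ideal" if "y \<in> fv.serre_ideal" for y
    using fv.serre_ideal.sc[OF that, of "- 1"] by (simp add: single_uminus)
  have "ideal ?J P"
  proof (rule idealI[OF P.ring_axioms])
    show "subgroup ?J (add_monoid P)"
      by (rule P.add.subgroupI)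
         (auto simp: a_inv_def[symmetric] fv.act_simps free_algebra_uminus free_algebra_add
           intro: fv.serre_ideal.add fv.serre_ideal.zero m free_algebra_zero intro!: exI[of _ 0])
  qed (auto simp: fv.act_mult free_algebra_mult intro: fv.act_serre_ideal)
  then have "I \<subseteq> ?J"
    unfolding rel_ideal_def by (rule P.genideal_minimal) (use fv.act_relator relators_closed in blast)
  then show ?thesis using assms by blast
qed

text \<open>The vacuum component of an element applied to the vacuum. It is well defined because
  relations land in the Serre ideal, which has no vacuum component.\<close>

definition phi :: "'k Urs_elem \<Rightarrow> 'k" where
  "phi Y = vac (SOME p. p \<in> carrier P \<and> cls p = Y)"

lemma phi_cls:
  assumes "p \<in> carrier P"
  shows "phi (cls p) = vac p"
proof -
  let ?p = "SOME p'. p' \<in> carrier P \<and> cls p' = cls p"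
  have "?p \<in> carrier P \<and> cls ?p = cls p" by (rule someI[of _ p]) (simp add: assms)
  then have "?p - p \<in> I" using cls_eq_iff[of ?p p] assms by blast
  then show ?thesis
    using fv.serre_ideal_vac[OF act_I, of "?p - p" 1] by (simp add: phi_def vac_def fv.act_simps lookup_minus)
qed

lemma phi_add: "x \<in> carrier U \<Longrightarrow> y \<in> carrier U \<Longrightarrow> phi (x \<oplus>\<^bsub>U\<^esub> y) = phi x + phi y"
  and phi_sc: "x \<in> carrier U \<Longrightarrow> phi (c \<odot>\<^bsub>U\<^esub> x) = c * phi x"
  by (auto simp: cls_carrier cls_add cls_sc phi_cls free_algebra_add free_algebra_closed vac_def fv.act_simps lookup_add)

text \<open>Asks for one representative with an exact scalar, not merely a scalar modulo the Serre
  ideal; in this form the property is closed under sums and products.\<close>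

definition scalar_on_vac :: "'k Urs_elem \<Rightarrow> bool" where
  "scalar_on_vac b \<longleftrightarrow> (\<exists>p\<in>carrier P. b = cls p \<and> (\<exists>c. fv.act p 1 = sc c))"

lemma scalar_on_vac_gens:
  "i \<in> {1..<n} \<Longrightarrow> scalar_on_vac (u (Gen_e i)) \<and> phi (u (Gen_e i)) = 0"
  "i \<in> {1..n} \<Longrightarrow> scalar_on_vac (u (Gen_a i)) \<and> phi (u (Gen_a i)) = \<alpha> i"
  "i \<in> {1..n} \<Longrightarrow> scalar_on_vac (u (Gen_b i)) \<and> phi (u (Gen_b i)) = \<beta> i"
  "i \<in> {1..n} \<Longrightarrow> scalar_on_vac (u (Gen_ai i))"
  "i \<in> {1..n} \<Longrightarrow> scalar_on_vac (u (Gen_bi i))"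
proof -
  have *: "scalar_on_vac (u g) \<and> phi (u g) = c" if "g \<in> gens n" "fv.op g (sc 1) = sc c" for g c
  proof -
    have p: "(var g :: gen word \<Rightarrow>\<^sub>0 'k) \<in> carrier P" using that(1) by (rule free_algebra_var)
    moreover have "fv.act (var g) 1 = sc c" using that(2) by (simp add: fv.act_var)
    ultimately show ?thesis unfolding scalar_on_vac_def cls_var phi_cls[OF p] vac_def by auto
  qed
  show "i \<in> {1..<n} \<Longrightarrow> scalar_on_vac (u (Gen_e i)) \<and> phi (u (Gen_e i)) = 0"
    by (rule *[OF gens_mem(1)]) (simp_all only: fv.op.simps fv.opE_sc single_zero)
  show "i \<in> {1..n} \<Longrightarrow> scalar_on_vac (u (Gen_a i)) \<and> phi (u (Gen_a i)) = \<alpha> i"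
    by (rule *[OF gens_mem(3)]) (simp_all only: fv.op.simps fv.opA_sc mult_1_right)
  show "i \<in> {1..n} \<Longrightarrow> scalar_on_vac (u (Gen_b i)) \<and> phi (u (Gen_b i)) = \<beta> i"
    by (rule *[OF gens_mem(4)]) (simp_all only: fv.op.simps fv.opB_sc mult_1_right)
  show "i \<in> {1..n} \<Longrightarrow> scalar_on_vac (u (Gen_ai i))"
    by (rule *[OF gens_mem(5), THEN conjunct1]) (simp_all only: fv.op.simps fv.opA'_def dg_sc)
  show "i \<in> {1..n} \<Longrightarrow> scalar_on_vac (u (Gen_bi i))"
    by (rule *[OF gens_mem(6), THEN conjunct1]) (simp_all only: fv.op.simps fv.opB'_def dg_sc)
qed

lemma scalar_on_vac:
  assumes "b \<in> carrier Ug"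
  shows "scalar_on_vac b"
  using borel_sub assms[unfolded Urs_ge0_def]
proof (induction b rule: U.generated_subalgebra_induct)
  case (sc c)
  show ?case unfolding scalar_on_vac_def
    by (rule bexI[of _ "sc c"]) (auto simp: cls_one cls_sc fv.act_sc free_algebra_closed)
next
  case (gen x)
  then show ?case using scalar_on_vac_gens unfolding torus_gens_def by blast
next
  case (add x y)
  then obtain p c p' c' where "p \<in> carrier P" "x = cls p" "fv.act p 1 = sc c" "p' \<in> carrier P" "y = cls p'" "fv.act p' 1 = sc c'"
    unfolding scalar_on_vac_def by blast
  then show ?case unfolding scalar_on_vac_def
    by (intro bexI[of _ "p + p'"]) (auto simp: cls_add fv.act_simps free_algebra_add single_add[symmetric])
next
  case (mult x y)
  then obtain p c p' c' where "p \<in> carrier P" "x = cls p" "fv.act p 1 = sc c" "p' \<in> carrier P" "y = cls p'" "fv.act p' 1 = sc c'"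
    unfolding scalar_on_vac_def by blast
  moreover from this have "fv.act (p * p') 1 = sc (c' * c)"
    using wlin_simps(2)[OF fv.wlin_act, of p c' 1] by (simp add: fv.act_mult mult_single)
  ultimately show ?case unfolding scalar_on_vac_def
    by (intro bexI[of _ "p * p'"]) (auto simp: cls_mult free_algebra_mult)
qed

text \<open>The Borel element acts first and returns a multiple of the vacuum; the scalar then
  passes through the action of \<open>x\<close>. So \<open>phi\<close> is multiplicative on the
  right by the Borel part and a character there.\<close>

lemma phi_mult:
  assumes "x \<in> carrier U" "b \<in> carrier Ug"
  shows "phi (x \<otimes>\<^bsub>U\<^esub> b) = phi x * phi b"
proof -
  obtain p c where p: "p \<in> carrier P" "b = cls p" "fv.act p 1 = sc c"
    using scalar_on_vac[OF assms(2)] unfolding scalar_on_vac_def by blast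
  obtain y where y: "y \<in> carrier P" "x = cls y" using assms(1) unfolding cls_carrier by blast
  have "fv.act (y * p) 1 = sc c * fv.act y 1"
    using wlin_simps(2)[OF fv.wlin_act, of y c 1] p(3) by (simp add: fv.act_mult)
  then show ?thesis
    using p y by (simp add: cls_mult phi_cls free_algebra_mult vac_def)
qed

lemma phi_one: "phi \<one>\<^bsub>U\<^esub> = 1"
  using phi_cls[of 1] by (simp add: cls_one free_algebra_closed vac_def fv.act_one)

lemma phi_Ug: "phi \<in> algebra_hom Ug ground_algebra" and phi_U0: "phi \<in> torus_chars n r s"
  using subsetD[OF Ug_sub] subsetD[OF U0_Ug]
  by (auto simp: torus_chars_def algebra_hom_def Ring.ring_hom_def U0_simps Ug_simps phi_add phi_sc phi_mult phi_one)

end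

section \<open>Verma modules and their simple quotients\<close>

lemma quotient_left_module:
  assumes "left_module R M" "Module.submodule N R M"
  shows "left_module R (quotient M N)" and "abelian_subgroup N M"
    and "\<And>a x. a \<in> carrier R \<Longrightarrow> x \<in> carrier M \<Longrightarrow> a \<odot>\<^bsub>quotient M N\<^esub> (N +>\<^bsub>M\<^esub> x) = N +>\<^bsub>M\<^esub> (a \<odot>\<^bsub>M\<^esub> x)"
    and "\<And>x y. x \<in> carrier M \<Longrightarrow> y \<in> carrier M \<Longrightarrow> (N +>\<^bsub>M\<^esub> x) \<oplus>\<^bsub>quotient M N\<^esub> (N +>\<^bsub>M\<^esub> y) = N +>\<^bsub>M\<^esub> (x \<oplus>\<^bsub>M\<^esub> y)"
proof -
  interpret left_module R M by fact
  note N = submoduleD[OF assms(2)]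
  show ab: "abelian_subgroup N M"
    by (rule abelian_subgroupI3) (use N(5) M.abelian_group_axioms in \<open>auto simp: additive_subgroup_def\<close>)
  interpret N: abelian_subgroup N M by fact
  show act: "a \<odot>\<^bsub>quotient M N\<^esub> (N +>\<^bsub>M\<^esub> x) = N +>\<^bsub>M\<^esub> (a \<odot>\<^bsub>M\<^esub> x)" if "a \<in> carrier R" "x \<in> carrier M" for a x
    by (rule quotient_smult[OF ab that(2)]) (use that smult_closed smult_r_distr N(4) in auto)
  show add: "(N +>\<^bsub>M\<^esub> x) \<oplus>\<^bsub>quotient M N\<^esub> (N +>\<^bsub>M\<^esub> y) = N +>\<^bsub>M\<^esub> (x \<oplus>\<^bsub>M\<^esub> y)" if "x \<in> carrier M" "y \<in> carrier M" for x y
    using N.a_rcos_sum[OF that] by simp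
  show "left_module R (quotient M N)"
  proof (intro left_module.intro left_module_axioms.intro R.ring_axioms quotient_abelian_group[OF ab])
    fix a b X Y assume a: "a \<in> carrier R" and X: "X \<in> carrier (quotient M N)"
    obtain x where x: "x \<in> carrier M" "X = N +>\<^bsub>M\<^esub> x" using X unfolding quotient_carrier by blast
    show "a \<odot>\<^bsub>quotient M N\<^esub> X \<in> carrier (quotient M N)"
      unfolding x(2) act[OF a x(1)] quotient_carrier by (rule imageI[OF smult_closed[OF a x(1)]])
    { assume b: "b \<in> carrier R"
      show "(a \<oplus>\<^bsub>R\<^esub> b) \<odot>\<^bsub>quotient M N\<^esub> X = (a \<odot>\<^bsub>quotient M N\<^esub> X) \<oplus>\<^bsub>quotient M N\<^esub> (b \<odot>\<^bsub>quotient M N\<^esub> X)"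
        unfolding x(2) act[OF a x(1)] act[OF b x(1)] act[OF R.a_closed[OF a b] x(1)]
          add[OF smult_closed[OF a x(1)] smult_closed[OF b x(1)]] smult_l_distr[OF a b x(1)] ..
      show "(a \<otimes>\<^bsub>R\<^esub> b) \<odot>\<^bsub>quotient M N\<^esub> X = a \<odot>\<^bsub>quotient M N\<^esub> (b \<odot>\<^bsub>quotient M N\<^esub> X)"
        unfolding x(2) act[OF b x(1)] act[OF R.m_closed[OF a b] x(1)] act[OF a smult_closed[OF b x(1)]] smult_assoc1[OF a b x(1)] .. }
    { assume "Y \<in> carrier (quotient M N)"
      then obtain y where y: "y \<in> carrier M" "Y = N +>\<^bsub>M\<^esub> y" unfolding quotient_carrier by blast
      show "a \<odot>\<^bsub>quotient M N\<^esub> (X \<oplus>\<^bsub>quotient M N\<^esub> Y) = (a \<odot>\<^bsub>quotient M N\<^esub> X) \<oplus>\<^bsub>quotient M N\<^esub> (a \<odot>\<^bsub>quotient M N\<^esub> Y)"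
        unfolding x(2) y(2) act[OF a x(1)] act[OF a y(1)] add[OF x(1) y(1)] act[OF a M.a_closed[OF x(1) y(1)]]
          add[OF smult_closed[OF a x(1)] smult_closed[OF a y(1)]] smult_r_distr[OF a x(1) y(1)] .. }
  next
    fix X assume X: "X \<in> carrier (quotient M N)"
    obtain x where x: "x \<in> carrier M" "X = N +>\<^bsub>M\<^esub> x" using X unfolding quotient_carrier by blast
    show "\<one>\<^bsub>R\<^esub> \<odot>\<^bsub>quotient M N\<^esub> X = X" unfolding x(2) act[OF R.one_closed x(1)] smult_one[OF x(1)] ..
  qed
qed

lemma coset_zero_iff:
  fixes M :: "('a, 'v) module"
  assumes "abelian_subgroup N M" "x \<in> carrier M"
  shows "N +>\<^bsub>M\<^esub> x = N \<longleftrightarrow> x \<in> N"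
proof -
  interpret abelian_subgroup N M by fact
  have "N +>\<^bsub>M\<^esub> x = N \<longleftrightarrow> N +>\<^bsub>M\<^esub> x = N +>\<^bsub>M\<^esub> \<zero>\<^bsub>M\<^esub>" using a_coset_add_zero[OF a_subset] by simp
  also have "\<dots> \<longleftrightarrow> x \<in> N"
  proof -
    have "\<ominus>\<^bsub>M\<^esub> \<zero>\<^bsub>M\<^esub> = \<zero>\<^bsub>M\<^esub>" by (rule minus_equality) simp_all
    then have "x \<ominus>\<^bsub>M\<^esub> \<zero>\<^bsub>M\<^esub> = x" using r_zero[OF assms(2)] by (simp only: minus_eq)
    then show ?thesis unfolding coset_eq_iff[OF assms(2) zero_closed] by (simp only:)
  qed
  finally show ?thesis .
qed

text \<open>Submodules of the quotient pull back to submodules that contain \<open>N\<close>, and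
  maximality leaves two of them. Closure under negatives comes from acting by -1 in the
  algebra.\<close>

lemma max_submodule_simple:
  assumes "left_module A M" "max_submodule A M N"
  shows "simple_module A (quotient M N)"
proof -
  interpret left_module A M by fact
  have sub: "Module.submodule N A M" and ne: "N \<noteq> carrier M"
    and mx: "\<And>N'. Module.submodule N' A M \<Longrightarrow> N \<subseteq> N' \<Longrightarrow> N' \<noteq> carrier M \<Longrightarrow> N' = N"
  proof -
    note mxd = assms(2)[unfolded max_submodule_def]
    show "Module.submodule N A M" by (rule conjunct1[OF mxd])
    show "N \<noteq> carrier M" by (rule conjunct1[OF conjunct2[OF mxd]])
    show "N' = N" if "Module.submodule N' A M" "N \<subseteq> N'" "N' \<noteq> carrier M" for N'
      by (rule mp[OF spec[OF conjunct2[OF conjunct2[OF mxd]]]]) (intro conjI that)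
  qed
  note Q = quotient_left_module[OF assms(1) sub]
  interpret N: abelian_subgroup N M by (rule Q(2))
  note Nd = submoduleD[OF sub]
  obtain x0 where x0: "x0 \<in> carrier M" "x0 \<notin> N" using ne Nd(1) by blast
  show ?thesis
    unfolding simple_module_def
  proof (intro conjI allI impI Q(1))
    have "N +>\<^bsub>M\<^esub> x0 \<in> carrier (quotient M N)" "N +>\<^bsub>M\<^esub> x0 \<noteq> N"
      unfolding quotient_carrier using x0 coset_zero_iff[OF Q(2) x0(1)] by simp_all
    then show "carrier (quotient M N) \<noteq> {\<zero>\<^bsub>quotient M N\<^esub>}" by (auto simp del: quotient_simps(1))
    fix K assume K: "Module.submodule K A (quotient M N)"
    note Kd = submoduleD[OF K]
    let ?K = "{x \<in> carrier M. N +>\<^bsub>M\<^esub> x \<in> K}"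
    have NK: "N \<subseteq> ?K"
    proof
      fix x assume "x \<in> N"
      then show "x \<in> ?K" using Nd(1) coset_zero_iff[OF Q(2), of x] Kd(2) by auto
    qed
    have "Module.submodule ?K A M"
    proof (intro Module.submodule.intro Module.submodule_axioms.intro)
      show "subgroup ?K (add_monoid M)"
      proof (rule M.add.subgroupI)
        show "?K \<noteq> {}" using NK Nd(2) by blast
        fix x assume x: "x \<in> ?K"
        have m1: "\<ominus>\<^bsub>A\<^esub> \<one>\<^bsub>A\<^esub> \<in> carrier A" by simp
        have xM: "x \<in> carrier M" "N +>\<^bsub>M\<^esub> x \<in> K" using x by simp_all
        have "N +>\<^bsub>M\<^esub> (\<ominus>\<^bsub>A\<^esub> \<one>\<^bsub>A\<^esub> \<odot>\<^bsub>M\<^esub> x) \<in> K" using Kd(4)[OF m1 xM(2)] unfolding Q(3)[OF m1 xM(1)] .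
        moreover have "\<ominus>\<^bsub>M\<^esub> x = \<ominus>\<^bsub>A\<^esub> \<one>\<^bsub>A\<^esub> \<odot>\<^bsub>M\<^esub> x"
        proof (rule M.minus_equality)
          have "\<ominus>\<^bsub>A\<^esub> \<one>\<^bsub>A\<^esub> \<odot>\<^bsub>M\<^esub> x \<oplus>\<^bsub>M\<^esub> \<one>\<^bsub>A\<^esub> \<odot>\<^bsub>M\<^esub> x = \<zero>\<^bsub>A\<^esub> \<odot>\<^bsub>M\<^esub> x"
            using smult_l_distr[of "\<ominus>\<^bsub>A\<^esub> \<one>\<^bsub>A\<^esub>" "\<one>\<^bsub>A\<^esub>" x] x R.l_neg[OF R.one_closed] by simp
          moreover have "\<zero>\<^bsub>A\<^esub> \<odot>\<^bsub>M\<^esub> x = \<zero>\<^bsub>M\<^esub>"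
            using smult_l_distr[of "\<zero>\<^bsub>A\<^esub>" "\<zero>\<^bsub>A\<^esub>" x] smult_closed[of "\<zero>\<^bsub>A\<^esub>" x] x by simp
          ultimately show "\<ominus>\<^bsub>A\<^esub> \<one>\<^bsub>A\<^esub> \<odot>\<^bsub>M\<^esub> x \<oplus>\<^bsub>M\<^esub> x = \<zero>\<^bsub>M\<^esub>" using smult_one[of x] x by simp
        qed (use x smult_closed[of "\<ominus>\<^bsub>A\<^esub> \<one>\<^bsub>A\<^esub>" x] in auto)
        ultimately show "\<ominus>\<^bsub>M\<^esub> x \<in> ?K" using smult_closed[OF m1 xM(1)] by simp
        fix y assume y: "y \<in> ?K"
        then have yM: "y \<in> carrier M" "N +>\<^bsub>M\<^esub> y \<in> K" by simp_all
        have "N +>\<^bsub>M\<^esub> (x \<oplus>\<^bsub>M\<^esub> y) \<in> K" using Kd(3)[OF xM(2) yM(2)] unfolding Q(4)[OF xM(1) yM(1)] .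
        then show "x \<oplus>\<^bsub>M\<^esub> y \<in> ?K" using xM(1) yM(1) by simp
      qed auto
      fix a x assume a: "a \<in> carrier A" and "x \<in> ?K"
      then have xM: "x \<in> carrier M" "N +>\<^bsub>M\<^esub> x \<in> K" by simp_all
      have "N +>\<^bsub>M\<^esub> (a \<odot>\<^bsub>M\<^esub> x) \<in> K" using Kd(4)[OF a xM(2)] unfolding Q(3)[OF a xM(1)] .
      then show "a \<odot>\<^bsub>M\<^esub> x \<in> ?K" using smult_closed[OF a xM(1)] by simp
    qed
    then have "?K = carrier M \<or> ?K = N" using mx[OF _ NK] by (cases "?K = carrier M") simp_all
    then show "K = {\<zero>\<^bsub>quotient M N\<^esub>} \<or> K = carrier (quotient M N)"
    proof
      assume KM: "?K = carrier M"
      have "(\<lambda>x. N +>\<^bsub>M\<^esub> x) ` carrier M \<subseteq> K"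
      proof (rule image_subsetI)
        fix x assume "x \<in> carrier M"
        then have "x \<in> ?K" unfolding KM .
        then show "N +>\<^bsub>M\<^esub> x \<in> K" by simp
      qed
      then have "carrier (quotient M N) \<subseteq> K" unfolding quotient_carrier .
      from subset_antisym[OF Kd(1) this] show ?thesis by (rule disjI2)
    next
      assume KN: "?K = N"
      have KN1: "Y = N" if Y: "Y \<in> K" for Y
      proof -
        have "Y \<in> carrier (quotient M N)" using Kd(1) Y by blast
        then obtain y where y: "y \<in> carrier M" "Y = N +>\<^bsub>M\<^esub> y" unfolding quotient_carrier by blast
        then have "y \<in> ?K" using Y by simp
        then show ?thesis unfolding KN y(2) using coset_zero_iff[OF Q(2) y(1)] by simp
      qed
      have "K = {N}"
      proof (rule subset_antisym)
        show "K \<subseteq> {N}"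
        proof
          fix Y assume "Y \<in> K"
          then have "Y = N" by (rule KN1)
          then show "Y \<in> {N}" by simp
        qed
        show "{N} \<subseteq> K" using Kd(2) by simp
      qed
      then show ?thesis by (intro disjI1) simp
    qed
  qed
qed

text \<open>The restricted vacuum functional with eigenvalues r^(lam i), s^(lam i) satisfies the
  description of \<open>weight_char\<close>, and agreement on a_i and b_i makes it the only
  solution.\<close>

lemma (in verma_data) weight_char_props:
  assumes al: "\<And>i. i \<in> {1..n} \<Longrightarrow> \<alpha> i = r powi lam i" and be: "\<And>i. i \<in> {1..n} \<Longrightarrow> \<beta> i = s powi lam i"
  shows "weight_char n r s lam \<in> torus_chars n r s"
    and "i \<in> {1..n} \<Longrightarrow> weight_char n r s lam (gen_Urs n r s (Gen_a i)) = r powi lam i"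
    and "i \<in> {1..n} \<Longrightarrow> weight_char n r s lam (gen_Urs n r s (Gen_b i)) = s powi lam i"
proof -
  have ip: "ip n (eps i) lam = lam i" if "i \<in> {1..n}" for i
  proof -
    have "ip n (eps i) lam = (\<Sum>k = 1..n. if k = i then lam k else 0)"
      unfolding ip_def eps_def by (rule sum.cong) simp_all
    then show ?thesis using that by simp
  qed
  let ?Q = "\<lambda>h. h \<in> torus_chars n r s \<inter> extensional (carrier (Urs0 n r s)) \<and>
        (\<forall>i\<in>{1..n}. h (u (Gen_a i)) = r powi ip n (eps i) lam \<and> h (u (Gen_b i)) = s powi ip n (eps i) lam)"
  have gm: "u (Gen_a i) \<in> carrier U0" "u (Gen_b i) \<in> carrier U0" if "i \<in> {1..n}" for i
    using that by (auto intro!: U0_gen gens_mem simp del: One_nat_def)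
  have "restrict phi (carrier U0) \<in> torus_chars n r s"
    using U.restrict_char[OF torus_sub phi_U0[unfolded torus_chars_def Urs0_def]] unfolding torus_chars_def Urs0_def .
  then have ex: "?Q (restrict phi (carrier U0))"
    using scalar_on_vac_gens(2,3) gm ip al be by (simp del: One_nat_def atLeastAtMost_iff)
  have uniq: "h = h'" if h: "?Q h" "?Q h'" for h h'
  proof (rule extensionalityI)
    show "h \<in> extensional (carrier U0)" "h' \<in> extensional (carrier U0)" using h by blast+
    show "h x = h' x" if "x \<in> carrier U0" for x
      by (rule torus_char_eq) (use h that in \<open>simp_all del: One_nat_def atLeastAtMost_iff\<close>)
  qed
  have "\<exists>!h. ?Q h"
    by (rule ex1I[where P = "?Q" and a = "restrict phi (carrier U0)"], rule ex, erule uniq[OF _ ex])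
  from theI'[OF this] have "?Q (weight_char n r s lam)" unfolding weight_char_def .
  then show "weight_char n r s lam \<in> torus_chars n r s"
    and "i \<in> {1..n} \<Longrightarrow> weight_char n r s lam (gen_Urs n r s (Gen_a i)) = r powi lam i"
    and "i \<in> {1..n} \<Longrightarrow> weight_char n r s lam (gen_Urs n r s (Gen_b i)) = s powi lam i"
    using ip by (simp_all del: One_nat_def atLeastAtMost_iff)
qed

section \<open>The Verma module and its maximal submodule\<close>

locale torus_verma = verma_data n r s \<alpha> \<beta> for n :: nat and r s :: "'k::field" and \<alpha> \<beta> :: "nat \<Rightarrow> 'k" +
  fixes \<psi> :: "'k Urs_elem \<Rightarrow> 'k"
  assumes psi: "\<psi> \<in> torus_chars n r s"
    and psi_a: "\<And>i. i \<in> {1..n} \<Longrightarrow> \<psi> (u (Gen_a i)) = \<alpha> i"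
    and psi_b: "\<And>i. i \<in> {1..n} \<Longrightarrow> \<psi> (u (Gen_b i)) = \<beta> i"
begin

lemma psi_phi: "x \<in> carrier U0 \<Longrightarrow> \<psi> x = phi x"
  by (rule torus_char_eq[OF psi phi_U0]) (simp_all add: psi_a psi_b scalar_on_vac_gens del: One_nat_def atLeastAtMost_iff)

text \<open>\<open>phi\<close> extends \<psi> from the torus and kills the e_j, so its restriction
  is the character that the description of \<open>Urs_ge0_char\<close> singles out.\<close>

lemma borel_char: "x \<in> carrier Ug \<Longrightarrow> Urs_ge0_char n r s \<psi> x = phi x"
proof -
  let ?Q = "\<lambda>h. h \<in> algebra_hom Ug ground_algebra \<inter> extensional (carrier Ug) \<and>
    (\<forall>x\<in>carrier U0. h x = \<psi> x) \<and> (\<forall>j\<in>{1..<n}. h (u (Gen_e j)) = 0)"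
  have e: "u (Gen_e j) \<in> carrier Ug" if "j \<in> {1..<n}" for j
    unfolding Urs_ge0_def using that by (intro U.generated_subalgebra_closed(3)) blast
  have "restrict phi (carrier Ug) \<in> algebra_hom Ug ground_algebra"
    using U.restrict_char[OF borel_sub phi_Ug[unfolded Urs_ge0_def]] unfolding Urs_ge0_def .
  then have ex: "?Q (restrict phi (carrier Ug))"
    using scalar_on_vac_gens(1) e subsetD[OF U0_Ug] psi_phi by (simp del: One_nat_def atLeastLessThan_iff)
  have uniq: "h = restrict phi (carrier Ug)" if h: "?Q h" for h
  proof (rule extensionalityI)
    show "h \<in> extensional (carrier Ug)" using h by blast
    show "restrict phi (carrier Ug) \<in> extensional (carrier Ug)" by simp
    fix x assume x: "x \<in> carrier Ug"
    have "h x = phi x"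
    proof (rule U.char_eq[OF borel_sub _ phi_Ug[unfolded Urs_ge0_def] _ x[unfolded Urs_ge0_def]])
      show "h \<in> algebra_hom (generated_subalgebra U (u ` (torus_gens n \<union> Gen_e ` {1..<n}))) ground_algebra"
        using h unfolding Urs_ge0_def by blast
      fix y assume "y \<in> u ` (torus_gens n \<union> Gen_e ` {1..<n})"
      then obtain g where g: "g \<in> torus_gens n \<union> Gen_e ` {1..<n}" "y = u g" by blast
      show "h y = phi y"
      proof (cases "g \<in> torus_gens n")
        case True
        then show ?thesis using h psi_phi[OF U0_gen[OF True]] U0_gen[OF True] g(2) by simp
      next
        case False
        then obtain j where j: "j \<in> {1..<n}" "g = Gen_e j" using g(1) by blast
        then show ?thesis using h scalar_on_vac_gens(1)[OF j(1)] g(2) by simp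
      qed
    qed
    then show "h x = restrict phi (carrier Ug) x" using x by simp
  qed
  have "Urs_ge0_char n r s \<psi> = restrict phi (carrier Ug)"
    unfolding Urs_ge0_char_def
    by (rule the_equality[where P = "?Q" and a = "restrict phi (carrier Ug)"], rule ex, erule uniq)
  then show "x \<in> carrier Ug \<Longrightarrow> Urs_ge0_char n r s \<psi> x = phi x" by simp
qed

abbreviation "RR \<equiv> right_regular U"
abbreviation "Vp \<equiv> Vpsi n r s \<psi>"
abbreviation "VV \<equiv> Verma n r s \<psi>"
abbreviation "pt \<equiv> pure_tensor Ug RR Vp"

lemma RR_simps [simp]: "carrier RR = carrier U" "ring.add RR = ring.add U" "ring.zero RR = ring.zero U" "b \<odot>\<^bsub>RR\<^esub> x = x \<otimes>\<^bsub>U\<^esub> b"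
  and Vp_simps [simp]: "carrier Vp = UNIV" "ring.add Vp = (+)" "ring.zero Vp = 0" "b \<in> carrier Ug \<Longrightarrow> b \<odot>\<^bsub>Vp\<^esub> c = phi b * c"
  by (simp_all add: right_regular_def Vpsi_def borel_char)

sublocale D: tensor_data Ug RR Vp
proof (intro tensor_data.intro tensor_data_axioms.intro)
  show "abelian_group RR"
  proof (rule abelian_groupI, unfold RR_simps)
    show "\<exists>y\<in>carrier U. y \<oplus>\<^bsub>U\<^esub> x = \<zero>\<^bsub>U\<^esub>" if "x \<in> carrier U" for x
      using that U.l_neg[of x] U.a_inv_closed[of x] by blast
  qed (rule U.a_closed U.zero_closed U.a_assoc U.a_comm U.l_zero; assumption)+
  show "abelian_group Vp"
  proof (rule abelian_groupI)
    show "\<exists>y\<in>carrier Vp. y \<oplus>\<^bsub>Vp\<^esub> x = \<zero>\<^bsub>Vp\<^esub>" if "x \<in> carrier Vp" for x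
      by (rule bexI[of _ "- x"]) simp_all
  qed (simp_all add: Groups.add_ac)
qed (use Ug_sub in auto)

lemma VV_simps: "carrier VV = carrier D.T" "ring.zero VV = \<one>\<^bsub>D.T\<^esub>" "ring.add VV = monoid.mult D.T"
  by (simp_all add: Verma_def induced_module_def)

text \<open>Left multiplication commutes with the right action of the Borel part, so it induces a
  homomorphism, and the union in the record is the value of that homomorphism.\<close>

lemma VV_act:
  assumes a: "a \<in> carrier U"
  obtains h where "h \<in> hom D.T D.T" "\<And>x c. x \<in> carrier U \<Longrightarrow> h (pt x c) = pt (a \<otimes>\<^bsub>U\<^esub> x) c"
    "\<And>z. z \<in> carrier VV \<Longrightarrow> a \<odot>\<^bsub>VV\<^esub> z = h z"
proof -
  have "balanced_map Ug RR Vp D.T (\<lambda>x c. pt (a \<otimes>\<^bsub>U\<^esub> x) c)"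
    unfolding balanced_map_def
  proof (intro conjI ballI)
    fix x x' y assume x: "x \<in> carrier RR" "x' \<in> carrier RR" "y \<in> carrier Vp"
    show "pt (a \<otimes>\<^bsub>U\<^esub> (x \<oplus>\<^bsub>RR\<^esub> x')) y = pt (a \<otimes>\<^bsub>U\<^esub> x) y \<otimes>\<^bsub>D.T\<^esub> pt (a \<otimes>\<^bsub>U\<^esub> x') y"
      using D.pt_simps(1)[of "a \<otimes>\<^bsub>U\<^esub> x" "a \<otimes>\<^bsub>U\<^esub> x'" y] x a by (simp add: U.r_distr)
  next
    fix x y y' assume x: "x \<in> carrier RR" "y \<in> carrier Vp" "y' \<in> carrier Vp"
    show "pt (a \<otimes>\<^bsub>U\<^esub> x) (y \<oplus>\<^bsub>Vp\<^esub> y') = pt (a \<otimes>\<^bsub>U\<^esub> x) y \<otimes>\<^bsub>D.T\<^esub> pt (a \<otimes>\<^bsub>U\<^esub> x) y'"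
      using D.pt_simps(2)[of "a \<otimes>\<^bsub>U\<^esub> x" y y'] x a by simp
  next
    fix b x y assume x: "b \<in> carrier Ug" "x \<in> carrier RR" "y \<in> carrier Vp"
    then show "pt (a \<otimes>\<^bsub>U\<^esub> (b \<odot>\<^bsub>RR\<^esub> x)) y = pt (a \<otimes>\<^bsub>U\<^esub> x) (b \<odot>\<^bsub>Vp\<^esub> y)"
      using D.pt_simps(3)[of b "a \<otimes>\<^bsub>U\<^esub> x" y] subsetD[OF Ug_sub x(1)] a by (simp add: U.m_assoc)
  qed (use a in simp)
  then obtain h where h: "h \<in> hom D.T D.T" "\<forall>x\<in>carrier RR. \<forall>c\<in>carrier Vp. h (pt x c) = pt (a \<otimes>\<^bsub>U\<^esub> x) c"
    using D.T_universal[OF D.T.comm_group_axioms] by blast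
  have "a \<odot>\<^bsub>VV\<^esub> z = h z" if z: "z \<in> carrier VV" for z
  proof -
    have "(\<Union>t\<in>z. D.tcls (frag_extend (\<lambda>(x, v). frag_of (a \<otimes>\<^bsub>U\<^esub> x, v)) t)) = h z"
      by (rule D.frag_extend_tcls[OF D.tensor_data_axioms h(1)])
         (use h(2) a z D.F_pure in \<open>simp_all add: pure_tensor_def VV_simps del: carrier_free_Abelian_group_iff\<close>)
    then show ?thesis by (simp add: Verma_def induced_module_def)
  qed
  with h show ?thesis by (intro that[of h]) simp_all
qed

lemma VV_act_pt: "a \<in> carrier U \<Longrightarrow> x \<in> carrier U \<Longrightarrow> a \<odot>\<^bsub>VV\<^esub> pt x c = pt (a \<otimes>\<^bsub>U\<^esub> x) c"
  by (erule VV_act) (simp add: VV_simps)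

lemma VV_act_closed: "a \<in> carrier U \<Longrightarrow> z \<in> carrier VV \<Longrightarrow> a \<odot>\<^bsub>VV\<^esub> z \<in> carrier VV"
  by (erule VV_act) (auto simp: VV_simps hom_def)

lemma VV_act_add:
  "a \<in> carrier U \<Longrightarrow> z \<in> carrier VV \<Longrightarrow> z' \<in> carrier VV \<Longrightarrow> a \<odot>\<^bsub>VV\<^esub> (z \<oplus>\<^bsub>VV\<^esub> z') = (a \<odot>\<^bsub>VV\<^esub> z) \<oplus>\<^bsub>VV\<^esub> (a \<odot>\<^bsub>VV\<^esub> z')"
  by (erule VV_act) (simp add: VV_simps hom_mult)

lemma VV_abelian: "abelian_group VV" by (rule D.T_abelian_group[OF VV_simps])

lemma VV_pt_add: "x \<in> carrier U \<Longrightarrow> x' \<in> carrier U \<Longrightarrow> pt (x \<oplus>\<^bsub>U\<^esub> x') c = pt x c \<oplus>\<^bsub>VV\<^esub> pt x' c"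
  using D.pt_simps(1)[of x x' c] by (simp add: VV_simps)

lemma VV_induct [consumes 1, case_names pt add]:
  assumes "z \<in> carrier VV"
    and "\<And>x c. x \<in> carrier U \<Longrightarrow> Q (pt x c)"
    and "\<And>z z'. z \<in> carrier VV \<Longrightarrow> z' \<in> carrier VV \<Longrightarrow> Q z \<Longrightarrow> Q z' \<Longrightarrow> Q (z \<oplus>\<^bsub>VV\<^esub> z')"
  shows "Q z"
  using assms(1) unfolding VV_simps
  by (rule D.T_induct) (use assms(2,3) in \<open>simp_all add: VV_simps\<close>)

lemma left_module_VV: "left_module U VV"
proof (intro left_module.intro left_module_axioms.intro ring_U VV_abelian VV_act_closed VV_act_add; assumption?)
  interpret V: abelian_group VV by (rule VV_abelian)
  fix z assume z: "z \<in> carrier VV"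
  show "\<one>\<^bsub>U\<^esub> \<odot>\<^bsub>VV\<^esub> z = z"
    using z by (induction z rule: VV_induct) (simp_all add: VV_act_pt VV_act_add)
  fix a b assume ab: "a \<in> carrier U" "b \<in> carrier U"
  show "(a \<otimes>\<^bsub>U\<^esub> b) \<odot>\<^bsub>VV\<^esub> z = a \<odot>\<^bsub>VV\<^esub> (b \<odot>\<^bsub>VV\<^esub> z)"
    using z by (induction z rule: VV_induct) (use ab in \<open>simp_all add: VV_act_pt VV_act_add VV_act_closed U.m_assoc\<close>)
  show "(a \<oplus>\<^bsub>U\<^esub> b) \<odot>\<^bsub>VV\<^esub> z = (a \<odot>\<^bsub>VV\<^esub> z) \<oplus>\<^bsub>VV\<^esub> (b \<odot>\<^bsub>VV\<^esub> z)"
    using z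
  proof (induction z rule: VV_induct)
    case (pt x c)
    then show ?case using ab by (simp add: VV_act_pt VV_pt_add U.l_distr)
  next
    case (add z z')
    then show ?case
      using ab V.add.m_ac by (simp add: VV_act_add VV_act_closed V.a_assoc V.a_lcomm)
  qed
qed

definition m0 where "m0 = pt \<one>\<^bsub>U\<^esub> 1"

sublocale VM: umod n r s VV
  by (rule umodI[OF left_module_VV r_nz s_nz])

lemma m0_closed: "m0 \<in> carrier VV" by (simp add: m0_def VV_simps)

text \<open>The coordinate \<open>c\<close> is moved across the tensor sign as the Borel scalar
  \<open>c\<close>, and then to the left of the generator.\<close>

lemma pt_m0: "x \<in> carrier U \<Longrightarrow> pt x c = x \<odot>\<^bsub>VV\<^esub> VM.sm c m0"
proof -
  assume x: "x \<in> carrier U"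
  have c: "c \<odot>\<^bsub>U\<^esub> \<one>\<^bsub>U\<^esub> \<in> carrier Ug" by (rule Ug_closed(2))
  have "phi (c \<odot>\<^bsub>U\<^esub> \<one>\<^bsub>U\<^esub>) = c" by (simp add: phi_sc phi_one)
  then have "pt x c = pt (x \<otimes>\<^bsub>U\<^esub> (c \<odot>\<^bsub>U\<^esub> \<one>\<^bsub>U\<^esub>)) 1"
    using D.pt_simps(3)[of "c \<odot>\<^bsub>U\<^esub> \<one>\<^bsub>U\<^esub>" x 1] x c by simp
  also have "\<dots> = x \<odot>\<^bsub>VV\<^esub> VM.sm c m0"
    using x by (simp add: VM.sm_def m0_def VV_act_pt)
  finally show "pt x c = x \<odot>\<^bsub>VV\<^esub> VM.sm c m0" .
qed

lemma borel_m0: "b \<in> carrier Ug \<Longrightarrow> b \<odot>\<^bsub>VV\<^esub> m0 = VM.sm (phi b) m0"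
proof -
  assume b: "b \<in> carrier Ug"
  have bU: "b \<in> carrier U" using Ug_sub b by blast
  have "b \<odot>\<^bsub>VV\<^esub> m0 = pt \<one>\<^bsub>U\<^esub> (phi b)"
    using D.pt_simps(3)[of b "\<one>\<^bsub>U\<^esub>" 1] b bU by (simp add: m0_def VV_act_pt)
  then show ?thesis using pt_m0[of "\<one>\<^bsub>U\<^esub>" "phi b"] VM.act_one m0_closed by simp
qed

text \<open>The assignment x (x) c to c phi(x) is balanced by \<open>phi_mult\<close>, so it is a
  well-defined homomorphism, and it takes the value 1 on \<open>m0\<close>.\<close>

lemma m0_nonzero: "m0 \<noteq> \<zero>\<^bsub>VV\<^esub>"
proof
  assume m0: "m0 = \<zero>\<^bsub>VV\<^esub>"
  have cg: "comm_group (add_monoid Vp)" by (rule D.N.a_comm_group)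
  have "balanced_map Ug RR Vp (add_monoid Vp) (\<lambda>x c. c * phi x)"
    unfolding balanced_map_def
  proof (intro conjI ballI)
    fix b x y assume "b \<in> carrier Ug" "x \<in> carrier RR" "y \<in> carrier Vp"
    then show "y * phi (b \<odot>\<^bsub>RR\<^esub> x) = (b \<odot>\<^bsub>Vp\<^esub> y) * phi x" by (simp add: phi_mult)
  qed (simp_all add: phi_add algebra_simps)
  then obtain h where h: "h \<in> hom D.T (add_monoid Vp)" "\<forall>x\<in>carrier RR. \<forall>c\<in>carrier Vp. h (pt x c) = c * phi x"
    using D.T_universal[OF cg] by blast
  have "h m0 = 1" using h(2) by (simp add: m0_def phi_one)
  moreover have "h (\<one>\<^bsub>D.T\<^esub>) = 0"
    using hom_one[OF h(1) D.T.is_group comm_group.axioms(2)[OF cg]] by simp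
  ultimately show False using m0 VV_simps(2) by simp
qed

sublocale H: hw_mod n r s \<alpha> \<beta> VV m0
proof (intro hw_mod.intro hw_mod_axioms.intro fv.free_verma_axioms VM.umod_axioms m0_closed m0_nonzero)
  show "u (Gen_e j) \<odot>\<^bsub>VV\<^esub> m0 = \<zero>\<^bsub>VV\<^esub>" if j: "j \<in> {1..<n}" for j
  proof -
    have "u (Gen_e j) \<in> carrier Ug" unfolding Urs_ge0_def using j by (intro U.generated_subalgebra_closed(3)) blast
    then show ?thesis using borel_m0 scalar_on_vac_gens(1)[OF j] VM.sm_simps(5)[OF m0_closed] by simp
  qed
  show "u (Gen_a i) \<odot>\<^bsub>VV\<^esub> m0 = VM.sm (\<alpha> i) m0" if i: "i \<in> {1..n}" for i
    using borel_m0[OF subsetD[OF U0_Ug U0_gen[OF gens_mem(8)[OF i]]]] scalar_on_vac_gens(2)[OF i] by simp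
  show "u (Gen_b i) \<odot>\<^bsub>VV\<^esub> m0 = VM.sm (\<beta> i) m0" if i: "i \<in> {1..n}" for i
    using borel_m0[OF subsetD[OF U0_Ug U0_gen[OF gens_mem(9)[OF i]]]] scalar_on_vac_gens(3)[OF i] by simp
qed

lemma H_surj: "H.pi ` fv.Fn = carrier VV"
proof (rule subset_antisym)
  show "H.pi ` fv.Fn \<subseteq> carrier VV" by (rule image_subsetI) simp
  note S = submoduleD[OF H.Fn_submodule]
  show "carrier VV \<subseteq> H.pi ` fv.Fn"
  proof
    fix z assume "z \<in> carrier VV"
    then show "z \<in> H.pi ` fv.Fn"
    proof (induction z rule: VV_induct)
      case (pt x c)
      show ?case unfolding pt_m0[OF pt] by (rule S(4)[OF pt VM.submodule_sm[OF H.Fn_submodule H.v_in_Fn]])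
    next
      case (add z z')
      show ?case by (rule S(3)[OF add(3,4)])
    qed
  qed
qed

lemma rad_proper: "H.pi ` fv.rad \<noteq> carrier VV"
proof
  assume "H.pi ` fv.rad = carrier VV"
  with m0_closed have "m0 \<in> H.pi ` fv.rad" by simp
  then show False using H.v_notin_rad by (rule notE[rotated])
qed

text \<open>A proper submodule misses \<open>m0\<close>, since \<open>m0\<close> generates. All of
  them lie in the image of the radical, which is therefore the unique maximal one.\<close>

lemma proper_submodule:
  assumes "Module.submodule N U VV" "N \<noteq> carrier VV"
  shows "N \<subseteq> H.pi ` fv.rad"
proof (rule H.submodule_rad[OF assms(1) _ H_surj])
  show "m0 \<notin> N"
  proof
    assume "m0 \<in> N"
    from H.v_generates[OF assms(1) this H_surj] show False by (rule notE[OF assms(2)])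
  qed
qed

lemma max_submodule_VV: "max_submodule U VV (H.pi ` fv.rad)"
  unfolding max_submodule_def
proof (intro conjI allI impI H.rad_submodule rad_proper)
  fix N assume N: "Module.submodule N U VV \<and> H.pi ` fv.rad \<subseteq> N \<and> N \<noteq> carrier VV"
  show "N = H.pi ` fv.rad"
    by (rule subset_antisym[OF proper_submodule[OF conjunct1[OF N] conjunct2[OF conjunct2[OF N]]] conjunct1[OF conjunct2[OF N]]])
qed

lemma max_submodule_unique:
  assumes "max_submodule U VV N"
  shows "N = H.pi ` fv.rad"
proof -
  note N = assms[unfolded max_submodule_def]
  have "H.pi ` fv.rad = N"
    by (rule mp[OF spec[OF conjunct2[OF conjunct2[OF N]]]])
       (intro conjI H.rad_submodule rad_proper proper_submodule[OF conjunct1[OF N] conjunct1[OF conjunct2[OF N]]])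
  then show ?thesis ..
qed

lemma Lsimple_eq: "Lsimple n r s \<psi> = quotient VV (H.pi ` fv.rad)"
  unfolding Lsimple_def
  by (rule arg_cong[where f = "quotient VV", OF the_equality[where P = "max_submodule U VV", OF max_submodule_VV max_submodule_unique]])

lemma Lsimple_simple: "simple_module U (Lsimple n r s \<psi>)"
  unfolding Lsimple_eq by (rule max_submodule_simple[OF left_module_VV max_submodule_VV])

lemma Lsimple_hw: "hw_mod n r s \<alpha> \<beta> (Lsimple n r s \<psi>) (H.pi ` fv.rad +>\<^bsub>VV\<^esub> m0)"
proof -
  let ?N = "H.pi ` fv.rad" and ?L = "Lsimple n r s \<psi>"
  note Q = quotient_left_module[OF left_module_VV H.rad_submodule, folded Lsimple_eq]
  interpret L: umod n r s ?L by (rule umodI[OF Q(1) r_nz s_nz])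
  have z: "\<zero>\<^bsub>?L\<^esub> = ?N" by (simp add: Lsimple_eq)
  have sm: "L.sm c (?N +>\<^bsub>VV\<^esub> m0) = ?N +>\<^bsub>VV\<^esub> VM.sm c m0" for c
    unfolding L.sm_def VM.sm_def by (rule Q(3)) (simp_all add: m0_closed)
  show ?thesis
  proof (intro hw_mod.intro hw_mod_axioms.intro fv.free_verma_axioms L.umod_axioms)
    show "?N +>\<^bsub>VV\<^esub> m0 \<in> carrier ?L" unfolding Lsimple_eq quotient_carrier by (rule imageI[OF m0_closed])
    show "?N +>\<^bsub>VV\<^esub> m0 \<noteq> \<zero>\<^bsub>?L\<^esub>" unfolding z using coset_zero_iff[OF Q(2) m0_closed] H.v_notin_rad by simp
    have act: "u g \<odot>\<^bsub>?L\<^esub> (?N +>\<^bsub>VV\<^esub> m0) = L.sm c (?N +>\<^bsub>VV\<^esub> m0)"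
      if "u g \<in> carrier U" "u g \<odot>\<^bsub>VV\<^esub> m0 = VM.sm c m0" for g c
      by (rule trans[OF Q(3)[OF that(1) m0_closed] trans[OF arg_cong[where f = "\<lambda>x. ?N +>\<^bsub>VV\<^esub> x", OF that(2)] sm[symmetric]]])
    have w: "?N +>\<^bsub>VV\<^esub> m0 \<in> carrier ?L" unfolding Lsimple_eq quotient_carrier by (rule imageI[OF m0_closed])
    show "u (Gen_e j) \<odot>\<^bsub>?L\<^esub> (?N +>\<^bsub>VV\<^esub> m0) = \<zero>\<^bsub>?L\<^esub>" if j: "j \<in> {1..<n}" for j
      by (rule trans[OF act[OF u_gens_closed(1)[OF j] trans[OF H.v_e[OF j] VM.sm_simps(5)[OF m0_closed, symmetric]]] L.sm_simps(5)[OF w]])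
    show "u (Gen_a i) \<odot>\<^bsub>?L\<^esub> (?N +>\<^bsub>VV\<^esub> m0) = L.sm (\<alpha> i) (?N +>\<^bsub>VV\<^esub> m0)" if i: "i \<in> {1..n}" for i
      by (rule act[OF u_gens_closed(3)[OF i] H.v_a[OF i]])
    show "u (Gen_b i) \<odot>\<^bsub>?L\<^esub> (?N +>\<^bsub>VV\<^esub> m0) = L.sm (\<beta> i) (?N +>\<^bsub>VV\<^esub> m0)" if i: "i \<in> {1..n}" for i
      by (rule act[OF u_gens_closed(4)[OF i] H.v_b[OF i]])
  qed
qed

end

section \<open>Finite-dimensional modules\<close>

context umod
begin

text \<open>Horner evaluation of the polynomial \<open>p\<close> at the operator of
  \<open>a\<close>, applied to \<open>x\<close>.\<close>

definition pact :: "'k Urs_elem \<Rightarrow> 'k poly \<Rightarrow> 'v \<Rightarrow> 'v" where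
  "pact a p x = fold_coeffs (\<lambda>c y. sm c x \<oplus>\<^bsub>M\<^esub> (a \<odot>\<^bsub>M\<^esub> y)) p \<zero>\<^bsub>M\<^esub>"

lemma pact_zero [simp]: "pact a 0 x = \<zero>\<^bsub>M\<^esub>" by (simp add: pact_def)

context
  fixes a assumes a: "a \<in> carrier U"
begin

lemma pact_pCons: "x \<in> carrier M \<Longrightarrow> pact a (pCons c p) x = sm c x \<oplus>\<^bsub>M\<^esub> (a \<odot>\<^bsub>M\<^esub> pact a p x)"
  using a by (cases "c = 0 \<and> p = 0") (auto simp: pact_def sm_simps)

lemma pact_closed [simp]: "x \<in> carrier M \<Longrightarrow> pact a p x \<in> carrier M"
  by (induction p) (simp_all add: pact_pCons a)

lemma pact_add: "x \<in> carrier M \<Longrightarrow> pact a (p + p') x = pact a p x \<oplus>\<^bsub>M\<^esub> pact a p' x"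
  by (induction p p' rule: poly_induct2)
     (simp_all add: pact_pCons a act_add_right sm_simps M.a_assoc M.a_lcomm)

lemma pact_smult: "x \<in> carrier M \<Longrightarrow> pact a (Polynomial.smult k p) x = sm k (pact a p x)"
  by (induction p) (simp_all add: pact_pCons a act_sm sm_simps)

lemma pact_mult: "x \<in> carrier M \<Longrightarrow> pact a (p * p') x = pact a p (pact a p' x)"
  by (induction p) (simp_all add: pact_pCons a pact_add pact_smult sm_simps)

lemma pact_right: "x \<in> carrier M \<Longrightarrow> y \<in> carrier M \<Longrightarrow> pact a p (x \<oplus>\<^bsub>M\<^esub> y) = pact a p x \<oplus>\<^bsub>M\<^esub> pact a p y"
  "x \<in> carrier M \<Longrightarrow> pact a p (sm k x) = sm k (pact a p x)" "pact a p \<zero>\<^bsub>M\<^esub> = \<zero>\<^bsub>M\<^esub>"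
proof -
  show "x \<in> carrier M \<Longrightarrow> y \<in> carrier M \<Longrightarrow> pact a p (x \<oplus>\<^bsub>M\<^esub> y) = pact a p x \<oplus>\<^bsub>M\<^esub> pact a p y"
    by (induction p) (simp_all add: pact_pCons a act_add_right sm_simps M.a_assoc M.a_lcomm)
  show "x \<in> carrier M \<Longrightarrow> pact a p (sm k x) = sm k (pact a p x)"
    by (induction p) (simp_all add: pact_pCons a act_sm sm_simps mult.commute)
  show "pact a p \<zero>\<^bsub>M\<^esub> = \<zero>\<^bsub>M\<^esub>"
    by (induction p) (simp_all add: pact_pCons a sm_simps)
qed

lemma pact_eigen:
  assumes "x \<in> carrier M" "a \<odot>\<^bsub>M\<^esub> x = sm k x"
  shows "pact a p x = sm (poly p k) x"
  by (induction p) (simp_all add: pact_pCons a act_sm sm_simps assms mult.commute)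

lemma pact_commute:
  assumes "b \<in> carrier U" "x \<in> carrier M" "a \<otimes>\<^bsub>U\<^esub> b = b \<otimes>\<^bsub>U\<^esub> a" "b \<odot>\<^bsub>M\<^esub> x = sm k x"
  shows "b \<odot>\<^bsub>M\<^esub> pact a p x = sm k (pact a p x)"
proof (induction p)
  case (pCons c p)
  have "b \<odot>\<^bsub>M\<^esub> (a \<odot>\<^bsub>M\<^esub> pact a p x) = a \<odot>\<^bsub>M\<^esub> (b \<odot>\<^bsub>M\<^esub> pact a p x)"
    using assms(1-3) a by (simp add: act_mult[symmetric])
  then show ?case
    using assms a pCons.IH by (simp add: pact_pCons act_add_right act_sm sm_simps mult.commute)
qed (simp add: assms sm_simps)

text \<open>The vectors a^k x cannot all be independent in finite dimension, and a dependence among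
  them is a polynomial.\<close>

lemma annihilate_vector:
  assumes fd: "fin_dim_module U M" and x: "x \<in> carrier M"
  shows "\<exists>p. p \<noteq> 0 \<and> pact a p x = \<zero>\<^bsub>M\<^esub>"
proof -
  interpret VS: vectorspace "class_ring :: 'k ring" vs by (rule vectorspace_vs)
  define y where "y k = pact a (monom 1 k) x" for k
  have y: "y k \<in> carrier M" for k using x by (simp add: y_def)
  show ?thesis
  \<comment> \<open>Dependence is a notion for sets, so two equal powers are treated separately;
    they give a difference of monomials.\<close>
  proof (cases "inj y")
    case False
    then obtain i j where ij: "i \<noteq> j" "y i = y j" unfolding inj_def by blast
    let ?p = "monom 1 i + Polynomial.smult (- 1) (monom 1 j) :: 'k poly"
    have "coeff ?p i = 1" using ij(1) by simp
    then have "?p \<noteq> 0" by (metis coeff_0 zero_neq_one)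
    moreover have "pact a ?p x = \<zero>\<^bsub>M\<^esub>"
      using diff_eq_zero_iff[OF y[of i] y[of j]] ij(2) by (simp only: pact_add[OF x] pact_smult[OF x] y_def)
    ultimately show ?thesis by blast
  next
    case True
    then have inf: "infinite (range y)" using finite_imageD infinite_UNIV_nat by blast
    have "VS.fin_dim" using fd by (simp add: fin_dim_module_def)
    then have "VS.lin_dep (range y)" using VS.fin_dim_li_fin[of "range y"] inf y by auto
    then obtain A c v where A: "finite A" "A \<subseteq> range y" "VS.lincomb c A = \<zero>\<^bsub>M\<^esub>" "v \<in> A" "c v \<noteq> 0"
      unfolding VS.lin_dep_def by (auto simp: class_ring_simps)
    have "\<exists>p. VS.lincomb c A = pact a p x \<and> (\<forall>k. coeff p k = (if y k \<in> A then c (y k) else 0))"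
      using A(1,2)
    proof (induction A rule: finite_induct)
      case empty
      show ?case by (rule exI[of _ 0]) (simp add: VS.lincomb_def)
    next
      case (insert w A)
      then obtain p where p: "VS.lincomb c A = pact a p x" "\<forall>k. coeff p k = (if y k \<in> A then c (y k) else 0)" by blast
      obtain i where i: "w = y i" using insert by blast
      have "VS.lincomb c (insert w A) = sm (c w) w \<oplus>\<^bsub>M\<^esub> VS.lincomb c A"
        unfolding VS.lincomb_def using insert y by (subst K.finsum_insert) auto
      also have "\<dots> = pact a (Polynomial.smult (c w) (monom 1 i) + p) x"
        unfolding pact_add[OF x] pact_smult[OF x] p(1) i y_def ..
      finally have 1: "VS.lincomb c (insert w A) = pact a (Polynomial.smult (c w) (monom 1 i) + p) x" .
      have 2: "coeff (Polynomial.smult (c w) (monom 1 i) + p) k = (if y k \<in> insert w A then c (y k) else 0)" for k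
        using p(2) insert(2) i injD[OF True, of k i] by (cases "k = i") auto
      show ?case using 1 2 by blast
    qed
    then obtain p where p: "VS.lincomb c A = pact a p x" "\<forall>k. coeff p k = (if y k \<in> A then c (y k) else 0)" by blast
    obtain i where "v = y i" using A(2,4) by blast
    then have "coeff p i \<noteq> 0" using p(2) A(4,5) by simp
    then have "p \<noteq> 0" by auto
    then show ?thesis using p(1) A(3) by auto
  qed
qed

text \<open>Annihilating polynomials of a finite spanning set are multiplied; the kernel of their
  product is a subspace that contains the span.\<close>

lemma annihilate:
  assumes fd: "fin_dim_module U M"
  shows "\<exists>p. p \<noteq> 0 \<and> (\<forall>x\<in>carrier M. pact a p x = \<zero>\<^bsub>M\<^esub>)"
proof -
  interpret VS: vectorspace "class_ring :: 'k ring" vs by (rule vectorspace_vs)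
  have "VS.fin_dim" using fd by (simp add: fin_dim_module_def)
  then obtain A where A: "finite A" "A \<subseteq> carrier M" "VS.span A = carrier M" unfolding VS.fin_dim_def by auto
  have "\<exists>p. p \<noteq> 0 \<and> (\<forall>x\<in>A. pact a p x = \<zero>\<^bsub>M\<^esub>)"
    using A(1,2)
  proof (induction A rule: finite_induct)
    case empty
    show ?case by (rule exI[of _ 1]) simp
  next
    case (insert x A)
    then obtain p where p: "p \<noteq> 0" "\<forall>x\<in>A. pact a p x = \<zero>\<^bsub>M\<^esub>" by blast
    obtain p' where p': "p' \<noteq> 0" "pact a p' x = \<zero>\<^bsub>M\<^esub>" using annihilate_vector[OF fd, of x] insert by blast
    have "pact a (p * p') z = \<zero>\<^bsub>M\<^esub>" if "z \<in> insert x A" for z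
    proof -
      have z: "z \<in> carrier M" using that insert by blast
      show ?thesis
        using that p(2) p'(2) pact_mult[OF z, of p p'] pact_mult[OF z, of p' p] pact_right(3)
        by (auto simp: mult.commute)
    qed
    then show ?case using p(1) p'(1) by (intro exI[of _ "p * p'"]) simp
  qed
  then obtain p where p: "p \<noteq> 0" "\<forall>x\<in>A. pact a p x = \<zero>\<^bsub>M\<^esub>" by blast
  let ?N = "{x \<in> carrier M. pact a p x = \<zero>\<^bsub>M\<^esub>}"
  have "LinearCombinations.submodule (class_ring :: 'k ring) ?N vs"
    by (rule LinearCombinations.submodule.intro[OF VS.module_axioms])
       (simp_all add: pact_right sm_simps class_ring_simps)
  then have "VS.span A \<subseteq> ?N" using p(2) A(2) by (intro VS.span_is_subset) auto
  then show ?thesis using p(1) A(3) by blast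
qed

text \<open>Eigenvalues are roots of an annihilating polynomial and hence finite in number, while
  \<delta> t^m takes infinitely many values.\<close>

lemma no_geometric_eigenvalues:
  assumes fd: "fin_dim_module U M" and "inj (\<lambda>m::nat. t ^ m)" "\<delta> \<noteq> 0"
  obtains m where "\<And>x. x \<in> carrier M \<Longrightarrow> a \<odot>\<^bsub>M\<^esub> x = sm (\<delta> * t ^ m) x \<Longrightarrow> x = \<zero>\<^bsub>M\<^esub>"
proof -
  obtain p where p: "p \<noteq> 0" "\<forall>x\<in>carrier M. pact a p x = \<zero>\<^bsub>M\<^esub>" using annihilate[OF fd] by blast
  have "inj (\<lambda>m. \<delta> * t ^ m)" using assms(2,3) by (auto simp: inj_def)
  then have "infinite (range (\<lambda>m. \<delta> * t ^ m))" using finite_imageD infinite_UNIV_nat by blast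
  then have "\<not> range (\<lambda>m. \<delta> * t ^ m) \<subseteq> {k. poly p k = 0}"
    using poly_roots_finite[OF p(1)] finite_subset by blast
  then obtain m where m: "poly p (\<delta> * t ^ m) \<noteq> 0" by blast
  show ?thesis
  proof (rule that[of m])
    fix x assume x: "x \<in> carrier M" "a \<odot>\<^bsub>M\<^esub> x = sm (\<delta> * t ^ m) x"
    then have "sm (poly p (\<delta> * t ^ m)) x = \<zero>\<^bsub>M\<^esub>" using pact_eigen[OF x, of p] p(2) by simp
    then show "x = \<zero>\<^bsub>M\<^esub>" by (rule sm_cancel[OF x(1) _ m])
  qed
qed

lemma eigenvector:
  assumes closed: "\<And>p :: 'k poly. degree p > 0 \<Longrightarrow> \<exists>k. poly p k = 0"
    and fd: "fin_dim_module U M" and x: "x \<in> carrier M" "x \<noteq> \<zero>\<^bsub>M\<^esub>"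
  shows "\<exists>p k. pact a p x \<noteq> \<zero>\<^bsub>M\<^esub> \<and> a \<odot>\<^bsub>M\<^esub> pact a p x = sm k (pact a p x)"
proof -
  obtain p where "p \<noteq> 0" "pact a p x = \<zero>\<^bsub>M\<^esub>" using annihilate_vector[OF fd x(1)] by blast
  then show ?thesis
  proof (induction "degree p" arbitrary: p rule: less_induct)
    case less
    show ?case
    proof (cases "degree p = 0")
      case True
      then obtain c where c: "p = [:c:]" by (rule degree_eq_zeroE)
      then have "sm c x = \<zero>\<^bsub>M\<^esub>" using less.prems(2) x a by (simp add: pact_pCons)
      then show ?thesis using sm_cancel[OF x(1)] x(2) c less.prems(1) by auto
    next
      case False
      then obtain k where "poly p k = 0" using closed[of p] by blast
      then obtain p' where p': "p = [:- k, 1:] * p'" by (auto simp: poly_eq_0_iff_dvd dvd_def)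
      have nz: "p' \<noteq> 0" using less.prems(1) p' by auto
      show ?thesis
      proof (cases "pact a p' x = \<zero>\<^bsub>M\<^esub>")
        case True
        have "degree p = Suc (degree p')" using nz unfolding p' by (subst degree_mult_eq) simp_all
        then show ?thesis using less.hyps[OF _ nz True] by simp
      next
        case False
        let ?y = "pact a p' x"
        have y: "?y \<in> carrier M" using x by simp
        have "\<zero>\<^bsub>M\<^esub> = sm (- k) ?y \<oplus>\<^bsub>M\<^esub> (a \<odot>\<^bsub>M\<^esub> ?y)"
          using less.prems(2) y a unfolding p' pact_mult[OF x(1)] by (simp add: pact_pCons sm_simps)
        also have "\<dots> = (a \<odot>\<^bsub>M\<^esub> ?y) \<oplus>\<^bsub>M\<^esub> sm (- 1) (sm k ?y)"
          using y a by (simp add: sm_simps M.a_comm)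
        finally have "a \<odot>\<^bsub>M\<^esub> ?y = sm k ?y"
          using diff_eq_zero_iff[of "a \<odot>\<^bsub>M\<^esub> ?y" "sm k ?y"] y a by simp
        then show ?thesis using False by blast
      qed
    qed
  qed
qed

end

text \<open>An eigenvector for \<open>a\<close> is found as a polynomial in \<open>a\<close> applied
  to a common eigenvector of the others. It remains one for them, with the same eigenvalues, because
  they commute with \<open>a\<close>.\<close>

lemma common_eigenvector:
  assumes closed: "\<And>p :: 'k poly. degree p > 0 \<Longrightarrow> \<exists>k. poly p k = 0"
    and fd: "fin_dim_module U M" and x: "x \<in> carrier M" "x \<noteq> \<zero>\<^bsub>M\<^esub>"
    and "set as \<subseteq> carrier U" "\<And>a b. a \<in> set as \<Longrightarrow> b \<in> set as \<Longrightarrow> a \<otimes>\<^bsub>U\<^esub> b = b \<otimes>\<^bsub>U\<^esub> a"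
  shows "\<exists>y\<in>carrier M. y \<noteq> \<zero>\<^bsub>M\<^esub> \<and> (\<forall>a\<in>set as. \<exists>k. a \<odot>\<^bsub>M\<^esub> y = sm k y)"
  using assms(5,6)
proof (induction as)
  case Nil
  then show ?case using x by auto
next
  case (Cons a as)
  then have a: "a \<in> carrier U" by simp
  have "\<exists>y\<in>carrier M. y \<noteq> \<zero>\<^bsub>M\<^esub> \<and> (\<forall>a\<in>set as. \<exists>k. a \<odot>\<^bsub>M\<^esub> y = sm k y)"
    by (rule Cons.IH) (use Cons.prems in auto)
  then obtain y where y: "y \<in> carrier M" "y \<noteq> \<zero>\<^bsub>M\<^esub>" "\<forall>a\<in>set as. \<exists>k. a \<odot>\<^bsub>M\<^esub> y = sm k y" by blast
  obtain p k where p: "pact a p y \<noteq> \<zero>\<^bsub>M\<^esub>" "a \<odot>\<^bsub>M\<^esub> pact a p y = sm k (pact a p y)"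
    using eigenvector[OF a closed fd y(1,2)] by blast
  have "\<exists>k. b \<odot>\<^bsub>M\<^esub> pact a p y = sm k (pact a p y)" if b: "b \<in> set (a # as)" for b
  proof (cases "b = a")
    case True
    then show ?thesis using p(2) by blast
  next
    case False
    then have b': "b \<in> set as" using b by simp
    then obtain k where "b \<odot>\<^bsub>M\<^esub> y = sm k y" using y(3) by blast
    moreover have "b \<in> carrier U" "a \<otimes>\<^bsub>U\<^esub> b = b \<otimes>\<^bsub>U\<^esub> a" using Cons.prems b by auto
    ultimately show ?thesis using pact_commute[OF a _ y(1)] by blast
  qed
  then show ?case using p(1) pact_closed[OF a y(1)] by blast
qed

end

section \<open>Torus elements that grade the raising operators\<close>

context urs_nz
begin

text \<open>\<open>\<kappa> j\<close> is the scalar with which some \<open>d\<close>, commuting with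
  the torus, passes e_j. The left inverse of \<open>d\<close> later ensures that its eigenvalues are
  nonzero.\<close>

definition grades :: "(nat \<Rightarrow> 'a) \<Rightarrow> bool" where
  "grades \<kappa> \<longleftrightarrow> (\<exists>d\<in>carrier U. \<exists>d'\<in>carrier U. d' \<otimes>\<^bsub>U\<^esub> d = \<one>\<^bsub>U\<^esub> \<and>
     (\<forall>g\<in>torus_gens n. u g \<otimes>\<^bsub>U\<^esub> d = d \<otimes>\<^bsub>U\<^esub> u g) \<and>
     (\<forall>j\<in>{1..<n}. d \<otimes>\<^bsub>U\<^esub> u (Gen_e j) = \<kappa> j \<odot>\<^bsub>U\<^esub> (u (Gen_e j) \<otimes>\<^bsub>U\<^esub> d)))"

lemma grades_cong: "grades \<kappa> \<Longrightarrow> (\<And>j. j \<in> {1..<n} \<Longrightarrow> \<kappa> j = \<kappa>' j) \<Longrightarrow> grades \<kappa>'"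
  unfolding grades_def by (simp cong: ball_cong del: One_nat_def atLeastLessThan_iff)

lemma grades_one: "grades (\<lambda>_. 1)"
  unfolding grades_def
  by (intro bexI[of _ "\<one>\<^bsub>U\<^esub>"] conjI ballI)
     (simp_all add: gens_mem(7) u_gens_closed(1) del: One_nat_def atLeastLessThan_iff)

lemma grades_mult:
  assumes "grades \<kappa>" "grades \<kappa>'"
  shows "grades (\<lambda>j. \<kappa> j * \<kappa>' j)"
proof -
  obtain a a' where a: "a \<in> carrier U" "a' \<in> carrier U" "a' \<otimes>\<^bsub>U\<^esub> a = \<one>\<^bsub>U\<^esub>"
    "\<forall>g\<in>torus_gens n. u g \<otimes>\<^bsub>U\<^esub> a = a \<otimes>\<^bsub>U\<^esub> u g" "\<forall>j\<in>{1..<n}. a \<otimes>\<^bsub>U\<^esub> u (Gen_e j) = \<kappa> j \<odot>\<^bsub>U\<^esub> (u (Gen_e j) \<otimes>\<^bsub>U\<^esub> a)"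
    using assms(1) unfolding grades_def by blast
  obtain b b' where b: "b \<in> carrier U" "b' \<in> carrier U" "b' \<otimes>\<^bsub>U\<^esub> b = \<one>\<^bsub>U\<^esub>"
    "\<forall>g\<in>torus_gens n. u g \<otimes>\<^bsub>U\<^esub> b = b \<otimes>\<^bsub>U\<^esub> u g" "\<forall>j\<in>{1..<n}. b \<otimes>\<^bsub>U\<^esub> u (Gen_e j) = \<kappa>' j \<odot>\<^bsub>U\<^esub> (u (Gen_e j) \<otimes>\<^bsub>U\<^esub> b)"
    using assms(2) unfolding grades_def by blast
  have "(b' \<otimes>\<^bsub>U\<^esub> a') \<otimes>\<^bsub>U\<^esub> (a \<otimes>\<^bsub>U\<^esub> b) = b' \<otimes>\<^bsub>U\<^esub> ((a' \<otimes>\<^bsub>U\<^esub> a) \<otimes>\<^bsub>U\<^esub> b)"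
    using a(1,2) b(1,2) by (simp add: U.m_assoc)
  then have 1: "(b' \<otimes>\<^bsub>U\<^esub> a') \<otimes>\<^bsub>U\<^esub> (a \<otimes>\<^bsub>U\<^esub> b) = \<one>\<^bsub>U\<^esub>" using a(3) b(1,3) by simp
  have 2: "u g \<otimes>\<^bsub>U\<^esub> (a \<otimes>\<^bsub>U\<^esub> b) = (a \<otimes>\<^bsub>U\<^esub> b) \<otimes>\<^bsub>U\<^esub> u g" if g: "g \<in> torus_gens n" for g
    by (rule U.commute_mult[OF u_closed[OF gens_mem(7)[OF g]] a(1) b(1)]) (use a(4) b(4) g in blast)+
  have 3: "(a \<otimes>\<^bsub>U\<^esub> b) \<otimes>\<^bsub>U\<^esub> u (Gen_e j) = (\<kappa> j * \<kappa>' j) \<odot>\<^bsub>U\<^esub> (u (Gen_e j) \<otimes>\<^bsub>U\<^esub> (a \<otimes>\<^bsub>U\<^esub> b))" if j: "j \<in> {1..<n}" for j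
    by (rule U.q_commute_mult[OF a(1) b(1) u_gens_closed(1)[OF j] bspec[OF a(5) j] bspec[OF b(5) j]])
  show ?thesis
    unfolding grades_def using 1 2 3 U.m_closed[OF a(1) b(1)] U.m_closed[OF b(2) a(2)] by blast
qed

text \<open>The product of the first i elements behaves like a fundamental coweight and rescales e_i
  alone, since the exponents of <eps_1 + ... + eps_i, alpha_j> telescope. Multiplying these over all
  i < n rescales every e_j by \<open>t\<close>.\<close>

lemma grades_const:
  assumes X: "\<And>i. i \<in> {1..n} \<Longrightarrow> grades (\<lambda>j. t powi ip n (eps i) (alpha j))" and "t \<noteq> 0"
  shows "grades (\<lambda>_. t)"
proof -
  have 1: "i < n \<Longrightarrow> grades (\<lambda>j. if j = i then t else 1)" for i
  proof (induction i)
    case 0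
    show ?case by (rule grades_cong[OF grades_one]) simp
  next
    case (Suc i)
    then have i: "Suc i \<in> {1..n}" "i < n" by auto
    show ?case
      by (rule grades_cong[OF grades_mult[OF Suc.IH[OF i(2)] X[OF i(1)]]])
         (use assms(2) in \<open>auto simp: ip_eps_alpha[OF i(1)]\<close>)
  qed
  have *: "m < n \<Longrightarrow> grades (\<lambda>j. if j \<le> m then t else 1)" for m
  proof (induction m)
    case 0
    show ?case by (rule grades_cong[OF grades_one]) simp
  next
    case (Suc m)
    then have "m < n" by simp
    show ?case
      by (rule grades_cong[OF grades_mult[OF Suc.IH[OF \<open>m < n\<close>] 1[OF Suc.prems]]]) auto
  qed
  show ?thesis
  proof (cases "n = 0")
    case True
    then show ?thesis by (intro grades_cong[OF grades_one]) simp
  next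
    case False
    then show ?thesis by (intro grades_cong[OF *[of "n - 1"]]) auto
  qed
qed

lemma grades_torus: "grades (\<lambda>_. r)" "grades (\<lambda>_. s)"
proof -
  have "grades (\<lambda>j. r powi ip n (eps i) (alpha j))" if i: "i \<in> {1..n}" for i
    unfolding grades_def
    using torus_commute[OF gens_mem(8)[OF i] gens_mem(10)[OF i]] a_inverse[OF i] a_e[OF i] torus_commute gens_mem(8)[OF i]
    by (intro bexI[of _ "u (Gen_a i)"] bexI[of _ "u (Gen_ai i)"] conjI ballI u_gens_closed i) simp_all
  then show "grades (\<lambda>_. r)" by (rule grades_const[OF _ r_nz])
  have "grades (\<lambda>j. s powi ip n (eps i) (alpha j))" if i: "i \<in> {1..n}" for i
    unfolding grades_def
    using torus_commute[OF gens_mem(9)[OF i] gens_mem(11)[OF i]] b_inverse[OF i] b_e[OF i] torus_commute gens_mem(9)[OF i]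
    by (intro bexI[of _ "u (Gen_b i)"] bexI[of _ "u (Gen_bi i)"] conjI ballI u_gens_closed i) simp_all
  then show "grades (\<lambda>_. s)" by (rule grades_const[OF _ s_nz])
qed

end

lemma inj_powers:
  fixes t :: "'k::field"
  assumes "t \<noteq> 0" "\<And>m::nat. m > 0 \<Longrightarrow> t ^ m \<noteq> 1"
  shows "inj (\<lambda>m::nat. t ^ m)"
proof (rule linorder_injI)
  fix i j :: nat assume "i < j"
  then have "t ^ j = t ^ i * t ^ (j - i)" by (simp add: power_add[symmetric])
  then show "t ^ i \<noteq> t ^ j" using assms(1) assms(2)[of "j - i"] \<open>i < j\<close> by simp
qed

text \<open>If both \<open>r\<close> and \<open>s\<close> had finite order, then so would their
  quotient. At least one of them thus separates the weights, and it may be either.\<close>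

lemma quotient_not_root:
  fixes r s :: "'k::field"
  assumes "\<And>m::nat. m > 0 \<Longrightarrow> (r * inverse s) ^ m \<noteq> 1"
  shows "(\<forall>m::nat. m > 0 \<longrightarrow> r ^ m \<noteq> 1) \<or> (\<forall>m::nat. m > 0 \<longrightarrow> s ^ m \<noteq> 1)"
proof (rule ccontr)
  assume "\<not> ?thesis"
  then obtain m k :: nat where mk: "m > 0" "k > 0" "r ^ m = 1" "s ^ k = 1" by blast
  have "(r * inverse s) ^ (m * k) = (r ^ m) ^ k * inverse ((s ^ k) ^ m)"
    by (simp add: power_mult_distrib power_mult[symmetric] power_inverse mult.commute)
  then show False using assms[of "m * k"] mk by simp
qed

context umod
begin

text \<open>If no torus eigenvector were killed by all e_j, raising would never end. Each raising
  multiplies the eigenvalue of the grading element \<open>d\<close> by \<open>t\<close>, which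
  produces infinitely many eigenvalues on a finite-dimensional space.\<close>

lemma highest_weight_vector:
  assumes closed: "\<And>p :: 'k poly. degree p > 0 \<Longrightarrow> \<exists>k. poly p k = 0"
    and fd: "fin_dim_module U M" and x0: "x0 \<in> carrier M" "x0 \<noteq> \<zero>\<^bsub>M\<^esub>"
    and t: "inj (\<lambda>m::nat. t ^ m)" "grades (\<lambda>_. t)"
  shows "\<exists>y\<in>carrier M. y \<noteq> \<zero>\<^bsub>M\<^esub> \<and> (\<forall>j\<in>{1..<n}. u (Gen_e j) \<odot>\<^bsub>M\<^esub> y = \<zero>\<^bsub>M\<^esub>) \<and>
    (\<forall>i\<in>{1..n}. (\<exists>k. u (Gen_a i) \<odot>\<^bsub>M\<^esub> y = sm k y) \<and> (\<exists>k. u (Gen_b i) \<odot>\<^bsub>M\<^esub> y = sm k y))"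
proof (rule ccontr)
  assume neg: "\<not> ?thesis"
  obtain d d' where d: "d \<in> carrier U" "d' \<in> carrier U" "d' \<otimes>\<^bsub>U\<^esub> d = \<one>\<^bsub>U\<^esub>"
    "\<And>g. g \<in> torus_gens n \<Longrightarrow> u g \<otimes>\<^bsub>U\<^esub> d = d \<otimes>\<^bsub>U\<^esub> u g"
    "\<And>j. j \<in> {1..<n} \<Longrightarrow> d \<otimes>\<^bsub>U\<^esub> u (Gen_e j) = t \<odot>\<^bsub>U\<^esub> (u (Gen_e j) \<otimes>\<^bsub>U\<^esub> d)"
    using t(2) unfolding grades_def by blast
  define W where "W y \<longleftrightarrow> (\<forall>i\<in>{1..n}. (\<exists>k. u (Gen_a i) \<odot>\<^bsub>M\<^esub> y = sm k y) \<and> (\<exists>k. u (Gen_b i) \<odot>\<^bsub>M\<^esub> y = sm k y))" for y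
  have not_hw: "\<exists>j. j \<in> {1..<n} \<and> u (Gen_e j) \<odot>\<^bsub>M\<^esub> y \<noteq> \<zero>\<^bsub>M\<^esub>" if y: "y \<in> carrier M" "y \<noteq> \<zero>\<^bsub>M\<^esub>" "W y" for y
  proof (rule ccontr)
    assume "\<not> ?thesis"
    then have e0: "\<forall>j\<in>{1..<n}. u (Gen_e j) \<odot>\<^bsub>M\<^esub> y = \<zero>\<^bsub>M\<^esub>" by blast
    show False
      by (rule notE[OF neg], rule bexI[OF _ y(1)], rule conjI[OF y(2)], rule conjI[OF e0 y(3)[unfolded W_def]])
  qed
  \<comment> \<open>The grading element is diagonalised together with the a_i and b_i, so that one
    vector starts both chains of eigenvalues.\<close>
  let ?as = "d # map u (map Gen_a [1..<Suc n] @ map Gen_b [1..<Suc n])"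
  have as: "a = d \<or> (\<exists>g\<in>torus_gens n. a = u g)" if "a \<in> set ?as" for a
    using that by (auto simp: torus_gens_def)
  have "\<exists>y\<in>carrier M. y \<noteq> \<zero>\<^bsub>M\<^esub> \<and> (\<forall>a\<in>set ?as. \<exists>k. a \<odot>\<^bsub>M\<^esub> y = sm k y)"
  proof (rule common_eigenvector[OF closed fd x0])
    show "set ?as \<subseteq> carrier U" using as d(1) u_closed[OF gens_mem(7)] by blast
    show "a \<otimes>\<^bsub>U\<^esub> b = b \<otimes>\<^bsub>U\<^esub> a" if "a \<in> set ?as" "b \<in> set ?as" for a b
      using as[OF that(1)] as[OF that(2)] d(4) torus_commute by metis
  qed
  then obtain y where y: "y \<in> carrier M" "y \<noteq> \<zero>\<^bsub>M\<^esub>" and ey: "\<And>a. a \<in> set ?as \<Longrightarrow> \<exists>k. a \<odot>\<^bsub>M\<^esub> y = sm k y" by blast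
  obtain \<delta> where \<delta>: "d \<odot>\<^bsub>M\<^esub> y = sm \<delta> y" using ey[of d] by auto
  have Wy: "W y"
    unfolding W_def
  proof
    fix i assume i: "i \<in> {1..n}"
    have up: "i \<in> set [1..<Suc n]"
      using i by (simp only: set_upt atLeastLessThan_iff atLeastAtMost_iff less_Suc_eq_le)
    have mem: "u g \<in> set ?as" if "g \<in> Gen_a ` set [1..<Suc n] \<union> Gen_b ` set [1..<Suc n]" for g
      using that by (simp only: list.set(2) set_map set_append) (rule insertI2, erule imageI)
    have "u (Gen_a i) \<in> set ?as" "u (Gen_b i) \<in> set ?as"
      by (rule mem[OF UnI1[OF imageI[OF up]]], rule mem[OF UnI2[OF imageI[OF up]]])
    then show "(\<exists>k. u (Gen_a i) \<odot>\<^bsub>M\<^esub> y = sm k y) \<and> (\<exists>k. u (Gen_b i) \<odot>\<^bsub>M\<^esub> y = sm k y)"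
      by (intro conjI ey)
  qed
  \<comment> \<open>Cancelling \<open>d\<close> by its left inverse shows \<delta> \<noteq> 0,
    without which the values \<delta> t^m would not be distinct.\<close>
  have "y = sm \<delta> (d' \<odot>\<^bsub>M\<^esub> y)"
    using act_mult[OF d(2,1) y(1)] act_sm[OF d(2) y(1), of \<delta>] by (simp add: d(3) \<delta> act_one y(1))
  then have \<delta>0: "\<delta> \<noteq> 0" using y sm_simps(5)[OF act_closed[OF d(2) y(1)]] by auto
  have step: "\<exists>x\<in>carrier M. x \<noteq> \<zero>\<^bsub>M\<^esub> \<and> d \<odot>\<^bsub>M\<^esub> x = sm (\<delta> * t ^ m) x \<and> W x" for m
  proof (induction m)
    case 0
    show ?case using y \<delta> Wy by (intro bexI[of _ y]) simp_all
  next
    case (Suc m)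
    then obtain x where x: "x \<in> carrier M" "x \<noteq> \<zero>\<^bsub>M\<^esub>" "d \<odot>\<^bsub>M\<^esub> x = sm (\<delta> * t ^ m) x" "W x" by blast
    obtain j where j: "j \<in> {1..<n}" "u (Gen_e j) \<odot>\<^bsub>M\<^esub> x \<noteq> \<zero>\<^bsub>M\<^esub>" using not_hw[OF x(1,2,4)] by blast
    let ?z = "u (Gen_e j) \<odot>\<^bsub>M\<^esub> x"
    note e = u_gens_closed(1)[OF j(1)]
    have z: "?z \<in> carrier M" using act_closed[OF e x(1)] .
    have scale: "b \<odot>\<^bsub>M\<^esub> ?z = sm (c * k) ?z"
      if "b \<in> carrier U" "b \<otimes>\<^bsub>U\<^esub> u (Gen_e j) = c \<odot>\<^bsub>U\<^esub> (u (Gen_e j) \<otimes>\<^bsub>U\<^esub> b)" "b \<odot>\<^bsub>M\<^esub> x = sm k x" for b c k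
      using act_q_commute[OF that(1) e x(1) that(2)] that(3) act_sm[OF e x(1)] z by (simp add: sm_simps)
    have "d \<odot>\<^bsub>M\<^esub> ?z = sm (\<delta> * t ^ Suc m) ?z"
      using scale[OF d(1) d(5)[OF j(1)] x(3)] by (simp add: mult_ac)
    moreover have "W ?z"
      unfolding W_def
    proof
      fix i assume i: "i \<in> {1..n}"
      obtain k k' where k: "u (Gen_a i) \<odot>\<^bsub>M\<^esub> x = sm k x" "u (Gen_b i) \<odot>\<^bsub>M\<^esub> x = sm k' x" using x(4)[unfolded W_def] i by blast
      show "(\<exists>k. u (Gen_a i) \<odot>\<^bsub>M\<^esub> ?z = sm k ?z) \<and> (\<exists>k. u (Gen_b i) \<odot>\<^bsub>M\<^esub> ?z = sm k ?z)"
        using scale[OF u_gens_closed(3)[OF i] a_e[OF i j(1)] k(1)] scale[OF u_gens_closed(4)[OF i] b_e[OF i j(1)] k(2)] by blast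
    qed
    ultimately show ?case using z j(2) by blast
  qed
  obtain m where "\<And>x. x \<in> carrier M \<Longrightarrow> d \<odot>\<^bsub>M\<^esub> x = sm (\<delta> * t ^ m) x \<Longrightarrow> x = \<zero>\<^bsub>M\<^esub>"
    using no_geometric_eigenvalues[OF d(1) fd t(1) \<delta>0] by blast
  then show False using step[of m] by blast
qed

end

section \<open>Dominance of the highest weight\<close>

context hw_mod
begin

text \<open>f_k^m v has eigenvalue \<alpha>_k r^-m under a_k and \<beta>_k s^-m under b_k. Whichever
  of \<open>r\<close> and \<open>s\<close> has infinite order supplies infinitely many possible
  eigenvalues, so some power vanishes.\<close>

lemma f_nilpotent:
  assumes fd: "fin_dim_module U M" and k: "k \<in> {1..<n}"
  obtains m where "pi (var k ^ m) = \<zero>\<^bsub>M\<^esub>"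
proof -
  note kn = omega_gens(5)[OF k]
  have Fk: "var k ^ m \<in> fv.Fn" for m
    by (induction m) (auto intro: fv.Fn_closed k simp del: One_nat_def)
  have wtr: "fv.wtr x k k = inverse x" for x
    using ip_eps_alpha[OF kn, of k] by (simp add: fv.wtr_def power_int_minus)
  have A: "fv.opA k (var k ^ m) = sc (\<alpha> k * inverse r ^ m) * var k ^ m"
    and B: "fv.opB k (var k ^ m) = sc (\<beta> k * inverse s ^ m) * var k ^ m" for m
  proof -
    show "fv.opA k (var k ^ m) = sc (\<alpha> k * inverse r ^ m) * var k ^ m"
      using fv.opA_sc[of k 1] by (induction m) (simp_all add: fv.opA_var wtr var_sc_left_commute sc_mult_sc_assoc mult_ac)
    show "fv.opB k (var k ^ m) = sc (\<beta> k * inverse s ^ m) * var k ^ m"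
      using fv.opB_sc[of k 1] by (induction m) (simp_all add: fv.opB_var wtr var_sc_left_commute sc_mult_sc_assoc mult_ac)
  qed
  have inv: "inj (\<lambda>m::nat. inverse t ^ m)" if "t \<noteq> 0" "\<forall>m::nat. m > 0 \<longrightarrow> t ^ m \<noteq> 1" for t :: 'k
    by (rule inj_powers) (use that in \<open>auto simp: power_inverse\<close>)
  from quotient_not_root[OF fv.q_root] show ?thesis
  proof
    assume "\<forall>m::nat. m > 0 \<longrightarrow> r ^ m \<noteq> 1"
    from inv[OF fv.r0 this] obtain m where
      "\<And>x. x \<in> carrier M \<Longrightarrow> u (Gen_a k) \<odot>\<^bsub>M\<^esub> x = sm (\<alpha> k * inverse r ^ m) x \<Longrightarrow> x = \<zero>\<^bsub>M\<^esub>"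
      using no_geometric_eigenvalues[OF u_gens_closed(3)[OF kn] fd _ fv.\<alpha>0[of k]] by blast
    moreover have "u (Gen_a k) \<odot>\<^bsub>M\<^esub> pi (var k ^ m) = sm (\<alpha> k * inverse r ^ m) (pi (var k ^ m))"
      unfolding pi_opA[OF kn Fk, symmetric] A pi_sc_mult ..
    ultimately show ?thesis by (intro that[of m]) simp
  next
    assume "\<forall>m::nat. m > 0 \<longrightarrow> s ^ m \<noteq> 1"
    from inv[OF fv.s0 this] obtain m where
      "\<And>x. x \<in> carrier M \<Longrightarrow> u (Gen_b k) \<odot>\<^bsub>M\<^esub> x = sm (\<beta> k * inverse s ^ m) x \<Longrightarrow> x = \<zero>\<^bsub>M\<^esub>"
      using no_geometric_eigenvalues[OF u_gens_closed(4)[OF kn] fd _ fv.\<beta>0[of k]] by blast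
    moreover have "u (Gen_b k) \<odot>\<^bsub>M\<^esub> pi (var k ^ m) = sm (\<beta> k * inverse s ^ m) (pi (var k ^ m))"
      unfolding pi_opB[OF kn Fk, symmetric] B pi_sc_mult ..
    ultimately show ?thesis by (intro that[of m]) simp
  qed
qed

text \<open>At the least vanishing power f_k^(m+1) v = 0, applying e_k gives a multiple of f_k^m v,
  which is not zero. The scalar of the sl_2 formula therefore vanishes.\<close>

lemma dominant:
  assumes fd: "fin_dim_module U M" and k: "k \<in> {1..<n}"
  shows "\<exists>m. \<alpha> k * \<beta> (k + 1) = fv.q ^ m * (\<alpha> (k + 1) * \<beta> k)"
proof -
  have Fk: "var k ^ m \<in> fv.Fn" for m
    by (induction m) (auto intro: fv.Fn_closed k simp del: One_nat_def)
  let ?Z = "\<lambda>m. pi (var k ^ m) = \<zero>\<^bsub>M\<^esub>"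
  obtain m0 where "?Z m0" by (rule f_nilpotent[OF fd k])
  then have L: "?Z (LEAST m. ?Z m)" by (rule LeastI)
  have "(LEAST m. ?Z m) \<noteq> 0"
  proof
    assume "(LEAST m. ?Z m) = 0"
    then have "?Z 0" using L by simp
    then show False using v_nonzero by (simp add: pi_one)
  qed
  then obtain m where m: "(LEAST m. ?Z m) = Suc m" using not0_implies_Suc by blast
  have Zm: "\<not> ?Z m" using not_less_Least[of m ?Z] m by simp
  obtain c where c: "fv.opE k (var k ^ Suc m) = sc c * var k ^ m" using fv.opE_var_power[OF k] by blast
  have "sm c (pi (var k ^ m)) = u (Gen_e k) \<odot>\<^bsub>M\<^esub> pi (var k ^ Suc m)"
    unfolding pi_opE[OF k Fk, symmetric] c pi_sc_mult ..
  also have "\<dots> = \<zero>\<^bsub>M\<^esub>" using L unfolding m by (simp only: act_zero[OF u_gens_closed(1)[OF k]])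
  finally have "c = 0" using sm_cancel[OF pi_closed] Zm by blast
  from fv.sl2_weight[OF k c this] show ?thesis by blast
qed

end

section \<open>One-dimensional twists of the simple modules\<close>

context hw_mod
begin

text \<open>Every word differs from its vacuum component by something in the radical, which a simple
  module sends to zero.\<close>

lemma one_dim:
  assumes simple: "simple_module U M"
    and ab: "\<And>i. i \<in> {1..<n} \<Longrightarrow> \<alpha> i * \<beta> (i + 1) = \<alpha> (i + 1) * \<beta> i"
  shows "carrier M \<subseteq> range (\<lambda>c. sm c v)"
    and "j \<in> {1..<n} \<Longrightarrow> u (Gen_f j) \<odot>\<^bsub>M\<^esub> v = \<zero>\<^bsub>M\<^esub>"
proof -
  have pi0: "pi x = \<zero>\<^bsub>M\<^esub>" if "x \<in> fv.Fn" "Poly_Mapping.lookup x 0 = 0" for x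
    using simple_pi(2)[OF simple] fv.one_dim_rad[OF ab] that by blast
  show "carrier M \<subseteq> range (\<lambda>c. sm c v)"
  proof
    fix y assume "y \<in> carrier M"
    then have "y \<in> pi ` fv.Fn" unfolding simple_pi(1)[OF simple] .
    then obtain x where x: "y = pi x" "x \<in> fv.Fn" by (rule imageE)
    let ?c = "Poly_Mapping.lookup x 0"
    have "pi (x - sc ?c) = \<zero>\<^bsub>M\<^esub>"
      by (rule pi0) (simp_all add: fv.Fn_closed x(2) lookup_minus)
    then have "pi x \<oplus>\<^bsub>M\<^esub> sm (- 1) (pi (sc ?c)) = \<zero>\<^bsub>M\<^esub>" by (simp only: pi_diff)
    then have "y = sm ?c v" using diff_eq_zero_iff[of "pi x" "pi (sc ?c)"] by (simp add: x(1) pi_sc v_closed)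
    then show "y \<in> range (\<lambda>c. sm c v)" by (rule range_eqI)
  qed
  assume j: "j \<in> {1..<n}"
  have "pi (var j) = u (Gen_f j) \<odot>\<^bsub>M\<^esub> v" using pi_var[OF j, of 1] by (simp only: mult_1_right pi_one)
  moreover have "pi (var j) = \<zero>\<^bsub>M\<^esub>"
    by (rule pi0[OF fv.Fn_closed(7)[OF j]]) (simp add: lookup_single zero_word_def when_def)
  ultimately show "u (Gen_f j) \<odot>\<^bsub>M\<^esub> v = \<zero>\<^bsub>M\<^esub>" by simp
qed

lemma torus_eigen:
  assumes "g \<in> torus_gens n"
  obtains c where "c \<noteq> 0" "u g \<odot>\<^bsub>M\<^esub> v = sm c v"
proof -
  have inv: "b \<odot>\<^bsub>M\<^esub> v = sm (inverse c) v"
    if "a \<in> carrier U" "b \<in> carrier U" "a \<otimes>\<^bsub>U\<^esub> b = \<one>\<^bsub>U\<^esub>" "a \<otimes>\<^bsub>U\<^esub> b = b \<otimes>\<^bsub>U\<^esub> a" "a \<odot>\<^bsub>M\<^esub> v = sm c v" "c \<noteq> 0" for a b c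
  proof -
    have "sm (inverse c) v = sm (inverse c) (b \<odot>\<^bsub>M\<^esub> (a \<odot>\<^bsub>M\<^esub> v))"
      using act_mult[OF that(2,1) v_closed] that(3,4) act_one[OF v_closed] by simp
    also have "\<dots> = b \<odot>\<^bsub>M\<^esub> v"
      unfolding that(5) using that(2,6) v_closed by (simp add: act_sm sm_simps)
    finally show ?thesis ..
  qed
  from assms consider i where "i \<in> {1..n}" "g = Gen_a i" | i where "i \<in> {1..n}" "g = Gen_ai i"
    | i where "i \<in> {1..n}" "g = Gen_b i" | i where "i \<in> {1..n}" "g = Gen_bi i"
    unfolding torus_gens_def by blast
  then show ?thesis
  proof cases
    case 1
    then show ?thesis using v_a fv.\<alpha>0 by (intro that[of "\<alpha> i" for i]) auto
  next
    case (2 i)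
    show ?thesis
      by (rule that[of "inverse (\<alpha> i)"]) (simp add: fv.\<alpha>0, unfold 2(2),
        rule inv[OF u_gens_closed(3,5)[OF 2(1)] a_inverse[OF 2(1)] torus_commute[OF gens_mem(8,10)[OF 2(1)]] v_a[OF 2(1)] fv.\<alpha>0])
  next
    case 3
    then show ?thesis using v_b fv.\<beta>0 by (intro that[of "\<beta> i" for i]) auto
  next
    case (4 i)
    show ?thesis
      by (rule that[of "inverse (\<beta> i)"]) (simp add: fv.\<beta>0, unfold 4(2),
        rule inv[OF u_gens_closed(4,6)[OF 4(1)] b_inverse[OF 4(1)] torus_commute[OF gens_mem(9,11)[OF 4(1)]] v_b[OF 4(1)] fv.\<beta>0])
  qed
qed

lemma omega_eigen:
  assumes i: "i \<in> {1..<n}"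
  shows "om i \<odot>\<^bsub>M\<^esub> v = sm (\<alpha> i * \<beta> (i + 1)) v"
proof -
  note g = omega_gens(5,6)[OF i]
  have "om i \<odot>\<^bsub>M\<^esub> v = u (Gen_a i) \<odot>\<^bsub>M\<^esub> sm (\<beta> (i + 1)) v"
    unfolding omega_def act_mult[OF u_gens_closed(3)[OF g(1)] u_gens_closed(4)[OF g(2)] v_closed] v_b[OF g(2)] ..
  also have "\<dots> = sm (\<beta> (i + 1)) (sm (\<alpha> i) v)"
    unfolding act_sm[OF u_gens_closed(3)[OF g(1)] v_closed] v_a[OF g(1)] ..
  finally show ?thesis using v_closed by (simp add: sm_simps mult.commute)
qed

end

text \<open>V is a line spanned by \<open>v\<close>. On v (x) y the element e_i acts as v (x) e_i y
  up to the nonzero eigenvalue of omega_i, f_i acts as v (x) f_i y since f_i v = 0, and the torus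
  acts diagonally. Submodules of the tensor product therefore correspond to submodules of W.\<close>

lemma tensor_simple_hw:
  assumes V: "hw_mod n r s \<alpha> \<beta> V v" "simple_module (Urs n r s) V"
    and W: "hw_mod n r s \<alpha>' \<beta>' W w" "simple_module (Urs n r s) W"
    and ab: "\<And>i. i \<in> {1..<n} \<Longrightarrow> \<alpha> i * \<beta> (i + 1) = \<alpha> (i + 1) * \<beta> i"
  shows "simple_module (Urs n r s) (Urs_tensor n r s V W)"
    and "\<exists>t. hw_mod n r s (\<lambda>i. \<alpha> i * \<alpha>' i) (\<lambda>i. \<beta> i * \<beta>' i) (Urs_tensor n r s V W) t"
proof -
  interpret V: hw_mod n r s \<alpha> \<beta> V v by fact
  interpret W: hw_mod n r s \<alpha>' \<beta>' W w by fact
  interpret T: tensor_umod n r s V W by (intro tensor_umod.intro V.umod_axioms W.umod_axioms)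
  have one_dim: "carrier V \<subseteq> range (\<lambda>c. V.sm c v)" by (rule V.one_dim(1)[OF V(2)]) (rule ab)
  have f0: "V.u (Gen_f j) \<odot>\<^bsub>V\<^esub> v = \<zero>\<^bsub>V\<^esub>" if "j \<in> {1..<n}" for j
    by (rule V.one_dim(2)[OF V(2) _ that]) (rule ab)
  note v = V.v_closed V.v_nonzero
  note TT_pt = T.TT_pt[OF v one_dim] and pt_inj = T.pt_inj[OF v one_dim]
  have pt0: "T.pt v y = \<zero>\<^bsub>T.TT\<^esub> \<Longrightarrow> y = \<zero>\<^bsub>W\<^esub>" if "y \<in> carrier W" for y
    using inj_onD[OF pt_inj, of y "\<zero>\<^bsub>W\<^esub>"] that T.pt_zero(1)[OF v(1)] by simp
  have pt_scale: "T.pt (V.sm c v) y = T.TT.sm c (T.pt v y)" if "y \<in> carrier W" for c y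
    using T.pt_add(3)[OF v(1) that, of c] T.pt_sm[OF v(1) that, of c] by simp
  have ne: "T.pt v w \<noteq> \<zero>\<^bsub>T.TT\<^esub>" using pt0[OF W.v_closed] W.v_nonzero by blast
  show "simple_module (Urs n r s) T.TT"
    unfolding simple_module_def
  proof (intro conjI allI impI T.left_module_TT)
    show "carrier T.TT \<noteq> {\<zero>\<^bsub>T.TT\<^esub>}" using T.pt_closed[OF v(1) W.v_closed] ne by blast
    fix N assume N: "Module.submodule N (Urs n r s) T.TT"
    note Nd = submoduleD[OF N]
    have unscale: "y \<in> N" if "T.TT.sm c y \<in> N" "c \<noteq> 0" "y \<in> carrier T.TT" for c y
      using T.TT.submodule_sm[OF N that(1), of "inverse c"] that(2,3) by (simp add: T.TT.sm_simps)
    \<comment> \<open>The submodule of W that corresponds to \<open>N\<close>; the scalars picked up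
      from \<open>v\<close> are removed by \<open>unscale\<close>.\<close>
    let ?N = "{y \<in> carrier W. T.pt v y \<in> N}"
    have "Module.submodule ?N (Urs n r s) W"
    proof (rule W.submoduleI_gens)
      show "?N \<subseteq> carrier W" by blast
      show "\<zero>\<^bsub>W\<^esub> \<in> ?N" using Nd(2) T.pt_zero(1)[OF v(1)] by simp
      show "x \<oplus>\<^bsub>W\<^esub> y \<in> ?N" if "x \<in> ?N" "y \<in> ?N" for x y
        using that Nd(3)[of "T.pt v x" "T.pt v y"] T.pt_add(2)[OF v(1), of x y] by simp
      show "W.sm c x \<in> ?N" if "x \<in> ?N" for c x
        using that T.TT.submodule_sm[OF N, of "T.pt v x" c] T.pt_sm[OF v(1), of x c] by simp
      fix g y assume g: "g \<in> gens n" and "y \<in> ?N"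
      then have y: "y \<in> carrier W" "T.pt v y \<in> N" by simp_all
      have gy: "V.u g \<odot>\<^bsub>W\<^esub> y \<in> carrier W" using W.act_closed[OF V.u_closed[OF g] y(1)] .
      have gN: "V.u g \<odot>\<^bsub>T.TT\<^esub> T.pt v y \<in> N" by (rule Nd(4)[OF V.u_closed[OF g] y(2)])
      from g have "T.pt v (V.u g \<odot>\<^bsub>W\<^esub> y) \<in> N"
      proof (cases rule: V.gens_cases)
        case 1
        obtain c where c: "c \<noteq> 0" "V.u g \<odot>\<^bsub>V\<^esub> v = V.sm c v" by (rule V.torus_eigen[OF 1])
        have "T.TT.sm c (T.pt v (V.u g \<odot>\<^bsub>W\<^esub> y)) \<in> N"
          using gN unfolding T.act_torus[OF 1 v(1) y(1)] c(2) pt_scale[OF gy] .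
        then show ?thesis by (rule unscale[OF _ c(1) T.pt_closed[OF v(1) gy]])
      next
        case (2 i)
        have nz: "\<alpha> i * \<beta> (i + 1) \<noteq> 0" using V.fv.\<alpha>0 V.fv.\<beta>0 by simp
        have gy': "V.u (Gen_e i) \<odot>\<^bsub>W\<^esub> y \<in> carrier W" using gy 2(2) by simp
        have c: "T.pt v (V.u (Gen_e i) \<odot>\<^bsub>W\<^esub> y) \<in> carrier T.TT" by (rule T.pt_closed[OF v(1) gy'])
        have "V.u (Gen_e i) \<odot>\<^bsub>T.TT\<^esub> T.pt v y = T.TT.sm (\<alpha> i * \<beta> (i + 1)) (T.pt v (V.u (Gen_e i) \<odot>\<^bsub>W\<^esub> y))"
          unfolding T.act_e[OF 2(1) v(1) y(1)] V.v_e[OF 2(1)] V.omega_eigen[OF 2(1)] pt_scale[OF gy'] T.pt_zero(2)[OF y(1)]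
          by (rule T.TT.M.l_zero[OF T.TT.sm_closed[OF c]])
        then show ?thesis using unscale[OF _ nz c] gN 2(2) by simp
      next
        case (3 i)
        have gy': "V.u (Gen_f i) \<odot>\<^bsub>W\<^esub> y \<in> carrier W" using gy 3(2) by simp
        have "V.u (Gen_f i) \<odot>\<^bsub>T.TT\<^esub> T.pt v y = T.pt v (V.u (Gen_f i) \<odot>\<^bsub>W\<^esub> y)"
          unfolding T.act_f[OF 3(1) v(1) y(1)] f0[OF 3(1)]
            T.pt_zero(2)[OF W.act_closed[OF V.omega_closed(2)[OF 3(1)] y(1)]]
          by (rule T.TT.M.r_zero[OF T.pt_closed[OF v(1) gy']])
        then show ?thesis using gN 3(2) by simp
      qed
      then show "V.u g \<odot>\<^bsub>W\<^esub> y \<in> ?N" using gy by simp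
    qed
    then have "?N = {\<zero>\<^bsub>W\<^esub>} \<or> ?N = carrier W" using W(2) unfolding simple_module_def by blast
    then show "N = {\<zero>\<^bsub>T.TT\<^esub>} \<or> N = carrier T.TT"
    proof
      assume N0: "?N = {\<zero>\<^bsub>W\<^esub>}"
      have "x = \<zero>\<^bsub>T.TT\<^esub>" if x: "x \<in> N" for x
      proof -
        have "x \<in> T.pt v ` carrier W" using Nd(1) x unfolding TT_pt by (rule subsetD)
        then obtain y where y: "x = T.pt v y" "y \<in> carrier W" by (rule imageE)
        then have "y \<in> ?N" using x by simp
        then show ?thesis unfolding N0 y(1) using T.pt_zero(1)[OF v(1)] by simp
      qed
      then show ?thesis using Nd(2) by blast
    next
      assume N1: "?N = carrier W"
      have "T.pt v ` carrier W \<subseteq> N"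
      proof (rule image_subsetI)
        fix y assume "y \<in> carrier W"
        then have "y \<in> ?N" unfolding N1 .
        then show "T.pt v y \<in> N" by simp
      qed
      then have "carrier T.TT \<subseteq> N" unfolding TT_pt .
      with Nd(1) show ?thesis by blast
    qed
  qed
  have fv: "free_verma r s (\<lambda>i. \<alpha> i * \<alpha>' i) (\<lambda>i. \<beta> i * \<beta>' i)"
    by (rule free_verma.intro)
       (use V.fv.free_verma_axioms W.fv.free_verma_axioms in \<open>auto simp: free_verma_def\<close>)
  have "hw_mod n r s (\<lambda>i. \<alpha> i * \<alpha>' i) (\<lambda>i. \<beta> i * \<beta>' i) T.TT (T.pt v w)"
  proof (intro hw_mod.intro hw_mod_axioms.intro fv T.TT.umod_axioms T.pt_closed v(1) W.v_closed ne)
    show "V.u (Gen_e j) \<odot>\<^bsub>T.TT\<^esub> T.pt v w = \<zero>\<^bsub>T.TT\<^esub>" if j: "j \<in> {1..<n}" for j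
      unfolding T.act_e[OF j v(1) W.v_closed] V.v_e[OF j] W.v_e[OF j] T.pt_zero(2)[OF W.v_closed]
        T.pt_zero(1)[OF V.act_closed[OF V.omega_closed(1)[OF j] v(1)]]
      by (rule T.TT.M.l_zero[OF T.TT.M.zero_closed])
    have sc: "T.pt (V.sm c v) (W.sm d w) = T.TT.sm (c * d) (T.pt v w)" for c d
      unfolding pt_scale[OF W.sm_closed[OF W.v_closed]] T.pt_sm[OF v(1) W.v_closed, symmetric]
      by (rule T.TT.sm_simps(3)[OF T.pt_closed[OF v(1) W.v_closed]])
    show "V.u (Gen_a i) \<odot>\<^bsub>T.TT\<^esub> T.pt v w = T.TT.sm (\<alpha> i * \<alpha>' i) (T.pt v w)" if i: "i \<in> {1..n}" for i
      unfolding T.act_torus[OF V.gens_mem(8)[OF i] v(1) W.v_closed] V.v_a[OF i] W.v_a[OF i] by (rule sc)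
    show "V.u (Gen_b i) \<odot>\<^bsub>T.TT\<^esub> T.pt v w = T.TT.sm (\<beta> i * \<beta>' i) (T.pt v w)" if i: "i \<in> {1..n}" for i
      unfolding T.act_torus[OF V.gens_mem(9)[OF i] v(1) W.v_closed] V.v_b[OF i] W.v_b[OF i] by (rule sc)
  qed
  then show "\<exists>t. hw_mod n r s (\<lambda>i. \<alpha> i * \<alpha>' i) (\<lambda>i. \<beta> i * \<beta>' i) T.TT t" by blast
qed

text \<open>The list holds lam_k - lam_(k+1) copies of {1..k}, the highest vectors of the
  fundamental exterior powers. Index i lies in those with k >= i, so its multiplicity telescopes to
  lam_i - lam_m.\<close>

lemma telescoping_weight:
  fixes x :: "'k::field" and lam :: "nat \<Rightarrow> int"
  assumes "x \<noteq> 0" "1 \<le> i" "i \<le> m" and dom: "\<And>k. k \<in> {1..<m} \<Longrightarrow> lam (k + 1) \<le> lam k"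
  shows "prod_list (map (\<lambda>I. if i \<in> I then x else 1)
    (concat (map (\<lambda>k. replicate (nat (lam k - lam (k + 1))) {1..k}) [1..<m]))) = x powi (lam i - lam m)"
  using assms(3) dom
proof (induction m rule: dec_induct)
  case base
  have "prod_list (map (\<lambda>I. if i \<in> I then x else 1) (concat (map (\<lambda>k. replicate (nat (lam k - lam (k + 1))) {1..k}) ks))) = 1"
    if "\<forall>k\<in>set ks. k < i" for ks
    using that by (induction ks) (auto simp: map_replicate_const prod_list_replicate)
  then show ?case by simp
next
  case (step m)
  have m: "1 \<le> m" using step.hyps assms(2) by simp
  have IH: "prod_list (map (\<lambda>I. if i \<in> I then x else 1)
    (concat (map (\<lambda>k. replicate (nat (lam k - lam (k + 1))) {1..k}) [1..<m]))) = x powi (lam i - lam m)"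
    by (rule step.IH) (use step.prems in auto)
  have "lam (m + 1) \<le> lam m" using step.prems[of m] m by simp
  then have p: "x ^ nat (lam m - lam (m + 1)) = x powi (lam m - lam (m + 1))" by (simp add: power_int_def)
  have "[1..<Suc m] = [1..<m] @ [m]" using m by simp
  moreover have "prod_list (map (\<lambda>I. if i \<in> I then x else 1) (replicate (nat (lam m - lam (m + 1))) {1..m})) = x ^ nat (lam m - lam (m + 1))"
    using assms(2) step.hyps by (simp add: map_replicate_const prod_list_replicate)
  ultimately show ?case
    using IH unfolding p by (simp add: power_int_add[symmetric] assms(1) del: upt_Suc)
qed

lemma ip_alpha:
  assumes "i \<in> {1..<n}"
  shows "ip n (alpha i) lam = lam i - lam (i + 1)"
proof -
  have "ip n (alpha i) lam = (\<Sum>k = 1..n. (if k = i then lam k else 0) - (if k = i + 1 then lam k else 0))"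
    unfolding ip_def alpha_def eps_def by (rule sum.cong) simp_all
  then show ?thesis using assms by (simp add: sum_subtractf)
qed

text \<open>The differences of a dominant weight are carried by exterior powers, and the residual
  constant lam_n, which may be negative, by the one-dimensional factor of the tensor model.\<close>

lemma twisted_fin_dim:
  assumes hw: "hw_mod n r s (\<lambda>i. \<alpha> i * \<alpha>' i) (\<lambda>i. \<beta> i * \<beta>' i) M t" and simple: "simple_module (Urs n r s) M"
    and ab: "\<And>i. i \<in> {1..<n} \<Longrightarrow> \<alpha> i * \<beta> (i + 1) = \<alpha> (i + 1) * \<beta> i"
    and al: "\<And>i. i \<in> {1..n} \<Longrightarrow> \<alpha>' i = r powi lam i" and be: "\<And>i. i \<in> {1..n} \<Longrightarrow> \<beta>' i = s powi lam i"
    and lam: "lam \<in> dominant_weights n"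
  shows "fin_dim_module (Urs n r s) M"
proof -
  interpret hw_mod n r s "\<lambda>i. \<alpha> i * \<alpha>' i" "\<lambda>i. \<beta> i * \<beta>' i" M t by fact
  have dom: "lam (k + 1) \<le> lam k" if "k \<in> {1..<n}" for k
    using lam that ip_alpha[OF that, of lam] unfolding dominant_weights_def by force
  have tele: "x powi lam i = x powi lam n * prod_list (map (\<lambda>I. if i \<in> I then x else 1)
      (concat (map (\<lambda>k. replicate (nat (lam k - lam (k + 1))) {1..k}) [1..<n])))" if "x \<noteq> 0" "i \<in> {1..n}" for x :: 'a and i
    using telescoping_weight[of x i n lam] dom that by (simp add: power_int_add[symmetric] del: One_nat_def)
  \<comment> \<open>The twist is multiplied by r^(lam n) and s^(lam n), a power of the determinant
    character; both sides of \<open>ab\<close> change by the same factor.\<close>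
  have "fock_model n r s (\<lambda>i. \<alpha> i * \<alpha>' i) (\<lambda>i. \<beta> i * \<beta>' i) (\<lambda>i. \<alpha> i * r powi lam n) (\<lambda>i. \<beta> i * s powi lam n)
      (concat (map (\<lambda>k. replicate (nat (lam k - lam (k + 1))) {1..k}) [1..<n]))"
  proof (intro fock_model.intro fock_model_axioms.intro fv.free_verma_axioms)
    show "(\<alpha> i * r powi lam n) * (\<beta> (i + 1) * s powi lam n) = (\<alpha> (i + 1) * r powi lam n) * (\<beta> i * s powi lam n)"
      if "i \<in> {1..<n}" for i
    proof -
      have "(\<alpha> i * r powi lam n) * (\<beta> (i + 1) * s powi lam n) = (\<alpha> i * \<beta> (i + 1)) * (r powi lam n * s powi lam n)" by simp
      then show ?thesis unfolding ab[OF that] by simp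
    qed
    show "\<alpha> i * \<alpha>' i = (\<alpha> i * r powi lam n) * prod_list (map (\<lambda>I. if i \<in> I then r else 1)
        (concat (map (\<lambda>k. replicate (nat (lam k - lam (k + 1))) {1..k}) [1..<n])))" if "i \<in> {1..n}" for i
      by (rule trans[OF arg_cong[where f = "times (\<alpha> i)", OF trans[OF al[OF that] tele[OF r_nz that]]] mult.assoc[symmetric]])
    show "\<beta> i * \<beta>' i = (\<beta> i * s powi lam n) * prod_list (map (\<lambda>I. if i \<in> I then s else 1)
        (concat (map (\<lambda>k. replicate (nat (lam k - lam (k + 1))) {1..k}) [1..<n])))" if "i \<in> {1..n}" for i
      by (rule trans[OF arg_cong[where f = "times (\<beta> i)", OF trans[OF be[OF that] tele[OF s_nz that]]] mult.assoc[symmetric]])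
    fix I assume "I \<in> set (concat (map (\<lambda>k. replicate (nat (lam k - lam (k + 1))) {1..k}) [1..<n]))"
    then obtain k where "k < n" "I = {1..k}" by (auto split: if_splits)
    then show "I \<subseteq> {1..n} \<and> (\<forall>i\<ge>1. Suc i \<in> I \<longrightarrow> i \<in> I)" by auto
  qed
  then obtain N where "\<And>w. set w \<subseteq> {1..<n} \<Longrightarrow> N < length w \<Longrightarrow> Poly_Mapping.single (Word w) 1 \<in> fv.rad"
    by (rule fock_model.long_words_rad) blast
  then show ?thesis by (rule simple_fin_dim[OF simple])
qed

lemma Lsimple_highest_weight:
  fixes r s :: "'k::field"
  assumes nz: "r \<noteq> 0" "s \<noteq> 0" "r \<noteq> s" and root: "\<forall>m::nat. m > 0 \<longrightarrow> (r * inverse s) ^ m \<noteq> 1"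
    and \<psi>: "\<psi> \<in> torus_chars n r s" and ne: "\<And>i. \<alpha> i \<noteq> 0" "\<And>i. \<beta> i \<noteq> 0"
    and a: "\<And>i. i \<in> {1..n} \<Longrightarrow> \<psi> (gen_Urs n r s (Gen_a i)) = \<alpha> i"
    and b: "\<And>i. i \<in> {1..n} \<Longrightarrow> \<psi> (gen_Urs n r s (Gen_b i)) = \<beta> i"
  shows "simple_module (Urs n r s) (Lsimple n r s \<psi>)" and "\<exists>v. hw_mod n r s \<alpha> \<beta> (Lsimple n r s \<psi>) v"
proof -
  interpret torus_verma n r s \<alpha> \<beta> \<psi>
    by (intro torus_verma.intro verma_data.intro free_verma.intro urs_nz.intro torus_verma_axioms.intro nz ne \<psi> a b)
       (use root in blast)+
  show "simple_module (Urs n r s) (Lsimple n r s \<psi>)" by (rule Lsimple_simple)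
  show "\<exists>v. hw_mod n r s \<alpha> \<beta> (Lsimple n r s \<psi>) v" by (rule exI, rule Lsimple_hw)
qed

text \<open>The highest weights of the two tensor factors multiply. The condition on \<chi> becomes
  the relation between \<alpha> and \<beta> that makes the left factor a line.\<close>

lemma twisted_module:
  fixes r s :: "'k::field"
  assumes nz: "r \<noteq> 0" "s \<noteq> 0" "r \<noteq> s" and root: "\<forall>m::nat. m > 0 \<longrightarrow> (r * inverse s) ^ m \<noteq> 1"
    and chi: "\<chi> \<in> one_dim_chars n r s" and lam: "lam \<in> dominant_weights n"
    and ne: "\<And>i. \<alpha> i \<noteq> 0" "\<And>i. \<beta> i \<noteq> 0"
    and a: "\<And>i. i \<in> {1..n} \<Longrightarrow> \<chi> (gen_Urs n r s (Gen_a i)) = \<alpha> i"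
    and b: "\<And>i. i \<in> {1..n} \<Longrightarrow> \<chi> (gen_Urs n r s (Gen_b i)) = \<beta> i"
  defines "T \<equiv> Urs_tensor n r s (Lsimple n r s \<chi>) (Lsimple n r s (weight_char n r s lam))"
  shows "simple_module (Urs n r s) T" and "fin_dim_module (Urs n r s) T"
    and "\<exists>t. hw_mod n r s (\<lambda>i. \<alpha> i * r powi lam i) (\<lambda>i. \<beta> i * s powi lam i) T t"
proof -
  have ne': "\<And>i. r powi lam i \<noteq> 0" "\<And>i. s powi lam i \<noteq> 0" using nz by simp_all
  interpret W: verma_data n r s "\<lambda>i. r powi lam i" "\<lambda>i. s powi lam i"
    by (intro verma_data.intro free_verma.intro urs_nz.intro nz ne') (use root in blast)+
  note wc = W.weight_char_props[of lam, OF refl refl]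
  have chi0: "\<chi> \<in> torus_chars n r s" and chi1: "\<And>i. i \<in> {1..<n} \<Longrightarrow> \<chi> (omega n r s i) = \<chi> (omega' n r s i)"
    using chi unfolding one_dim_chars_def by simp_all
  have ab: "\<alpha> i * \<beta> (i + 1) = \<alpha> (i + 1) * \<beta> i" if i: "i \<in> {1..<n}" for i
  proof -
    note g = W.omega_gens[OF i]
    have "\<chi> (omega n r s i) = \<alpha> i * \<beta> (i + 1)"
      unfolding omega_def W.char_mult(1)[OF chi0 W.U0_gen[OF g(1)] W.U0_gen[OF g(2)]] a[OF g(5)] b[OF g(6)] ..
    moreover have "\<chi> (omega' n r s i) = \<alpha> (i + 1) * \<beta> i"
      unfolding omega'_def W.char_mult(1)[OF chi0 W.U0_gen[OF g(3)] W.U0_gen[OF g(4)]] a[OF g(6)] b[OF g(5)] ..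
    ultimately show ?thesis using chi1[OF i] by simp
  qed
  obtain v where V: "hw_mod n r s \<alpha> \<beta> (Lsimple n r s \<chi>) v"
    using Lsimple_highest_weight(2)[where \<alpha> = \<alpha> and \<beta> = \<beta>, OF nz root chi0 ne a b] by blast
  have V': "simple_module (Urs n r s) (Lsimple n r s \<chi>)"
    by (rule Lsimple_highest_weight(1)[where \<alpha> = \<alpha> and \<beta> = \<beta>, OF nz root chi0 ne a b])
  obtain w where W: "hw_mod n r s (\<lambda>i. r powi lam i) (\<lambda>i. s powi lam i) (Lsimple n r s (weight_char n r s lam)) w"
    using Lsimple_highest_weight(2)[where \<alpha> = "\<lambda>i. r powi lam i" and \<beta> = "\<lambda>i. s powi lam i", OF nz root wc(1) ne' wc(2,3)] by blast
  have W': "simple_module (Urs n r s) (Lsimple n r s (weight_char n r s lam))"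
    by (rule Lsimple_highest_weight(1)[where \<alpha> = "\<lambda>i. r powi lam i" and \<beta> = "\<lambda>i. s powi lam i", OF nz root wc(1) ne' wc(2,3)])
  show simple: "simple_module (Urs n r s) T"
    unfolding T_def by (rule tensor_simple_hw(1)[OF V V' W W']) (rule ab)
  show ex: "\<exists>t. hw_mod n r s (\<lambda>i. \<alpha> i * r powi lam i) (\<lambda>i. \<beta> i * s powi lam i) T t"
    unfolding T_def by (rule tensor_simple_hw(2)[OF V V' W W']) (rule ab)
  then obtain t where t: "hw_mod n r s (\<lambda>i. \<alpha> i * r powi lam i) (\<lambda>i. \<beta> i * s powi lam i) T t" ..
  show "fin_dim_module (Urs n r s) T"
    by (rule twisted_fin_dim[OF t simple _ refl refl lam]) (rule ab)
qed

theorem theorem2p19: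
  fixes n :: nat and r s :: "'k :: alg_closed_field"
  assumes "n \<ge> 1" and "r \<noteq> 0" and "s \<noteq> 0" and "r \<noteq> s"
    and "\<forall>m::nat. m > 0 \<longrightarrow> (r * inverse s) ^ m \<noteq> 1"
  shows "(\<forall>\<chi>\<in>one_dim_chars n r s. \<forall>lam\<in>dominant_weights n.
            simple_module (Urs n r s) (Urs_tensor n r s (Lsimple n r s \<chi>) (Lsimple n r s (weight_char n r s lam))) \<and>
            fin_dim_module (Urs n r s) (Urs_tensor n r s (Lsimple n r s \<chi>) (Lsimple n r s (weight_char n r s lam))))
       \<and> (\<forall>V :: ('k Urs_elem, 'v) module.
            simple_module (Urs n r s) V \<and> fin_dim_module (Urs n r s) V \<longrightarrow>
            (\<exists>\<chi>\<in>one_dim_chars n r s. \<exists>lam\<in>dominant_weights n.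
               isomorphic_modules (Urs n r s) V
                 (Urs_tensor n r s (Lsimple n r s \<chi>) (Lsimple n r s (weight_char n r s lam)))))"
proof (rule conjI)
  interpret urs_nz n r s by (rule urs_nz.intro[OF assms(2,3)])
  show "\<forall>\<chi>\<in>one_dim_chars n r s. \<forall>lam\<in>dominant_weights n.
            simple_module (Urs n r s) (Urs_tensor n r s (Lsimple n r s \<chi>) (Lsimple n r s (weight_char n r s lam))) \<and>
            fin_dim_module (Urs n r s) (Urs_tensor n r s (Lsimple n r s \<chi>) (Lsimple n r s (weight_char n r s lam)))"
  proof (intro ballI)
    fix \<chi> lam assume chi: "\<chi> \<in> one_dim_chars n r s" and lam: "lam \<in> dominant_weights n"
    have chi0: "\<chi> \<in> torus_chars n r s" using chi unfolding one_dim_chars_def by simp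
    \<comment> \<open>The value 1 outside the index range serves the requirement that the eigenvalue
      functions vanish nowhere.\<close>
    define A where "A i = (if i \<in> {1..n} then \<chi> (u (Gen_a i)) else 1)" for i
    define B where "B i = (if i \<in> {1..n} then \<chi> (u (Gen_b i)) else 1)" for i
    have nzA: "A i \<noteq> 0" for i
      by (cases "i \<in> {1..n}") (use char_inverse(1)[OF chi0, of i] in \<open>auto simp: A_def\<close>)
    have nzB: "B i \<noteq> 0" for i
      by (cases "i \<in> {1..n}") (use char_inverse(2)[OF chi0, of i] in \<open>auto simp: B_def\<close>)
    have vA: "\<chi> (u (Gen_a i)) = A i" and vB: "\<chi> (u (Gen_b i)) = B i" if "i \<in> {1..n}" for i
      using that by (simp_all add: A_def B_def)
    note T = twisted_module[where \<alpha> = A and \<beta> = B, OF assms(2-5) chi lam nzA nzB vA vB]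
    show "simple_module (Urs n r s) (Urs_tensor n r s (Lsimple n r s \<chi>) (Lsimple n r s (weight_char n r s lam))) \<and>
          fin_dim_module (Urs n r s) (Urs_tensor n r s (Lsimple n r s \<chi>) (Lsimple n r s (weight_char n r s lam)))"
      by (rule conjI[OF T(1,2)])
  qed
  show "\<forall>V :: ('k Urs_elem, 'v) module.
            simple_module (Urs n r s) V \<and> fin_dim_module (Urs n r s) V \<longrightarrow>
            (\<exists>\<chi>\<in>one_dim_chars n r s. \<exists>lam\<in>dominant_weights n.
               isomorphic_modules (Urs n r s) V
                 (Urs_tensor n r s (Lsimple n r s \<chi>) (Lsimple n r s (weight_char n r s lam))))"
  proof (intro allI impI)
    fix V :: "('k Urs_elem, 'v) module"
    assume V: "simple_module (Urs n r s) V \<and> fin_dim_module (Urs n r s) V"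
    note simple = conjunct1[OF V] and fd = conjunct2[OF V]
    have lmV: "left_module (Urs n r s) V" and nzV: "carrier V \<noteq> {\<zero>\<^bsub>V\<^esub>}"
      using simple unfolding simple_module_def by simp_all
    interpret M: umod n r s V by (rule umodI[OF lmV assms(2,3)])
    obtain x0 where x0: "x0 \<in> carrier V" "x0 \<noteq> \<zero>\<^bsub>V\<^esub>" using nzV M.M.zero_closed by blast
    \<comment> \<open>\<open>t\<close> is whichever of \<open>r\<close> and \<open>s\<close> has
      infinite order; both occur as constant gradings of the e_j.\<close>
    have "\<exists>t. inj (\<lambda>m::nat. t ^ m) \<and> grades (\<lambda>_. t)"
      using quotient_not_root[of r s] assms(5) inj_powers[OF assms(2)] inj_powers[OF assms(3)] grades_torus by blast
    then obtain t where t: "inj (\<lambda>m::nat. t ^ m)" "grades (\<lambda>_. t)" by blast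
    obtain y where y: "y \<in> carrier V" "y \<noteq> \<zero>\<^bsub>V\<^esub>"
      and e: "\<forall>j\<in>{1..<n}. u (Gen_e j) \<odot>\<^bsub>V\<^esub> y = \<zero>\<^bsub>V\<^esub>"
      and ex: "\<forall>i\<in>{1..n}. (\<exists>k. u (Gen_a i) \<odot>\<^bsub>V\<^esub> y = M.sm k y) \<and> (\<exists>k. u (Gen_b i) \<odot>\<^bsub>V\<^esub> y = M.sm k y)"
      using M.highest_weight_vector[OF alg_closed_imp_poly_has_root fd x0 t] by blast
    have "\<exists>k. i \<in> {1..n} \<longrightarrow> u (Gen_a i) \<odot>\<^bsub>V\<^esub> y = M.sm k y" for i using ex by blast
    then obtain A0 where A0: "\<And>i. i \<in> {1..n} \<Longrightarrow> u (Gen_a i) \<odot>\<^bsub>V\<^esub> y = M.sm (A0 i) y" by metis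
    have "\<exists>k. i \<in> {1..n} \<longrightarrow> u (Gen_b i) \<odot>\<^bsub>V\<^esub> y = M.sm k y" for i using ex by blast
    then obtain B0 where B0: "\<And>i. i \<in> {1..n} \<Longrightarrow> u (Gen_b i) \<odot>\<^bsub>V\<^esub> y = M.sm (B0 i) y" by metis
    have inv: "c \<noteq> 0" if "a \<in> carrier (Urs n r s)" "b \<in> carrier (Urs n r s)" "b \<otimes>\<^bsub>Urs n r s\<^esub> a = \<one>\<^bsub>Urs n r s\<^esub>" "a \<odot>\<^bsub>V\<^esub> y = M.sm c y" for a b c
    proof
      assume "c = 0"
      then have "y = b \<odot>\<^bsub>V\<^esub> \<zero>\<^bsub>V\<^esub>"
        using M.act_mult[OF that(2,1) y(1)] that(3,4) M.act_one[OF y(1)] M.sm_simps(5)[OF y(1)] by simp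
      then show False using y(2) M.act_zero[OF that(2)] by simp
    qed
    define A where "A i = (if i \<in> {1..n} then A0 i else 1)" for i
    define B where "B i = (if i \<in> {1..n} then B0 i else 1)" for i
    have nzA: "A i \<noteq> 0" for i
    proof (cases "i \<in> {1..n}")
      case True
      have "u (Gen_ai i) \<otimes>\<^bsub>Urs n r s\<^esub> u (Gen_a i) = \<one>\<^bsub>Urs n r s\<^esub>"
        using a_inverse[OF True] torus_commute[OF gens_mem(8,10)[OF True]] by simp
      from inv[OF u_gens_closed(3,5)[OF True] this A0[OF True]] show ?thesis using True by (simp add: A_def)
    next
      case False
      then show ?thesis by (simp only: A_def if_False one_neq_zero not_False_eq_True)
    qed
    have nzB: "B i \<noteq> 0" for i
    proof (cases "i \<in> {1..n}")
      case True
      have "u (Gen_bi i) \<otimes>\<^bsub>Urs n r s\<^esub> u (Gen_b i) = \<one>\<^bsub>Urs n r s\<^esub>"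
        using b_inverse[OF True] torus_commute[OF gens_mem(9,11)[OF True]] by simp
      from inv[OF u_gens_closed(4,6)[OF True] this B0[OF True]] show ?thesis using True by (simp add: B_def)
    next
      case False
      then show ?thesis by (simp only: B_def if_False one_neq_zero not_False_eq_True)
    qed
    have hw: "hw_mod n r s A B V y"
    proof (intro hw_mod.intro hw_mod_axioms.intro free_verma.intro M.umod_axioms y assms(2-4) nzA nzB)
      show "(r * inverse s) ^ m \<noteq> 1" if "m > 0" for m using assms(5) that by blast
      show "u (Gen_e j) \<odot>\<^bsub>V\<^esub> y = \<zero>\<^bsub>V\<^esub>" if "j \<in> {1..<n}" for j using bspec[OF e that] .
      show "u (Gen_a i) \<odot>\<^bsub>V\<^esub> y = M.sm (A i) y" if "i \<in> {1..n}" for i using A0[OF that] that by (simp add: A_def)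
      show "u (Gen_b i) \<odot>\<^bsub>V\<^esub> y = M.sm (B i) y" if "i \<in> {1..n}" for i using B0[OF that] that by (simp add: B_def)
    qed
    interpret H: hw_mod n r s A B V y by (rule hw)
    have "\<exists>m. k \<in> {1..<n} \<longrightarrow> A k * B (k + 1) = (r * inverse s) ^ m * (A (k + 1) * B k)" for k
      using H.dominant[OF fd, of k] unfolding H.fv.q_def by blast
    then obtain m where m: "\<And>k. k \<in> {1..<n} \<Longrightarrow> A k * B (k + 1) = (r * inverse s) ^ m k * (A (k + 1) * B k)" by metis
    \<comment> \<open>The weight is rebuilt from its differences m_i and normalised to lam_n = 0.
      Any other normalisation would only shift a determinant power into \<chi>.\<close>
    define lam where "lam i = (if i \<in> {1..n} then \<Sum>k = i..<n. int (m k) else 0)" for i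
    have step: "lam i = lam (i + 1) + int (m i)" if "i \<in> {1..<n}" for i
      using that by (simp add: lam_def sum.atLeast_Suc_lessThan)
    have lam: "lam \<in> dominant_weights n"
      unfolding dominant_weights_def weights_def
      using ip_alpha[of _ n lam] step by (auto simp: lam_def simp del: One_nat_def)
    \<comment> \<open>The part of the highest weight left after dividing by that of L(lam); it is to
      be the character \<chi>.\<close>
    define A1 where "A1 i = A i / r powi lam i" for i
    define B1 where "B1 i = B i / s powi lam i" for i
    have nz1: "A1 i \<noteq> 0" "B1 i \<noteq> 0" for i using nzA nzB assms(2,3) by (simp_all add: A1_def B1_def)
    \<comment> \<open>The vacuum functional for the eigenvalues \<open>A1\<close> and
      \<open>B1\<close> provides \<chi> as an actual homomorphism on the torus algebra.\<close>
    interpret D: verma_data n r s A1 B1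
      by (intro verma_data.intro urs_nz.intro free_verma.intro assms(2-4) nz1) (use assms(5) in blast)
    have vals: "D.phi (u (Gen_a i)) = A1 i" "D.phi (u (Gen_b i)) = B1 i" if "i \<in> {1..n}" for i
      using D.scalar_on_vac_gens(2,3)[OF that] by simp_all
    have "D.phi (omega n r s i) = D.phi (omega' n r s i)" if i: "i \<in> {1..<n}" for i
    proof -
      note g = omega_gens[OF i]
      \<comment> \<open>The dominance relation cleared of denominators. Since lam_i - lam_(i+1) =
        m_i, it says that omega_i and omega_i' agree under the twist.\<close>
      have "r ^ m i * (A (i + 1) * B i) = s ^ m i * (A i * B (i + 1))"
        unfolding m[OF i] using assms(3) by (simp add: power_mult_distrib power_inverse field_simps)
      then have "A1 i * B1 (i + 1) = A1 (i + 1) * B1 i"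
        unfolding A1_def B1_def step[OF i] using assms(2,3) by (simp add: power_int_add divide_simps mult_ac)
      moreover have "D.phi (omega n r s i) = A1 i * B1 (i + 1)"
        unfolding omega_def char_mult(1)[OF D.phi_U0 U0_gen[OF g(1)] U0_gen[OF g(2)]] vals(1)[OF g(5)] vals(2)[OF g(6)] ..
      moreover have "D.phi (omega' n r s i) = A1 (i + 1) * B1 i"
        unfolding omega'_def char_mult(1)[OF D.phi_U0 U0_gen[OF g(3)] U0_gen[OF g(4)]] vals(1)[OF g(6)] vals(2)[OF g(5)] ..
      ultimately show ?thesis by simp
    qed
    then have chi: "D.phi \<in> one_dim_chars n r s" unfolding one_dim_chars_def using D.phi_U0 by blast
    note T = twisted_module[where \<alpha> = A1 and \<beta> = B1, OF assms(2-5) chi lam nz1 vals]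
    have AB: "(\<lambda>i. A1 i * r powi lam i) = A" "(\<lambda>i. B1 i * s powi lam i) = B"
      using assms(2,3) by (simp_all add: A1_def B1_def)
    obtain w where "hw_mod n r s A B (Urs_tensor n r s (Lsimple n r s D.phi) (Lsimple n r s (weight_char n r s lam))) w"
      using T(3) unfolding AB by blast
    from hw_simple_isomorphic[OF hw this simple T(1)]
    show "\<exists>\<chi>\<in>one_dim_chars n r s. \<exists>lam\<in>dominant_weights n.
        isomorphic_modules (Urs n r s) V (Urs_tensor n r s (Lsimple n r s \<chi>) (Lsimple n r s (weight_char n r s lam)))"
      using chi lam by blast
  qed
qed

end
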